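(* There exists a data structure answering Approximate Nearest Neighbor Search queries under edit distance in $\tilde{O}(d\,3^r n^{1/c})$ time per query and $\tilde{O}(n^2)$ space, where $r$ is the edit distance from the query to its nearest database string.
   Context: The edit distance $\mathrm{ED}(x,y)$ between strings $x,y$ is the minimum number of single-character insertions, deletions and replacements needed to transform $x$ into $y$. Approximate Nearest Neighbor Search under edit distance: given a set $S$ of $n$ strings and a constant $c$, preprocess $S$ so as to answer queries $q$ of the form: "for the smallest $r$ such that there exists $y\in S$ with $\mathrm{ED}(q,y)\le r$, return some $y'\in S$ with $\mathrm{ED}(q,y')\le cr$", correctly with probability $>1/10$. All query and database strings have length at most $d$, over an alphabet $\Sigma$; it is assumed that $d=O(n)$ and $|\Sigma|=O(n)$. The notation $\tilde{O}(\cdot)$ hides polylogarithmic factors. *)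

theory Defs
  imports "HOL-Probability.Probability"
begin

section \<open>Edit distance and approximate nearest neighbors\<close>

text \<open>Characters are natural numbers, since they have to be machine words; the alphabet of size
  \<open>\<sigma>\<close> is \<open>{..<\<sigma>}\<close>.\<close>

inductive edit_op :: "nat list \<Rightarrow> nat list \<Rightarrow> bool" where
  insertion: "edit_op (u @ v) (u @ a # v)"
| deletion: "edit_op (u @ a # v) (u @ v)"
| replacement: "edit_op (u @ a # v) (u @ b # v)"

definition edit_distance :: "nat list \<Rightarrow> nat list \<Rightarrow> nat" where
  "edit_distance x y = (LEAST k. (edit_op ^^ k) x y)"

definition strings :: "nat \<Rightarrow> nat \<Rightarrow> nat list set" where
  "strings \<sigma> d = {x. set x \<subseteq> {..<\<sigma>} \<and> length x \<le> d}"

definition nearest_distance :: "nat list \<Rightarrow> nat list set \<Rightarrow> nat" where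
  "nearest_distance q S = (LEAST r. \<exists>y\<in>S. edit_distance q y \<le> r)"

definition approx_nearest :: "real \<Rightarrow> nat list set \<Rightarrow> nat list \<Rightarrow> nat list \<Rightarrow> bool" where
  "approx_nearest c S q y \<longleftrightarrow>
     y \<in> S \<and> real (edit_distance q y) \<le> c * real (nearest_distance q S)"


section \<open>A randomized word RAM\<close>

text \<open>Programs are finite syntactic objects, so that all computation is charged.  A program has
  finitely many registers and three random access memories: a read-only input, the cells of the
  data structure, and zero-initialized working cells.  Registers and memory cells hold words,
  i.e. numbers below \<open>word_mod\<close>; the values of constants and of all operations are reduced modulo
  \<open>word_mod\<close>.  Subtraction is truncated, and \<open>x div 0 = 0\<close>, \<open>x mod 0 = x\<close> as usual in HOL.\<close>

datatype exp =
    Const nat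
  | Reg nat
  | Plus exp exp
  | Minus exp exp
  | Times exp exp
  | Div exp exp
  | Mod exp exp
  | Less exp exp
  | Equal exp exp

datatype com =
    Assign nat exp
  | LoadInput nat exp
  | LoadData nat exp
  | LoadWork nat exp
  | StoreData exp exp
  | StoreWork exp exp
  | Rand nat exp
  | Seq com com
  | If exp com com
  | While exp com

record machine =
  word_mod :: nat
  input :: "nat list"
  data_cells :: nat
  work_cells :: nat
  data_writable :: bool

record store =
  regs :: "nat \<Rightarrow> nat"
  data :: "nat \<Rightarrow> nat"
  work :: "nat \<Rightarrow> nat"

fun eval_exp :: "nat \<Rightarrow> (nat \<Rightarrow> nat) \<Rightarrow> exp \<Rightarrow> nat" where
  "eval_exp W \<rho> (Const k) = k mod W"
| "eval_exp W \<rho> (Reg x) = \<rho> x"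
| "eval_exp W \<rho> (Plus e f) = (eval_exp W \<rho> e + eval_exp W \<rho> f) mod W"
| "eval_exp W \<rho> (Minus e f) = eval_exp W \<rho> e - eval_exp W \<rho> f"
| "eval_exp W \<rho> (Times e f) = (eval_exp W \<rho> e * eval_exp W \<rho> f) mod W"
| "eval_exp W \<rho> (Div e f) = eval_exp W \<rho> e div eval_exp W \<rho> f"
| "eval_exp W \<rho> (Mod e f) = eval_exp W \<rho> e mod eval_exp W \<rho> f"
| "eval_exp W \<rho> (Less e f) = (if eval_exp W \<rho> e < eval_exp W \<rho> f then 1 else 0) mod W"
| "eval_exp W \<rho> (Equal e f) = (if eval_exp W \<rho> e = eval_exp W \<rho> f then 1 else 0) mod W"

text \<open>A configuration is a stack of commands still to be executed, together with the store.  One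
  step costs one unit of time; the expressions of a fixed program have constant size, so charging
  one unit for a whole expression changes running times by a constant factor only.  \<open>Rand x e\<close>
  draws a uniformly random number below the value of \<open>e\<close>.  An illegal step (access outside the
  available cells, write to read-only data, draw from the empty range) repeats the same
  configuration for ever, so a program performing one with positive probability has infinite
  expected running time and does not count as halting.\<close>

type_synonym config = "com list \<times> store"

fun step :: "machine \<Rightarrow> config \<Rightarrow> config pmf" where
  "step M ([], s) = return_pmf ([], s)"
| "step M (Assign x e # cs, s) =
     return_pmf (cs, s\<lparr>regs := (regs s)(x := eval_exp (word_mod M) (regs s) e)\<rparr>)"
| "step M (LoadInput x e # cs, s) =
     (let i = eval_exp (word_mod M) (regs s) e in
      if i < length (input M)
      then return_pmf (cs, s\<lparr>regs := (regs s)(x := (input M ! i) mod word_mod M)\<rparr>)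
      else return_pmf (LoadInput x e # cs, s))"
| "step M (LoadData x e # cs, s) =
     (let i = eval_exp (word_mod M) (regs s) e in
      if i < data_cells M
      then return_pmf (cs, s\<lparr>regs := (regs s)(x := data s i)\<rparr>)
      else return_pmf (LoadData x e # cs, s))"
| "step M (LoadWork x e # cs, s) =
     (let i = eval_exp (word_mod M) (regs s) e in
      if i < work_cells M
      then return_pmf (cs, s\<lparr>regs := (regs s)(x := work s i)\<rparr>)
      else return_pmf (LoadWork x e # cs, s))"
| "step M (StoreData e f # cs, s) =
     (let i = eval_exp (word_mod M) (regs s) e in
      if i < data_cells M \<and> data_writable M
      then return_pmf (cs, s\<lparr>data := (data s)(i := eval_exp (word_mod M) (regs s) f)\<rparr>)
      else return_pmf (StoreData e f # cs, s))"
| "step M (StoreWork e f # cs, s) =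
     (let i = eval_exp (word_mod M) (regs s) e in
      if i < work_cells M
      then return_pmf (cs, s\<lparr>work := (work s)(i := eval_exp (word_mod M) (regs s) f)\<rparr>)
      else return_pmf (StoreWork e f # cs, s))"
| "step M (Rand x e # cs, s) =
     (let b = eval_exp (word_mod M) (regs s) e in
      if 0 < b
      then map_pmf (\<lambda>v. (cs, s\<lparr>regs := (regs s)(x := v)\<rparr>)) (pmf_of_set {..<b})
      else return_pmf (Rand x e # cs, s))"
| "step M (Seq c1 c2 # cs, s) = return_pmf (c1 # c2 # cs, s)"
| "step M (If e c1 c2 # cs, s) =
     return_pmf ((if eval_exp (word_mod M) (regs s) e \<noteq> 0 then c1 else c2) # cs, s)"
| "step M (While e c # cs, s) =
     return_pmf (if eval_exp (word_mod M) (regs s) e \<noteq> 0 then c # While e c # cs else cs, s)"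

fun run :: "machine \<Rightarrow> nat \<Rightarrow> config \<Rightarrow> config pmf" where
  "run M 0 cf = return_pmf cf"
| "run M (Suc t) cf = bind_pmf (step M cf) (run M t)"

definition halted :: "config \<Rightarrow> bool" where
  "halted cf \<longleftrightarrow> fst cf = []"

definition start :: "com \<Rightarrow> (nat \<Rightarrow> nat) \<Rightarrow> config" where
  "start P D = ([P], \<lparr>regs = (\<lambda>_. 0), data = D, work = (\<lambda>_. 0)\<rparr>)"

text \<open>The expectation of the halting time \<open>T\<close>, as \<open>\<Sum>t. P(T > t)\<close>, for a random initial
  configuration.\<close>

definition expected_time :: "machine \<Rightarrow> config pmf \<Rightarrow> ennreal" where
  "expected_time M p =
     (\<Sum>t. emeasure (measure_pmf (bind_pmf p (run M t))) {cf. \<not> halted cf})"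

text \<open>The events below increase with \<open>t\<close>, so the supremum is the probability that the machine
  eventually halts in a store satisfying \<open>Q\<close>.\<close>

definition prob_halts_with :: "machine \<Rightarrow> config pmf \<Rightarrow> (store \<Rightarrow> bool) \<Rightarrow> real" where
  "prob_halts_with M p Q =
     (SUP t. measure_pmf.prob (bind_pmf p (run M t)) {cf. halted cf \<and> Q (snd cf)})"

definition halts_surely :: "machine \<Rightarrow> config \<Rightarrow> bool" where
  "halts_surely M cf \<longleftrightarrow> (\<exists>t. \<forall>cf'\<in>set_pmf (run M t cf). halted cf')"

definition final :: "machine \<Rightarrow> config \<Rightarrow> config pmf" where
  "final M cf = run M (LEAST t. \<forall>cf'\<in>set_pmf (run M t cf). halted cf') cf"


section \<open>Data structures\<close>

definition encode_string :: "nat list \<Rightarrow> nat list" where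
  "encode_string x = length x # x"

text \<open>The approximation factor \<open>c\<close> is an arbitrary real constant, which a finite program over
  words cannot contain; it is supplied to precision \<open>1/n\<close> as the word \<open>\<lfloor>c n\<rfloor>\<close>.\<close>

definition build_input :: "real \<Rightarrow> nat \<Rightarrow> nat \<Rightarrow> nat list list \<Rightarrow> nat list" where
  "build_input c d \<sigma> xs =
     [length xs, d, \<sigma>, nat \<lfloor>c * real (length xs)\<rfloor>] @ concat (map encode_string xs)"

text \<open>Words of \<open>\<kappa> \<lceil>log\<^sub>2 (n + 2)\<rceil>\<close> bits.\<close>

definition word_bound :: "nat \<Rightarrow> nat \<Rightarrow> nat" where
  "word_bound \<kappa> n = 2 ^ (\<kappa> * nat \<lceil>log 2 (real n + 2)\<rceil>)"

text \<open>Preprocessing has to fit its result into \<open>s\<close> data cells; its own working memory is limited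
  by the addressable range only.\<close>

definition build_machine :: "nat \<Rightarrow> nat \<Rightarrow> real \<Rightarrow> nat \<Rightarrow> nat \<Rightarrow> nat list list \<Rightarrow> machine" where
  "build_machine W s c d \<sigma> xs =
     \<lparr>word_mod = W, input = build_input c d \<sigma> xs, data_cells = s, work_cells = W,
      data_writable = True\<rparr>"

text \<open>A query finds the data structure in read-only memory (so any number of queries can be
  answered by the same structure), and has at most \<open>s\<close> working cells.\<close>

definition query_machine :: "nat \<Rightarrow> nat \<Rightarrow> nat list \<Rightarrow> machine" where
  "query_machine W s q =
     \<lparr>word_mod = W, input = encode_string q, data_cells = s, work_cells = s,
      data_writable = False\<rparr>"

text \<open>The random start of a query: the data memory is the random outcome of preprocessing.\<close>

definition query_start :: "machine \<Rightarrow> com \<Rightarrow> com \<Rightarrow> config pmf" where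
  "query_start B build query =
     map_pmf (\<lambda>cf. start query (data (snd cf))) (final B (start build (\<lambda>_. 0)))"

text \<open>A query returns a string by leaving its address in the data memory in register 0 and its
  length in register 1.\<close>

definition returns :: "machine \<Rightarrow> store \<Rightarrow> nat list \<Rightarrow> bool" where
  "returns M s y \<longleftrightarrow>
     regs s 0 + regs s 1 \<le> data_cells M \<and> y = map (data s) [regs s 0..<regs s 0 + regs s 1]"

text \<open>The list \<open>xs\<close> enumerates the database.  Probability and expectation are over the coins of
  both preprocessing and query, for a query string fixed in advance.\<close>

definition solves_ANN ::
  "com \<Rightarrow> com \<Rightarrow> nat \<Rightarrow> nat \<Rightarrow> (nat \<Rightarrow> real) \<Rightarrow> real \<Rightarrow> nat \<Rightarrow> nat \<Rightarrow> nat list list \<Rightarrow> bool" where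
  "solves_ANN build query W s time c d \<sigma> xs \<longleftrightarrow>
     (let B = build_machine W s c d \<sigma> xs in
      halts_surely B (start build (\<lambda>_. 0)) \<and>
      (\<forall>q\<in>strings \<sigma> d.
         let M = query_machine W s q; p = query_start B build query in
         prob_halts_with M p (\<lambda>st. \<exists>y. returns M st y \<and> approx_nearest c (set xs) q y) > 1 / 10 \<and>
         expected_time M p \<le> ennreal (time (nearest_distance q (set xs)))))"

end

theory Submission
  imports Defs
begin

text \<open>The data structure is locality-sensitive hashing with the hash function of McCauley.  The hash
  walks along a string under the control of random words indexed by step and letter; in every step it
  emits a blank and stays with probability \<open>s\<close>, emits a blank and advances with probability \<open>s\<close>, and
  emits the current letter and advances otherwise.  If two walks stand at different letters, one
  insertion, deletion or replacement is imitated with probability \<open>s\<^sup>2\<close> each.  Hence strings at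
  distance \<open>r\<close> receive equal hashes with probability at least \<open>(q / 3)\<^sup>r\<close> and, up to an error of order
  \<open>1 / n\<close>, at most \<open>q\<^sup>r\<close>, where \<open>q = 3 s\<^sup>2 / (1 - s\<^sup>2)\<close>.

  A query tries the radii \<open>r = 0, 1, 2, \<dots>\<close>.  If \<open>q\<close> is such that \<open>q\<^sup>c\<^sup>r\<close> is about \<open>1 / n\<close>, then
  \<open>O(3\<^sup>r n\<^sup>1\<^sup>/\<^sup>c)\<close> tables contain a collision with a string at distance \<open>r\<close> with probability
  \<open>9 / 10\<close>, while the expected number of false candidates is of the same order.  Since the right \<open>q\<close>
  depends on \<open>r\<close> and \<open>c\<close> and no logarithms are computed, all thresholds of a geometric grid of
  polylogarithmic size are tried.  The tables of a level are pairwise independent, which is enough for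
  the second moment method; different levels use disjoint random cells, so the probability of reaching
  radius \<open>r\<close> decays like \<open>10\<close> to the power of minus the distance from \<open>r\<close> to the radius of the
  nearest neighbour, and beats the growth of the costs by factors of \<open>3\<close>.\<close>

text \<open>Outputs of walks are lists of length \<open>H\<close>, too long to index buckets. They
  are replaced by sums of random words modulo \<open>P\<close>, which never separates equal lists
  and merges different ones with probability at most \<open>1 / P\<close>.

  Pairwise independence is forced by the space bound. A threshold needs about \<open>P\<close>
  tables, and one walk has to find a random word for every step and letter, about \<open>P^2\<close>
  words, so independent tables would take about \<open>P^3\<close> cells. Summing rows selected by
  the bits of the table number needs only logarithmically many rows.

  Queries toss no coins. All randomness lies in the cells that one loop of preprocessing fills,
  everything else is deterministic, and both expected time and success probability are computed over
  these cells.

  The power n^(1/c) enters as \<open>2 ^ JJ\<close> with \<open>JJ\<close> about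
  \<open>L * n / N\<close>, where \<open>P = 2 ^ L\<close>. As soon as \<open>3 ^ r * 2 ^ JJ\<close>
  exceeds \<open>P\<close>, scanning the whole database is within the budget of level
  \<open>r\<close>. So only \<open>L + 1\<close> levels need tables, and every query halts with
  certainty.\<close>

section \<open>Edit distance as a recursion on two strings\<close>

text \<open>Equal heads are matched greedily, without comparing the other moves. Two hash walks make
  the same case distinction, so the collision bounds can follow this recursion.\<close>

fun lev :: "nat list \<Rightarrow> nat list \<Rightarrow> nat" where
  "lev [] y = length y"
| "lev (a # x) [] = Suc (length x)"
| "lev (a # x) (b # y) =
     (if a = b then lev x y else Suc (min (lev x y) (min (lev x (b # y)) (lev (a # x) y))))"

lemma lev_Nil2 [simp]: "lev x [] = length x"
  by (cases x) auto

lemma lev_length: "length x \<le> length y + lev x y" "length y \<le> length x + lev x y"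
  by (induction x y rule: lev.induct) (auto simp: min_def)

lemma lev_le_max: "lev x y \<le> max (length x) (length y)"
  by (induction x y rule: lev.induct) (auto simp: min_def)

text \<open>Because of the greedy matching these bounds are not immediate. Unfolding one side at its
  head leads to pairs that differ in the other argument, so all four are proved together by
  induction on the total length.\<close>

lemma lev_Cons_bounds:
  "lev x (b # y) \<le> Suc (lev x y)" "lev x y \<le> Suc (lev x (b # y))"
  "lev (a # x) y \<le> Suc (lev x y)" "lev x y \<le> Suc (lev (a # x) y)"
proof -
  have "(\<forall>b. lev x y \<le> Suc (lev x (b # y)) \<and> lev x (b # y) \<le> Suc (lev x y)) \<and>
        (\<forall>a. lev x y \<le> Suc (lev (a # x) y) \<and> lev (a # x) y \<le> Suc (lev x y))" for x y
  proof (induction "length x + length y" arbitrary: x y rule: less_induct)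
    case less
    consider "x = []" | "y = []" | a' x' b' y' where "x = a' # x'" "y = b' # y'"
      by (cases x; cases y) auto
    then show ?case
    proof cases
      case 1
      have "lev [a] y \<le> Suc (length y)" "length y \<le> Suc (lev [a] y)" for a
        using lev_le_max[of "[a]" y] lev_length(2)[of y "[a]"] by auto
      with 1 show ?thesis by auto
    next
      case 2
      have "lev x [a] \<le> Suc (length x)" "length x \<le> Suc (lev x [a])" for a
        using lev_le_max[of x "[a]"] lev_length(1)[of x "[a]"] by auto
      with 2 show ?thesis by auto
    next
      case (3 a' x' b' y')
      have IH1: "lev x' y \<le> Suc (lev x' (b # y))" "lev x' (b # y) \<le> Suc (lev x' y)"
        "lev x' y \<le> Suc (lev x y)" "lev x y \<le> Suc (lev x' y)" for b
        using less[of x' y] 3 by (auto simp del: lev.simps)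
      have IH2: "lev x y' \<le> Suc (lev (b # x) y')" "lev (b # x) y' \<le> Suc (lev x y')"
        "lev x y' \<le> Suc (lev x y)" "lev x y \<le> Suc (lev x y')" for b
        using less[of x y'] 3 by (auto simp del: lev.simps)
      have "lev x (b # y) = (if a' = b then lev x' y else Suc (min (lev x' y) (min (lev x' (b # y)) (lev x y))))" for b
        using 3 by simp
      then have "lev x y \<le> Suc (lev x (b # y)) \<and> lev x (b # y) \<le> Suc (lev x y)" for b
        using IH1(1,2)[of b] IH1(3,4) by (auto simp del: lev.simps simp add: min_def split: if_splits)
      moreover have "lev (b # x) y = (if b = b' then lev x y' else Suc (min (lev x y') (min (lev x y) (lev (b # x) y'))))" for b
        using 3 by simp
      then have "lev x y \<le> Suc (lev (b # x) y) \<and> lev (b # x) y \<le> Suc (lev x y)" for b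
        using IH2(1,2)[of b] IH2(3,4) by (auto simp del: lev.simps simp add: min_def split: if_splits)
      ultimately show ?thesis by blast
    qed
  qed
  then show "lev x (b # y) \<le> Suc (lev x y)" "lev x y \<le> Suc (lev x (b # y))"
    "lev (a # x) y \<le> Suc (lev x y)" "lev x y \<le> Suc (lev (a # x) y)" by blast+
qed

lemma lev_Cons_le: "lev (a # x) (b # y) \<le> Suc (lev x y)"
  by auto

text \<open>The induction is on \<open>x\<close> and the prefix \<open>u\<close> before the edited
  position. The edit itself is met only when \<open>u\<close> is exhausted, where
  \<open>lev_Cons_bounds\<close> applies.\<close>

lemma lev_edit_op: "edit_op y z \<Longrightarrow> lev x z \<le> Suc (lev x y)"
proof (induction rule: edit_op.induct)
  case (insertion u v a)
  show ?case
  proof (induction x u arbitrary: rule: lev.induct)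
    case (3 a' x b' y)
    then show ?case using lev_Cons_bounds by (auto simp: min_def)
  next
    case (2 c x)
    then show ?case using lev_Cons_bounds by (simp del: lev.simps)
  qed auto
next
  case (deletion u a v)
  show ?case
  proof (induction x u arbitrary: rule: lev.induct)
    case (3 a' x b' y)
    then show ?case using lev_Cons_bounds by (auto simp: min_def)
  next
    case (2 c x)
    then show ?case using lev_Cons_bounds by (simp del: lev.simps)
  qed auto
next
  case (replacement u a v b)
  show ?case
  proof (induction x u arbitrary: rule: lev.induct)
    case (2 c x)
    have "lev (c # x) (b # v) \<le> Suc (lev (c # x) (a # v))" if "c \<noteq> a"
    proof -
      have "lev (c # x) (a # v) = Suc (min (lev x v) (min (lev x (a # v)) (lev (c # x) v)))"
        using that by simp
      then show ?thesis
        using lev_Cons_le[of c x b v] lev_Cons_bounds(1)[of "c # x" b v] lev_Cons_bounds(2)[of x v a]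
        by linarith
    qed
    moreover have "lev (c # x) (b # v) \<le> Suc (lev (c # x) (a # v))" if "c = a"
      using lev_Cons_le[of c x b v] that by simp
    ultimately show ?case by auto
  next
    case (3 a' x b' y)
    then show ?case using lev_Cons_bounds by (auto simp: min_def)
  qed auto
qed

lemma lev_refl [simp]: "lev x x = 0"
  by (induction x) auto

lemma lev_le_relpow: "(edit_op ^^ k) x y \<Longrightarrow> lev x y \<le> k"
proof (induction k arbitrary: y)
  case (Suc k)
  then obtain z where "(edit_op ^^ k) x z" "edit_op z y" by auto
  then show ?case using Suc.IH[of z] lev_edit_op[of z y x] by auto
qed auto

lemma edit_op_Cons: "edit_op x y \<Longrightarrow> edit_op (a # x) (a # y)"
  by (induction rule: edit_op.induct) (metis append_Cons edit_op.intros)+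

lemma edit_relpow_Cons: "(edit_op ^^ k) x y \<Longrightarrow> (edit_op ^^ k) (a # x) (a # y)"
proof (induction k arbitrary: y)
  case (Suc k)
  then obtain z where "(edit_op ^^ k) x z" "edit_op z y" by auto
  then show ?case using Suc.IH[of z] edit_op_Cons by auto
qed auto

text \<open>Each branch of the recursion is realised by one operation at the head: replacements and
  deletions come first, whereas an insertion comes last, since it creates the head of the
  target.\<close>

lemma relpow_lev: "(edit_op ^^ lev x y) x y"
proof (induction x y rule: lev.induct)
  case (1 y)
  show ?case
  proof (induction y)
    case (Cons a y)
    have "edit_op y (a # y)" using insertion[of "[]" y] by simp
    with Cons show ?case by auto
  qed auto
next
  case (2 a x)
  have "(edit_op ^^ length x) x []" for x
  proof (induction x)
    case (Cons a x)
    have "edit_op (a # x) x" using deletion[of "[]" a] by simp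
    with Cons show ?case using relpowp_Suc_I2[of edit_op] by auto
  qed auto
  from this[of "a # x"] show ?case by simp
next
  case (3 a x b y)
  show ?case
  proof (cases "a = b")
    case True
    then show ?thesis using 3(1) by (auto intro: edit_relpow_Cons)
  next
    case False
    have "edit_op (a # x) (b # x)" using replacement[of "[]" a x b] by simp
    moreover have "(edit_op ^^ lev x y) (b # x) (b # y)"
      using 3(2)[OF False] by (rule edit_relpow_Cons)
    ultimately have R: "(edit_op ^^ Suc (lev x y)) (a # x) (b # y)"
      by (rule relpowp_Suc_I2)
    have "edit_op (a # x) x" using deletion[of "[]" a] by simp
    then have D: "(edit_op ^^ Suc (lev x (b # y))) (a # x) (b # y)"
      using 3(3)[OF False] by (rule relpowp_Suc_I2)
    have "edit_op y (b # y)" using insertion[of "[]" y] by simp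
    then have I: "(edit_op ^^ Suc (lev (a # x) y)) (a # x) (b # y)"
      using 3(4)[OF False] by (intro relpowp_Suc_I)
    show ?thesis using R D I False by (auto simp: min_def simp del: relpowp.simps)
  qed
qed

theorem edit_distance_eq_lev: "edit_distance x y = lev x y"
  unfolding edit_distance_def
  by (rule Least_equality) (auto intro: relpow_lev lev_le_relpow)

section \<open>A program logic with running times\<close>

text \<open>The continuation \<open>cs\<close> is arbitrary, so that commands compose, and the
  outcome is a point mass. Hence the calculus covers deterministic commands only; the single loop
  with \<open>Rand\<close> is computed directly in \<open>run_random\<close>.\<close>

definition steps :: "machine \<Rightarrow> nat \<Rightarrow> com \<Rightarrow> store \<Rightarrow> store \<Rightarrow> bool" where
  "steps M t c s s' \<longleftrightarrow> (\<forall>cs. run M t (c # cs, s) = return_pmf (cs, s'))"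

definition wp :: "machine \<Rightarrow> com \<Rightarrow> (nat \<Rightarrow> store \<Rightarrow> bool) \<Rightarrow> store \<Rightarrow> bool" where
  "wp M c Q s \<longleftrightarrow> (\<exists>t s'. steps M t c s s' \<and> Q t s')"

lemma run_add: "run M (t + u) cf = bind_pmf (run M t cf) (run M u)"
proof (induction t arbitrary: cf)
  case (Suc t)
  then have "run M (t + u) = (\<lambda>cf. bind_pmf (run M t cf) (run M u))" by blast
  then show ?case by (simp add: bind_assoc_pmf del: split_paired_All)
qed (simp add: bind_return_pmf)

lemma run_halted: "run M t ([], s) = return_pmf ([], s)"
  by (induction t) (auto simp: bind_return_pmf)

lemma run_le: "run M t cf = return_pmf ([], s) \<Longrightarrow> t \<le> u \<Longrightarrow> run M u cf = return_pmf ([], s)"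
  using run_add[of M t "u - t" cf] by (simp add: bind_return_pmf run_halted)

lemma wp_mono: "wp M c Q s \<Longrightarrow> (\<And>t s'. Q t s' \<Longrightarrow> Q' t s') \<Longrightarrow> wp M c Q' s"
  unfolding wp_def by blast

lemma wp_step1:
  assumes "\<And>cs. step M (c # cs, s) = return_pmf (cs, s')" "Q 1 s'"
  shows "wp M c Q s"
  unfolding wp_def steps_def using assms
  by (intro exI[of _ 1] exI[of _ s']) (auto simp: bind_return_pmf)

lemma wp_Assign: "Q 1 (s\<lparr>regs := (regs s)(x := eval_exp (word_mod M) (regs s) e)\<rparr>) \<Longrightarrow> wp M (Assign x e) Q s"
  by (rule wp_step1) auto

lemma wp_LoadInput:
  "eval_exp (word_mod M) (regs s) e < length (input M) \<Longrightarrow>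
   Q 1 (s\<lparr>regs := (regs s)(x := (input M ! eval_exp (word_mod M) (regs s) e) mod word_mod M)\<rparr>) \<Longrightarrow>
   wp M (LoadInput x e) Q s"
  by (rule wp_step1) auto

lemma wp_LoadData:
  "eval_exp (word_mod M) (regs s) e < data_cells M \<Longrightarrow>
   Q 1 (s\<lparr>regs := (regs s)(x := data s (eval_exp (word_mod M) (regs s) e))\<rparr>) \<Longrightarrow>
   wp M (LoadData x e) Q s"
  by (rule wp_step1) auto

lemma wp_LoadWork:
  "eval_exp (word_mod M) (regs s) e < work_cells M \<Longrightarrow>
   Q 1 (s\<lparr>regs := (regs s)(x := work s (eval_exp (word_mod M) (regs s) e))\<rparr>) \<Longrightarrow>
   wp M (LoadWork x e) Q s"
  by (rule wp_step1) auto

lemma wp_StoreData: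
  "eval_exp (word_mod M) (regs s) e < data_cells M \<Longrightarrow> data_writable M \<Longrightarrow>
   Q 1 (s\<lparr>data := (data s)(eval_exp (word_mod M) (regs s) e := eval_exp (word_mod M) (regs s) f)\<rparr>) \<Longrightarrow>
   wp M (StoreData e f) Q s"
  by (rule wp_step1) auto

lemma wp_StoreWork:
  "eval_exp (word_mod M) (regs s) e < work_cells M \<Longrightarrow>
   Q 1 (s\<lparr>work := (work s)(eval_exp (word_mod M) (regs s) e := eval_exp (word_mod M) (regs s) f)\<rparr>) \<Longrightarrow>
   wp M (StoreWork e f) Q s"
  by (rule wp_step1) auto

lemma wp_Seq:
  assumes "wp M c1 (\<lambda>t1. wp M c2 (\<lambda>t2. Q (Suc (t1 + t2)))) s"
  shows "wp M (Seq c1 c2) Q s"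
proof -
  obtain t1 s1 t2 s2 where "steps M t1 c1 s s1" "steps M t2 c2 s1 s2" "Q (Suc (t1 + t2)) s2"
    using assms unfolding wp_def by blast
  then have "steps M (Suc (t1 + t2)) (Seq c1 c2) s s2"
    unfolding steps_def by (auto simp: bind_return_pmf run_add)
  with \<open>Q (Suc (t1 + t2)) s2\<close> show ?thesis unfolding wp_def by blast
qed

lemma wp_If:
  assumes "eval_exp (word_mod M) (regs s) e \<noteq> 0 \<Longrightarrow> wp M c1 (\<lambda>t. Q (Suc t)) s"
    and "eval_exp (word_mod M) (regs s) e = 0 \<Longrightarrow> wp M c2 (\<lambda>t. Q (Suc t)) s"
  shows "wp M (If e c1 c2) Q s"
proof -
  let ?c = "if eval_exp (word_mod M) (regs s) e \<noteq> 0 then c1 else c2"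
  have "wp M ?c (\<lambda>t. Q (Suc t)) s" using assms by auto
  then obtain t s' where *: "steps M t ?c s s'" "Q (Suc t) s'" unfolding wp_def by blast
  then have "steps M (Suc t) (If e c1 c2) s s'" unfolding steps_def by (auto simp: bind_return_pmf)
  with * show ?thesis unfolding wp_def by blast
qed

lemma wp_If_False:
  "eval_exp (word_mod M) (regs s) e = 0 \<Longrightarrow> wp M c2 (\<lambda>t. Q (Suc t)) s \<Longrightarrow> wp M (If e c1 c2) Q s"
  by (rule wp_If) auto

lemma wp_While_step:
  assumes "eval_exp (word_mod M) (regs s) e \<noteq> 0"
    "wp M c (\<lambda>t1. wp M (While e c) (\<lambda>t2. Q (Suc (t1 + t2)))) s"
  shows "wp M (While e c) Q s"
proof -
  obtain t1 s1 t2 s2 where "steps M t1 c s s1" "steps M t2 (While e c) s1 s2" "Q (Suc (t1 + t2)) s2"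
    using assms unfolding wp_def by blast
  then have "steps M (Suc (t1 + t2)) (While e c) s s2"
    using assms(1) unfolding steps_def by (auto simp: bind_return_pmf run_add)
  with \<open>Q (Suc (t1 + t2)) s2\<close> show ?thesis unfolding wp_def by blast
qed

lemma wp_While_end:
  assumes "eval_exp (word_mod M) (regs s) e = 0" "Q 1 s"
  shows "wp M (While e c) Q s"
  by (rule wp_step1) (use assms in auto)

text \<open>\<open>I k\<close> is the invariant after \<open>k\<close> iterations. An iteration is
  charged \<open>b\<close> for its body and one for its test, and the failing test costs one
  more.\<close>

lemma wp_for_from:
  assumes body: "\<And>k s. k < m \<Longrightarrow> I k s \<Longrightarrow> eval_exp (word_mod M) (regs s) e \<noteq> 0 \<and>
      wp M c (\<lambda>t s'. t \<le> b \<and> I (Suc k) s') s"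
    and exit: "\<And>s. I m s \<Longrightarrow> eval_exp (word_mod M) (regs s) e = 0"
  shows "k \<le> m \<Longrightarrow> I k s \<Longrightarrow> wp M (While e c) (\<lambda>t s'. t \<le> (m - k) * (b + 1) + 1 \<and> I m s') s"
proof (induction "m - k" arbitrary: k s)
  case 0
  then show ?case using exit by (intro wp_While_end) auto
next
  case (Suc d)
  then have k: "k < m" by simp
  have IH: "wp M (While e c) (\<lambda>t s'. t \<le> (m - Suc k) * (b + 1) + 1 \<and> I m s') s'" if "I (Suc k) s'" for s'
    using Suc(1)[of "Suc k" s'] Suc(2) k that by simp
  have mk: "m - k = Suc (m - Suc k)" using k by simp
  show ?case
    using body[OF k Suc.prems(2)] unfolding mk
    by (intro wp_While_step) (auto elim!: wp_mono dest!: IH)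
qed

lemma wp_for:
  assumes "\<And>k s. k < m \<Longrightarrow> I k s \<Longrightarrow> eval_exp (word_mod M) (regs s) e \<noteq> 0"
    and "\<And>k s. k < m \<Longrightarrow> I k s \<Longrightarrow> wp M c (\<lambda>t s'. t \<le> b \<and> I (Suc k) s') s"
    and "\<And>s. I m s \<Longrightarrow> eval_exp (word_mod M) (regs s) e = 0" "I 0 s"
    and "\<And>t s'. t \<le> m * (b + 1) + 1 \<Longrightarrow> I m s' \<Longrightarrow> Q t s'"
  shows "wp M (While e c) Q s"
proof -
  have "wp M (While e c) (\<lambda>t s'. t \<le> (m - 0) * (b + 1) + 1 \<and> I m s') s"
    using assms(1-4) by (intro wp_for_from) auto
  then show ?thesis by (rule wp_mono) (use assms(5) in auto)
qed

lemmas wp_intros = wp_Assign wp_LoadInput wp_LoadData wp_LoadWork wp_StoreData wp_StoreWork wp_Seq wp_If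

notation Plus (infixl "\<oplus>" 65)
notation Minus (infixl "\<ominus>" 65)
notation Times (infixl "\<otimes>" 70)
abbreviation seq (infixr ";;" 20) where "c1 ;; c2 \<equiv> Seq c1 c2"

section \<open>Uniformly random memory cells\<close>

definition unif :: "nat set \<Rightarrow> nat \<Rightarrow> (nat \<Rightarrow> nat) pmf" where
  "unif I m = Pi_pmf I 0 (\<lambda>_. pmf_of_set {..<m})"

abbreviation pr :: "nat set \<Rightarrow> nat \<Rightarrow> ((nat \<Rightarrow> nat) \<Rightarrow> bool) \<Rightarrow> real" where
  "pr I m E \<equiv> measure_pmf.prob (unif I m) {D. E D}"

lemma unif_eq: "finite I \<Longrightarrow> 0 < m \<Longrightarrow> unif I m = pmf_of_set (PiE_dflt I 0 (\<lambda>_. {..<m}))"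
  unfolding unif_def by (subst Pi_pmf_of_set) auto

lemma finite_set_unif: "finite I \<Longrightarrow> 0 < m \<Longrightarrow> finite (set_pmf (unif I m))"
  by (subst unif_eq; (subst set_pmf_of_set)?) (auto simp: PiE_dflt_empty_iff intro!: finite_PiE_dflt)

lemma set_unif: "finite I \<Longrightarrow> 0 < m \<Longrightarrow> D \<in> set_pmf (unif I m) \<Longrightarrow> i \<in> I \<Longrightarrow> D i < m"
  unfolding unif_def
  by (subst (asm) set_Pi_pmf) (auto simp: PiE_dflt_def set_pmf_of_set lessThan_empty_iff)

text \<open>Cell \<open>i\<close> is uniform and independent of all others, so it may be redrawn
  once everything else is fixed. The collision estimates expose the words of a single step in this
  way.\<close>

lemma unif_resample:
  assumes "finite I" "0 < m" "i \<in> I"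
  shows "pr I m E = (\<Sum>v<m. pr I m (\<lambda>D. E (D(i := v)))) / real m"
proof -
  define N where "N = unif (I - {i}) m"
  have I: "insert i (I - {i}) = I" using assms by auto
  have U: "unif I m = bind_pmf (pmf_of_set {..<m}) (\<lambda>y. map_pmf (\<lambda>f. f(i := y)) N)"
    using Pi_pmf_insert'[of "I - {i}" i 0 "\<lambda>_. pmf_of_set {..<m}"] assms I
    by (simp add: unif_def N_def map_pmf_def)
  have fN: "finite (set_pmf N)" unfolding N_def using assms by (intro finite_set_unif) auto
  have *: "pr I m F = (\<Sum>v<m. measure_pmf.prob N {D. F (D(i := v))}) / real m" for F
  proof -
    have "pr I m F = measure_pmf.expectation (unif I m) (indicator {D. F D})" by simp
    also have "\<dots> = (\<Sum>v<m. measure_pmf.expectation (map_pmf (\<lambda>f. f(i := v)) N) (indicator {D. F D}) / real m)"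
      unfolding U using assms fN
      by (subst pmf_expectation_bind_pmf_of_set) (auto simp: lessThan_empty_iff divide_inverse mult.commute)
    also have "\<dots> = (\<Sum>v<m. measure_pmf.prob N {D. F (D(i := v))}) / real m"
      by (subst sum_divide_distrib, intro sum.cong refl)
        (simp add: measure_map_pmf vimage_def del: integral_map_pmf)
    finally show ?thesis .
  qed
  have "pr I m (\<lambda>D. E (D(i := v))) = measure_pmf.prob N {D. E (D(i := v))}" for v
    unfolding *[of "\<lambda>D. E (D(i := v))"] using assms by simp
  then show ?thesis using *[of E] by simp
qed

text \<open>The product distribution splits into its parts on \<open>A\<close> and on
  \<open>I - A\<close>; the first event reads only the former, the second only the latter.\<close>

lemma unif_indep:
  assumes I: "finite I" "0 < m" "A \<subseteq> I" "A \<inter> B = {}"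
    and E: "\<And>D D'. (\<And>i. i \<in> A \<Longrightarrow> D i = D' i) \<Longrightarrow> E D = E D'"
    and F: "\<And>D D'. (\<And>i. i \<in> B \<Longrightarrow> D i = D' i) \<Longrightarrow> F D = F D'"
  shows "pr I m (\<lambda>D. E D \<and> F D) = pr I m E * pr I m F"
proof -
  let ?f = "\<lambda>(f, g) x. if x \<in> A then f x else (g x :: nat)"
  let ?N1 = "unif A m" and ?N2 = "unif (I - A) m"
  have "finite A" using I finite_subset by blast
  have AI: "A \<union> (I - A) = I" using I by auto
  have U: "unif I m = map_pmf ?f (pair_pmf ?N1 ?N2)"
    unfolding unif_def using \<open>finite A\<close> I AI Pi_pmf_union[of A "I - A" 0 "\<lambda>_. pmf_of_set {..<m}"] by simp
  have E': "E (\<lambda>x. if x \<in> A then f x else g x) = E f" for f g by (rule E) auto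
  have F': "F (\<lambda>x. if x \<in> A then f x else g x) = F g" for f g by (rule F) (use I in auto)
  have *: "measure_pmf.prob (pair_pmf ?N1 ?N2) {(f, g). G f \<and> H g} =
      measure_pmf.prob ?N1 {f. G f} * measure_pmf.prob ?N2 {g. H g}" for G H
  proof -
    have fin: "finite (set_pmf ?N1)" "finite (set_pmf ?N2)"
      using I \<open>finite A\<close> by (auto intro: finite_set_unif)
    have "measure_pmf.prob (pair_pmf ?N1 ?N2) {(f, g). G f \<and> H g} =
        measure_pmf.prob (pair_pmf ?N1 ?N2) (({f. G f} \<inter> set_pmf ?N1) \<times> ({g. H g} \<inter> set_pmf ?N2))"
      by (subst measure_Int_set_pmf[symmetric]) (auto intro!: arg_cong[where f = "measure_pmf.prob _"])
    also have "\<dots> = measure_pmf.prob ?N1 ({f. G f} \<inter> set_pmf ?N1) * measure_pmf.prob ?N2 ({g. H g} \<inter> set_pmf ?N2)"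
      using fin by (intro measure_pmf_prob_product) (auto intro: countable_finite)
    finally show ?thesis by (simp add: measure_Int_set_pmf)
  qed
  have "pr I m (\<lambda>D. E D \<and> F D) = measure_pmf.prob ?N1 {f. E f} * measure_pmf.prob ?N2 {g. F g}"
    unfolding U measure_map_pmf *[symmetric] using E' F'
    by (intro arg_cong[where f = "measure_pmf.prob _"]) (auto simp: vimage_def)
  moreover have "pr I m E = measure_pmf.prob ?N1 {f. E f}"
    using *[of E "\<lambda>_. True"] unfolding U measure_map_pmf by (simp add: vimage_def case_prod_unfold E')
  moreover have "pr I m F = measure_pmf.prob ?N2 {g. F g}"
    using *[of "\<lambda>_. True" F] unfolding U measure_map_pmf by (simp add: vimage_def case_prod_unfold F')
  ultimately show ?thesis by simp
qed

text \<open>An injective self-map of the finite set of assignments permutes it, and permutations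
  preserve the uniform distribution.\<close>

lemma unif_invariant:
  assumes I: "finite I" "0 < m"
    and into: "\<And>D. D \<in> PiE_dflt I 0 (\<lambda>_. {..<m}) \<Longrightarrow> \<Phi> D \<in> PiE_dflt I 0 (\<lambda>_. {..<m})"
    and inj: "inj_on \<Phi> (PiE_dflt I 0 (\<lambda>_. {..<m}))"
  shows "pr I m (\<lambda>D. E (\<Phi> D)) = pr I m E"
proof -
  let ?O = "PiE_dflt I 0 (\<lambda>_. {..<m})"
  have fin: "finite ?O" using I by auto
  have ne: "?O \<noteq> {}" using I by (auto simp: PiE_dflt_empty_iff lessThan_empty_iff)
  have "\<Phi> ` ?O = ?O" using into inj fin by (intro endo_inj_surj) auto
  then have "map_pmf \<Phi> (unif I m) = unif I m"
    using map_pmf_of_set_inj[OF inj ne fin] unif_eq[OF I] by simp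
  then have "pr I m E = measure_pmf.prob (map_pmf \<Phi> (unif I m)) {D. E D}" by simp
  then show ?thesis by (simp add: measure_map_pmf vimage_def)
qed

lemma pr_mono: "(\<And>D. E D \<Longrightarrow> F D) \<Longrightarrow> pr I m E \<le> pr I m F"
  by (intro measure_pmf.finite_measure_mono) auto

lemma pr_le_1: "pr I m E \<le> 1"
  by (rule measure_pmf.prob_le_1)

section \<open>The locality-sensitive hash function\<close>

fun hd0 :: "nat \<Rightarrow> nat list \<Rightarrow> nat" where
  "hd0 e [] = e"
| "hd0 e (a # x) = a"

text \<open>The list is padded with the letter \<open>e\<close>.  With \<open>s = X / m\<close>, a step outputs the blank
  \<open>Suc e\<close> and stays with probability \<open>s\<close>, outputs it and moves on with probability \<open>s\<close>, and otherwise
  outputs the current letter and moves on.  The step number is part of the output, so that the entries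
  of a list of outputs are distinct and can index the random words of a fingerprint.\<close>

fun outs :: "(nat \<Rightarrow> nat \<Rightarrow> nat) \<Rightarrow> nat \<Rightarrow> nat \<Rightarrow> nat \<Rightarrow> nat list \<Rightarrow> (nat \<times> nat) list" where
  "outs w X e 0 x = []"
| "outs w X e (Suc k) x =
     (let a = hd0 e x; v = w k a in
      (k, if v < 2 * X then Suc e else a) # outs w X e k (if v < X then x else tl x))"

lemma set_tl_subset: "set x \<subseteq> A \<Longrightarrow> set (tl x) \<subseteq> A"
  by (cases x) auto

lemma hd0_le: "set x \<subseteq> {..<e} \<Longrightarrow> hd0 e x \<le> e"
  by (cases x) auto

lemma outs_cong:
  assumes "\<And>j a. j < k \<Longrightarrow> a \<le> e \<Longrightarrow> w j a = w' j a" "set x \<subseteq> {..<e}"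
  shows "outs w X e k x = outs w' X e k x"
  using assms
proof (induction k arbitrary: x)
  case (Suc k)
  have "w k (hd0 e x) = w' k (hd0 e x)" using Suc.prems hd0_le by auto
  moreover have "set (tl x) \<subseteq> {..<e}" using Suc.prems by (simp add: set_tl_subset)
  ultimately show ?case using Suc by (auto simp: Let_def)
qed simp

lemma sum_cases3:
  assumes "2 * X \<le> (m::nat)"
  shows "(\<Sum>v<m. if v < X then A else if v < 2 * X then B else (C::real)) =
    X * A + X * B + (real m - 2 * X) * C"
proof -
  have "(\<Sum>v<m. if v < X then A else if v < 2 * X then B else C) =
      (\<Sum>v\<in>{..<X} \<union> {X..<2*X} \<union> {2*X..<m}. if v < X then A else if v < 2 * X then B else C)"
    using assms by (intro sum.cong) auto
  also have "\<dots> = (\<Sum>v\<in>{..<X}. A) + (\<Sum>v\<in>{X..<2*X}. B) + (\<Sum>v\<in>{2*X..<m}. C)"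
    by (subst sum.union_disjoint, simp, simp, force, subst sum.union_disjoint)
      (auto intro!: arg_cong2[where f="(+)"] sum.cong)
  finally show ?thesis using assms by (simp add: of_nat_diff)
qed

text \<open>One walk with genuinely independent words: \<open>r k a\<close> is the cell for step
  \<open>k\<close> and letter \<open>a\<close>, and injectivity makes different words independent.
  The mixed words of an actual table are reduced to this case by \<open>mix_row\<close>.\<close>

locale letter_cells =
  fixes I :: "nat set" and m X e H :: nat and r :: "nat \<Rightarrow> nat \<Rightarrow> nat"
  assumes fin: "finite I" and m0: "0 < m" and X: "2 * X \<le> m"
    and rI: "\<And>k a. k < H \<Longrightarrow> a \<le> e \<Longrightarrow> r k a \<in> I"
    and inj: "\<And>k a k' a'. k < H \<Longrightarrow> a \<le> e \<Longrightarrow> k' < H \<Longrightarrow> a' \<le> e \<Longrightarrow> r k a = r k' a' \<Longrightarrow> k = k' \<and> a = a'"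
begin

abbreviation w :: "(nat \<Rightarrow> nat) \<Rightarrow> nat \<Rightarrow> nat \<Rightarrow> nat" where "w D \<equiv> \<lambda>k a. D (r k a)"

abbreviation agree where "agree k x y D \<equiv> outs (w D) X e k x = outs (w D) X e k y"

definition s :: real where "s = X / m"

lemma s_bounds: "0 \<le> s" "s \<le> 1 / 2"
  using X m0 by (auto simp: s_def field_simps)

lemma outs_upd:
  assumes "k \<le> j" "j < H" "a \<le> e" "set x \<subseteq> {..<e}"
  shows "outs (w (D(r j a := v))) X e k x = outs (w D) X e k x"
proof (rule outs_cong)
  fix j' a' assume "j' < k" "a' \<le> e"
  then have "r j' a' \<noteq> r j a" using inj[of j' a' j a] assms by auto
  then show "w (D(r j a := v)) j' a' = w D j' a'" by simp
qed (use assms in auto)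

text \<open>Both walks read the same cell, hence emit the same symbol and move alike; whether that
  symbol is a blank does not affect agreement.\<close>

lemma agree_step_eq:
  assumes "Suc k \<le> H" "set x \<subseteq> {..<e}" "set y \<subseteq> {..<e}" "hd0 e x = hd0 e y"
  shows "pr I m (agree (Suc k) x y) = s * pr I m (agree k x y) + (1 - s) * pr I m (agree k (tl x) (tl y))"
proof -
  let ?a = "hd0 e x"
  have a: "?a \<le> e" using assms hd0_le by blast
  have t: "set (tl x) \<subseteq> {..<e}" "set (tl y) \<subseteq> {..<e}" using assms by (simp_all add: set_tl_subset)
  have *: "pr I m (\<lambda>D. agree (Suc k) x y (D(r k ?a := v))) =
      (if v < X then pr I m (agree k x y) else if v < 2 * X then pr I m (agree k (tl x) (tl y))
       else pr I m (agree k (tl x) (tl y)))" for v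
    using assms a t by (auto simp del: fun_upd_apply simp add: fun_upd_same fun_upd_other outs_upd Let_def)
  show ?thesis
    unfolding unif_resample[OF fin m0 rI[of k ?a], of "agree (Suc k) x y", OF _ a, OF Suc_le_lessD[OF assms(1)]]
      * sum_cases3[OF X] s_def
    using m0 by (simp add: field_simps)
qed

text \<open>The two cells are independent. The outputs agree only if both are the blank
  \<open>Suc e\<close>, as the letters differ from each other and are at most \<open>e\<close>; the
  four combinations of staying and advancing then have probability s^2 each. Two cells are
  resampled, one after the other.\<close>

lemma agree_step_neq:
  assumes "Suc k \<le> H" "set x \<subseteq> {..<e}" "set y \<subseteq> {..<e}" "hd0 e x \<noteq> hd0 e y"
  shows "pr I m (agree (Suc k) x y) =
    s\<^sup>2 * (pr I m (agree k x y) + pr I m (agree k x (tl y)) + pr I m (agree k (tl x) y) + pr I m (agree k (tl x) (tl y)))"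
proof -
  let ?a = "hd0 e x" and ?b = "hd0 e y"
  have ab: "?a \<le> e" "?b \<le> e" using assms hd0_le by blast+
  have t: "set (tl x) \<subseteq> {..<e}" "set (tl y) \<subseteq> {..<e}" using assms by (simp_all add: set_tl_subset)
  have neq: "r k ?a \<noteq> r k ?b" using inj[of k ?a k ?b] ab assms by auto
  have k: "k < H" using assms by simp
  let ?F = "\<lambda>x y. pr I m (agree k x y)"
  have *: "pr I m (\<lambda>D. agree (Suc k) x y (D(r k ?a := v, r k ?b := u))) =
      (if u < X then if v < X then ?F x y else if v < 2 * X then ?F (tl x) y else 0
       else if u < 2 * X then if v < X then ?F x (tl y) else if v < 2 * X then ?F (tl x) (tl y) else 0
       else 0)" for v u
    using assms ab t neq k by (auto simp del: fun_upd_apply simp add: fun_upd_same fun_upd_other outs_upd Let_def)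
  have "pr I m (\<lambda>D. agree (Suc k) x y (D(r k ?a := v))) =
      (if v < X then real X * (?F x y + ?F x (tl y)) / m
       else if v < 2 * X then real X * (?F (tl x) y + ?F (tl x) (tl y)) / m else 0)" for v
  proof -
    have swap: "D(r k ?b := u, r k ?a := v) = D(r k ?a := v, r k ?b := u)" for D :: "nat \<Rightarrow> nat" and u v
      using neq by (simp add: fun_upd_twist)
    show ?thesis
      unfolding unif_resample[OF fin m0 rI[OF k ab(2)], of "\<lambda>D. agree (Suc k) x y (D(r k ?a := v))"]
        swap * sum_cases3[OF X]
      by (auto simp: algebra_simps)
  qed
  note ** = this
  show ?thesis
    unfolding unif_resample[OF fin m0 rI[OF k ab(1)], of "agree (Suc k) x y"] ** sum_cases3[OF X] s_def
    using m0 by (simp add: field_simps power2_eq_square)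
qed

text \<open>The base p = s^2 / (1 - s^2) solves p = s^2 (p + 1). At a mismatch one move lowers the
  distance to \<open>n\<close> and contributes \<open>p ^ n\<close>, and the move in which both
  walks stay contributes another \<open>p ^ Suc n\<close>; the remaining moves are dropped.\<close>

theorem agree_near:
  assumes "k \<le> H" "set x \<subseteq> {..<e}" "set y \<subseteq> {..<e}"
  shows "(s\<^sup>2 / (1 - s\<^sup>2)) ^ lev x y \<le> pr I m (agree k x y)"
  using assms
proof (induction k arbitrary: x y)
  define p where "p = s\<^sup>2 / (1 - s\<^sup>2)"
  have s2: "0 \<le> s\<^sup>2" "s\<^sup>2 \<le> 1 / 4" using s_bounds power_mono[of s "1/2" 2] by (auto simp: power2_eq_square)
  then have p: "0 \<le> p" "p \<le> 1" "s\<^sup>2 * (p + 1) = p" by (auto simp: p_def field_simps)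
  note p_def[symmetric, simp]
  {
    case 0
    then show ?case using p by (simp add: power_le_one)
  next
    case (Suc k)
    let ?F = "\<lambda>x y. pr I m (agree k x y)"
    have IH: "p ^ lev x y \<le> ?F x y" if "set x \<subseteq> {..<e}" "set y \<subseteq> {..<e}" for x y
      using Suc that by simp
    have F0: "0 \<le> ?F x y" for x y by simp
    have t: "set (tl x) \<subseteq> {..<e}" "set (tl y) \<subseteq> {..<e}" using Suc.prems by (simp_all add: set_tl_subset)
    have pS: "s\<^sup>2 * (p ^ Suc n + p ^ n) = p ^ Suc n" for n
    proof -
      have "s\<^sup>2 * (p ^ Suc n + p ^ n) = (s\<^sup>2 * (p + 1)) * p ^ n" by (simp add: algebra_simps)
      then show ?thesis using p by simp
    qed
    show ?case
    proof (cases "hd0 e x = hd0 e y")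
      case True
      have "lev (tl x) (tl y) = lev x y"
        using True Suc.prems by (cases x; cases y) auto
      then have "s * p ^ lev x y + (1 - s) * p ^ lev x y \<le> s * ?F x y + (1 - s) * ?F (tl x) (tl y)"
        using IH[of x y] IH[of "tl x" "tl y"] t Suc.prems s_bounds by (intro add_mono mult_left_mono) auto
      then have "p ^ lev x y \<le> s * ?F x y + (1 - s) * ?F (tl x) (tl y)"
        by (simp add: algebra_simps)
      then show ?thesis using agree_step_eq[OF _ _ _ True] Suc.prems by simp
    next
      case False
      obtain n where n: "lev x y = Suc n" and
        d: "lev (tl x) (tl y) = n \<or> lev x (tl y) = n \<or> lev (tl x) y = n"
        using False by (cases x; cases y) (auto simp: min_def)
      have "p ^ n \<le> ?F x (tl y) + ?F (tl x) y + ?F (tl x) (tl y)"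
      proof -
        have "p ^ lev x (tl y) \<le> ?F x (tl y)" "p ^ lev (tl x) y \<le> ?F (tl x) y"
          "p ^ lev (tl x) (tl y) \<le> ?F (tl x) (tl y)"
          using IH t Suc.prems by blast+
        moreover have "p ^ n = p ^ lev x (tl y) \<or> p ^ n = p ^ lev (tl x) y \<or> p ^ n = p ^ lev (tl x) (tl y)"
          using d by auto
        ultimately show ?thesis
          using F0[of x "tl y"] F0[of "tl x" y] F0[of "tl x" "tl y"] by linarith
      qed
      then have "p ^ Suc n + p ^ n \<le> ?F x y + ?F x (tl y) + ?F (tl x) y + ?F (tl x) (tl y)"
        using IH[of x y] Suc.prems n by simp
      then have "s\<^sup>2 * (p ^ Suc n + p ^ n) \<le> s\<^sup>2 * (?F x y + ?F x (tl y) + ?F (tl x) y + ?F (tl x) (tl y))"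
        by (intro mult_left_mono) auto
      then show ?thesis using agree_step_neq[OF _ _ _ False] Suc.prems pS[of n] n by simp
    qed
  }
qed

text \<open>The base q = 3 s^2 / (1 - s^2) solves q = s^2 (q + 3): at a mismatch three moves lower
  the distance by at most one and the fourth leaves it unchanged. The second summand pays for walks
  that have not consumed the strings after \<open>k\<close> steps. Its factor
  \<open>2 ^ (length x + length y)\<close> is a potential halved by every consumed letter; even with
  the staying moves it shrinks by \<open>3 / 4\<close> per step on average.\<close>

theorem agree_far:
  assumes "k \<le> H" "set x \<subseteq> {..<e}" "set y \<subseteq> {..<e}"
  shows "pr I m (agree k x y) \<le>
    (3 * s\<^sup>2 / (1 - s\<^sup>2)) ^ lev x y + 2 ^ (length x + length y) * (3 / 4) ^ k"
  using assms
proof (induction k arbitrary: x y)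
  define q where "q = 3 * s\<^sup>2 / (1 - s\<^sup>2)"
  have s2: "0 \<le> s\<^sup>2" "s\<^sup>2 \<le> 1 / 4" using s_bounds power_mono[of s "1/2" 2] by (auto simp: power2_eq_square)
  then have q: "0 \<le> q" "q \<le> 1" "s\<^sup>2 * (q + 3) = q"
    by (auto simp: q_def field_simps)
  \<comment> \<open>Needed when one string is exhausted: advancing in it changes nothing, so two of
    the four moves keep the distance and two lower it.\<close>
  have "2 * s\<^sup>2 * (q + 1) \<le> s\<^sup>2 * (q + 3)"
    using mult_left_mono[OF q(2) s2(1)] by (simp add: algebra_simps)
  with q(3) have q4: "2 * s\<^sup>2 * (q + 1) \<le> q" by simp
  note q_def[symmetric, simp]
  {
    case 0
    have "(1::real) \<le> 2 ^ (length x + length y)" by simp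
    moreover have "0 \<le> q ^ lev x y" using q by simp
    ultimately have "1 \<le> q ^ lev x y + 2 ^ (length x + length y)" by linarith
    then show ?case by simp
  next
    case (Suc k)
    let ?F = "\<lambda>x y. pr I m (agree k x y)"
    let ?G = "\<lambda>x y. q ^ lev x y + 2 ^ (length x + length y) * (3 / 4) ^ k"
    have IH: "?F x y \<le> ?G x y" if "set x \<subseteq> {..<e}" "set y \<subseteq> {..<e}" for x y
      using Suc that by simp
    have t: "set (tl x) \<subseteq> {..<e}" "set (tl y) \<subseteq> {..<e}" using Suc.prems by (simp_all add: set_tl_subset)
    define z where "z = (3 / 4 :: real) ^ k"
    have z: "0 \<le> z" by (simp add: z_def)
    note z_def[symmetric, simp]
    consider "x = []" "y = []" | a x' y' where "x = a # x'" "y = a # y'"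
      | "hd0 e x \<noteq> hd0 e y" "x = [] \<or> y = []" | a x' b y' where "x = a # x'" "y = b # y'" "a \<noteq> b"
      using Suc.prems by (cases x; cases y) fastforce+
    then show ?case
    proof cases
      case 1
      then show ?thesis using z by simp
    next
      case (2 a x' y')
      then have "pr I m (agree (Suc k) x y) = s * ?F x y + (1 - s) * ?F x' y'"
        using agree_step_eq[of k x y] Suc.prems by simp
      also have "\<dots> \<le> s * ?G x y + (1 - s) * ?G x' y'"
        using IH[of x y] IH[of x' y'] 2 Suc.prems s_bounds by (intro add_mono mult_left_mono) auto
      also have "\<dots> = q ^ lev x y + 2 ^ (length x' + length y') * z * (1 + 3 * s)"
        using 2 by (simp add: algebra_simps)
      also have "\<dots> \<le> q ^ lev x y + 2 ^ (length x' + length y') * z * 3"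
        using s_bounds z by (intro add_mono mult_left_mono) auto
      also have "\<dots> = q ^ lev x y + 2 ^ (length x + length y) * (3 / 4) ^ Suc k"
        using 2 by simp
      finally show ?thesis by simp
    next
      case 3
      have "pr I m (agree (Suc k) x y) = s\<^sup>2 * (?F x y + ?F x (tl y) + ?F (tl x) y + ?F (tl x) (tl y))"
        using agree_step_neq[OF _ _ _ 3(1)] Suc.prems by simp
      also have "\<dots> \<le> s\<^sup>2 * (?G x y + ?G x (tl y) + ?G (tl x) y + ?G (tl x) (tl y))"
        using IH[of x y] IH[of x "tl y"] IH[of "tl x" y] IH[of "tl x" "tl y"] t Suc.prems
        by (intro mult_left_mono add_mono) auto
      also have "\<dots> = 2 * s\<^sup>2 * (q + 1) * q ^ (lev x y - 1) + 2 * s\<^sup>2 * 3 * 2 ^ (length x + length y - 1) * z"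
      proof -
        have "x = [] \<and> (\<exists>b y'. y = b # y') \<or> y = [] \<and> (\<exists>a x'. x = a # x')" using 3 by (cases x; cases y) auto
        then show ?thesis by (auto simp: algebra_simps)
      qed
      also have "\<dots> \<le> q * q ^ (lev x y - 1) + 2 * (1 / 4) * 3 * 2 ^ (length x + length y - 1) * z"
        using q q4 s2 z by (intro add_mono mult_right_mono) auto
      also have "\<dots> = q ^ lev x y + 2 ^ (length x + length y) * (3 / 4) ^ Suc k"
      proof -
        have "x = [] \<and> (\<exists>b y'. y = b # y') \<or> y = [] \<and> (\<exists>a x'. x = a # x')" using 3 by (cases x; cases y) auto
        then show ?thesis by auto
      qed
      finally show ?thesis by simp
    next
      case (4 a x' b y')
      obtain n where n: "lev x y = Suc n" and d: "n \<le> lev x y'" "n \<le> lev x' y" "n \<le> lev x' y'"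
        using 4 by (auto simp: min_def)
      have "pr I m (agree (Suc k) x y) = s\<^sup>2 * (?F x y + ?F x y' + ?F x' y + ?F x' y')"
        using agree_step_neq[of k x y] Suc.prems 4 by simp
      also have "\<dots> \<le> s\<^sup>2 * (?G x y + ?G x y' + ?G x' y + ?G x' y')"
        using IH[of x y] IH[of x y'] IH[of x' y] IH[of x' y'] 4 Suc.prems
        by (intro mult_left_mono add_mono) auto
      also have "\<dots> \<le> s\<^sup>2 * ((q ^ Suc n + 2 ^ (length x + length y) * z) + (q ^ n + 2 ^ (length x + length y') * z)
          + (q ^ n + 2 ^ (length x' + length y) * z) + (q ^ n + 2 ^ (length x' + length y') * z))"
        using n d q by (intro mult_left_mono add_mono) (auto intro!: power_decreasing)
      also have "\<dots> = s\<^sup>2 * (q + 3) * q ^ n + s\<^sup>2 * 9 * 2 ^ (length x' + length y') * z"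
        using 4 by (simp add: algebra_simps)
      also have "\<dots> \<le> q * q ^ n + 1 / 4 * 12 * 2 ^ (length x' + length y') * z"
        using q s2 z by (intro add_mono mult_right_mono mult_mono) auto
      also have "\<dots> = q ^ lev x y + 2 ^ (length x + length y) * (3 / 4) ^ Suc k"
        unfolding n using 4 by simp
      finally show ?thesis by simp
    qed
  }
qed

end

subsection \<open>Fingerprints\<close>

lemma mod_add_right_cancel: "(v + R) mod p = (v' + R) mod p \<Longrightarrow> v mod p = v' mod (p::nat)"
  unfolding nat_mod_eq_iff by auto

text \<open>Members of one residue class are told apart by their quotients by \<open>p\<close>, and
  there are \<open>m div p\<close> quotients because \<open>p\<close> divides
  \<open>m\<close>.\<close>

lemma card_mod_le:
  assumes "0 < (p::nat)" "p dvd m"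
  shows "card {v. v < m \<and> (v + R) mod p = c} \<le> m div p"
proof -
  have "inj_on (\<lambda>v. v div p) {v. v < m \<and> (v + R) mod p = c}"
  proof (rule inj_onI, clarsimp)
    fix v v' assume "(v' + R) mod p = (v + R) mod p" "v div p = v' div p"
    then have "v mod p = v' mod p" by (metis mod_add_right_cancel)
    with \<open>v div p = v' div p\<close> show "v = v'" by (metis div_mult_mod_eq)
  qed
  moreover have "(\<lambda>v. v div p) ` {v. v < m \<and> (v + R) mod p = c} \<subseteq> {..<m div p}"
    using assms by (auto simp: div_less_iff_less_mult mult.commute elim!: dvdE)
  ultimately have "card {v. v < m \<and> (v + R) mod p = c} \<le> card {..<m div p}"
    by (intro card_inj_on_le[where f = "\<lambda>v. v div p"]) auto
  then show ?thesis by simp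
qed

lemma expectation_indicator_sum:
  assumes "finite (set_pmf p)" "finite T"
  shows "(\<Sum>t\<in>T. measure_pmf.prob p {D. A t D}) = measure_pmf.expectation p (\<lambda>D. \<Sum>t\<in>T. indicator {D. A t D} D)"
  using assms by (subst Bochner_Integration.integral_sum) (auto intro: integrable_measure_pmf_finite)

text \<open>If the address lists differ, some address of \<open>u D\<close> is missing from
  \<open>v D\<close>. Redrawing its word moves one sum and leaves the other unchanged, so they agree
  modulo \<open>p\<close> with probability at most \<open>1 / p\<close>. The lists may be random
  themselves, but must not depend on the words in \<open>Z\<close> that they select.\<close>

lemma fingerprint_collision:
  fixes u v :: "(nat \<Rightarrow> nat) \<Rightarrow> nat list"
  assumes I: "finite I" "0 < m" "0 < p" "p dvd m" "Z \<subseteq> I"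
    and u: "\<And>D. distinct (u D)" "\<And>D. set (u D) \<subseteq> Z" "\<And>D i a. i \<in> Z \<Longrightarrow> u (D(i := a)) = u D"
    and v: "\<And>D i a. i \<in> Z \<Longrightarrow> v (D(i := a)) = v D"
    and neq: "\<And>D. u D \<noteq> v D \<Longrightarrow> \<not> set (u D) \<subseteq> set (v D)"
  shows "pr I m (\<lambda>D. u D \<noteq> v D \<and> sum_list (map D (u D)) mod p = sum_list (map D (v D)) mod p) \<le> 1 / p"
proof -
  define pick where "pick D = (SOME i. i \<in> set (u D) - set (v D))" for D
  have pick: "pick D \<in> set (u D) - set (v D)" if "u D \<noteq> v D" for D
  proof -
    have "\<exists>i. i \<in> set (u D) - set (v D)" using neq[OF that] by auto
    then show ?thesis unfolding pick_def by (rule someI_ex)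
  qed
  \<comment> \<open>The choice depends on the two lists alone, so redrawing a cell of
    \<open>Z\<close> does not change which address is picked.\<close>
  have pick_upd: "pick (D(i := a)) = pick D" if "i \<in> Z" for D i a
    unfolding pick_def using u(3)[OF that] v[OF that] by simp
  have fZ: "finite Z" using I finite_subset by blast
  have finU: "finite (set_pmf (unif I m))" using I by (intro finite_set_unif) auto
  let ?E = "\<lambda>D. u D \<noteq> v D \<and> sum_list (map D (u D)) mod p = sum_list (map D (v D)) mod p"
  let ?C = "\<lambda>i D. u D \<noteq> v D \<and> pick D = i"
  have one: "pr I m (\<lambda>D. ?C i D \<and> ?E D) \<le> pr I m (?C i) / p" if i: "i \<in> Z" for i
  proof -
    \<comment> \<open>Distinctness of \<open>u D\<close> makes \<open>i\<close> occur exactly once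
      on the left, and it does not occur on the right.\<close>
    have "\<exists>R R'. \<forall>a. ?E (D(i := a)) \<longleftrightarrow> (a + R) mod p = R' mod p" if "?C i D" for D
    proof -
      have iu: "i \<in> set (u D)" "i \<notin> set (v D)" using pick[of D] that by auto
      obtain xs ys where xs: "u D = xs @ i # ys" using iu by (meson split_list)
      then have ni: "i \<notin> set xs" "i \<notin> set ys" using u(1)[of D] by auto
      have m: "map (D(i := a)) xs = map D xs" "map (D(i := a)) ys = map D ys"
        "map (D(i := a)) (v D) = map D (v D)" for a using ni iu by auto
      have sm: "sum_list (map (D(i := a)) (u D)) = a + sum_list (map D (xs @ ys))" for a
        unfolding xs map_append list.map m sum_list_append sum_list.Cons fun_upd_same by simp
      have "?E (D(i := a)) \<longleftrightarrow> (a + sum_list (map D (xs @ ys))) mod p = sum_list (map D (v D)) mod p" for a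
        unfolding u(3)[OF i] v[OF i] sm m using that by simp
      then show ?thesis by blast
    qed
    then obtain R R' where R: "\<And>D a. ?C i D \<Longrightarrow> ?E (D(i := a)) \<longleftrightarrow> (a + R D) mod p = R' D mod p"
      by metis
    have h1: "pr I m (\<lambda>D. ?C i D \<and> ?E D) = (\<Sum>a<m. pr I m (\<lambda>D. ?C i D \<and> (a + R D) mod p = R' D mod p)) / m"
    proof -
      have *: "(?C i (D(i := a)) \<and> ?E (D(i := a))) = (?C i D \<and> (a + R D) mod p = R' D mod p)" for D a
        using R[of D a] pick_upd[OF i, of D a] u(3)[OF i, of D a] v[OF i, of D a] by metis
      show ?thesis
        using i I by (subst unif_resample[of I m i]) (auto simp only: *)
    qed
    have "(\<Sum>a<m. pr I m (\<lambda>D. ?C i D \<and> (a + R D) mod p = R' D mod p)) =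
        measure_pmf.expectation (unif I m) (\<lambda>D. \<Sum>a<m. indicator {D. ?C i D \<and> (a + R D) mod p = R' D mod p} D)"
      by (rule expectation_indicator_sum[OF finU]) auto
    also have "\<dots> \<le> measure_pmf.expectation (unif I m) (\<lambda>D. (m / p) * indicator {D. ?C i D} D)"
    proof (intro integral_mono integrable_measure_pmf_finite finU)
      fix D
      have "(\<Sum>a<m. indicator {D. ?C i D \<and> (a + R D) mod p = R' D mod p} D :: real) =
          indicator {D. ?C i D} D * real (card {a. a < m \<and> (a + R D) mod p = R' D mod p})"
        by (auto simp: indicator_def sum.If_cases Int_def)
      also have "\<dots> \<le> indicator {D. ?C i D} D * (m / p)"
        using card_mod_le[OF I(3,4)] I(3,4)
        by (intro mult_left_mono) (auto simp: real_of_nat_div[symmetric] simp del: of_nat_div)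
      finally show "(\<Sum>a<m. indicator {D. ?C i D \<and> (a + R D) mod p = R' D mod p} D :: real) \<le> (m / p) * indicator {D. ?C i D} D"
        by (simp add: mult.commute)
    qed
    also have "\<dots> = (m / p) * pr I m (?C i)" by simp
    finally have h2: "(\<Sum>a<m. pr I m (\<lambda>D. ?C i D \<and> (a + R D) mod p = R' D mod p)) \<le> (m / p) * pr I m (?C i)" .
    have "pr I m (\<lambda>D. ?C i D \<and> ?E D) \<le> (m / p) * pr I m (?C i) / m"
      unfolding h1 by (rule divide_right_mono[OF h2]) simp
    also have "\<dots> = pr I m (?C i) / p" using I by simp
    finally show ?thesis .
  qed
  \<comment> \<open>The failure event is split by the picked address. These cases are disjoint, so
    the factor \<open>1 / p\<close> survives summation.\<close>
  have "pr I m ?E = pr I m (\<lambda>D. \<exists>i\<in>Z. ?C i D \<and> ?E D)"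
    using pick u(2) by (intro arg_cong[where f="measure_pmf.prob _"]) blast
  also have "\<dots> = measure_pmf.prob (unif I m) (\<Union>i\<in>Z. {D. ?C i D \<and> ?E D})"
    by (intro arg_cong[where f="measure_pmf.prob _"]) blast
  also have "\<dots> \<le> (\<Sum>i\<in>Z. pr I m (\<lambda>D. ?C i D \<and> ?E D))"
    using fZ by (intro measure_pmf.finite_measure_subadditive_finite) auto
  also have "\<dots> \<le> (\<Sum>i\<in>Z. pr I m (?C i) / p)" by (intro sum_mono one)
  also have "\<dots> = (\<Sum>i\<in>Z. pr I m (?C i)) / p" by (simp add: sum_divide_distrib)
  also have "\<dots> \<le> 1 / p"
  proof (rule divide_right_mono)
    have "(\<Sum>i\<in>Z. pr I m (?C i)) = measure_pmf.prob (unif I m) (\<Union>i\<in>Z. {D. ?C i D})"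
      using fZ by (intro measure_pmf.finite_measure_finite_Union[symmetric]) (auto simp: disjoint_family_on_def)
    then show "(\<Sum>i\<in>Z. pr I m (?C i)) \<le> 1" by simp
  qed simp
  finally show ?thesis .
qed

subsection \<open>Pairwise independent tables\<close>

text \<open>Chebyshev's inequality: under pairwise independence the variance of the number of events
  is at most its mean \<mu>, so this number is 0 with probability at most \<mu> / \<mu>^2.\<close>

lemma second_moment:
  assumes fin: "finite (set_pmf p)" "finite T"
    and indep: "\<And>t t'. t \<in> T \<Longrightarrow> t' \<in> T \<Longrightarrow> t \<noteq> t' \<Longrightarrow>
      measure_pmf.prob p {D. A t D \<and> A t' D} = measure_pmf.prob p {D. A t D} * measure_pmf.prob p {D. A t' D}"
    and mu: "0 < c" "c \<le> (\<Sum>t\<in>T. measure_pmf.prob p {D. A t D})"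
  shows "measure_pmf.prob p {D. \<forall>t\<in>T. \<not> A t D} \<le> 1 / c"
proof -
  define P where "P t = measure_pmf.prob p {D. A t D}" for t
  define \<mu> where "\<mu> = (\<Sum>t\<in>T. P t)"
  define N :: "_ \<Rightarrow> real" where "N D = (\<Sum>t\<in>T. indicator {D. A t D} D)" for D
  have \<mu>: "0 < \<mu>" "c \<le> \<mu>" using mu by (auto simp: \<mu>_def P_def)
  have int: "integrable p f" for f :: "_ \<Rightarrow> real" using fin by (auto intro: integrable_measure_pmf_finite)
  have EN: "measure_pmf.expectation p N = \<mu>"
    unfolding N_def \<mu>_def P_def using expectation_indicator_sum[OF fin] by simp
  have "measure_pmf.expectation p (\<lambda>D. (N D)\<^sup>2) =
      (\<Sum>t\<in>T. \<Sum>t'\<in>T. measure_pmf.prob p {D. A t D \<and> A t' D})"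
  proof -
    have "(N D)\<^sup>2 = (\<Sum>t\<in>T. \<Sum>t'\<in>T. indicator {D. A t D \<and> A t' D} D)" for D
      unfolding N_def power2_eq_square sum_product by (intro sum.cong refl) (auto simp: indicator_def)
    then show ?thesis using int by (simp add: Bochner_Integration.integral_sum)
  qed
  also have "\<dots> \<le> (\<Sum>t\<in>T. \<Sum>t'\<in>T. P t * P t' + (if t = t' then P t else 0))"
    using indep by (intro sum_mono) (auto simp: P_def)
  also have "\<dots> = \<mu>\<^sup>2 + \<mu>"
    unfolding \<mu>_def power2_eq_square sum_product using fin by (simp add: sum.distrib)
  finally have EN2: "measure_pmf.expectation p (\<lambda>D. (N D)\<^sup>2) \<le> \<mu>\<^sup>2 + \<mu>" .
  have "\<mu>\<^sup>2 * measure_pmf.prob p {D. \<forall>t\<in>T. \<not> A t D} =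
      measure_pmf.expectation p (\<lambda>D. \<mu>\<^sup>2 * indicator {D. \<forall>t\<in>T. \<not> A t D} D)" by simp
  also have "\<dots> \<le> measure_pmf.expectation p (\<lambda>D. (N D - \<mu>)\<^sup>2)"
  proof (intro integral_mono int)
    fix D show "\<mu>\<^sup>2 * indicator {D. \<forall>t\<in>T. \<not> A t D} D \<le> (N D - \<mu>)\<^sup>2"
      by (cases "\<forall>t\<in>T. \<not> A t D") (auto simp: N_def indicator_def)
  qed
  also have "\<dots> = measure_pmf.expectation p (\<lambda>D. (N D)\<^sup>2 - 2 * \<mu> * N D + \<mu>\<^sup>2)"
    by (simp add: power2_eq_square algebra_simps)
  also have "\<dots> = measure_pmf.expectation p (\<lambda>D. (N D)\<^sup>2) - 2 * \<mu> * measure_pmf.expectation p N + \<mu>\<^sup>2"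
    using int by simp
  also have "\<dots> \<le> \<mu>" using EN2 EN by (simp add: power2_eq_square)
  finally have "measure_pmf.prob p {D. \<forall>t\<in>T. \<not> A t D} \<le> 1 / \<mu>"
    using \<mu> by (simp add: field_simps power2_eq_square)
  also have "\<dots> \<le> 1 / c" using \<mu> mu by (simp add: field_simps)
  finally show ?thesis .
qed

text \<open>The rows \<open>r b\<close> hold independent words from which the words of all tables
  are mixed; \<open>Z\<close> is a set of cells kept apart from them, later those of the
  fingerprints.\<close>

locale rows =
  fixes I :: "nat set" and m B H e :: nat and r :: "nat \<Rightarrow> nat \<Rightarrow> nat \<Rightarrow> nat" and Z :: "nat set"
  assumes fin: "finite I" and m0: "0 < m"
    and rI: "\<And>b k a. b < B \<Longrightarrow> k < H \<Longrightarrow> a \<le> e \<Longrightarrow> r b k a \<in> I \<and> r b k a \<notin> Z"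
    and inj: "\<And>b k a b' k' a'. b < B \<Longrightarrow> k < H \<Longrightarrow> a \<le> e \<Longrightarrow> b' < B \<Longrightarrow> k' < H \<Longrightarrow> a' \<le> e \<Longrightarrow>
      r b k a = r b' k' a' \<Longrightarrow> b = b' \<and> k = k' \<and> a = a'"
begin

text \<open>Sums over the sets of bits of the table numbers make the tables pairwise independent, at the cost
  of logarithmically many random words per step and letter.\<close>

definition mix :: "nat set \<Rightarrow> (nat \<Rightarrow> nat) \<Rightarrow> nat \<Rightarrow> nat \<Rightarrow> nat" where
  "mix S D k a = (\<Sum>b\<in>S. D (r b k a)) mod m"

definition dep :: "((nat \<Rightarrow> nat \<Rightarrow> nat) \<Rightarrow> (nat \<Rightarrow> nat) \<Rightarrow> bool) \<Rightarrow> bool" where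
  "dep G \<longleftrightarrow> (\<forall>w w' D D'. (\<forall>k<H. \<forall>a\<le>e. w k a = w' k a) \<longrightarrow> (\<forall>i\<in>Z. D i = D' i) \<longrightarrow> G w D = G w' D')"

lemma depD:
  "dep G \<Longrightarrow> (\<And>k a. k < H \<Longrightarrow> a \<le> e \<Longrightarrow> w k a = w' k a) \<Longrightarrow> (\<And>i. i \<in> Z \<Longrightarrow> D i = D' i) \<Longrightarrow> G w D = G w' D'"
  unfolding dep_def by blast

text \<open>Replacing row \<open>b0\<close> by the sum of the rows in \<open>S \<ni> b0\<close> is a bijection, hence preserves the
  uniform distribution.\<close>

lemma mix_row:
  assumes S: "S \<subseteq> {..<B}" "b0 \<in> S" and G: "dep G"
    and F: "\<And>D D'. (\<And>i. i \<notin> (\<lambda>(k, a). r b0 k a) ` ({..<H} \<times> {..e}) \<Longrightarrow> D i = D' i) \<Longrightarrow> F D = F D'"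
  shows "pr I m (\<lambda>D. G (mix S D) D \<and> F D) = pr I m (\<lambda>D. G (\<lambda>k a. D (r b0 k a)) D \<and> F D)"
proof -
  let ?R = "(\<lambda>(k, a). r b0 k a) ` ({..<H} \<times> {..e})"
  let ?f = "\<lambda>(k, a). r b0 k a"
  define \<Phi> where "\<Phi> D i = (if i \<in> ?R then case inv_into ({..<H} \<times> {..e}) ?f i of (k, a) \<Rightarrow> mix S D k a else D i)"
    for D i
  have b0: "b0 < B" using S by auto
  have injf: "inj_on ?f ({..<H} \<times> {..e})" using inj[OF b0 _ _ b0] by (auto simp: inj_on_def)
  have \<Phi>1: "\<Phi> D (r b0 k a) = mix S D k a" if "k < H" "a \<le> e" for D k a
    using that inv_into_f_f[OF injf, of "(k, a)"] by (auto simp: \<Phi>_def)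
  have \<Phi>2: "\<Phi> D i = D i" if "i \<notin> ?R" for D i using that by (simp add: \<Phi>_def)
  have RI: "?R \<subseteq> I" "?R \<inter> Z = {}" using rI b0 by auto
  have "pr I m (\<lambda>D. G (\<lambda>k a. \<Phi> D (r b0 k a)) (\<Phi> D) \<and> F (\<Phi> D)) = pr I m (\<lambda>D. G (\<lambda>k a. D (r b0 k a)) D \<and> F D)"
  proof (rule unif_invariant[OF fin m0, where E = "\<lambda>D. G (\<lambda>k a. D (r b0 k a)) D \<and> F D"])
    fix D assume D: "D \<in> PiE_dflt I 0 (\<lambda>_. {..<m})"
    have "\<Phi> D i < m" if "i \<in> I" for i
      using that D m0 by (auto simp: \<Phi>_def mix_def PiE_dflt_def split: prod.split)
    moreover have "\<Phi> D i = 0" if "i \<notin> I" for i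
      using that D RI \<Phi>2[of i D] by (auto simp: PiE_dflt_def)
    ultimately show "\<Phi> D \<in> PiE_dflt I 0 (\<lambda>_. {..<m})" by (auto simp: PiE_dflt_def)
  next
    show "inj_on \<Phi> (PiE_dflt I 0 (\<lambda>_. {..<m}))"
    proof (rule inj_onI, rule ext)
      fix D D' i
      assume D: "D \<in> PiE_dflt I 0 (\<lambda>_. {..<m})" "D' \<in> PiE_dflt I 0 (\<lambda>_. {..<m})" and eq: "\<Phi> D = \<Phi> D'"
      have off: "D j = D' j" if "j \<notin> ?R" for j using \<Phi>2[OF that, of D] \<Phi>2[OF that, of D'] eq by simp
      show "D i = D' i"
      proof (cases "i \<in> ?R")
        case True
        then obtain k a where ka: "k < H" "a \<le> e" "i = r b0 k a" by auto
        have fS: "finite S" using S finite_subset by blast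
        \<comment> \<open>The other summands lie outside row \<open>b0\<close>, where the
          assignments agree, so the sum modulo \<open>m\<close> determines the remaining
          cell.\<close>
        have "D (r b k a) = D' (r b k a)" if "b \<in> S - {b0}" for b
        proof (rule off)
          show "r b k a \<notin> ?R" using that S ka b0 inj[of b k a b0] by auto
        qed
        then have "(\<Sum>b\<in>S - {b0}. D (r b k a)) = (\<Sum>b\<in>S - {b0}. D' (r b k a))" by simp
        moreover have "mix S D k a = mix S D' k a" using \<Phi>1[OF ka(1,2), of D] \<Phi>1[OF ka(1,2), of D'] eq by simp
        ultimately have "D i mod m = D' i mod m"
          unfolding mix_def sum.remove[OF fS S(2)] ka(3) by (metis mod_add_right_cancel)
        moreover have "D i < m" "D' i < m" using D RI True by (auto simp: PiE_dflt_def)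
        ultimately show ?thesis by simp
      qed (use off in auto)
    qed
  qed
  moreover have "G (\<lambda>k a. \<Phi> D (r b0 k a)) (\<Phi> D) = G (mix S D) D" for D
    using G RI \<Phi>1 \<Phi>2 unfolding dep_def by (smt (verit) disjoint_iff)
  moreover have "F (\<Phi> D) = F D" for D by (rule F) (rule \<Phi>2)
  ultimately show ?thesis by simp
qed

text \<open>Some row \<open>b0\<close> belongs to exactly one of the two sets. By
  \<open>mix_row\<close> the mixed words of that set may be replaced by row \<open>b0\<close> alone,
  which the other event does not read, so the events live on disjoint cells.\<close>

lemma mix_indep:
  assumes S: "S \<subseteq> {..<B}" "T \<subseteq> {..<B}" "S \<noteq> {}" "T \<noteq> {}" "S \<noteq> T"
    and G: "dep (\<lambda>w D. G w)" "dep (\<lambda>w D. G' w)"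
  shows "pr I m (\<lambda>D. G (mix S D) \<and> G' (mix T D)) = pr I m (\<lambda>D. G (mix S D)) * pr I m (\<lambda>D. G' (mix T D))"
proof -
  have main: "pr I m (\<lambda>D. G (mix S D) \<and> G' (mix T D)) = pr I m (\<lambda>D. G (mix S D)) * pr I m (\<lambda>D. G' (mix T D))"
    if S: "S \<subseteq> {..<B}" "T \<subseteq> {..<B}" and b0: "b0 \<in> S" "b0 \<notin> T"
      and G: "dep (\<lambda>w D. G w)" "dep (\<lambda>w D. G' w)" for S T b0 G G'
  proof -
    let ?R = "(\<lambda>(k, a). r b0 k a) ` ({..<H} \<times> {..e})"
    let ?T = "\<Union>b\<in>T. (\<lambda>(k, a). r b k a) ` ({..<H} \<times> {..e})"
    have b0B: "b0 < B" using S b0 by auto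
    have RT: "?R \<inter> ?T = {}"
    proof -
      have "r b0 k a \<noteq> r b k' a'" if "b \<in> T" "k < H" "a \<le> e" "k' < H" "a' \<le> e" for b k a k' a'
        using inj[of b0 k a b k' a'] b0 b0B S that by auto
      then show ?thesis by auto
    qed
    have RI: "?R \<subseteq> I" using rI b0B by auto
    have G'T: "G' (mix T D) = G' (mix T D')" if "\<And>i. i \<in> ?T \<Longrightarrow> D i = D' i" for D D'
    proof -
      have *: "mix T D k a = mix T D' k a" if ka: "k < H" "a \<le> e" for k a
      proof -
        have "D (r b k a) = D' (r b k a)" if "b \<in> T" for b using ka that by (intro \<open>\<And>i. i \<in> ?T \<Longrightarrow> D i = D' i\<close>) auto
        then show ?thesis by (simp add: mix_def)
      qed
      show ?thesis using depD[OF G(2) *, where D = D and D' = D] by simp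
    qed
    have GR: "G (\<lambda>k a. D (r b0 k a)) = G (\<lambda>k a. D' (r b0 k a))" if "\<And>i. i \<in> ?R \<Longrightarrow> D i = D' i" for D D'
    proof -
      have *: "D (r b0 k a) = D' (r b0 k a)" if "k < H" "a \<le> e" for k a
        using that by (intro \<open>\<And>i. i \<in> ?R \<Longrightarrow> D i = D' i\<close>) auto
      show ?thesis using depD[OF G(1) *, where D = D and D' = D] by simp
    qed
    have "pr I m (\<lambda>D. G (mix S D) \<and> G' (mix T D)) = pr I m (\<lambda>D. G (\<lambda>k a. D (r b0 k a)) \<and> G' (mix T D))"
      by (rule mix_row[OF S(1) b0(1) G(1)]) (rule G'T, use RT in blast)
    also have "\<dots> = pr I m (\<lambda>D. G (\<lambda>k a. D (r b0 k a))) * pr I m (\<lambda>D. G' (mix T D))"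
      by (rule unif_indep[OF fin m0 RI RT GR G'T])
    also have "pr I m (\<lambda>D. G (\<lambda>k a. D (r b0 k a))) = pr I m (\<lambda>D. G (mix S D))"
      using mix_row[OF S(1) b0(1) G(1), of "\<lambda>_. True"] by simp
    finally show ?thesis .
  qed
  show ?thesis
  proof (cases "S \<subseteq> T")
    case False
    then obtain b0 where "b0 \<in> S" "b0 \<notin> T" by auto
    then show ?thesis by (intro main[OF S(1,2) _ _ G])
  next
    case True
    then obtain b0 where b0: "b0 \<in> T" "b0 \<notin> S" using S by auto
    have "pr I m (\<lambda>D. G' (mix T D) \<and> G (mix S D)) = pr I m (\<lambda>D. G' (mix T D)) * pr I m (\<lambda>D. G (mix S D))"
      by (rule main[OF S(2,1) b0 G(2,1)])
    moreover have "pr I m (\<lambda>D. G (mix S D) \<and> G' (mix T D)) = pr I m (\<lambda>D. G' (mix T D) \<and> G (mix S D))"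
      by (intro arg_cong[where f = "measure_pmf.prob _"]) auto
    ultimately show ?thesis by (simp only: mult.commute)
  qed
qed

end

section \<open>Parameters and memory layout\<close>

text \<open>A power of two makes the table numbers below \<open>64 * P\<close> correspond to the
  sets of \<open>L + 6\<close> bits, and it makes \<open>m\<close> even.\<close>

definition log_size :: "nat \<Rightarrow> nat \<Rightarrow> nat \<Rightarrow> nat" where
  "log_size n d sg = (LEAST L. n + d + sg + 4 \<le> 2 ^ L)"

text \<open>There are \<open>L + 1\<close> levels with \<open>GI\<close> thresholds each, and \<open>64 P\<close> hash tables for each of the
  \<open>NL\<close> pairs.  Data cells 0 to 3 hold the parameters, \<open>saddr i\<close> is the address of the \<open>i\<close>-th string (its
  length, followed by its letters), \<open>rnd\<close> those of the random cells and \<open>tab\<close> those of the tables.  The factor \<open>N\<close> is the word \<open>\<lfloor>c n\<rfloor>\<close>, \<open>sg\<close> is the size of the alphabet, and \<open>W\<close> the word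
  modulus.\<close>

locale ann =
  fixes n d sg N W :: nat
  assumes n1: "1 \<le> n" and d1: "1 \<le> d" and nN: "n \<le> N"
    and W: "N * (2 ^ log_size n d sg) ^ 16 \<le> W"
begin

definition "L = log_size n d sg"
definition P :: nat where "P = 2 ^ L"
text \<open>The truncation error of two walks is at most \<open>4 ^ d * (3 / 4) ^ H\<close>. Since
  \<open>(3 / 4) ^ 5 < 1 / 4\<close>, this length brings it below \<open>1 / P\<close>.\<close>

definition "H = 5 * (d + L)"
text \<open>A multiple of \<open>P\<close>, for the fingerprints, and fine enough for integer
  thresholds to follow a geometric sequence down to about \<open>m / P\<close>.\<close>

definition "m = P ^ 4"
text \<open>Neighbouring grid points q differ by a factor of at least (1 - 1 / G)^4, and even the
  \<open>r\<close>-th power of this factor is at least \<open>1 / 2\<close> for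
  \<open>r \<le> L\<close>.\<close>

definition "G = 8 * L"
text \<open>More than the \<open>2 * G * L\<close> steps after which the grid has reached
  \<open>1 / P\<^sup>2\<close>.\<close>

definition "GI = 32 * L * L"
definition "NL = (L + 1) * GI"
definition "RB = 4 + P * P"
text \<open>Each threshold owns \<open>L + 6\<close> rows to be mixed and one row of fingerprint
  words, each with room for \<open>16 * P\<close> steps and \<open>P\<close> letters.\<close>

definition "TB = RB + NL * (L + 7) * (16 * P) * P"
text \<open>A table has \<open>P\<close> bucket heads followed by \<open>P\<close> links. At most
  \<open>40 * P\<close> tables are probed, and 64 is the next power of two.\<close>

definition "DS = TB + NL * (64 * P) * (2 * P)"

definition "saddr i = 4 + i * P"
definition "rnd l b k a = RB + (((l * (L + 7) + b) * (16 * P) + k) * P + a)"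
definition "tab l t z = TB + ((l * (64 * P) + t) * (2 * P) + z)"

lemma P_ge: "n + d + sg + 4 \<le> P"
  unfolding P_def L_def log_size_def by (rule LeastI_ex) (meson less_exp less_imp_le)

lemma L_ge: "3 \<le> L"
proof (rule ccontr)
  assume "\<not> 3 \<le> L"
  then have "P \<le> 2 ^ 2" unfolding P_def by (intro power_increasing) auto
  then show False using P_ge n1 d1 by simp
qed

lemma P8: "8 \<le> P"
proof -
  have "(2::nat) ^ 3 \<le> P" unfolding P_def using L_ge by (intro power_increasing) auto
  then show ?thesis by simp
qed

lemma L_less: "L < P" unfolding P_def by (rule less_exp)

lemma P_le: "P < 2 * (n + d + sg + 4)"
proof -
  have "\<not> n + d + sg + 4 \<le> 2 ^ (L - 1)"
    unfolding L_def log_size_def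
    by (rule not_less_Least) (use L_ge in \<open>simp add: L_def log_size_def\<close>)
  moreover have "P = 2 * 2 ^ (L - 1)" unfolding P_def using L_ge by (simp flip: power_Suc)
  ultimately show ?thesis by simp
qed

lemma H_less: "H \<le> 16 * P" and H_pos: "0 < H"
  unfolding H_def using P_ge L_less d1 by auto

lemma P_power_le: "i \<le> j \<Longrightarrow> P ^ i \<le> P ^ j"
  using P8 by (intro power_increasing) auto

lemma NL_le: "NL \<le> P ^ 5"
proof -
  have "32 \<le> P * P" using mult_mono[of 8 P 8 P] P8 by simp
  moreover have "L + 1 \<le> P" "L \<le> P" using L_less by auto
  ultimately have "(L + 1) * (32 * L * L) \<le> P * (P * P * P * P)"
    by (intro mult_mono) auto
  then show ?thesis unfolding NL_def GI_def by (simp add: eval_nat_numeral)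
qed

lemma DS_le: "DS \<le> P ^ 11"
proof -
  have "16 * (L + 7) + 128 \<le> 16 * P + 240" using L_less by simp
  also have "\<dots> \<le> 46 * P" using P8 by simp
  also have "\<dots> \<le> P * P * P" using mult_mono[of 8 P 8 P] P8 by simp
  finally have a: "16 * (L + 7) + 128 \<le> P * P * P" .
  have "DS = 4 + P * P + NL * (16 * (L + 7) + 128) * (P * P)"
    unfolding DS_def TB_def RB_def by (simp add: algebra_simps)
  also have "\<dots> \<le> 4 + P * P + P ^ 5 * (P * P * P) * (P * P)"
    using NL_le a by (intro add_left_mono mult_right_mono mult_mono) auto
  also have "\<dots> = 4 + P ^ 2 + P ^ 10" by (simp add: eval_nat_numeral)
  also have "\<dots> \<le> 4 + P ^ 10 + P ^ 10" using P_power_le[of 2 10] by simp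
  also have "\<dots> \<le> P ^ 10 + P ^ 10 + P ^ 10" using P_power_le[of 1 10] P8 by simp
  also have "\<dots> = 3 * P ^ 10" by simp
  also have "\<dots> \<le> P * P ^ 10" using P8 by (intro mult_right_mono) auto
  finally show ?thesis by (simp add: eval_nat_numeral)
qed

lemma NW: "N * P ^ 16 \<le> W" using W by (simp add: P_def L_def)

lemma P_power_W: "i \<le> 16 \<Longrightarrow> P ^ i \<le> W"
proof -
  assume "i \<le> 16"
  then have "P ^ i \<le> P ^ 16" by (rule P_power_le)
  also have "\<dots> \<le> N * P ^ 16" using n1 nN by simp
  finally show ?thesis using NW by simp
qed

lemma P_power_lt_W: "i < 16 \<Longrightarrow> P ^ i < W"
proof -
  assume "i < 16"
  then have "P ^ i < P ^ Suc i" using P8 by simp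
  also have "\<dots> \<le> W" using \<open>i < 16\<close> by (intro P_power_W) auto
  finally show ?thesis .
qed

lemma DS_W: "DS < W" using DS_le P_power_lt_W[of 11] by simp

lemma W_big: "32768 < W"
proof -
  have "(8::nat) ^ 5 \<le> P ^ 5" using P8 by (intro power_mono) auto
  then show ?thesis using P_power_lt_W[of 5] by simp
qed

lemma mixed_radix_less:
  assumes "(a::nat) < A" "b < B" shows "a * B + b < A * B"
proof -
  have "a * B + b < Suc a * B" using assms by simp
  also have "\<dots> \<le> A * B" using assms by (intro mult_right_mono) auto
  finally show ?thesis .
qed

lemma mixed_radix_eq:
  assumes "(a::nat) * B + b = a' * B + b'" "b < B" "b' < B" shows "a = a' \<and> b = b'"
proof -
  have "B \<noteq> 0" using assms by auto
  then have "a = (a * B + b) div B" "b = (a * B + b) mod B" using assms(2) by (simp_all add: div_add1_eq)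
  moreover have "a' = (a' * B + b') div B" "b' = (a' * B + b') mod B"
    using assms(3) \<open>B \<noteq> 0\<close> by (simp_all add: div_add1_eq)
  ultimately show ?thesis using assms(1) by metis
qed

lemma rnd_bounds:
  assumes "l < NL" "b < L + 7" "k < 16 * P" "a < P"
  shows "RB \<le> rnd l b k a" "rnd l b k a < TB"
  unfolding rnd_def TB_def using mixed_radix_less[OF mixed_radix_less[OF mixed_radix_less[OF assms(1,2)] assms(3)] assms(4)]
  by auto

lemma rnd_inj:
  assumes "rnd l b k a = rnd l' b' k' a'" "b < L + 7" "k < 16 * P" "a < P" "b' < L + 7" "k' < 16 * P" "a' < P"
  shows "l = l' \<and> b = b' \<and> k = k' \<and> a = a'"
proof -
  have "((l * (L + 7) + b) * (16 * P) + k) * P + a = ((l' * (L + 7) + b') * (16 * P) + k') * P + a'"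
    using assms(1) by (simp add: rnd_def)
  then have 1: "(l * (L + 7) + b) * (16 * P) + k = (l' * (L + 7) + b') * (16 * P) + k'" "a = a'"
    using mixed_radix_eq assms(4,7) by blast+
  then have 2: "l * (L + 7) + b = l' * (L + 7) + b'" "k = k'"
    using mixed_radix_eq assms(3,6) by blast+
  then show ?thesis using 1 mixed_radix_eq[OF 2(1) assms(2,5)] by simp
qed

lemma tab_bounds:
  assumes "l < NL" "t < 64 * P" "z < 2 * P"
  shows "TB \<le> tab l t z" "tab l t z < DS"
  unfolding tab_def DS_def using mixed_radix_less[OF mixed_radix_less[OF assms(1,2)] assms(3)] by auto

lemma tab_inj:
  assumes "tab l t z = tab l' t' z'" "t < 64 * P" "z < 2 * P" "t' < 64 * P" "z' < 2 * P"
  shows "l = l' \<and> t = t' \<and> z = z'"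
proof -
  have "(l * (64 * P) + t) * (2 * P) + z = (l' * (64 * P) + t') * (2 * P) + z'"
    using assms(1) by (simp add: tab_def)
  then have 1: "l * (64 * P) + t = l' * (64 * P) + t'" "z = z'"
    using mixed_radix_eq assms(3,5) by blast+
  then show ?thesis using mixed_radix_eq[OF 1(1) assms(2,4)] by simp
qed

lemma saddr_bounds:
  assumes "i < n" "k < P"
  shows "4 \<le> saddr i + k" "saddr i + k < RB"
proof -
  have "i * P + k < P * P" using assms P_ge by (intro mixed_radix_less) auto
  then show "4 \<le> saddr i + k" "saddr i + k < RB" by (auto simp: saddr_def RB_def)
qed

lemma RB_TB_DS: "4 \<le> RB" "RB \<le> TB" "TB \<le> DS" "P + P * P \<le> DS"
proof -
  show "4 \<le> RB" "RB \<le> TB" "TB \<le> DS" by (auto simp: RB_def TB_def DS_def)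
  have "1 \<le> NL" unfolding NL_def GI_def using L_ge by (simp add: Suc_le_eq)
  then have "P + P * P \<le> NL * (64 * P) * (2 * P)"
    using P8 mult_mono[of 1 NL "P + P * P" "(64 * P) * (2 * P)"] by simp
  then show "P + P * P \<le> DS" by (simp add: DS_def)
qed

section \<open>Hash values\<close>

text \<open>This is \<open>rows.mix\<close> for the set of binary digits of
  \<open>t\<close>.\<close>

definition "lett D l (t::nat) k a = (\<Sum>b | b < L + 6 \<and> bit t b. D (rnd l b k a)) mod m"
text \<open>An integer geometric sequence with ratio about 1 - 1 / G, starting at s = 1 / 2.\<close>

definition "Xi i = ((\<lambda>x. x - x div G) ^^ i) (m div 2)"
text \<open>All tables of a threshold share the fingerprint words in row \<open>L + 6\<close>. This
  is harmless: the second moment argument speaks of equal outputs rather than equal fingerprints,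
  and false collisions are counted only in expectation.\<close>

definition "hsum D l t X k x = (\<Sum>(j, a)\<leftarrow>outs (lett D l t) X sg k x. D (rnd l (L + 6) j a))"
text \<open>Thresholds of all levels are numbered consecutively as \<open>r * GI + i\<close>, so
  \<open>l mod GI\<close> is the position in the grid.\<close>

definition "fpt D l t x = hsum D l t (Xi (l mod GI)) H x mod P"

end

text \<open>Registers 10 to 22 hold the parameters, 23 to 26 the arguments of the hash routine (level,
  table, threshold, length of the string in working memory), 30 its result.\<close>

definition env :: "nat \<Rightarrow> nat \<Rightarrow> nat \<Rightarrow> nat \<Rightarrow> store \<Rightarrow> bool" where
  "env n d sg N s \<longleftrightarrow>
    regs s 10 = n \<and> regs s 11 = d \<and> regs s 12 = sg \<and> regs s 13 = N \<and> regs s 14 = ann.P n d sg \<and>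
    regs s 15 = ann.L n d sg \<and> regs s 16 = ann.H n d sg \<and> regs s 17 = ann.m n d sg \<and>
    regs s 18 = ann.G n d sg \<and> regs s 19 = ann.GI n d sg \<and> regs s 20 = ann.NL n d sg \<and>
    regs s 21 = ann.RB n d sg \<and> regs s 22 = ann.TB n d sg"

definition rnd_exp :: "exp \<Rightarrow> exp \<Rightarrow> exp \<Rightarrow> exp" where
  "rnd_exp b k a = Reg 21 \<oplus> (((Reg 23 \<otimes> (Reg 15 \<oplus> Const 7) \<oplus> b) \<otimes> (Const 16 \<otimes> Reg 14) \<oplus> k) \<otimes> Reg 14 \<oplus> a)"

definition tab_exp :: "exp \<Rightarrow> exp" where
  "tab_exp z = Reg 22 \<oplus> ((Reg 23 \<otimes> (Const 64 \<otimes> Reg 14) \<oplus> Reg 24) \<otimes> (Const 2 \<otimes> Reg 14) \<oplus> z)"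

definition letter_com :: com where
  "letter_com =
    (Assign 34 (Const 0) ;; Assign 35 (Reg 24) ;; Assign 36 (Const 0) ;;
     While (Less (Reg 36) (Reg 15 \<oplus> Const 6))
      (LoadData 37 (rnd_exp (Reg 36) (Reg 31) (Reg 33)) ;;
       Assign 34 (Mod (Reg 34 \<oplus> Mod (Reg 35) (Const 2) \<otimes> Reg 37) (Reg 17)) ;;
       Assign 35 (Div (Reg 35) (Const 2)) ;;
       Assign 36 (Reg 36 \<oplus> Const 1)))"

definition head_com :: com where
  "head_com = If (Less (Reg 32) (Reg 26)) (LoadWork 33 (Reg 32)) (Assign 33 (Reg 12))"

definition move_com :: com where
  "move_com =
    If (Less (Reg 34) (Reg 25)) (Assign 33 (Reg 12 \<oplus> Const 1))
     (Assign 32 (Reg 32 \<oplus> Const 1) ;;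
      If (Less (Reg 34) (Const 2 \<otimes> Reg 25)) (Assign 33 (Reg 12 \<oplus> Const 1)) (Assign 33 (Reg 33)))"

definition hash_com :: com where
  "hash_com =
    (Assign 30 (Const 0) ;; Assign 31 (Reg 16) ;; Assign 32 (Const 0) ;;
     While (Reg 31)
      (Assign 31 (Reg 31 \<ominus> Const 1) ;;
       head_com ;; letter_com ;; move_com ;;
       LoadData 37 (rnd_exp (Reg 15 \<oplus> Const 6) (Reg 31) (Reg 33)) ;;
       Assign 30 (Mod (Reg 30 \<oplus> Reg 37) (Reg 14))))"

section \<open>Correctness and time of the hash routine\<close>

context ann
begin

definition "mach M \<longleftrightarrow> word_mod M = W \<and> DS \<le> data_cells M \<and> DS \<le> work_cells M"
abbreviation "en \<equiv> env n d sg N"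

text \<open>Reductions modulo \<open>W\<close> commute with sums and products, so intermediate
  overflow is irrelevant once the final address is below \<open>W\<close>. Most later address
  computations rest on this.\<close>

lemma eval_rnd:
  assumes "en s" "regs s 23 < NL" "eval_exp W (regs s) b < L + 7" "eval_exp W (regs s) k < 16 * P"
    "eval_exp W (regs s) a < P"
  shows "eval_exp W (regs s) (rnd_exp b k a) =
    rnd (regs s 23) (eval_exp W (regs s) b) (eval_exp W (regs s) k) (eval_exp W (regs s) a)"
proof -
  have "rnd (regs s 23) (eval_exp W (regs s) b) (eval_exp W (regs s) k) (eval_exp W (regs s) a) < W"
    using rnd_bounds[OF assms(2-5)] RB_TB_DS DS_W by linarith
  then show ?thesis
    using assms(1) unfolding env_def rnd_exp_def rnd_def eval_exp.simps by (simp add: mod_simps)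
qed

lemma eval_tab:
  assumes "en s" "regs s 23 < NL" "regs s 24 < 64 * P" "eval_exp W (regs s) z < 2 * P"
  shows "eval_exp W (regs s) (tab_exp z) = tab (regs s 23) (regs s 24) (eval_exp W (regs s) z)"
proof -
  have "tab (regs s 23) (regs s 24) (eval_exp W (regs s) z) < W"
    using tab_bounds[OF assms(2-4)] DS_W by linarith
  then show ?thesis
    using assms(1) unfolding env_def tab_exp_def tab_def eval_exp.simps by (simp add: mod_simps)
qed

lemma small_W: "x \<le> 30000 \<Longrightarrow> x < W" "P < W" "L + 7 < W" "16 * P < W" "m < W" "2 * m < W" "sg + 1 < W"
proof -
  show "x \<le> 30000 \<Longrightarrow> x < W" using W_big by simp
  show 1: "P < W" using P_power_lt_W[of 1] by simp
  have "16 * P \<le> P * P * P" using mult_mono[of 8 P 8 P] P8 by simp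
  then show "16 * P < W" using P_power_lt_W[of 3] by (simp add: eval_nat_numeral)
  then show "L + 7 < W" using L_less P8 by simp
  show "m < W" unfolding m_def by (rule P_power_lt_W) simp
  have "2 * m \<le> P * m" using P8 by simp
  then show "2 * m < W" using P_power_lt_W[of 5] unfolding m_def by (simp add: eval_nat_numeral)
  show "sg + 1 < W" using 1 P_ge by simp
qed

lemma num_mod_W [simp]: "numeral k \<le> (30000::nat) \<Longrightarrow> numeral k mod W = numeral k"
  "1 mod W = 1" "Suc 0 mod W = Suc 0"
  "W \<noteq> Suc 0" "Suc 0 < W" "0 < W"
  using small_W(1)[of "numeral k"] small_W(1)[of 1] by auto

lemma par_mod_W [simp]: "P mod W = P" "(L + 7) mod W = L + 7" "(L + 6) mod W = L + 6" "(16 * P) mod W = 16 * P"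
  "m mod W = m" "(2 * m) mod W = 2 * m" "(sg + 1) mod W = sg + 1" "Suc sg mod W = Suc sg"
  using small_W by auto

lemma m0: "0 < m" using P8 by (simp add: m_def)

lemma Xi_le: "2 * Xi i \<le> m"
proof (induction i)
  case (Suc i)
  have "Xi (Suc i) = Xi i - Xi i div G" by (simp add: Xi_def)
  then show ?case using Suc by simp
qed (simp add: Xi_def)

lemma wp_letter:
  assumes M: "mach M" and s: "en s" "regs s 23 < NL" "regs s 31 < 16 * P" "regs s 33 < P" "regs s 24 < 64 * P"
    and D: "\<forall>i. RB \<le> i \<and> i < TB \<longrightarrow> data s i < m"
    and Q: "\<And>t s'. t \<le> 9 * (L + 6) + 8 \<Longrightarrow> \<forall>x<34. regs s' x = regs s x \<Longrightarrow>
      regs s' 34 = lett (data s) (regs s 23) (regs s 24) (regs s 31) (regs s 33) \<Longrightarrow>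
      data s' = data s \<Longrightarrow> work s' = work s \<Longrightarrow> Q t s'"
  shows "wp M letter_com Q s"
proof -
  let ?S = "\<lambda>j. (\<Sum>b | b < j \<and> bit (regs s 24) b. data s (rnd (regs s 23) b (regs s 31) (regs s 33))) mod m"
  define Inv where "Inv j s' \<longleftrightarrow> (\<forall>x<34. regs s' x = regs s x) \<and> data s' = data s \<and> work s' = work s \<and>
    regs s' 36 = j \<and> regs s' 35 = regs s 24 div 2 ^ j \<and> regs s' 34 = ?S j" for j and s' :: store
  have Wm: "word_mod M = W" and dc: "DS \<le> data_cells M" using M by (auto simp: mach_def)
  have en': "en s'" if "Inv j s'" for j s' using that s(1) unfolding Inv_def env_def by simp
  have cond: "eval_exp (word_mod M) (regs s') (Less (Reg 36) (Reg 15 \<oplus> Const 6)) = (if j < L + 6 then 1 else 0)"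
    if "Inv j s'" for j s'
    using that en'[OF that] unfolding Inv_def env_def Wm by simp
  have "wp M letter_com (\<lambda>t s'. t \<le> 9 * (L + 6) + 8 \<and> Inv (L + 6) s') s"
    unfolding letter_com_def
  proof (intro wp_intros, rule wp_for[where m = "L + 6" and I = Inv and b = 8])
    fix j s' assume j: "j < L + 6" and I: "Inv j s'"
    let ?b = "rnd (regs s 23) j (regs s 31) (regs s 33)"
    have rb: "RB \<le> ?b" "?b < TB" using rnd_bounds[of "regs s 23" j] s j by auto
    then have bd: "?b < data_cells M" using RB_TB_DS(3) dc by linarith
    have ev: "eval_exp W (regs s') (rnd_exp (Reg 36) (Reg 31) (Reg 33)) = ?b"
      using eval_rnd[OF en'[OF I], of "Reg 36" "Reg 31" "Reg 33"] I s j unfolding Inv_def by simp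
    have b1: "?S j + (regs s 24 div 2 ^ j) mod 2 * data s ?b < W"
    proof -
      have "(regs s 24 div 2 ^ j) mod 2 * data s ?b < m"
        using D rb m0 by (cases "(regs s 24 div 2 ^ j) mod 2 = 0") (auto simp: mod_2_eq_odd)
      moreover have "?S j < m" using m0 by simp
      ultimately show ?thesis using small_W(6) by linarith
    qed
    have dd: "regs s 24 div 2 ^ j div 2 = regs s 24 div (2 * 2 ^ j)"
      by (simp flip: div_mult2_eq add: mult.commute)
    have b2: "(?S j + (regs s 24 div 2 ^ j) mod 2 * data s ?b) mod W = ?S j + (regs s 24 div 2 ^ j) mod 2 * data s ?b"
      "((regs s 24 div 2 ^ j) mod 2 * data s ?b) mod W = (regs s 24 div 2 ^ j) mod 2 * data s ?b"
      "Suc j mod W = Suc j"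
      using b1 j small_W(3) by auto
    have step: "(?S j + (regs s 24 div 2 ^ j) mod 2 * data s ?b) mod m = ?S (Suc j)"
    proof -
      have "{b. b < Suc j \<and> bit (regs s 24) b} =
          {b. b < j \<and> bit (regs s 24) b} \<union> (if bit (regs s 24) j then {j} else {})"
        by (auto simp: less_Suc_eq)
      then show ?thesis
        by (simp add: bit_iff_odd mod_2_eq_odd mod_simps add.commute split: if_splits)
    qed
    have r: "regs s' 36 = j" "regs s' 35 = regs s 24 div 2 ^ j" "regs s' 34 = ?S j" "data s' = data s"
      "work s' = work s" "regs s' 17 = m" "\<And>x. x < 34 \<Longrightarrow> regs s' x = regs s x"
      using I en'[OF I] unfolding Inv_def env_def by auto
    show "wp M (LoadData 37 (rnd_exp (Reg 36) (Reg 31) (Reg 33)) ;;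
       Assign 34 (Mod (Reg 34 \<oplus> Mod (Reg 35) (Const 2) \<otimes> Reg 37) (Reg 17)) ;;
       Assign 35 (Div (Reg 35) (Const 2)) ;;
       Assign 36 (Reg 36 \<oplus> Const 1)) (\<lambda>t s'. t \<le> 8 \<and> Inv (Suc j) s') s'"
      by (intro wp_intros) (simp_all add: Wm ev dd b2 r step bd Inv_def)
  next
    fix j s' assume "j < L + 6" "Inv j s'"
    then show "eval_exp (word_mod M) (regs s') (Less (Reg 36) (Reg 15 \<oplus> Const 6)) \<noteq> 0"
      by (simp only: cond) simp
  next
    fix s' assume "Inv (L + 6) s'"
    then show "eval_exp (word_mod M) (regs s') (Less (Reg 36) (Reg 15 \<oplus> Const 6)) = 0"
      by (simp only: cond) simp
  qed (use s in \<open>auto simp: Inv_def\<close>)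
  then show ?thesis by (rule wp_mono) (auto intro!: Q simp: Inv_def lett_def)
qed

lemma hd0_drop: "hd0 e (drop p x) = (if p < length x then x ! p else e)"
  by (cases "drop p x") (auto simp: drop_eq_Nil nth_via_drop)

lemma wp_head:
  assumes M: "mach M" and s: "en s" "regs s 26 = length x" "length x \<le> P" "\<forall>i<length x. work s i = x ! i"
    and Q: "\<And>t s'. t \<le> 2 \<Longrightarrow> s' = s\<lparr>regs := (regs s)(33 := hd0 sg (drop (regs s 32) x))\<rparr> \<Longrightarrow> Q t s'"
  shows "wp M head_com Q s"
proof -
  have "word_mod M = W" "length x \<le> work_cells M" using M RB_TB_DS(4) s(3) by (auto simp: mach_def)
  then show ?thesis
    unfolding head_com_def using s by (intro wp_intros Q; simp add: hd0_drop env_def split: if_splits)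
qed

lemma wp_move:
  assumes M: "mach M" and s: "en s" "2 * regs s 25 \<le> m" "regs s 32 < 16 * P"
    and Q: "\<And>t s'. t \<le> 5 \<Longrightarrow> s' = s\<lparr>regs := (regs s)(33 := if regs s 34 < 2 * regs s 25 then Suc sg else regs s 33,
      32 := if regs s 34 < regs s 25 then regs s 32 else Suc (regs s 32))\<rparr> \<Longrightarrow> Q t s'"
  shows "wp M move_com Q s"
proof -
  have Wm: "word_mod M = W" using M by (auto simp: mach_def)
  have "Suc (regs s 32) mod W = Suc (regs s 32)" "(2 * regs s 25) mod W = 2 * regs s 25"
    using s small_W(4,5) by auto
  then show ?thesis
    unfolding move_com_def using s(1)
    by (intro wp_intros Q; auto simp add: Wm env_def fun_eq_iff split: if_splits)
qed

lemma wp_hash: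
  assumes M: "mach M" and s: "en s" "regs s 23 < NL" "regs s 24 < 64 * P" "2 * regs s 25 \<le> m"
      "regs s 26 = length x" "length x \<le> P" "\<forall>i<length x. work s i = x ! i" "set x \<subseteq> {..<sg}"
    and D: "\<forall>i. RB \<le> i \<and> i < TB \<longrightarrow> data s i < m"
    and Q: "\<And>t s'. t \<le> 64 * (L + 6) * H \<Longrightarrow> \<forall>r<30. regs s' r = regs s r \<Longrightarrow>
      regs s' 30 = hsum (data s) (regs s 23) (regs s 24) (regs s 25) H x mod P \<Longrightarrow>
      data s' = data s \<Longrightarrow> work s' = work s \<Longrightarrow> Q t s'"
  shows "wp M hash_com Q s"
proof -
  let ?h = "hsum (data s) (regs s 23) (regs s 24) (regs s 25)"
  \<comment> \<open>The accumulated sum plus the sum still to come from the unread suffix is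
    constant modulo \<open>P\<close>. The position may run past the end of \<open>x\<close>, where
    \<open>drop\<close> is empty and the padding letter is read.\<close>
  define Inv where "Inv j s' \<longleftrightarrow> (\<forall>r<30. regs s' r = regs s r) \<and> data s' = data s \<and> work s' = work s \<and>
    regs s' 31 = H - j \<and> regs s' 32 \<le> j \<and> regs s' 30 < P \<and>
    (regs s' 30 + ?h (H - j) (drop (regs s' 32) x)) mod P = ?h H x mod P" for j and s' :: store
  have Wm: "word_mod M = W" and dc: "DS \<le> data_cells M" using M by (auto simp: mach_def)
  have en': "en s'" if "\<forall>r<30. regs s' r = regs s r" for s' using that s(1) unfolding env_def by simp
  let ?b = "9 * (L + 6) + 50"
  have "wp M hash_com (\<lambda>t s'. t \<le> H * (?b + 1) + 7 \<and> Inv H s') s"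
    unfolding hash_com_def
  proof (intro wp_intros, rule wp_for[where m = H and I = Inv and b = ?b])
    fix j s' assume j: "j < H" and I: "Inv j s'"
    show "eval_exp (word_mod M) (regs s') (Reg 31) \<noteq> 0" using I j unfolding Inv_def by simp
    define k where "k = H - Suc j"
    have k: "H - j = Suc k" "k < 16 * P" using j H_less by (auto simp: k_def)
    let ?x = "drop (regs s' 32) x"
    have fr: "\<And>r. r < 30 \<Longrightarrow> regs s' r = regs s r" "data s' = data s" "work s' = work s" "regs s' 31 = Suc k"
      and p: "regs s' 32 \<le> j" and f: "regs s' 30 < P"
      and sum: "(regs s' 30 + ?h (Suc k) ?x) mod P = ?h H x mod P"
      using I unfolding Inv_def k by auto
    let ?a = "hd0 sg ?x"
    let ?v = "lett (data s) (regs s 23) (regs s 24) k ?a"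
    let ?o = "if ?v < 2 * regs s 25 then Suc sg else ?a"
    let ?x' = "if ?v < regs s 25 then ?x else tl ?x"
    have a: "?a < P"
      using hd0_le[of ?x sg] set_drop_subset[of "regs s' 32" x] s(8) P_ge by fastforce
    have o: "?o < P" using a P_ge by auto
    have enS: "en (s'\<lparr>regs := (regs s')(31 := y)\<rparr>)" "en (s'\<lparr>regs := (regs s')(31 := y, 33 := z)\<rparr>)" for y z
      by (rule en'; simp add: fr)+
    have rb: "rnd (regs s 23) (L + 6) k ?o < TB" "RB \<le> rnd (regs s 23) (L + 6) k ?o"
      using rnd_bounds[OF s(2), of "L + 6" k ?o] k o by auto
    then have bd: "rnd (regs s 23) (L + 6) k ?o < data_cells M" using RB_TB_DS(3) dc by linarith
    let ?d = "data s (rnd (regs s 23) (L + 6) k ?o)"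
    have hS: "?h (Suc k) ?x = ?d + ?h k ?x'"
      unfolding hsum_def by (simp add: Let_def)
    have modW: "(regs s' 30 + ?d) mod W = regs s' 30 + ?d"
    proof -
      have "?d < m" using D rb by simp
      moreover have "P \<le> m" using P_power_le[of 1 4] by (simp add: m_def)
      ultimately show ?thesis using f small_W(6) by simp
    qed
    have fin: "((regs s' 30 + ?d) mod P + ?h k ?x') mod P = ?h H x mod P"
      using sum unfolding hS by (simp add: mod_simps add.assoc)
    have ev: "eval_exp W (regs s3) (rnd_exp (Reg 15 \<oplus> Const 6) (Reg 31) (Reg 33)) = rnd (regs s 23) (L + 6) k ?o"
      if "\<forall>r<30. regs s3 r = regs s r" "regs s3 31 = k" "regs s3 33 = ?o" for s3 :: store
      using eval_rnd[OF en'[OF that(1)], of "Reg 15 \<oplus> Const 6" "Reg 31" "Reg 33"] en'[OF that(1)] that s(2) k(2) o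
      by (simp add: env_def)
    have post: "regs s3 30 = regs s' 30" "\<forall>r<30. regs s3 r = regs s r" "regs s3 31 = k" "regs s3 33 = ?o"
      "data s3 = data s" "work s3 = work s" "drop (regs s3 32) x = ?x'" "regs s3 32 \<le> Suc j"
      if "s1 = s'\<lparr>regs := (regs s')(31 := k, 33 := ?a)\<rparr>" "\<forall>x<34. regs s2 x = regs s1 x" "regs s2 34 = ?v"
        "data s2 = data s1" "work s2 = work s1"
        "s3 = s2\<lparr>regs := (regs s2)(33 := if regs s2 34 < 2 * regs s2 25 then Suc sg else regs s2 33,
            32 := if regs s2 34 < regs s2 25 then regs s2 32 else Suc (regs s2 32))\<rparr>" for s1 s2 s3 :: store
      using that p by (auto simp: fr drop_Suc tl_drop)
    show "wp M (Assign 31 (Reg 31 \<ominus> Const 1) ;; head_com ;; letter_com ;; move_com ;;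
       LoadData 37 (rnd_exp (Reg 15 \<oplus> Const 6) (Reg 31) (Reg 33)) ;;
       Assign 30 (Mod (Reg 30 \<oplus> Reg 37) (Reg 14))) (\<lambda>t s'. t \<le> ?b \<and> Inv (Suc j) s') s'"
      apply (intro wp_Seq wp_Assign)
      apply (rule wp_head[OF M, where x = x])
      subgoal by (simp add: enS)
      subgoal by (simp add: fr s)
      subgoal by (rule s)
      subgoal by (simp add: fr s)
      apply (rule wp_Seq, rule wp_letter[OF M])
      subgoal by (simp add: enS Wm fr)
      subgoal by (simp add: fr s)
      subgoal using k by (simp add: fr Wm)
      subgoal using a by simp
      subgoal by (simp add: fr s)
      subgoal using D by (simp add: fr)
      apply (rule wp_Seq, rule wp_move[OF M])
      subgoal by (rule en') (simp add: fr)
      subgoal by (simp add: fr s)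
      subgoal using p j H_less by simp
      apply (rule wp_Seq, rule wp_LoadData, unfold Wm)
      subgoal premises prems for t1 s1 t2 s2 t3 s3
      proof -
        have s1: "s1 = s'\<lparr>regs := (regs s')(31 := k, 33 := ?a)\<rparr>" using prems(2) by (simp add: fr)
        have v: "regs s2 34 = ?v" using prems(5) by (simp add: s1 fr)
        note po = post[OF s1 prems(4) v prems(6,7,9)]
        have ev': "eval_exp W (regs s3) (rnd_exp (Reg 15 \<oplus> Const 6) (Reg 31) (Reg 33)) = rnd (regs s 23) (L + 6) k ?o"
          by (rule ev) (use po in auto)
        show ?thesis unfolding ev' by (rule bd)
      qed
      subgoal premises prems for t1 s1 t2 s2 t3 s3
      proof -
        have s1: "s1 = s'\<lparr>regs := (regs s')(31 := k, 33 := ?a)\<rparr>" using prems(2) by (simp add: fr)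
        have v: "regs s2 34 = ?v" using prems(5) by (simp add: s1 fr)
        note po = post[OF s1 prems(4) v prems(6,7,9)]
        have ev': "eval_exp W (regs s3) (rnd_exp (Reg 15 \<oplus> Const 6) (Reg 31) (Reg 33)) = rnd (regs s 23) (L + 6) k ?o"
          by (rule ev) (use po in auto)
        have r14: "regs s3 14 = P" using en'[OF po(2)] by (simp add: env_def)
        have Hk: "H - Suc j = k" by (simp add: k_def)
        show ?thesis unfolding ev'
          by (rule wp_Assign) (use prems(1,3,8) fin po P8 in \<open>simp add: Wm r14 modW Inv_def Hk\<close>)
      qed
      done
  next
    fix s' assume "Inv H s'"
    then show "eval_exp (word_mod M) (regs s') (Reg 31) = 0" by (simp add: Inv_def)
  qed (use s P8 in \<open>auto simp: Inv_def env_def\<close>)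
  then show ?thesis
  proof (rule wp_mono)
    fix t s' assume A: "t \<le> H * (?b + 1) + 7 \<and> Inv H s'"
    have "7 \<le> 7 * H" using H_pos by simp
    then have "t \<le> H * (9 * (L + 6) + 58)" using A by (simp add: algebra_simps)
    also have "\<dots> \<le> H * (64 * (L + 6))" by (intro mult_left_mono) auto
    finally show "Q t s'" using A unfolding Inv_def
      by (intro Q) (auto simp: hsum_def mult.commute)
  qed
qed

end

section \<open>Testing the edit distance\<close>

text \<open>\<open>lev\<close> recurses on tails, so the table of the dynamic program is indexed by
  lengths of suffixes.\<close>

definition suf :: "nat list \<Rightarrow> nat \<Rightarrow> nat list" where
  "suf x a = drop (length x - a) x"

lemma suf_0 [simp]: "suf x 0 = []" and length_suf: "a \<le> length x \<Longrightarrow> length (suf x a) = a"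
  and suf_Suc: "a < length x \<Longrightarrow> suf x (Suc a) = x ! (length x - Suc a) # suf x a"
  and suf_length [simp]: "suf x (length x) = x"
  unfolding suf_def using Cons_nth_drop_Suc[of "length x - Suc a" x] by (auto simp: Suc_diff_Suc)

text \<open>Only whether the distance is at most \<open>K\<close> matters, so values are capped at
  \<open>K + 1\<close>; this makes all entries far from the diagonal constant.\<close>

definition band :: "nat list \<Rightarrow> nat list \<Rightarrow> nat \<Rightarrow> nat \<Rightarrow> nat \<Rightarrow> nat" where
  "band x y K a b = min (lev (suf x a) (suf y b)) (Suc K)"

text \<open>The distance is at least the difference of the lengths, which here exceeds
  \<open>K\<close>.\<close>

lemma band_out: "a \<le> length x \<Longrightarrow> b \<le> length y \<Longrightarrow> K < (a - b) + (b - a) \<Longrightarrow> band x y K a b = Suc K"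
  using lev_length(1)[of "suf x a" "suf y b"] lev_length(2)[of "suf y b" "suf x a"] by (auto simp: band_def length_suf)

lemma band_0: "b \<le> length y \<Longrightarrow> b \<le> K \<Longrightarrow> band x y K 0 b = b"
  "a \<le> length x \<Longrightarrow> a \<le> K \<Longrightarrow> band x y K a 0 = a"
  by (auto simp: band_def length_suf)

text \<open>Capping commutes with the recursion, so capped neighbours suffice to compute a capped
  entry.\<close>

lemma min_Suc_cap:
  "min (Suc (min p (min q r))) (Suc K) =
    min (Suc (min (min p (Suc K)) (min (min q (Suc K)) (min r (Suc K))))) (Suc K)"
  by (auto simp: min_def)

lemma band_Suc:
  assumes "a < length x" "b < length y"
  shows "band x y K (Suc a) (Suc b) = (if x ! (length x - Suc a) = y ! (length y - Suc b) then band x y K a b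
    else min (Suc (min (band x y K a b) (min (band x y K a (Suc b)) (band x y K (Suc a) b)))) (Suc K))"
  unfolding band_def using assms
  by (cases "x ! (length x - Suc a) = y ! (length y - Suc b)")
    (simp add: suf_Suc, simp only: suf_Suc lev.simps if_False min_Suc_cap[symmetric])

text \<open>Register 26 holds the length of the query string, which is stored in the working cells below
  \<open>P\<close>; register 27 the distance \<open>K\<close> and register 28 the index of a database string.  The table of
  \<^term>\<open>band\<close> is stored in row-major order from cell \<open>P\<close> on, restricted to the band
  \<open>\<bar>a - b\<bar> \<le> K + 1\<close>.  The answer is left in register 40.\<close>

definition dp_exp :: "exp \<Rightarrow> exp \<Rightarrow> exp" where
  "dp_exp a b = Reg 14 \<oplus> (a \<otimes> Reg 14 \<oplus> b)"

abbreviation "skip \<equiv> Assign 46 (Reg 46)"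

definition cell_com :: com where
  "cell_com =
    If (Less (Reg 27) ((Reg 43 \<ominus> Reg 44) \<oplus> (Reg 44 \<ominus> Reg 43))) (Assign 46 (Reg 27 \<oplus> Const 1))
    (If (Equal (Reg 43) (Const 0)) (Assign 46 (Reg 44))
    (If (Equal (Reg 44) (Const 0)) (Assign 46 (Reg 43))
     (LoadWork 47 (Reg 26 \<ominus> Reg 43) ;; LoadData 48 (Reg 42 \<oplus> (Reg 41 \<ominus> Reg 44)) ;;
      LoadWork 46 (dp_exp (Reg 43 \<ominus> Const 1) (Reg 44 \<ominus> Const 1)) ;;
      If (Equal (Reg 47) (Reg 48)) skip
       (LoadWork 47 (dp_exp (Reg 43 \<ominus> Const 1) (Reg 44)) ;;
        LoadWork 48 (dp_exp (Reg 43) (Reg 44 \<ominus> Const 1)) ;;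
        If (Less (Reg 47) (Reg 46)) (Assign 46 (Reg 47)) skip ;;
        If (Less (Reg 48) (Reg 46)) (Assign 46 (Reg 48)) skip ;;
        If (Less (Reg 46) (Reg 27)) (Assign 46 (Reg 46 \<oplus> Const 1)) (Assign 46 (Reg 27 \<oplus> Const 1))))))"

text \<open>A row extends to distance \<open>K + 1\<close> from the diagonal, one cell beyond the
  entries that need the recursion, because a neighbour may be one step further off than the entry
  that reads it.\<close>

definition row_com :: com where
  "row_com =
    (Assign 44 (Reg 43 \<ominus> (Reg 27 \<oplus> Const 1)) ;;
     If (Less (Reg 43 \<oplus> (Reg 27 \<oplus> Const 1)) (Reg 41)) (Assign 45 (Reg 43 \<oplus> (Reg 27 \<oplus> Const 1))) (Assign 45 (Reg 41)) ;;
     While (Less (Reg 44) (Reg 45 \<oplus> Const 1))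
      (cell_com ;; StoreWork (dp_exp (Reg 43) (Reg 44)) (Reg 46) ;; Assign 44 (Reg 44 \<oplus> Const 1)) ;;
     Assign 43 (Reg 43 \<oplus> Const 1))"

definition test_com :: com where
  "test_com =
    (LoadData 41 (Const 4 \<oplus> Reg 28 \<otimes> Reg 14) ;; Assign 42 (Const 5 \<oplus> Reg 28 \<otimes> Reg 14) ;;
     Assign 43 (Const 0) ;; While (Less (Reg 43) (Reg 26 \<oplus> Const 1)) row_com ;;
     If (Less (Reg 27) ((Reg 26 \<ominus> Reg 41) \<oplus> (Reg 41 \<ominus> Reg 26))) (Assign 40 (Const 0))
      (LoadWork 46 (dp_exp (Reg 26) (Reg 41)) ;; Assign 40 (Less (Reg 46) (Reg 27 \<oplus> Const 1))))"

section \<open>Correctness and time of the distance test\<close>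

locale ann_test = ann +
  fixes M :: machine and x y :: "nat list" and K c :: nat and s0 :: store
  assumes M: "mach M" and env: "en s0"
    and x: "regs s0 26 = length x" "length x \<le> d" "\<forall>i<length x. work s0 i = x ! i"
    and y: "length y \<le> d" "data s0 (saddr c) = length y" "\<forall>i<length y. data s0 (saddr c + 1 + i) = y ! i"
    and c: "c < n" "regs s0 28 = c" and K: "regs s0 27 = K" "K + 4 * P < W"
begin

lemma Wm: "word_mod M = W" and dc: "DS \<le> data_cells M" "DS \<le> work_cells M" using M by (auto simp: mach_def)

lemma lens: "length x < P" "length y < P" using x(2) y(1) P_ge by auto

definition "ok s \<longleftrightarrow> (\<forall>r<40. regs s r = regs s0 r) \<and> data s = data s0 \<and> (\<forall>i<P. work s i = work s0 i) \<and>
  regs s 41 = length y \<and> regs s 42 = saddr c + 1"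

lemma okD:
  assumes "ok s"
  shows "en s" "regs s 14 = P" "regs s 26 = length x" "regs s 27 = K" "regs s 28 = c" "regs s 41 = length y"
    "regs s 42 = saddr c + 1" "data s = data s0" "i < length x \<Longrightarrow> work s i = x ! i" "r < 40 \<Longrightarrow> regs s r = regs s0 r"
  using assms env x y c K lens unfolding ok_def by (auto simp: env_def)

lemma ok_upd: "ok s \<Longrightarrow> (\<forall>r. r \<noteq> 40 \<and> r < 43 \<longrightarrow> f r = regs s r) \<Longrightarrow> ok (s\<lparr>regs := f\<rparr>)"
  unfolding ok_def by auto

lemma dp_bounds:
  assumes "a < P" "b < P" shows "P + (a * P + b) < DS" "P \<le> P + (a * P + b)"
  using mixed_radix_less[OF assms] RB_TB_DS(4) by auto

lemma eval_dp:
  assumes "\<rho> 14 = P" "eval_exp W \<rho> a < P" "eval_exp W \<rho> b < P"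
  shows "eval_exp W \<rho> (dp_exp a b) = P + (eval_exp W \<rho> a * P + eval_exp W \<rho> b)"
  using dp_bounds[OF assms(2,3)] DS_W assms(1) unfolding dp_exp_def eval_exp.simps by (simp add: mod_simps)

lemma KW [simp]: "Suc K mod W = Suc K" using K(2) P8 by simp

lemma small_mod: "z \<le> K + 4 * P \<Longrightarrow> z mod W = z" using K(2) by simp

lemma wp_min:
  assumes "Q 2 (s\<lparr>regs := (regs s)(46 := min (regs s r) (regs s 46))\<rparr>)"
  shows "wp M (If (Less (Reg r) (Reg 46)) (Assign 46 (Reg r)) skip) Q s"
  using assms by (intro wp_intros) (auto simp: Wm min_def numeral_2_eq_2 split: if_splits)

lemma wp_cap:
  assumes "regs s 27 = K" "Q 2 (s\<lparr>regs := (regs s)(46 := min (Suc (regs s 46)) (Suc K))\<rparr>)"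
  shows "wp M (If (Less (Reg 46) (Reg 27)) (Assign 46 (Reg 46 \<oplus> Const 1)) (Assign 46 (Reg 27 \<oplus> Const 1))) Q s"
proof -
  have "regs s 46 < K \<Longrightarrow> Suc (regs s 46) mod W = Suc (regs s 46)" using K by (intro small_mod) auto
  then show ?thesis
    using assms by (intro wp_intros) (auto simp: Wm min_def numeral_2_eq_2 split: if_splits)
qed

lemma wp_cell:
  assumes ok: "ok s" and ab: "regs s 43 = a" "regs s 44 = b" "a \<le> length x" "b \<le> length y"
    and nb: "\<And>a' b'. a = Suc a' \<Longrightarrow> b = Suc b' \<Longrightarrow> \<not> K < (a - b) + (b - a) \<Longrightarrow>
        work s (P + (a' * P + b')) = band x y K a' b' \<and> work s (P + (a' * P + b)) = band x y K a' b \<and>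
        work s (P + (a * P + b')) = band x y K a b'"
    and Q: "\<And>t s' u v. t \<le> 30 \<Longrightarrow> s' = s\<lparr>regs := (regs s)(46 := band x y K a b, 47 := u, 48 := v)\<rparr> \<Longrightarrow> Q t s'"
  shows "wp M cell_com Q s"
proof -
  note r = okD[OF ok] ab
  have QQ: "Q t s'" if "t \<le> 30" "s' = s\<lparr>regs := (regs s)(46 := band x y K a b, 47 := regs s' 47, 48 := regs s' 48)\<rparr>" for t s'
    using that by (rule Q)
  have ml: "((a - b) + (b - a)) mod W = (a - b) + (b - a)" using ab lens by (intro small_mod) auto
  consider "K < (a - b) + (b - a)" | "\<not> K < (a - b) + (b - a)" "a = 0"
    | "\<not> K < (a - b) + (b - a)" "b = 0" "a \<noteq> 0"
    | a' b' where "\<not> K < (a - b) + (b - a)" "a = Suc a'" "b = Suc b'"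
    by (cases a; cases b) auto
  then show ?thesis
  proof cases
    case 1
    then show ?thesis unfolding cell_com_def
      by (intro wp_If) (auto simp add: Wm r ml intro!: wp_Assign QQ simp: band_out[OF ab(3,4)] fun_eq_iff)
  next
    case 2
    then show ?thesis unfolding cell_com_def
      by (intro wp_If) (use ab in \<open>auto simp add: Wm r intro!: wp_Assign QQ simp: band_0 fun_eq_iff small_mod\<close>)
  next
    case 3
    then show ?thesis unfolding cell_com_def
      by (intro wp_If) (use ab in \<open>auto simp add: Wm r intro!: wp_Assign QQ simp: band_0 fun_eq_iff small_mod\<close>)
  next
    case (4 a' b')
    have lt: "a' < length x" "b' < length y" "a < P" "b < P" "a' < P" "b' < P" using 4 ab lens by auto
    have nbs: "work s (P + (a' * P + b')) = band x y K a' b'" "work s (P + (a' * P + Suc b')) = band x y K a' (Suc b')"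
        "work s (P + (Suc a' * P + b')) = band x y K (Suc a') b'"
      using nb[OF 4(2,3,1)] 4 by auto
    have dpb: "P + (i * P + j) < work_cells M" if "i < P" "j < P" for i j
      using dp_bounds[OF that] dc by linarith
    have dp: "eval_exp W \<rho> (dp_exp (Reg 43 \<ominus> Const 1) (Reg 44 \<ominus> Const 1)) = P + (a' * P + b')"
      "eval_exp W \<rho> (dp_exp (Reg 43 \<ominus> Const 1) (Reg 44)) = P + (a' * P + Suc b')"
      "eval_exp W \<rho> (dp_exp (Reg 43) (Reg 44 \<ominus> Const 1)) = P + (Suc a' * P + b')"
      if "\<rho> 43 = Suc a'" "\<rho> 44 = Suc b'" "\<rho> 14 = P" for \<rho> :: "nat \<Rightarrow> nat"
      using that lt 4 by (subst eval_dp; simp)+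
    obtain zx where zx: "length x - Suc a' = zx" "zx < length x" "zx < work_cells M"
      using lt lens dc RB_TB_DS(4) by auto
    obtain zy where zy: "length y - Suc b' = zy" "zy < length y" using lt by auto
    have "Suc (saddr c + zy) < RB" using saddr_bounds[OF c(1), of "Suc zy"] lens zy by auto
    then have y1: "Suc (saddr c + zy) < data_cells M" "Suc (saddr c + zy) mod W = Suc (saddr c + zy)"
        "data s0 (Suc (saddr c + zy)) = y ! zy"
      using RB_TB_DS DS_W dc zy(2) y(3) by auto
    have y2: "saddr c + 1 + zy < data_cells M" "(saddr c + 1 + zy) mod W = saddr c + 1 + zy"
        "data s0 (saddr c + 1 + zy) = y ! zy" using y1 by simp_all
    have wx: "work s zx = x ! zx" using r(9)[OF zx(2)] .
    have bS: "band x y K (Suc a') (Suc b') = (if x ! zx = y ! zy then band x y K a' b' else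
      min (Suc (min (band x y K a' b') (min (band x y K a' (Suc b')) (band x y K (Suc a') b')))) (Suc K))"
      using band_Suc[OF lt(1,2)] zx(1) zy(1) by simp
    have bd: "band x y K i j \<le> Suc K" for i j by (simp add: band_def)
    have K1: "z < K \<Longrightarrow> Suc z mod W = Suc z" for z using K by (intro small_mod) auto
    have ncond: "\<not> K < (Suc a' - Suc b') + (Suc b' - Suc a')" using 4 by simp
    have nc: "((a' - b') + (b' - a')) mod W = (a' - b') + (b' - a')" "\<not> K < (a' - b') + (b' - a')"
      using ml 4 by auto
    have d2: "Suc (P + (a' * P + b')) < work_cells M" "P + (P + a' * P + b') < work_cells M"
      "work s (Suc (P + (a' * P + b'))) = band x y K a' (Suc b')"
      "work s (P + (P + a' * P + b')) = band x y K (Suc a') b'"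
      using dpb[of a' "Suc b'"] dpb[of "Suc a'" b'] nbs lt 4 by simp_all
    show ?thesis unfolding cell_com_def
      apply (rule wp_If_False, use nc in \<open>simp add: Wm r 4\<close>)
      apply (rule wp_If_False, simp add: Wm r 4)
      apply (rule wp_If_False, simp add: Wm r 4)
      apply (intro wp_Seq wp_LoadWork wp_LoadData)
           apply (simp_all del: One_nat_def add: Wm dp dpb lt zx zy y2 wx r 4)
      apply (rule wp_If)
       apply (rule wp_Assign, rule QQ, simp, simp add: nbs 4 bS fun_eq_iff Wm split: if_splits)
      apply (intro wp_Seq wp_LoadWork)
         apply (simp_all del: One_nat_def add: Wm dp dpb lt r 4 d2 nbs(1))
      apply (intro wp_Seq wp_min wp_cap QQ)
        apply (simp add: r)
       apply simp
      apply (simp add: bS 4 fun_upd_twist ac_simps Wm split: if_splits)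
      done
  qed
qed

definition "good a s \<longleftrightarrow> (\<forall>a'<a. \<forall>b\<le>length y. a' \<le> b + K + 1 \<longrightarrow> b \<le> a' + K + 1 \<longrightarrow>
  work s (P + (a' * P + b)) = band x y K a' b)"

lemma goodD: "good a s \<Longrightarrow> a' < a \<Longrightarrow> b \<le> length y \<Longrightarrow> a' \<le> b + K + 1 \<Longrightarrow> b \<le> a' + K + 1 \<Longrightarrow>
    work s (P + (a' * P + b)) = band x y K a' b"
  unfolding good_def by blast

lemma ok_work: "ok s \<Longrightarrow> P \<le> i \<Longrightarrow> ok (s\<lparr>work := (work s)(i := v)\<rparr>)"
  unfolding ok_def by auto

lemma good_work: "good a s \<Longrightarrow> b < P \<Longrightarrow> good a (s\<lparr>work := (work s)(P + (a * P + b) := v)\<rparr>)"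
  unfolding good_def using mixed_radix_eq[of _ P _ a b] lens by fastforce

lemma wp_row:
  assumes ok: "ok s" and a: "regs s 43 = a" "a \<le> length x" and good: "good a s"
    and Q: "\<And>t s'. t \<le> 40 * (2 * K + 3) + 14 \<Longrightarrow> ok s' \<Longrightarrow> regs s' 43 = Suc a \<Longrightarrow> good (Suc a) s' \<Longrightarrow> Q t s'"
  shows "wp M row_com Q s"
proof -
  let ?b0 = "a - Suc K" and ?b1 = "min (a + Suc K) (length y)"
  define Inv where "Inv j s' \<longleftrightarrow> ok s' \<and> regs s' 43 = a \<and> regs s' 44 = ?b0 + j \<and> regs s' 45 = ?b1 \<and> good a s' \<and>
    (\<forall>b<?b0 + j. b \<le> length y \<longrightarrow> a \<le> b + K + 1 \<longrightarrow> b \<le> a + K + 1 \<longrightarrow> work s' (P + (a * P + b)) = band x y K a b)"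
    for j and s' :: store
  note r = okD[OF ok]
  have aP: "a < P" using a lens by simp
  have m1: "(a + Suc K) mod W = a + Suc K" "Suc (a + K) mod W = Suc (a + K)" "Suc a mod W = Suc a"
    "Suc ?b1 mod W = Suc ?b1"
    using aP by (auto intro!: small_mod)
  have cond: "eval_exp (word_mod M) (regs s') (Less (Reg 44) (Reg 45 \<oplus> Const 1)) = (if ?b0 + j < Suc ?b1 then 1 else 0)"
    if "Inv j s'" for j s'
    using that m1(4) unfolding Inv_def by (simp add: Wm)
  have loop: "wp M (While (Less (Reg 44) (Reg 45 \<oplus> Const 1))
      (cell_com ;; StoreWork (dp_exp (Reg 43) (Reg 44)) (Reg 46) ;; Assign 44 (Reg 44 \<oplus> Const 1))) Q' s'"
    if "Inv 0 s'" and Q': "\<And>t s'. t \<le> (2 * K + 3) * 40 + 1 \<Longrightarrow> Inv (Suc ?b1 - ?b0) s' \<Longrightarrow> Q' t s'" for s' Q'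
  proof (rule wp_for[where m = "Suc ?b1 - ?b0" and I = Inv and b = 39])
    fix j s' assume j: "j < Suc ?b1 - ?b0" and I: "Inv j s'"
    show "eval_exp (word_mod M) (regs s') (Less (Reg 44) (Reg 45 \<oplus> Const 1)) \<noteq> 0"
      unfolding cond[OF I] using j by simp
    let ?b = "?b0 + j"
    have b: "?b \<le> length y" "?b < P" "a \<le> ?b + K + 1" "?b \<le> a + K + 1" using j lens by auto
    have I': "ok s'" "regs s' 43 = a" "regs s' 44 = ?b" "regs s' 45 = ?b1" "good a s'"
      using I unfolding Inv_def by auto
    have row: "work s' (P + (a * P + b')) = band x y K a b'"
      if "b' < ?b" "b' \<le> length y" "a \<le> b' + K + 1" "b' \<le> a + K + 1" for b'
      using I that unfolding Inv_def by auto
    have nb: "work s' (P + (a' * P + b')) = band x y K a' b' \<and> work s' (P + (a' * P + ?b)) = band x y K a' ?b \<and>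
        work s' (P + (a * P + b')) = band x y K a b'"
      if "a = Suc a'" "?b = Suc b'" "\<not> K < (a - ?b) + (?b - a)" for a' b'
    proof (intro conjI)
      show "work s' (P + (a' * P + b')) = band x y K a' b'" "work s' (P + (a' * P + ?b)) = band x y K a' ?b"
        by (rule goodD[OF I'(5)]; use that b in auto)+
      show "work s' (P + (a * P + b')) = band x y K a b'" by (rule row) (use that b in auto)
    qed
    have dpb: "P + (a * P + ?b) < work_cells M" "P \<le> P + (a * P + ?b)"
      using dp_bounds[OF aP b(2)] dc by auto
    have bm: "Suc ?b mod W = Suc ?b" using b K(2) by (intro small_mod) auto
    show "wp M (cell_com ;; StoreWork (dp_exp (Reg 43) (Reg 44)) (Reg 46) ;; Assign 44 (Reg 44 \<oplus> Const 1))
      (\<lambda>t s'. t \<le> 39 \<and> Inv (Suc j) s') s'"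
    proof (rule wp_Seq, rule wp_cell[OF I'(1-3) a(2) b(1) nb], assumption+)
      fix t u v :: nat and s2 :: store assume t: "t \<le> 30" and s2: "s2 = s'\<lparr>regs := (regs s')(46 := band x y K a ?b, 47 := u, 48 := v)\<rparr>"
      have ok2: "ok s2" unfolding s2 by (rule ok_upd[OF I'(1)]) auto
      have ev: "eval_exp W (regs s2) (dp_exp (Reg 43) (Reg 44)) = P + (a * P + ?b)"
        using okD(2)[OF ok2] I' aP b(2) by (subst eval_dp) (auto simp: s2)
      let ?s3 = "s2\<lparr>work := (work s2)(P + (a * P + ?b) := band x y K a ?b), regs := (regs s2)(44 := Suc ?b)\<rparr>"
      have "ok (s2\<lparr>work := (work s2)(P + (a * P + ?b) := band x y K a ?b)\<rparr>)"
        by (rule ok_work[OF ok2 dpb(2)])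
      from ok_upd[OF this, of "(regs s2)(44 := Suc ?b)"] have ok3: "ok ?s3" by simp
      have g2: "good a s2" using I'(5) unfolding s2 good_def by simp
      have g3: "good a ?s3" using good_work[OF g2 b(2), of "band x y K a ?b"] unfolding good_def by simp
      have "work ?s3 (P + (a * P + b')) = band x y K a b'"
        if "b' < Suc ?b" "b' \<le> length y" "a \<le> b' + K + 1" "b' \<le> a + K + 1" for b'
        using row[of b'] that by (cases "b' = ?b") (auto simp: s2)
      then have I3: "Inv (Suc j) ?s3" using ok3 g3 I' unfolding Inv_def by (auto simp: s2)
      show "wp M (StoreWork (dp_exp (Reg 43) (Reg 44)) (Reg 46) ;; Assign 44 (Reg 44 \<oplus> Const 1))
          (\<lambda>t2 s'. Suc (t + t2) \<le> 39 \<and> Inv (Suc j) s') s2"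
        apply (intro wp_Seq wp_StoreWork wp_Assign)
        subgoal using dpb by (simp add: Wm ev)
        subgoal using I3 t I' bm unfolding Wm ev by (simp add: s2)
        done
    qed
  next
    fix s' assume I: "Inv (Suc ?b1 - ?b0) s'"
    show "eval_exp (word_mod M) (regs s') (Less (Reg 44) (Reg 45 \<oplus> Const 1)) = 0"
      unfolding cond[OF I] by auto
  next
    fix t s' assume "t \<le> (Suc ?b1 - ?b0) * (39 + 1) + 1" "Inv (Suc ?b1 - ?b0) s'"
    moreover have "(Suc ?b1 - ?b0) * 40 \<le> (2 * K + 3) * 40" by (intro mult_right_mono) auto
    ultimately show "Q' t s'" by (intro Q') auto
  qed (rule that)
  have If: "wp M (If (Less (Reg 43 \<oplus> (Reg 27 \<oplus> Const 1)) (Reg 41)) (Assign 45 (Reg 43 \<oplus> (Reg 27 \<oplus> Const 1))) (Assign 45 (Reg 41))) Q' s'"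
    if "ok s'" "regs s' 43 = a" "Q' 2 (s'\<lparr>regs := (regs s')(45 := ?b1)\<rparr>)" for Q' s'
    using that m1 okD[OF that(1)] by (intro wp_intros) (auto simp: Wm min_def numeral_2_eq_2 split: if_splits)
  show ?thesis
    unfolding row_com_def
    apply (rule wp_Seq, rule wp_Assign, rule wp_Seq, rule If)
    subgoal by (rule ok_upd[OF ok]) simp
    subgoal using a by simp
    apply (rule wp_Seq, rule loop)
    subgoal
      unfolding Inv_def using a r(1-8,10) good m1 by (simp add: Wm good_def ok_upd[OF ok])
    subgoal premises prems for t s'
    proof (rule wp_Assign)
      let ?s4 = "s'\<lparr>regs := (regs s')(43 := Suc a)\<rparr>"
      have I: "ok s'" "good a s'" "regs s' 43 = a" using prems(2) unfolding Inv_def by auto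
      have "work s' (P + (a * P + b)) = band x y K a b" if "b \<le> length y" "a \<le> b + K + 1" "b \<le> a + K + 1" for b
      proof -
        have "b < ?b0 + (Suc ?b1 - ?b0)" using that by auto
        then show ?thesis using prems(2) that unfolding Inv_def by blast
      qed
      then have "good (Suc a) ?s4" using I(2) unfolding good_def by (auto simp: less_Suc_eq)
      moreover have "ok ?s4" by (rule ok_upd[OF I(1)]) simp
      ultimately show "Q (Suc (1 + Suc (2 + Suc (t + 1)))) (s'\<lparr>regs := (regs s')(43 := eval_exp (word_mod M) (regs s') (Reg 43 \<oplus> Const 1))\<rparr>)"
        using prems(1) m1 I(3) by (intro Q) (auto simp: Wm)
    qed
    done
qed

theorem wp_test:
  assumes Q: "\<And>t s'. t \<le> 200 * (d + 1) * (K + 1) \<Longrightarrow> regs s' 40 = (if lev x y \<le> K then 1 else 0) \<Longrightarrow>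
      \<forall>r<40. regs s' r = regs s0 r \<Longrightarrow> data s' = data s0 \<Longrightarrow> \<forall>i<P. work s' i = work s0 i \<Longrightarrow> Q t s'"
  shows "wp M test_com Q s0"
proof -
  define Inv where "Inv a s \<longleftrightarrow> ok s \<and> regs s 43 = a \<and> good a s" for a and s :: store
  let ?b = "40 * (2 * K + 3) + 14"
  have e14: "regs s0 14 = P" using env by (simp add: env_def)
  have ca: "saddr c + 1 < RB" using saddr_bounds[OF c(1), of 1] P8 by simp
  have cm: "saddr c + 1 < W" using ca RB_TB_DS DS_W by linarith
  have ev: "eval_exp W (regs s0) (Const 4 \<oplus> Reg 28 \<otimes> Reg 14) = saddr c"
    using cm by (simp add: e14 c mod_simps saddr_def)
  have ev2: "eval_exp W ((regs s0)(41 := v)) (Const 5 \<oplus> Reg 28 \<otimes> Reg 14) = saddr c + 1" for v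
    using cm by (simp add: e14 c mod_simps saddr_def)
  have lx: "Suc (length x) mod W = Suc (length x)" using lens by (intro small_mod) auto
  have cond: "eval_exp (word_mod M) (regs s) (Less (Reg 43) (Reg 26 \<oplus> Const 1)) = (if a < Suc (length x) then 1 else 0)"
    if "Inv a s" for a s
    using that okD(3)[of s] lx unfolding Inv_def by (simp add: Wm)
  have sc: "saddr c < data_cells M" using ca RB_TB_DS dc by linarith
  have "?b + 1 \<le> 95 * (K + 1) + 40" by simp
  have T: "(length x + 1) * (?b + 1) + 40 \<le> 200 * (d + 1) * (K + 1)"
  proof -
    have "(length x + 1) * (?b + 1) \<le> (d + 1) * (136 * (K + 1))"
      using x(2) by (intro mult_mono) auto
    moreover have "40 \<le> (d + 1) * (64 * (K + 1))" by simp
    ultimately have "(length x + 1) * (?b + 1) + 40 \<le> (d + 1) * (136 * (K + 1)) + (d + 1) * (64 * (K + 1))"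
      by (rule add_mono)
    also have "\<dots> = 200 * (d + 1) * (K + 1)" by (simp add: algebra_simps)
    finally show ?thesis .
  qed
  have rows: "wp M (While (Less (Reg 43) (Reg 26 \<oplus> Const 1)) row_com) Q' s"
    if "Inv 0 s" "\<And>t s'. t \<le> (length x + 1) * (?b + 1) + 1 \<Longrightarrow> Inv (Suc (length x)) s' \<Longrightarrow> Q' t s'" for Q' s
  proof (rule wp_for[where m = "Suc (length x)" and I = Inv and b = ?b])
    fix a s assume a: "a < Suc (length x)" and I: "Inv a s"
    show "eval_exp (word_mod M) (regs s) (Less (Reg 43) (Reg 26 \<oplus> Const 1)) \<noteq> 0" using a cond[OF I] by simp
    show "wp M row_com (\<lambda>t s'. t \<le> ?b \<and> Inv (Suc a) s') s"
      using I a by (intro wp_row[of s a]) (auto simp: Inv_def)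
  next
    fix s assume "Inv (Suc (length x)) s"
    then show "eval_exp (word_mod M) (regs s) (Less (Reg 43) (Reg 26 \<oplus> Const 1)) = 0" using cond by simp
  qed (use that in auto)
  show ?thesis
    unfolding test_com_def
    apply (rule wp_Seq, rule wp_LoadData)
    subgoal by (simp only: Wm ev sc)
    apply (rule wp_Seq, rule wp_Assign, rule wp_Seq, rule wp_Assign, rule wp_Seq, rule rows)
    subgoal
      using y(2) by (simp add: Inv_def Wm ev ev2 good_def del: eval_exp.simps(3)) (simp add: ok_def)
    subgoal premises prems for t s
    proof -
      have I: "ok s" "good (Suc (length x)) s" using prems(2) unfolding Inv_def by auto
      note r = okD[OF I(1)]
      let ?k = "(length x - length y) + (length y - length x)"
      have km: "?k mod W = ?k" using lens by (intro small_mod) auto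
      have rest: "\<forall>r<40. regs s r = regs s0 r" "data s = data s0" "\<forall>i<P. work s i = work s0 i"
        using I(1) unfolding ok_def by auto
      show ?thesis
      proof (cases "K < ?k")
        case True
        \<comment> \<open>The corner of the table may lie outside the stored band; the lengths alone
          then rule out a distance of at most \<open>K\<close>.\<close>
        then have "\<not> lev x y \<le> K" using lev_length(1)[of x y] lev_length(2)[of y x] by auto
        then show ?thesis
          using True T prems(1) rest
          by (intro wp_If wp_Assign Q) (auto simp: Wm r km)
      next
        case False
        have ev3: "eval_exp W (regs s) (dp_exp (Reg 26) (Reg 41)) = P + (length x * P + length y)"
          using r lens by (subst eval_dp) auto
        have "work s (P + (length x * P + length y)) = band x y K (length x) (length y)"
          using I(2) False unfolding good_def by auto
        then have wk: "work s (P + (length x * P + length y)) = min (lev x y) (Suc K)"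
          by (simp add: band_def)
        have db: "P + (length x * P + length y) < work_cells M" using dp_bounds[OF lens] dc by linarith
        show ?thesis
          apply (rule wp_If_False)
          subgoal using False by (simp add: Wm r km)
          apply (rule wp_Seq, rule wp_LoadWork)
          subgoal using db by (simp add: Wm ev3)
          apply (rule wp_Assign, rule Q)
          using T prems(1) rest wk by (auto simp: Wm ev3 r)
      qed
    qed
    done
qed

end

section \<open>The query program\<close>

definition params_com :: com where
  "params_com =
    (LoadData 10 (Const 0) ;; LoadData 11 (Const 1) ;; LoadData 12 (Const 2) ;; LoadData 13 (Const 3) ;;
     Assign 14 (Const 1) ;; Assign 15 (Const 0) ;;
     While (Less (Reg 14) (Reg 10 \<oplus> Reg 11 \<oplus> Reg 12 \<oplus> Const 4))
      (Assign 14 (Const 2 \<otimes> Reg 14) ;; Assign 15 (Reg 15 \<oplus> Const 1)) ;;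
     Assign 16 (Const 5 \<otimes> (Reg 11 \<oplus> Reg 15)) ;;
     Assign 17 (Reg 14 \<otimes> Reg 14 \<otimes> Reg 14 \<otimes> Reg 14) ;;
     Assign 18 (Const 8 \<otimes> Reg 15) ;;
     Assign 19 (Const 32 \<otimes> Reg 15 \<otimes> Reg 15) ;;
     Assign 20 ((Reg 15 \<oplus> Const 1) \<otimes> Reg 19) ;;
     Assign 21 (Const 4 \<oplus> Reg 14 \<otimes> Reg 14) ;;
     Assign 22 (Reg 21 \<oplus> Reg 20 \<otimes> (Reg 15 \<oplus> Const 7) \<otimes> (Const 16 \<otimes> Reg 14) \<otimes> Reg 14))"

section \<open>Parameters, buckets, and the success of a level\<close>

context ann
begin

lemma par_mod_W2 [simp]: "n mod W = n" "d mod W = d" "sg mod W = sg" "(n + d + sg + 4) mod W = n + d + sg + 4"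
    "H mod W = H" "G mod W = G" "GI mod W = GI" "NL mod W = NL" "RB mod W = RB" "TB mod W = TB"
proof -
  have "P < W" by (rule small_W)
  then show "n mod W = n" "d mod W = d" "sg mod W = sg" "(n + d + sg + 4) mod W = n + d + sg + 4"
    using P_ge by auto
  show "H mod W = H" using H_less small_W(4) by simp
  have "8 * L \<le> 16 * P" using L_less by simp
  then show "G mod W = G" using small_W(4) by (simp add: G_def)
  have "NL < W" using NL_le P_power_lt_W[of 5] by simp
  moreover have "GI \<le> NL" by (simp add: NL_def)
  ultimately show "GI mod W = GI" "NL mod W = NL" by auto
  show "RB mod W = RB" "TB mod W = TB" using RB_TB_DS DS_W by auto
qed

lemma L_least: "2 ^ j < n + d + sg + 4 \<longleftrightarrow> j < L"
proof
  assume "j < L"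
  then have "\<not> n + d + sg + 4 \<le> 2 ^ j" unfolding L_def log_size_def by (rule not_less_Least)
  then show "2 ^ j < n + d + sg + 4" by simp
next
  assume "2 ^ j < n + d + sg + 4"
  then have "(2::nat) ^ j < 2 ^ L" using P_ge unfolding P_def by linarith
  then show "j < L" by simp
qed

lemma wp_params:
  assumes M: "mach M" and D: "data s 0 = n" "data s 1 = d" "data s 2 = sg" "data s 3 = N"
    and Q: "\<And>t s'. t \<le> 5 * L + 40 \<Longrightarrow> en s' \<Longrightarrow> \<forall>r. r < 10 \<or> 22 < r \<longrightarrow> regs s' r = regs s r \<Longrightarrow>
      data s' = data s \<Longrightarrow> work s' = work s \<Longrightarrow> Q t s'"
  shows "wp M params_com Q s"
proof -
  have Wm: "word_mod M = W" and dc: "DS \<le> data_cells M" using M by (auto simp: mach_def)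
  have dc4: "3 < data_cells M" using dc RB_TB_DS by linarith
  define Inv where "Inv j s' \<longleftrightarrow> regs s' 10 = n \<and> regs s' 11 = d \<and> regs s' 12 = sg \<and> regs s' 13 = N \<and>
    regs s' 14 = 2 ^ j \<and> regs s' 15 = j \<and> (\<forall>r. r < 10 \<or> 22 < r \<longrightarrow> regs s' r = regs s r) \<and>
    data s' = data s \<and> work s' = work s" for j and s' :: store
  have cond: "eval_exp W (regs s') (Less (Reg 14) (Reg 10 \<oplus> Reg 11 \<oplus> Reg 12 \<oplus> Const 4)) = (if j < L then 1 else 0)"
    if "Inv j s'" for j s'
    using that L_least[of j] unfolding Inv_def by (simp add: mod_simps)
  have loop: "wp M (While (Less (Reg 14) (Reg 10 \<oplus> Reg 11 \<oplus> Reg 12 \<oplus> Const 4))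
      (Assign 14 (Const 2 \<otimes> Reg 14) ;; Assign 15 (Reg 15 \<oplus> Const 1))) Q' s'"
    if "Inv 0 s'" "\<And>t s'. t \<le> L * (3 + 1) + 1 \<Longrightarrow> Inv L s' \<Longrightarrow> Q' t s'" for s' Q'
  proof (rule wp_for[where m = L and I = Inv and b = 3])
    fix j s' assume j: "j < L" and I: "Inv j s'"
    show "eval_exp (word_mod M) (regs s') (Less (Reg 14) (Reg 10 \<oplus> Reg 11 \<oplus> Reg 12 \<oplus> Const 4)) \<noteq> 0"
      unfolding Wm cond[OF I] using j by simp
    have "(2::nat) * 2 ^ j \<le> P" using power_increasing[of "Suc j" L "2::nat"] j by (simp add: P_def)
    then have "(2 * 2 ^ j) mod W = 2 * 2 ^ j" "Suc j mod W = Suc j" using small_W(2,3) j by auto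
    then show "wp M (Assign 14 (Const 2 \<otimes> Reg 14) ;; Assign 15 (Reg 15 \<oplus> Const 1)) (\<lambda>t s'. t \<le> 3 \<and> Inv (Suc j) s') s'"
      using I unfolding Inv_def by (intro wp_intros) (auto simp: Wm)
  next
    fix s' assume I: "Inv L s'"
    show "eval_exp (word_mod M) (regs s') (Less (Reg 14) (Reg 10 \<oplus> Reg 11 \<oplus> Reg 12 \<oplus> Const 4)) = 0"
      unfolding Wm cond[OF I] by simp
  qed (use that in auto)
  have HH: "(5 * (d + L)) mod W = H" "(P * P * P * P) mod W = m" "(8 * L) mod W = G" "(32 * L * L) mod W = GI"
      "((L + 1) * GI) mod W = NL" "(4 + P * P) mod W = RB" "(RB + NL * (L + 7) * (16 * P) * P) mod W = TB"
    using par_mod_W par_mod_W2 unfolding H_def m_def G_def GI_def NL_def RB_def TB_def by (simp_all add: eval_nat_numeral mult.assoc)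
  show ?thesis
    unfolding params_com_def
    apply (rule wp_Seq, rule wp_LoadData, use dc4 in \<open>simp add: Wm\<close>)
    apply (rule wp_Seq, rule wp_LoadData, use dc4 in \<open>simp add: Wm\<close>)
    apply (rule wp_Seq, rule wp_LoadData, use dc4 in \<open>simp add: Wm\<close>)
    apply (rule wp_Seq, rule wp_LoadData, use dc4 in \<open>simp add: Wm\<close>)
    apply (rule wp_Seq, rule wp_Assign, rule wp_Seq, rule wp_Assign, rule wp_Seq, rule loop)
    subgoal using D by (simp add: Inv_def Wm)
    subgoal premises prems for t s1
    proof -
      have r: "regs s1 10 = n" "regs s1 11 = d" "regs s1 12 = sg" "regs s1 13 = N" "regs s1 14 = P" "regs s1 15 = L"
        "\<forall>r. r < 10 \<or> 22 < r \<longrightarrow> regs s1 r = regs s r" "data s1 = data s" "work s1 = work s"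
        using prems(2) unfolding Inv_def by (auto simp: P_def)
      have e: "eval_exp W \<rho> (Const 5 \<otimes> (Reg 11 \<oplus> Reg 15)) = H" if "\<rho> 11 = d" "\<rho> 15 = L" for \<rho>
        using that HH by (simp add: mod_simps)
      have e2: "eval_exp W \<rho> (Reg 14 \<otimes> Reg 14 \<otimes> Reg 14 \<otimes> Reg 14) = m" if "\<rho> 14 = P" for \<rho>
        using that HH by (simp add: mod_simps)
      have e3: "eval_exp W \<rho> (Const 8 \<otimes> Reg 15) = G" "eval_exp W \<rho> (Const 32 \<otimes> Reg 15 \<otimes> Reg 15) = GI" if "\<rho> 15 = L" for \<rho>
        using that HH by (simp_all add: mod_simps)
      have e4: "eval_exp W \<rho> ((Reg 15 \<oplus> Const 1) \<otimes> Reg 19) = NL" if "\<rho> 15 = L" "\<rho> 19 = GI" for \<rho>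
        using that HH(5) by (simp add: mod_simps)
      have e5: "eval_exp W \<rho> (Const 4 \<oplus> Reg 14 \<otimes> Reg 14) = RB" if "\<rho> 14 = P" for \<rho>
        using that HH(6) by (simp add: mod_simps)
      have e6: "eval_exp W \<rho> (Reg 21 \<oplus> Reg 20 \<otimes> (Reg 15 \<oplus> Const 7) \<otimes> (Const 16 \<otimes> Reg 14) \<otimes> Reg 14) = TB"
        if "\<rho> 14 = P" "\<rho> 15 = L" "\<rho> 20 = NL" "\<rho> 21 = RB" for \<rho>
        using that HH(7) by (simp add: mod_simps)
      show ?thesis
        by (intro wp_Seq wp_Assign Q; use prems(1) r in \<open>simp del: eval_exp.simps One_nat_def add: Wm e e2 e3 e4 e5 e6 env_def\<close>)
    qed
    done
qed

text \<open>Buckets are linked lists: \<^term>\<open>nx g f i\<close> is the first index from \<open>i\<close> on whose string has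
  fingerprint \<open>f\<close>, and \<open>n\<close> if there is none.\<close>

definition "nx g f i = (LEAST j. i \<le> j \<and> (n \<le> j \<or> g j = f))" for g :: "nat \<Rightarrow> nat" and f i

lemma nx:
  assumes "i \<le> n"
  shows "i \<le> nx g f i" "nx g f i \<le> n" "nx g f i < n \<Longrightarrow> g (nx g f i) = f"
    "i \<le> j \<Longrightarrow> j < nx g f i \<Longrightarrow> g j \<noteq> f"
proof -
  let ?p = "\<lambda>j. i \<le> j \<and> (n \<le> j \<or> g j = f)"
  have "?p n" using assms by simp
  then have 1: "?p (nx g f i)" unfolding nx_def by (rule LeastI)
  show "nx g f i \<le> n" unfolding nx_def using \<open>?p n\<close> by (rule Least_le)
  show "i \<le> nx g f i" "nx g f i < n \<Longrightarrow> g (nx g f i) = f" using 1 by auto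
  show "i \<le> j \<Longrightarrow> j < nx g f i \<Longrightarrow> g j \<noteq> f" unfolding nx_def using not_less_Least[of j ?p] by auto
qed

text \<open>The interface between preprocessing and queries: the random cells may hold any words
  below \<open>m\<close>, and the tables are the function of them that is spelled out here.\<close>

definition wf :: "nat list list \<Rightarrow> (nat \<Rightarrow> nat) \<Rightarrow> bool" where
  "wf xs D \<longleftrightarrow> D 0 = n \<and> D 1 = d \<and> D 2 = sg \<and> D 3 = N \<and>
    (\<forall>i<n. D (saddr i) = length (xs ! i) \<and> (\<forall>j<length (xs ! i). D (saddr i + 1 + j) = xs ! i ! j)) \<and>
    (\<forall>a. RB \<le> a \<and> a < TB \<longrightarrow> D a < m) \<and>
    (\<forall>l t. l < NL \<longrightarrow> t < 64 * P \<longrightarrow>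
      (\<forall>f<P. D (tab l t f) = nx (\<lambda>j. fpt D l t (xs ! j)) f 0) \<and>
      (\<forall>i<n. D (tab l t (P + i)) = nx (\<lambda>j. fpt D l t (xs ! j)) (fpt D l t (xs ! i)) (Suc i)))"

text \<open>At level \<open>r\<close> the candidates within distance \<open>\<lfloor>N r / n\<rfloor>\<close> are accepted.  The first
  \<open>40 T\<close> tables of each threshold are probed for \<open>T = 3\<^sup>r 2\<^sup>J\<^sup>J\<close>, until \<open>2400 T\<close> false
  candidates have been met; once there are not enough tables, the whole database is scanned.\<close>

definition "Coll D q xs l t = {j. j < n \<and> fpt D l t (xs ! j) = fpt D l t q}"
definition "Hit D q xs K T B l \<longleftrightarrow> (\<Sum>t\<in>{1..T}. card {j \<in> Coll D q xs l t. K < lev q (xs ! j)}) \<le> B \<and>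
  (\<exists>t\<in>{1..T}. \<exists>j\<in>Coll D q xs l t. lev q (xs ! j) \<le> K)"
text \<open>\<open>N / n\<close> approximates \<open>c\<close> from below, so the accepted radius is
  at most \<open>c * r\<close>, and it is at least \<open>r\<close> because
  \<open>n \<le> N\<close>.\<close>

definition "Kr r = N * r div n"
text \<open>The least integer above \<open>L * n / N\<close>. Thus q^r \<le> 2^(-JJ) forces q^k
  \<le> 1 / P for k > r N / n, while \<open>2 ^ JJ\<close> remains of order n^(1/c).\<close>

definition "JJ = L * n div N + 1"
definition "Ts r = (3::nat) ^ r * 2 ^ JJ"
definition "level_ok D q xs r \<longleftrightarrow> (if Ts r \<le> P
  then \<exists>i<GI. Hit D q xs (Kr r) (40 * Ts r) (2400 * Ts r) (r * GI + i) else \<exists>j<n. lev q (xs ! j) \<le> Kr r)"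
definition "TT K = 200 * (d + 1) * (K + 1)"
definition "TH = 64 * (L + 6) * H"
definition "Cost r = (if Ts r \<le> P
  then GI * (2441 * Ts r * (TT (Kr r) + TH + 13) + 20) + 10 else n * (TT (Kr r) + 7)) + 20"

lemma r_le_Kr: "r \<le> Kr r"
proof -
  have "n * r div n \<le> N * r div n" using nN by (intro div_le_mono mult_right_mono) auto
  then show ?thesis using n1 by (simp add: Kr_def)
qed

text \<open>The factor \<open>3 ^ r\<close> alone exceeds \<open>P\<close> beyond level
  \<open>L\<close>. Hence tables for \<open>L + 1\<close> levels are enough.\<close>

lemma Ts_level: "Ts r \<le> P \<Longrightarrow> r \<le> L"
proof (rule ccontr)
  assume "Ts r \<le> P" "\<not> r \<le> L"
  have "P < 2 ^ r" using \<open>\<not> r \<le> L\<close> unfolding P_def by (intro power_strict_increasing) auto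
  also have "\<dots> \<le> 3 ^ r" by (intro power_mono) auto
  also have "\<dots> \<le> Ts r" by (simp add: Ts_def)
  finally show False using \<open>Ts r \<le> P\<close> by simp
qed

lemma JJ_bounds: "L * n < JJ * N" "JJ \<le> L + 1"
proof -
  have N: "0 < N" using nN n1 by simp
  show "L * n < JJ * N"
    using dividend_less_times_div[OF N, of "L * n"] unfolding JJ_def by (simp add: mult.commute)
  have "L * n div N \<le> L * N div N" using nN by (intro div_le_mono mult_left_mono) auto
  then show "JJ \<le> L + 1" using N by (simp add: JJ_def)
qed

end

text \<open>Register 2 holds the level \<open>r\<close>, register 3 the successor of the index of an accepted string (or 0),
  register 4 the number \<open>T\<close> with \<open>40 T\<close> tables to be probed, capped once it exceeds \<open>P\<close>.  One round of
  the inner loop either tests one candidate or opens the next bucket, so that bounding the number of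
  rounds bounds the number of false candidates.\<close>

definition try_com :: com where
  "try_com = (test_com ;; If (Reg 40) (Assign 3 (Reg 28 \<oplus> Const 1)) (Assign 3 (Reg 3)))"

definition round_com :: com where
  "round_com =
    (If (Less (Reg 28) (Reg 10))
      (try_com ;; LoadData 28 (tab_exp (Reg 14 \<oplus> Reg 28)))
      (If (Less (Reg 24) (Const 40 \<otimes> Reg 4))
        (Assign 24 (Reg 24 \<oplus> Const 1) ;; hash_com ;; LoadData 28 (tab_exp (Reg 30)))
        (Assign 28 (Reg 10))) ;;
     Assign 6 (Reg 6 \<oplus> Const 1))"

text \<open>The number of rounds is 2441 = 40 + 2400 + 1 times \<open>T\<close>: one round for each
  opened table, one for each tolerated false candidate, and a remainder so that running out of
  rounds contradicts the bounds.\<close>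

definition probe_com :: com where
  "probe_com =
    (Assign 25 (Div (Reg 17) (Const 2)) ;; Assign 5 (Const 0) ;;
     While (Less (Reg 5) (Reg 19))
      (Assign 23 (Reg 2 \<otimes> Reg 19 \<oplus> Reg 5) ;; Assign 24 (Const 0) ;; Assign 28 (Reg 10) ;;
       Assign 6 (Const 0) ;;
       While (Less (Reg 6) (Const 2441 \<otimes> Reg 4)) round_com ;;
       Assign 25 (Reg 25 \<ominus> Div (Reg 25) (Reg 18)) ;;
       Assign 5 (Reg 5 \<oplus> Const 1)))"

definition scan_com :: com where
  "scan_com =
    (Assign 28 (Const 0) ;;
     While (Less (Reg 28) (Reg 10)) (try_com ;; Assign 28 (Reg 28 \<oplus> Const 1)))"

text \<open>Register 7 holds \<open>JJ\<close>, the number of doublings that turn register 4 into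
  \<open>Ts 0\<close>. At the end register 3 is \<open>Suc j\<close>; the letters of string
  \<open>j\<close> start one cell after its length, hence the offset 5 instead of 4.\<close>

definition query_com :: com where
  "query_com =
    (LoadInput 26 (Const 0) ;; Assign 5 (Const 0) ;;
     While (Less (Reg 5) (Reg 26))
      (LoadInput 6 (Reg 5 \<oplus> Const 1) ;; StoreWork (Reg 5) (Reg 6) ;; Assign 5 (Reg 5 \<oplus> Const 1)) ;;
     params_com ;;
     Assign 7 (Div (Reg 15 \<otimes> Reg 10) (Reg 13) \<oplus> Const 1) ;; Assign 4 (Const 1) ;; Assign 5 (Const 0) ;;
     While (Less (Reg 5) (Reg 7)) (Assign 4 (Const 2 \<otimes> Reg 4) ;; Assign 5 (Reg 5 \<oplus> Const 1)) ;;
     Assign 2 (Const 0) ;; Assign 3 (Const 0) ;;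
     While (Equal (Reg 3) (Const 0))
      (Assign 27 (Div (Reg 13 \<otimes> Reg 2) (Reg 10)) ;;
       If (Less (Reg 14) (Reg 4)) scan_com (probe_com ;; Assign 4 (Const 3 \<otimes> Reg 4)) ;;
       Assign 2 (Reg 2 \<oplus> Const 1)) ;;
     Assign 0 (Const 5 \<oplus> (Reg 3 \<ominus> Const 1) \<otimes> Reg 14) ;;
     LoadData 1 (Const 4 \<oplus> (Reg 3 \<ominus> Const 1) \<otimes> Reg 14))"

section \<open>Correctness and time of a query for given table contents\<close>

locale ann_query = ann +
  fixes M :: machine and q :: "nat list" and xs :: "nat list list" and D :: "nat \<Rightarrow> nat"
  assumes M: "mach M" and q: "length q \<le> d" "set q \<subseteq> {..<sg}"
    and xs: "length xs = n" "\<And>i. i < n \<Longrightarrow> length (xs ! i) \<le> d \<and> set (xs ! i) \<subseteq> {..<sg}"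
    and wfD: "wf xs D"
begin

lemma Wm: "word_mod M = W" and dc: "DS \<le> data_cells M" "DS \<le> work_cells M" using M by (auto simp: mach_def)

definition "base s \<longleftrightarrow> en s \<and> regs s 26 = length q \<and> data s = D \<and> (\<forall>i<length q. work s i = q ! i)"

lemma q_len: "length q < P" using q P_ge by auto

lemma base_regs: "base s \<Longrightarrow> (\<And>r. 10 \<le> r \<Longrightarrow> r \<le> 22 \<or> r = 26 \<Longrightarrow> f r = regs s r) \<Longrightarrow> base (s\<lparr>regs := f\<rparr>)"
  unfolding base_def env_def by auto

lemma base_r:
  assumes "base s"
  shows "en s" "regs s 10 = n" "regs s 13 = N" "regs s 14 = P" "regs s 15 = L" "regs s 17 = m" "regs s 18 = G"
    "regs s 19 = GI" "regs s 26 = length q" "data s = D"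
  using assms unfolding base_def by (auto simp: env_def)

definition "acc K j \<longleftrightarrow> lev q (xs ! j) \<le> K"

lemma wp_try:
  assumes b: "base s" and c: "regs s 28 < n" and K: "regs s 27 = K" "K + 4 * P < W"
    and Q: "\<And>t s'. t \<le> TT K + 3 \<Longrightarrow> base s' \<Longrightarrow>
      regs s' 3 = (if acc K (regs s 28) then Suc (regs s 28) else regs s 3) \<Longrightarrow>
      \<forall>r<40. r \<noteq> 3 \<longrightarrow> regs s' r = regs s r \<Longrightarrow> Q t s'"
  shows "wp M try_com Q s"
proof -
  note r = base_r[OF b]
  interpret T: ann_test n d sg N W M q "xs ! (regs s 28)" K "regs s 28" s
    using M q xs(2)[OF c] b c K wfD unfolding base_def wf_def by unfold_locales auto
  have c1: "Suc (regs s 28) mod W = Suc (regs s 28)" using c P_ge small_W(2) by simp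
  show ?thesis
    unfolding try_com_def
  proof (rule wp_Seq, rule T.wp_test)
    fix t and s' :: store assume s': "t \<le> 200 * (d + 1) * (K + 1)"
      "regs s' 40 = (if lev q (xs ! regs s 28) \<le> K then 1 else 0)" "\<forall>r<40. regs s' r = regs s r"
      "data s' = data s" "\<forall>i<P. work s' i = work s i"
    have b': "base s'" using b s' q_len unfolding base_def by (auto simp: env_def)
    show "wp M (If (Reg 40) (Assign 3 (Reg 28 \<oplus> Const 1)) (Assign 3 (Reg 3))) (\<lambda>t2. Q (Suc (t + t2))) s'"
      by (intro wp_intros Q base_regs[OF b']) (use s' c1 in \<open>auto simp: TT_def acc_def Wm split: if_splits\<close>)
  qed
qed

lemma wp_scan:
  assumes b: "base s" and K: "regs s 27 = K" "K + 4 * P < W" and s3: "regs s 3 = 0"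
    and Q: "\<And>t s'. t \<le> n * (TT K + 7) + 4 \<Longrightarrow> base s' \<Longrightarrow>
      \<forall>r<40. r \<noteq> 3 \<and> r \<noteq> 28 \<longrightarrow> regs s' r = regs s r \<Longrightarrow>
      regs s' 3 = 0 \<and> (\<forall>j<n. \<not> acc K j) \<or> (\<exists>j<n. regs s' 3 = Suc j \<and> acc K j) \<Longrightarrow> Q t s'"
  shows "wp M scan_com Q s"
proof -
  define Inv where "Inv j s' \<longleftrightarrow> base s' \<and> regs s' 28 = j \<and> (\<forall>r<40. r \<noteq> 3 \<and> r \<noteq> 28 \<longrightarrow> regs s' r = regs s r) \<and>
    (regs s' 3 = 0 \<and> (\<forall>i<j. \<not> acc K i) \<or> (\<exists>i<n. regs s' 3 = Suc i \<and> acc K i))" for j and s' :: store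
  have nW: "j < n \<Longrightarrow> Suc j mod W = Suc j" for j using P_ge small_W(2) by simp
  show ?thesis
    unfolding scan_com_def
  proof (rule wp_Seq, rule wp_Assign, rule wp_for[where m = n and I = Inv and b = "TT K + 6"])
    fix j s' assume j: "j < n" and I: "Inv j s'"
    have I': "base s'" "regs s' 28 = j" "\<forall>r<40. r \<noteq> 3 \<and> r \<noteq> 28 \<longrightarrow> regs s' r = regs s r"
        "regs s' 3 = 0 \<and> (\<forall>i<j. \<not> acc K i) \<or> (\<exists>i<n. regs s' 3 = Suc i \<and> acc K i)"
      using I unfolding Inv_def by auto
    show "eval_exp (word_mod M) (regs s') (Less (Reg 28) (Reg 10)) \<noteq> 0"
      using j I' base_r[OF I'(1)] by (simp add: Wm)
    show "wp M (try_com ;; Assign 28 (Reg 28 \<oplus> Const 1)) (\<lambda>t s'. t \<le> TT K + 6 \<and> Inv (Suc j) s') s'"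
    proof (rule wp_Seq, rule wp_try[OF I'(1)])
      show "regs s' 28 < n" "regs s' 27 = K" "K + 4 * P < W" using I' j K by auto
    next
      fix t s2 assume s2: "t \<le> TT K + 3" "base s2" "regs s2 3 = (if acc K (regs s' 28) then Suc (regs s' 28) else regs s' 3)"
        "\<forall>r<40. r \<noteq> 3 \<longrightarrow> regs s2 r = regs s' r"
      have 28: "regs s2 28 = j" using s2 I' by simp
      show "wp M (Assign 28 (Reg 28 \<oplus> Const 1)) (\<lambda>t2 s'. Suc (t + t2) \<le> TT K + 6 \<and> Inv (Suc j) s') s2"
      proof (rule wp_Assign, intro conjI)
        show "Inv (Suc j) (s2\<lparr>regs := (regs s2)(28 := eval_exp (word_mod M) (regs s2) (Reg 28 \<oplus> Const 1))\<rparr>)"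
          unfolding Inv_def
        proof (intro conjI)
          show "base (s2\<lparr>regs := (regs s2)(28 := eval_exp (word_mod M) (regs s2) (Reg 28 \<oplus> Const 1))\<rparr>)"
            by (rule base_regs[OF s2(2)]) auto
        qed (use s2 I' j nW[OF j] 28 in \<open>auto simp: Wm less_Suc_eq\<close>)
      qed (use s2 in auto)
    qed
  next
    fix s' assume "Inv n s'"
    then show "eval_exp (word_mod M) (regs s') (Less (Reg 28) (Reg 10)) = 0"
      using base_r(2)[of s'] unfolding Inv_def by (simp add: Wm)
  next
    show "Inv 0 (s\<lparr>regs := (regs s)(28 := eval_exp (word_mod M) (regs s) (Const 0))\<rparr>)"
      unfolding Inv_def using s3 by (auto intro!: base_regs[OF b])
  next
    fix t s' assume "t \<le> n * (TT K + 6 + 1) + 1" "Inv n s'"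
    moreover from this have "Suc (1 + t) \<le> n * (TT K + 7) + 4" by (simp add: add.commute add.left_commute)
    ultimately show "Q (Suc (1 + t)) s'" unfolding Inv_def by (intro Q) auto
  qed
qed

abbreviation "coll \<equiv> Coll D q xs"
abbreviation "hit \<equiv> Hit D q xs"
abbreviation "lvl_ok \<equiv> level_ok D q xs"

definition "false_hits K l t = card {j \<in> coll l t. \<not> acc K j}"
definition "valid K f \<longleftrightarrow> f = 0 \<or> (\<exists>j<n. f = Suc j \<and> acc K j)"
text \<open>The false candidates met when bucket \<open>t\<close> is at candidate \<open>c\<close>
  and the buckets of tables \<open>1, ..., t - 1\<close> are exhausted. The value 0 of
  \<open>t\<close> means that no table has been opened.\<close>

definition "seen K l t c = (if t = 0 then 0 else
  (\<Sum>u\<in>{1..<t}. false_hits K l u) + card {j \<in> coll l t. j < c \<and> \<not> acc K j})"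
definition "clean K l t c \<longleftrightarrow> (\<forall>u\<in>{1..<t}. \<forall>j\<in>coll l u. \<not> acc K j) \<and> (1 \<le> t \<longrightarrow> (\<forall>j\<in>coll l t. j < c \<longrightarrow> \<not> acc K j))"

lemma finite_coll: "finite (coll l t)" by (simp add: Coll_def)

lemma hit_iff: "hit K T B l \<longleftrightarrow> (\<Sum>t\<in>{1..T}. false_hits K l t) \<le> B \<and> (\<exists>t\<in>{1..T}. \<exists>j\<in>coll l t. acc K j)"
  by (simp add: Hit_def false_hits_def acc_def not_le)

lemma lvl_ok_iff: "lvl_ok r \<longleftrightarrow> (if Ts r \<le> P then \<exists>i<GI. hit (Kr r) (40 * Ts r) (2400 * Ts r) (r * GI + i)
  else \<exists>j<n. acc (Kr r) j)"
  by (simp add: level_ok_def acc_def)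

lemma seen_le: "t \<le> T \<Longrightarrow> seen K l t c \<le> (\<Sum>u\<in>{1..T}. false_hits K l u)"
proof (cases "t = 0")
  case False
  assume "t \<le> T"
  have "seen K l t c \<le> (\<Sum>u\<in>{1..<t}. false_hits K l u) + false_hits K l t"
    using False unfolding seen_def false_hits_def by (auto intro!: card_mono finite_subset[OF _ finite_coll])
  also have "\<dots> = (\<Sum>u\<in>{1..t}. false_hits K l u)"
    using False by (cases t) (simp_all add: atLeastLessThanSuc_atLeastAtMost)
  also have "\<dots> \<le> (\<Sum>u\<in>{1..T}. false_hits K l u)" using \<open>t \<le> T\<close> by (intro sum_mono2) auto
  finally show ?thesis .
qed (simp add: seen_def)

lemma seen_next_table:
  assumes c': "\<And>j. j \<in> coll l (Suc t) \<Longrightarrow> c' \<le> j"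
  shows "seen K l (Suc t) c' = seen K l t n"
    "clean K l t n \<Longrightarrow> clean K l (Suc t) c'"
proof -
  have e: "{j \<in> coll l (Suc t). j < c' \<and> \<not> acc K j} = {}" using c' by force
  have a: "{j \<in> coll l t. j < n \<and> \<not> acc K j} = {j \<in> coll l t. \<not> acc K j}" by (auto simp: Coll_def)
  show "seen K l (Suc t) c' = seen K l t n"
    unfolding seen_def e a by (cases t) (auto simp: false_hits_def)
  show "clean K l (Suc t) c'" if "clean K l t n"
    unfolding clean_def
  proof (intro conjI ballI impI)
    fix u j assume "u \<in> {1..<Suc t}" "j \<in> coll l u"
    then show "\<not> acc K j" using that unfolding clean_def by (cases "u = t") (auto simp: Coll_def)
  next
    fix j assume "j \<in> coll l (Suc t)" "j < c'"
    then show "\<not> acc K j" using c' by force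
  qed
qed

lemma seen_next_candidate:
  assumes "1 \<le> t" "c \<in> coll l t" "\<not> acc K c" "\<And>j. j \<in> coll l t \<Longrightarrow> c < j \<Longrightarrow> c' \<le> j" "c < c'"
  shows "seen K l t c' = Suc (seen K l t c)" "clean K l t c \<Longrightarrow> clean K l t c'"
proof -
  have k: "j < c' \<longleftrightarrow> j = c \<or> j < c" if "j \<in> coll l t" for j
  proof (cases "c < j")
    case True
    then show ?thesis using assms(4)[OF that True] by simp
  next
    case False
    then have "j \<le> c" by simp
    then show ?thesis using assms(5) le_less_trans[of j c c'] le_less[of j c] by blast
  qed
  have "{j \<in> coll l t. j < c' \<and> \<not> acc K j} = insert c {j \<in> coll l t. j < c \<and> \<not> acc K j}"
    using assms(2,3) k by blast
  moreover have "finite {j \<in> coll l t. j < c \<and> \<not> acc K j}" "t \<noteq> 0"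
    using assms(1) by (auto intro: finite_subset[OF _ finite_coll])
  ultimately show "seen K l t c' = Suc (seen K l t c)" unfolding seen_def by simp
  have "j < c \<or> j = c" if "j \<in> coll l t" "j < c'" for j using k[OF that(1)] that(2) by blast
  then show "clean K l t c'" if "clean K l t c" using that assms unfolding clean_def by blast
qed

lemma wf_tab:
  assumes "l < NL" "t < 64 * P"
  shows "D (tab l t (fpt D l t q)) = nx (\<lambda>j. fpt D l t (xs ! j)) (fpt D l t q) 0"
    "i < n \<Longrightarrow> D (tab l t (P + i)) = nx (\<lambda>j. fpt D l t (xs ! j)) (fpt D l t (xs ! i)) (Suc i)"
proof -
  have "fpt D l t q < P" using P8 by (simp add: fpt_def)
  then show "D (tab l t (fpt D l t q)) = nx (\<lambda>j. fpt D l t (xs ! j)) (fpt D l t q) 0"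
    using wfD assms unfolding wf_def by blast
  show "i < n \<Longrightarrow> D (tab l t (P + i)) = nx (\<lambda>j. fpt D l t (xs ! j)) (fpt D l t (xs ! i)) (Suc i)"
    using wfD assms unfolding wf_def by blast
qed

lemma tab_first:
  assumes "l < NL" "t < 64 * P"
  defines "c \<equiv> D (tab l t (fpt D l t q))"
  shows "c \<le> n" "c < n \<Longrightarrow> c \<in> coll l t" "j \<in> coll l t \<Longrightarrow> c \<le> j"
proof -
  note c = c_def[unfolded wf_tab(1)[OF assms(1,2)]]
  show "c \<le> n" "c < n \<Longrightarrow> c \<in> coll l t" unfolding c Coll_def using nx[of 0] by auto
  show "c \<le> j" if "j \<in> coll l t" using nx(4)[of 0 j] that unfolding c Coll_def by (auto simp: not_le[symmetric])
qed

lemma tab_next: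
  assumes "l < NL" "t < 64 * P" "i \<in> coll l t"
  defines "c \<equiv> D (tab l t (P + i))"
  shows "c \<le> n" "i < c" "c < n \<Longrightarrow> c \<in> coll l t" "j \<in> coll l t \<Longrightarrow> i < j \<Longrightarrow> c \<le> j"
proof -
  have i: "i < n" "fpt D l t (xs ! i) = fpt D l t q" using assms(3) by (auto simp: Coll_def)
  note c = c_def[unfolded wf_tab(2)[OF assms(1,2) i(1)], unfolded i(2)]
  show "c \<le> n" "c < n \<Longrightarrow> c \<in> coll l t" "i < c" unfolding c Coll_def using nx[of "Suc i"] i by (auto simp: Suc_le_eq)
  show "c \<le> j" if "j \<in> coll l t" "i < j"
    using nx(4)[of "Suc i" j] that i unfolding c Coll_def by (auto simp: not_le[symmetric])
qed

lemma fpt_less: "fpt D l t x < 2 * P"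
proof -
  have "fpt D l t x < P" using P8 by (simp add: fpt_def)
  then show ?thesis by simp
qed

text \<open>As long as nothing has been accepted, the round number \<open>g\<close> equals the
  number of opened tables plus the number of false candidates met, unless all tables are exhausted
  and the loop idles. Acceptance is never revoked.\<close>

definition "RI K l T1 s0 g s \<longleftrightarrow> base s \<and> regs s 23 = l \<and> regs s 25 = Xi (l mod GI) \<and> regs s 27 = K \<and> regs s 4 = T1 \<and>
  regs s 6 = g \<and> regs s 24 \<le> 40 * T1 \<and> regs s 28 \<le> n \<and> (regs s 28 < n \<longrightarrow> 1 \<le> regs s 24 \<and> regs s 28 \<in> coll l (regs s 24)) \<and>
  (\<forall>r<30. r \<notin> {3, 6, 24, 28} \<longrightarrow> regs s r = regs s0 r) \<and> valid K (regs s 3) \<and>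
  (regs s0 3 \<noteq> 0 \<longrightarrow> regs s 3 \<noteq> 0) \<and>
  (regs s 3 \<noteq> 0 \<or> clean K l (regs s 24) (regs s 28) \<and>
    (regs s 24 = 40 * T1 \<and> regs s 28 = n \<or> g = regs s 24 + seen K l (regs s 24) (regs s 28)))"

lemma wp_round:
  assumes I: "RI K l T1 s0 g s" and l: "l < NL" and T1: "T1 \<le> P" "1 \<le> T1" and K: "K + 4 * P < W" and g: "g < 2441 * T1"
    and Q: "\<And>t s'. t \<le> TT K + TH + 12 \<Longrightarrow> RI K l T1 s0 (Suc g) s' \<Longrightarrow> Q t s'"
  shows "wp M round_com Q s"
proof -
  let ?t = "regs s 24" and ?c = "regs s 28"
  have i: "base s" "regs s 23 = l" "regs s 25 = Xi (l mod GI)" "regs s 27 = K" "regs s 4 = T1" "regs s 6 = g" "?t \<le> 40 * T1"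
    "?c \<le> n" "?c < n \<Longrightarrow> 1 \<le> ?t \<and> ?c \<in> coll l ?t" "\<And>r. r < 30 \<Longrightarrow> r \<notin> {3, 6, 24, 28} \<Longrightarrow> regs s r = regs s0 r"
    "valid K (regs s 3)" "regs s0 3 \<noteq> 0 \<Longrightarrow> regs s 3 \<noteq> 0" using I unfolding RI_def by auto
  have i0: "clean K l ?t ?c" "?t = 40 * T1 \<and> ?c = n \<or> g = ?t + seen K l ?t ?c" if "regs s 3 = 0"
    using I that unfolding RI_def by auto
  note r = base_r[OF i(1)]
  have tP: "?t < 64 * P" "Suc ?t \<le> 40 * T1 \<Longrightarrow> Suc ?t < 64 * P" using i(7) T1 P8 by auto
  have "P * 8 ^ 4 \<le> P * P ^ 4" using P8 by (intro mult_left_mono power_mono) auto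
  also have "\<dots> < W" using P_power_lt_W[of 5] by (simp flip: power_Suc)
  finally have TW: "2441 * T1 < W" using T1 by simp
  have gW: "Suc g mod W = Suc g" using g TW by simp
  have T40: "(40 * T1) mod W = 40 * T1" using TW by simp
  have tW: "Suc ?t \<le> 40 * T1 \<Longrightarrow> Suc ?t mod W = Suc ?t" using TW by simp
  have step6: "wp M (Assign 6 (Reg 6 \<oplus> Const 1)) Q' s'"
    if "regs s' 6 = g" "Q' 1 (s'\<lparr>regs := (regs s')(6 := Suc g)\<rparr>)" for Q' s'
    using that gW by (intro wp_Assign) (simp add: Wm)
  have RI6: "RI K l T1 s0 (Suc g) (s'\<lparr>regs := (regs s')(6 := Suc g)\<rparr>)"
    if "base s'" "regs s' 23 = l" "regs s' 25 = Xi (l mod GI)" "regs s' 27 = K" "regs s' 4 = T1" "regs s' 24 \<le> 40 * T1"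
      "regs s' 28 \<le> n" "regs s' 28 < n \<Longrightarrow> 1 \<le> regs s' 24 \<and> regs s' 28 \<in> coll l (regs s' 24)"
      "\<And>r. r < 30 \<Longrightarrow> r \<notin> {3, 6, 24, 28} \<Longrightarrow> regs s' r = regs s0 r" "valid K (regs s' 3)"
      "regs s0 3 \<noteq> 0 \<Longrightarrow> regs s' 3 \<noteq> 0"
      "regs s' 3 = 0 \<Longrightarrow> clean K l (regs s' 24) (regs s' 28) \<and>
        (regs s' 24 = 40 * T1 \<and> regs s' 28 = n \<or> Suc g = regs s' 24 + seen K l (regs s' 24) (regs s' 28))" for s'
    using that base_regs[OF that(1), of "(regs s')(6 := Suc g)"] unfolding RI_def
    by (cases "regs s' 3 = 0") auto
  show ?thesis
  proof (cases "?c < n")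
    case True
    note ct = i(9)[OF True]
    show ?thesis unfolding round_com_def
    proof (rule wp_Seq, rule wp_If, rule wp_Seq, rule wp_try[OF i(1) True i(4) K])
      fix t s1 assume s1: "t \<le> TT K + 3" "base s1" "regs s1 3 = (if acc K ?c then Suc ?c else regs s 3)"
        "\<forall>r<40. r \<noteq> 3 \<longrightarrow> regs s1 r = regs s r"
      have z: "eval_exp W (regs s1) (Reg 14 \<oplus> Reg 28) = P + ?c"
        using s1 True r P_ge small_W(4) by simp
      have ev: "eval_exp W (regs s1) (tab_exp (Reg 14 \<oplus> Reg 28)) = tab l ?t (P + ?c)"
        using eval_tab[of s1 "Reg 14 \<oplus> Reg 28"] base_r(1)[OF s1(2)] s1 i l tP True P_ge unfolding z by simp
      have tb: "tab l ?t (P + ?c) < data_cells M" using tab_bounds[OF l tP(1), of "P + ?c"] True P_ge dc by linarith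
      let ?c' = "D (tab l ?t (P + ?c))"
      note nt = tab_next[OF l tP(1) ct[THEN conjunct2]]
      let ?s2 = "s1\<lparr>regs := (regs s1)(28 := ?c')\<rparr>"
      have b2: "base ?s2" by (rule base_regs[OF s1(2)]) auto
      have I2: "RI K l T1 s0 (Suc g) (?s2\<lparr>regs := (regs ?s2)(6 := Suc g)\<rparr>)"
      proof (rule RI6)
        show "valid K (regs ?s2 3)" using s1 True i(11) by (auto simp: valid_def)
        assume "regs ?s2 3 = 0"
        then have na: "\<not> acc K ?c" "regs s 3 = 0" using s1(3) by (auto split: if_splits)
        have "seen K l ?t ?c' = Suc (seen K l ?t ?c)" "clean K l ?t ?c'"
          using seen_next_candidate[OF _ _ na(1) nt(4) nt(2)] ct i0[OF na(2)] by auto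
        then show "clean K l (regs ?s2 24) (regs ?s2 28) \<and>
          (regs ?s2 24 = 40 * T1 \<and> regs ?s2 28 = n \<or> Suc g = regs ?s2 24 + seen K l (regs ?s2 24) (regs ?s2 28))"
          using i0(2)[OF na(2)] True s1(4) by auto
      qed (use b2 s1 i nt ct in auto)
      show "wp M (LoadData 28 (tab_exp (Reg 14 \<oplus> Reg 28)))
         (\<lambda>t2. (\<lambda>t1. wp M (Assign 6 (Reg 6 \<oplus> Const 1)) (\<lambda>t2. Q (Suc (t1 + t2)))) (Suc (Suc (t + t2)))) s1"
        using ev tb s1 i I2 base_r(10)[OF s1(2)]
        by (intro wp_LoadData step6 Q) (simp_all add: Wm)
    qed (use True r in \<open>simp add: Wm\<close>)
  next
    case False
    then have cn: "?c = n" using i by simp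
    show ?thesis
    proof (cases "?t < 40 * T1")
      case True
      then have t': "Suc ?t \<le> 40 * T1" by simp
      let ?s1 = "s\<lparr>regs := (regs s)(24 := Suc ?t)\<rparr>"
      have b1: "base ?s1" by (rule base_regs[OF i(1)]) auto
      show ?thesis unfolding round_com_def
        apply (rule wp_Seq, rule wp_If_False)
        subgoal using False r by (simp add: Wm)
        apply (rule wp_If)
         prefer 2
        subgoal using True r i T40 by (simp add: Wm)
        apply (rule wp_Seq, rule wp_Assign, rule wp_Seq)
        apply (rule wp_hash[OF M, where x = q])
        subgoal using base_r(1)[OF b1] tW[OF t'] by (simp add: Wm)
        subgoal using i l by simp
        subgoal using tP(2)[OF t'] tW[OF t'] by (simp add: Wm)
        subgoal using Xi_le i by simp
        subgoal using r by simp
        subgoal using q_len by simp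
        subgoal using i(1) by (simp add: base_def)
        subgoal by (rule q)
        subgoal using wfD r by (simp add: wf_def)
        subgoal premises prems for t s2
        proof -
          have e: "s\<lparr>regs := (regs s)(24 := eval_exp (word_mod M) (regs s) (Reg 24 \<oplus> Const 1))\<rparr> = ?s1"
            using tW[OF t'] by (simp add: Wm)
          note p = prems(2-)[unfolded e]
          have s2: "\<forall>r<30. regs s2 r = regs ?s1 r" "regs s2 30 = fpt D l (Suc ?t) q" "data s2 = D" "work s2 = work s"
            using p r i by (auto simp: fpt_def)
          have b2: "base s2" using s2 i(1) unfolding base_def env_def by simp
          have fP: "fpt D l (Suc ?t) q < 2 * P"
            by (rule fpt_less)
          have ev: "eval_exp W (regs s2) (tab_exp (Reg 30)) = tab l (Suc ?t) (fpt D l (Suc ?t) q)"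
            using eval_tab[of s2 "Reg 30"] base_r(1)[OF b2] s2 i l tP(2)[OF t'] fP by simp
          have tb: "tab l (Suc ?t) (fpt D l (Suc ?t) q) < data_cells M"
            using tab_bounds[OF l tP(2)[OF t'] fP] dc by linarith
          note ft = tab_first[OF l tP(2)[OF t']]
          let ?c' = "D (tab l (Suc ?t) (fpt D l (Suc ?t) q))"
          let ?s3 = "s2\<lparr>regs := (regs s2)(28 := ?c')\<rparr>"
          have b3: "base ?s3" by (rule base_regs[OF b2]) auto
          have I3: "RI K l T1 s0 (Suc g) (?s3\<lparr>regs := (regs ?s3)(6 := Suc g)\<rparr>)"
          proof (rule RI6)
            assume "regs ?s3 3 = 0"
            then have z: "regs s 3 = 0" using s2 by simp
            have "seen K l (Suc ?t) ?c' = seen K l ?t n" "clean K l (Suc ?t) ?c'"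
              using seen_next_table[OF ft(3)] i0(1)[OF z] cn by auto
            then show "clean K l (regs ?s3 24) (regs ?s3 28) \<and>
              (regs ?s3 24 = 40 * T1 \<and> regs ?s3 28 = n \<or> Suc g = regs ?s3 24 + seen K l (regs ?s3 24) (regs ?s3 28))"
              using i0(2)[OF z] cn True s2(1) by auto
          qed (use b3 s2 i ft t' in auto)
          have "t \<le> TH" using prems(2) unfolding TH_def by simp
          then show ?thesis
            using ev tb s2 i I3
            by (intro wp_LoadData step6 Q) (simp_all add: Wm)
        qed
        done
    next
      case f: False
      then have tT: "?t = 40 * T1" using i by simp
      let ?s1 = "s\<lparr>regs := (regs s)(28 := n)\<rparr>"
      have b1: "base ?s1" by (rule base_regs[OF i(1)]) auto
      have I1: "RI K l T1 s0 (Suc g) (?s1\<lparr>regs := (regs ?s1)(6 := Suc g)\<rparr>)"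
        by (rule RI6) (use b1 i i0 tT cn in auto)
      show ?thesis unfolding round_com_def
        apply (rule wp_Seq, rule wp_If_False)
        subgoal using False r by (simp add: Wm)
        apply (rule wp_If_False)
        subgoal using f r i T40 by (simp add: Wm)
        using r i I1 by (intro wp_Assign step6 Q) (simp_all add: Wm)
    qed
  qed
qed

text \<open>Without acceptance, either all tables are exhausted without an accepted candidate,
  against the second part of \<open>hit\<close>, or \<open>2441 * T1\<close> rounds are accounted
  for by at most \<open>40 * T1\<close> tables and \<open>2400 * T1\<close> false
  candidates.\<close>

lemma RI_exit:
  assumes I: "RI K l T1 s0 (2441 * T1) s" and T1: "1 \<le> T1" and h: "hit K (40 * T1) (2400 * T1) l"
  shows "regs s 3 \<noteq> 0"
proof
  assume z: "regs s 3 = 0"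
  have i: "regs s 24 \<le> 40 * T1" "clean K l (regs s 24) (regs s 28)"
    "regs s 24 = 40 * T1 \<and> regs s 28 = n \<or> 2441 * T1 = regs s 24 + seen K l (regs s 24) (regs s 28)"
    using I z unfolding RI_def by auto
  have "seen K l (regs s 24) (regs s 28) \<le> 2400 * T1"
    using seen_le[OF i(1), of K l "regs s 28"] h unfolding hit_iff by linarith
  then have e: "regs s 24 = 40 * T1" "regs s 28 = n" using i T1 by auto
  have "\<not> acc K j" if "t \<in> {1..40 * T1}" "j \<in> coll l t" for t j
    using i(2) that unfolding clean_def e by (cases "t = 40 * T1") (auto simp: Coll_def)
  then show False using h unfolding hit_iff by blast
qed

lemma wp_probe:
  assumes b: "base s" and r: "regs s 2 = r" "r \<le> L" and K: "regs s 27 = K" "K + 4 * P < W"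
    and T1: "regs s 4 = T1" "1 \<le> T1" "T1 \<le> P" and s3: "regs s 3 = 0"
    and Q: "\<And>t s'. t \<le> GI * (2441 * T1 * (TT K + TH + 13) + 20) + 10 \<Longrightarrow> base s' \<Longrightarrow> valid K (regs s' 3) \<Longrightarrow>
      \<forall>i<GI. hit K (40 * T1) (2400 * T1) (r * GI + i) \<longrightarrow> regs s' 3 \<noteq> 0 \<Longrightarrow>
      regs s' 2 = r \<Longrightarrow> regs s' 4 = T1 \<Longrightarrow> regs s' 27 = K \<Longrightarrow> Q t s'"
  shows "wp M probe_com Q s"
proof -
  let ?b = "2441 * T1 * (TT K + TH + 13) + 18"
  define Inv where "Inv i s' \<longleftrightarrow> base s' \<and> regs s' 2 = r \<and> regs s' 4 = T1 \<and> regs s' 27 = K \<and> regs s' 5 = i \<and>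
    regs s' 25 = Xi i \<and> valid K (regs s' 3) \<and>
    (\<forall>i'<i. hit K (40 * T1) (2400 * T1) (r * GI + i') \<longrightarrow> regs s' 3 \<noteq> 0)" for i and s' :: store
  have GIW: "GI < W" using par_mod_W2(7) by (metis mod_less_divisor small_W(1) le0 bot_nat_0.not_eq_extremum less_nat_zero_code)
  have lNL: "r * GI + i < NL" if "i < GI" for i
    unfolding NL_def using r(2) that by (intro mixed_radix_less) auto
  have NLW: "NL < W" using NL_le P_power_lt_W[of 5] by simp
  have m2: "m div 2 = Xi 0" by (simp add: Xi_def)
  have TW: "(2441 * T1) mod W = 2441 * T1"
  proof -
    have "P * 8 ^ 4 \<le> P * P ^ 4" using P8 by (intro mult_left_mono power_mono) auto
    also have "\<dots> < W" using P_power_lt_W[of 5] by (simp flip: power_Suc)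
    finally show ?thesis using T1 by simp
  qed
  have b0: "base (s\<lparr>regs := (regs s)(25 := Xi 0, 5 := 0)\<rparr>)" by (rule base_regs[OF b]) auto
  show ?thesis
    unfolding probe_com_def
  proof (rule wp_Seq, rule wp_Assign, rule wp_Seq, rule wp_Assign, rule wp_for[where m = GI and I = Inv and b = ?b])
    fix i s' assume i: "i < GI" and I: "Inv i s'"
    have I': "base s'" "regs s' 2 = r" "regs s' 4 = T1" "regs s' 27 = K" "regs s' 5 = i" "regs s' 25 = Xi i"
      "valid K (regs s' 3)" "\<forall>i'<i. hit K (40 * T1) (2400 * T1) (r * GI + i') \<longrightarrow> regs s' 3 \<noteq> 0"
      using I unfolding Inv_def by auto
    note br = base_r[OF I'(1)]
    show "eval_exp (word_mod M) (regs s') (Less (Reg 5) (Reg 19)) \<noteq> 0" using i I' br by (simp add: Wm)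
    let ?l = "r * GI + i"
    have l: "?l < NL" "?l mod W = ?l" "?l mod GI = i" using lNL[OF i] NLW i by auto
    have iW: "Suc i mod W = Suc i" using i GIW by simp
    have ev: "eval_exp W (regs s') (Reg 2 \<otimes> Reg 19 \<oplus> Reg 5) = ?l" using I' br l by (simp add: mod_simps)
    define s1 where "s1 = s'\<lparr>regs := (regs s')(23 := ?l, 24 := 0, 28 := n, 6 := 0)\<rparr>"
    have b1: "base s1" unfolding s1_def by (rule base_regs[OF I'(1)]) auto
    have R1: "RI K ?l T1 s1 0 s1"
      using b1 I' l unfolding RI_def s1_def by (auto simp: seen_def clean_def)
    have loop: "wp M (While (Less (Reg 6) (Const 2441 \<otimes> Reg 4)) round_com) Q' s1"
      if "\<And>t s2. t \<le> 2441 * T1 * (TT K + TH + 12 + 1) + 1 \<Longrightarrow> RI K ?l T1 s1 (2441 * T1) s2 \<Longrightarrow> Q' t s2" for Q'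
    proof (rule wp_for[where m = "2441 * T1" and I = "RI K ?l T1 s1" and b = "TT K + TH + 12"])
      fix g s2 assume g: "g < 2441 * T1" and R: "RI K ?l T1 s1 g s2"
      have "regs s2 6 = g" "regs s2 4 = T1" using R unfolding RI_def by auto
      then show "eval_exp (word_mod M) (regs s2) (Less (Reg 6) (Const 2441 \<otimes> Reg 4)) \<noteq> 0" using g TW by (simp add: Wm)
      show "wp M round_com (\<lambda>t s'. t \<le> TT K + TH + 12 \<and> RI K ?l T1 s1 (Suc g) s') s2"
        by (rule wp_round[OF R l(1) T1(3,2) K(2) g]) auto
    next
      fix s2 assume R: "RI K ?l T1 s1 (2441 * T1) s2"
      have "regs s2 6 = 2441 * T1" "regs s2 4 = T1" using R unfolding RI_def by auto
      then show "eval_exp (word_mod M) (regs s2) (Less (Reg 6) (Const 2441 \<otimes> Reg 4)) = 0" using TW by (simp add: Wm)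
    qed (use R1 that in auto)
    show "wp M (Assign 23 (Reg 2 \<otimes> Reg 19 \<oplus> Reg 5) ;; Assign 24 (Const 0) ;; Assign 28 (Reg 10) ;; Assign 6 (Const 0) ;;
       While (Less (Reg 6) (Const 2441 \<otimes> Reg 4)) round_com ;;
       Assign 25 (Reg 25 \<ominus> Div (Reg 25) (Reg 18)) ;; Assign 5 (Reg 5 \<oplus> Const 1)) (\<lambda>t s'. t \<le> ?b \<and> Inv (Suc i) s') s'"
      apply (rule wp_Seq, rule wp_Assign, unfold Wm ev, rule wp_Seq, rule wp_Assign, rule wp_Seq, rule wp_Assign,
        rule wp_Seq, rule wp_Assign)
      apply (rule wp_Seq)
      subgoal
      proof -
        have e: "s'\<lparr>regs := (regs s')(23 := ?l)\<rparr>\<lparr>regs := (regs (s'\<lparr>regs := (regs s')(23 := ?l)\<rparr>))(24 := 0)\<rparr>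
          \<lparr>regs := ((regs s')(23 := ?l, 24 := 0))(28 := n)\<rparr>\<lparr>regs := ((regs s')(23 := ?l, 24 := 0, 28 := n))(6 := 0)\<rparr> = s1"
          by (simp add: s1_def)
        have *: "wp M (While (Less (Reg 6) (Const 2441 \<otimes> Reg 4)) round_com) (\<lambda>t1. wp M (Assign 25 (Reg 25 \<ominus> Div (Reg 25) (Reg 18)) ;; Assign 5 (Reg 5 \<oplus> Const 1))
          (\<lambda>t2 s'. Suc (1 + Suc (1 + Suc (1 + Suc (1 + Suc (t1 + t2))))) \<le> ?b \<and> Inv (Suc i) s')) s1"
        proof (rule loop)
          fix t s2 assume t: "t \<le> 2441 * T1 * (TT K + TH + 12 + 1) + 1" and R: "RI K ?l T1 s1 (2441 * T1) s2"
          have h: "hit K (40 * T1) (2400 * T1) ?l \<longrightarrow> regs s2 3 \<noteq> 0" using RI_exit[OF R T1(2)] by blast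
          have r2: "base s2" "regs s2 25 = Xi i" "regs s2 27 = K" "regs s2 4 = T1" "regs s2 2 = r" "regs s2 5 = i" "valid K (regs s2 3)"
            using R l(3) I' unfolding RI_def by (auto simp: s1_def)
          have Xs: "Xi i - Xi i div G = Xi (Suc i)" by (simp add: Xi_def)
          let ?s3 = "s2\<lparr>regs := (regs s2)(25 := Xi (Suc i), 5 := Suc i)\<rparr>"
          have b3: "base ?s3" by (rule base_regs[OF r2(1)]) auto
          have f: "regs s' 3 \<noteq> 0 \<Longrightarrow> regs s2 3 \<noteq> 0" using R unfolding RI_def by (simp add: s1_def)
          have t': "t \<le> 2441 * T1 * (TT K + TH + 13) + 1" using t by (simp add: algebra_simps)
          have "Inv (Suc i) ?s3"
            using b3 r2 h I'(8) f unfolding Inv_def by (auto simp: less_Suc_eq)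
          then show "wp M (Assign 25 (Reg 25 \<ominus> Div (Reg 25) (Reg 18)) ;; Assign 5 (Reg 5 \<oplus> Const 1))
            (\<lambda>t2 s'. Suc (1 + Suc (1 + Suc (1 + Suc (1 + Suc (t + t2))))) \<le> ?b \<and> Inv (Suc i) s') s2"
            using t' r2 base_r[OF r2(1)] iW Xs by (intro wp_intros) (simp_all add: Wm)
        qed
        show ?thesis using * br by (simp add: s1_def)
      qed
      done
  next
    fix s' assume "Inv GI s'"
    then show "eval_exp (word_mod M) (regs s') (Less (Reg 5) (Reg 19)) = 0"
      using base_r[of s'] unfolding Inv_def by (simp add: Wm)
  next
    show "Inv 0 (s\<lparr>regs := (regs s)(25 := eval_exp (word_mod M) (regs s) (Div (Reg 17) (Const 2)))\<rparr>
      \<lparr>regs := (regs (s\<lparr>regs := (regs s)(25 := eval_exp (word_mod M) (regs s) (Div (Reg 17) (Const 2)))\<rparr>))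
        (5 := eval_exp (word_mod M) (regs (s\<lparr>regs := (regs s)(25 := eval_exp (word_mod M) (regs s) (Div (Reg 17) (Const 2)))\<rparr>)) (Const 0))\<rparr>)"
      unfolding Inv_def using r K T1 s3 m2 base_r[OF b] b0 by (simp add: Wm valid_def)
  next
    fix t s' assume "t \<le> GI * (?b + 1) + 1" "Inv GI s'"
    moreover from this have "Suc (1 + Suc (1 + t)) \<le> GI * (2441 * T1 * (TT K + TH + 13) + 20) + 10"
      by (simp add: algebra_simps)
    ultimately show "Q (Suc (1 + Suc (1 + t))) s'" unfolding Inv_def by (intro Q) auto
  qed
qed

lemma Ts_ge1: "1 \<le> Ts r" by (simp add: Ts_def Suc_le_eq)

text \<open>The product \<open>N * r\<close> has to fit into a word for every
  \<open>r \<le> P\<close>; this is why the bound on \<open>W\<close> carries the factor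
  \<open>N\<close>.\<close>

lemma NP_W: "N * P + 4 * P < W"
proof -
  have "N * P + 4 * P \<le> N * P + N * (4 * P)" using nN n1 by simp
  also have "\<dots> = N * (5 * P)" by simp
  also have "\<dots> \<le> N * (P * P)" using P8 by simp
  also have "\<dots> < N * (P * P * P)" using P8 nN n1 by simp
  also have "\<dots> \<le> N * P ^ 16" using P_power_le[of 3 16] by (simp add: eval_nat_numeral)
  finally show ?thesis using NW by simp
qed

lemma Kr_W: "r \<le> P \<Longrightarrow> Kr r + 4 * P < W" "r \<le> P \<Longrightarrow> (N * r) mod W = N * r"
proof -
  assume "r \<le> P"
  then have "N * r \<le> N * P" by (rule mult_le_mono2)
  moreover have "Kr r \<le> N * r" by (simp add: Kr_def)
  ultimately have "Kr r + 4 * P < W" "N * r < W" using NP_W by linarith+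
  then show "Kr r + 4 * P < W" "(N * r) mod W = N * r" by simp_all
qed

abbreviation "level_loop \<equiv> While (Equal (Reg 3) (Const 0))
      (Assign 27 (Div (Reg 13 \<otimes> Reg 2) (Reg 10)) ;;
       If (Less (Reg 14) (Reg 4)) scan_com (probe_com ;; Assign 4 (Const 3 \<otimes> Reg 4)) ;;
       Assign 2 (Reg 2 \<oplus> Const 1))"

text \<open>Register 4 is tripled only while tables are probed. Afterwards it no longer equals
  \<open>Ts r\<close>, but both stay above \<open>P\<close>, which is all that the test
  compares.\<close>

lemma wp_level:
  assumes b: "base s" and r: "regs s 2 = r" "r \<le> P" and s3: "regs s 3 = 0"
    and T: "regs s 4 = Ts r \<or> P < regs s 4 \<and> P < Ts r"
    and Q: "\<And>t s'. t + 2 \<le> Cost r \<Longrightarrow> base s' \<Longrightarrow> valid (Kr r) (regs s' 3) \<Longrightarrow> lvl_ok r \<longrightarrow> regs s' 3 \<noteq> 0 \<Longrightarrow>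
      regs s' 2 = Suc r \<Longrightarrow> regs s' 4 = Ts (Suc r) \<or> P < regs s' 4 \<and> P < Ts (Suc r) \<Longrightarrow> Q t s'"
  shows "wp M (Assign 27 (Div (Reg 13 \<otimes> Reg 2) (Reg 10)) ;;
       If (Less (Reg 14) (Reg 4)) scan_com (probe_com ;; Assign 4 (Const 3 \<otimes> Reg 4)) ;;
       Assign 2 (Reg 2 \<oplus> Const 1)) Q s"
proof -
  note br = base_r[OF b]
  let ?s1 = "s\<lparr>regs := (regs s)(27 := Kr r)\<rparr>"
  have b1: "base ?s1" by (rule base_regs[OF b]) auto
  have ev: "eval_exp (word_mod M) (regs s) (Div (Reg 13 \<otimes> Reg 2) (Reg 10)) = Kr r"
    using br r Kr_W(2) by (simp add: Wm Kr_def)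
  have TS3: "Ts (Suc r) = 3 * Ts r" by (simp add: Ts_def)
  have rW: "Suc r mod W = Suc r" using r small_W(4) P8 by simp
  show ?thesis
  proof (cases "Ts r \<le> P")
    case True
    then have s4: "regs s 4 = Ts r" using T by simp
    have T3W: "(3 * Ts r) mod W = 3 * Ts r" using True small_W(4) by simp
    show ?thesis
      apply (rule wp_Seq, rule wp_Assign, unfold ev, rule wp_Seq, rule wp_If_False)
      subgoal using br s4 True by (simp add: Wm)
      apply (rule wp_Seq, rule wp_probe[OF b1, where r = r and ?T1.0 = "Ts r" and K = "Kr r"])
      subgoal using r by simp
      subgoal by (rule Ts_level[OF True])
      subgoal by simp
      subgoal by (rule Kr_W[OF r(2)])
      subgoal using s4 by simp
      subgoal by (rule Ts_ge1)
      subgoal by (rule True)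
      subgoal using s3 by simp
      subgoal premises p for t s2
      proof -
        let ?s3 = "s2\<lparr>regs := (regs s2)(4 := 3 * Ts r, 2 := Suc r)\<rparr>"
        have b3: "base ?s3" by (rule base_regs[OF p(2)]) auto
        have "lvl_ok r \<longrightarrow> regs s2 3 \<noteq> 0" using p(4) True unfolding lvl_ok_iff by auto
        then show ?thesis
          using p b3 T3W rW True TS3 by (intro wp_intros Q) (simp_all add: Wm Cost_def)
      qed
      done
  next
    case False
    then have s4: "P < regs s 4" using T by auto
    show ?thesis
      apply (rule wp_Seq, rule wp_Assign, unfold ev, rule wp_Seq, rule wp_If)
       prefer 2
      subgoal using br s4 by (simp add: Wm)
      apply (rule wp_scan[OF b1, where K = "Kr r"])
      subgoal by simp
      subgoal by (rule Kr_W[OF r(2)])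
      subgoal using s3 by simp
      subgoal premises p for t s2
      proof -
        let ?s3 = "s2\<lparr>regs := (regs s2)(2 := Suc r)\<rparr>"
        have b3: "base ?s3" by (rule base_regs[OF p(3)]) auto
        have "lvl_ok r \<longrightarrow> regs s2 3 \<noteq> 0" "valid (Kr r) (regs s2 3)"
          using p(5) False unfolding lvl_ok_iff valid_def by auto
        then show ?thesis
          using p b3 rW False TS3 s4 r by (intro wp_intros Q) (simp_all add: Wm Cost_def)
      qed
      done
  qed
qed

text \<open>\<open>R\<close> is any level known to succeed and only guarantees termination. The
  search may stop earlier, at a level \<open>R'\<close>, even if \<open>R'\<close> does not satisfy
  \<open>lvl_ok\<close>, which is sufficient for acceptance but not necessary.\<close>

lemma wp_levels:
  assumes "base s" "regs s 2 = r" "r \<le> R" "R \<le> P" "lvl_ok R" "regs s 3 = 0"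
    "regs s 4 = Ts r \<or> P < regs s 4 \<and> P < Ts r"
    "\<And>t s' R'. t \<le> (\<Sum>i\<in>{r..R'}. Cost i) \<Longrightarrow> r \<le> R' \<Longrightarrow> R' \<le> R \<Longrightarrow> \<forall>i\<in>{r..<R'}. \<not> lvl_ok i \<Longrightarrow> base s' \<Longrightarrow>
      \<exists>j<n. regs s' 3 = Suc j \<and> acc (Kr R') j \<Longrightarrow> Q t s'"
  shows "wp M level_loop Q s"
  using assms
proof (induction "R - r" arbitrary: r s Q rule: less_induct)
  case less
  note rR = less.prems(3) and Q = less.prems(8)
  show ?case
  proof (rule wp_While_step)
    show "eval_exp (word_mod M) (regs s) (Equal (Reg 3) (Const 0)) \<noteq> 0" using less.prems(6) by (simp add: Wm)
    have "r \<le> P" using rR less.prems(4) by simp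
    then show "wp M (Assign 27 (Div (Reg 13 \<otimes> Reg 2) (Reg 10)) ;;
       If (Less (Reg 14) (Reg 4)) scan_com (probe_com ;; Assign 4 (Const 3 \<otimes> Reg 4)) ;;
       Assign 2 (Reg 2 \<oplus> Const 1)) (\<lambda>t1. wp M level_loop (\<lambda>t2. Q (Suc (t1 + t2)))) s"
    proof (rule wp_level[OF less.prems(1,2) _ less.prems(6,7)])
      fix t s' assume s': "t + 2 \<le> Cost r" "base s'" "valid (Kr r) (regs s' 3)" "lvl_ok r \<longrightarrow> regs s' 3 \<noteq> 0"
        "regs s' 2 = Suc r" "regs s' 4 = Ts (Suc r) \<or> P < regs s' 4 \<and> P < Ts (Suc r)"
      show "wp M level_loop (\<lambda>t2. Q (Suc (t + t2))) s'"
      proof (cases "regs s' 3 = 0")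
        case False
        then have "\<exists>j<n. regs s' 3 = Suc j \<and> acc (Kr r) j" using s'(3) unfolding valid_def by auto
        then show ?thesis
          using s' False rR by (intro wp_While_end Q[of _ r]) (simp_all add: Wm)
      next
        case True
        then have nr: "\<not> lvl_ok r" using s' by simp
        then have "r < R" using rR less.prems(5) by (cases "r = R") auto
        then show ?thesis
        proof (intro less.hyps[of "Suc r" s'])
          fix u s2 R' assume A: "u \<le> (\<Sum>i\<in>{Suc r..R'}. Cost i)" "Suc r \<le> R'" "R' \<le> R" "\<forall>i\<in>{Suc r..<R'}. \<not> lvl_ok i"
            "base s2" "\<exists>j<n. regs s2 3 = Suc j \<and> acc (Kr R') j"
          have "(\<Sum>i\<in>{r..R'}. Cost i) = Cost r + (\<Sum>i\<in>{Suc r..R'}. Cost i)"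
            using A(2) by (intro sum.atLeast_Suc_atMost) auto
          moreover have "\<not> lvl_ok i" if "i \<in> {r..<R'}" for i using that A(4) nr by (cases "i = r") auto
          ultimately show "Q (Suc (t + u)) s2" using A s'(1) by (intro Q[of _ R']) auto
        qed (use s' True less.prems(4,5) in auto)
      qed
    qed
  qed
qed

theorem wp_query:
  assumes inp: "input M = length q # q" and R: "lvl_ok R" "R \<le> P" and D: "data s = D"
    and Q: "\<And>t s' R' j. t \<le> (\<Sum>i\<in>{0..R'}. Cost i) + 7 * d + 9 * L + 90 \<Longrightarrow> R' \<le> R \<Longrightarrow> \<forall>i<R'. \<not> lvl_ok i \<Longrightarrow>
      j < n \<Longrightarrow> acc (Kr R') j \<Longrightarrow> regs s' 0 = saddr j + 1 \<Longrightarrow> regs s' 1 = length (xs ! j) \<Longrightarrow> data s' = D \<Longrightarrow> Q t s'"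
  shows "wp M query_com Q s"
proof -
  have qW: "j \<le> length q \<Longrightarrow> j mod W = j" "j < length q \<Longrightarrow> Suc j mod W = Suc j" for j
    using q_len small_W(2) by auto
  have qc: "q ! j mod W = q ! j" if "j < length q" for j
    using q(2) that nth_mem[of j q] small_W(7) by (metis Suc_eq_plus1 less_SucI less_trans lessThan_iff mod_less subsetD)
  define I1 where "I1 j s' \<longleftrightarrow> data s' = D \<and> regs s' 26 = length q \<and> regs s' 5 = j \<and> (\<forall>i<j. work s' i = q ! i)"
    for j and s' :: store
  define I2 where "I2 j s' \<longleftrightarrow> base s' \<and> regs s' 7 = JJ \<and> regs s' 5 = j \<and> regs s' 4 = 2 ^ j" for j and s' :: store
  have copy: "wp M (While (Less (Reg 5) (Reg 26))
      (LoadInput 6 (Reg 5 \<oplus> Const 1) ;; StoreWork (Reg 5) (Reg 6) ;; Assign 5 (Reg 5 \<oplus> Const 1))) Q' s'"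
    if "I1 0 s'" "\<And>t s'. t \<le> length q * (5 + 1) + 1 \<Longrightarrow> I1 (length q) s' \<Longrightarrow> Q' t s'" for Q' s'
  proof (rule wp_for[where m = "length q" and I = I1 and b = 5])
    fix j s' assume j: "j < length q" and I: "I1 j s'"
    show "eval_exp (word_mod M) (regs s') (Less (Reg 5) (Reg 26)) \<noteq> 0" using I j by (simp add: I1_def Wm)
    have "j < work_cells M" using j q_len dc RB_TB_DS(4) by linarith
    then show "wp M (LoadInput 6 (Reg 5 \<oplus> Const 1) ;; StoreWork (Reg 5) (Reg 6) ;; Assign 5 (Reg 5 \<oplus> Const 1))
       (\<lambda>t s'. t \<le> 5 \<and> I1 (Suc j) s') s'"
      using I j qW(2)[OF j] qc[OF j] unfolding I1_def by (intro wp_intros) (auto simp: Wm inp less_Suc_eq)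
  next
    fix s' assume "I1 (length q) s'"
    then show "eval_exp (word_mod M) (regs s') (Less (Reg 5) (Reg 26)) = 0" by (simp add: I1_def Wm)
  qed (use that in auto)
  have J2: "(2::nat) ^ JJ \<le> 2 * P"
    using power_increasing[OF JJ_bounds(2), of "2::nat"] by (simp add: P_def)
  have pow: "wp M (While (Less (Reg 5) (Reg 7)) (Assign 4 (Const 2 \<otimes> Reg 4) ;; Assign 5 (Reg 5 \<oplus> Const 1))) Q' s'"
    if "I2 0 s'" "\<And>t s'. t \<le> JJ * (3 + 1) + 1 \<Longrightarrow> I2 JJ s' \<Longrightarrow> Q' t s'" for Q' s'
  proof (rule wp_for[where m = JJ and I = I2 and b = 3])
    fix j s' assume j: "j < JJ" and I: "I2 j s'"
    show "eval_exp (word_mod M) (regs s') (Less (Reg 5) (Reg 7)) \<noteq> 0" using I j by (simp add: I2_def Wm)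
    have "(2::nat) * 2 ^ j \<le> 2 ^ JJ" using power_increasing[of "Suc j" JJ "2::nat"] j by simp
    then have "(2 * 2 ^ j) mod W = 2 * 2 ^ j" "Suc j mod W = Suc j" using J2 j JJ_bounds(2) small_W(3,4) by auto
    then show "wp M (Assign 4 (Const 2 \<otimes> Reg 4) ;; Assign 5 (Reg 5 \<oplus> Const 1)) (\<lambda>t s'. t \<le> 3 \<and> I2 (Suc j) s') s'"
      using I unfolding I2_def by (intro wp_intros) (auto simp: Wm intro!: base_regs)
  next
    fix s' assume "I2 JJ s'"
    then show "eval_exp (word_mod M) (regs s') (Less (Reg 5) (Reg 7)) = 0" by (simp add: I2_def Wm)
  qed (use that in auto)
  have D03: "D 0 = n" "D 1 = d" "D 2 = sg" "D 3 = N" using wfD unfolding wf_def by auto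
  have JW: "(L * n) mod W = L * n" "Suc (L * n div N) mod W = Suc (L * n div N)"
  proof -
    have "L * n \<le> P * P" using L_less P_ge by (intro mult_mono) auto
    then show "(L * n) mod W = L * n" using P_power_lt_W[of 2] by (simp add: power2_eq_square)
    show "Suc (L * n div N) mod W = Suc (L * n div N)" using JJ_bounds(2) small_W(3) by (simp add: JJ_def)
  qed
  show ?thesis
    unfolding query_com_def
    apply (rule wp_Seq, rule wp_LoadInput)
    subgoal by (simp add: Wm inp)
    apply (rule wp_Seq, rule wp_Assign, rule wp_Seq, rule copy)
    subgoal using D qW(1)[of "length q"] by (simp add: I1_def Wm inp)
    apply (rule wp_Seq, rule wp_params[OF M])
    subgoal using D03 by (simp add: I1_def)
    subgoal using D03 by (simp add: I1_def)
    subgoal using D03 by (simp add: I1_def)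
    subgoal using D03 by (simp add: I1_def)
    subgoal premises p for t s1 t2 s2
    proof -
      have b: "base s2" using p(2,4-7) unfolding base_def I1_def by simp
      note br = base_r[OF b]
      have t: "t + t2 \<le> 6 * d + 1 + 5 * L + 40" using p(1,3) q by simp
      show ?thesis
        apply (rule wp_Seq, rule wp_Assign, rule wp_Seq, rule wp_Assign, rule wp_Seq, rule wp_Assign, rule wp_Seq, rule pow)
        subgoal using br JW base_regs[OF b] unfolding I2_def by (simp add: Wm JJ_def[symmetric]) (simp add: JJ_def)
        apply (rule wp_Seq, rule wp_Assign, rule wp_Seq, rule wp_Assign, rule wp_Seq)
        subgoal premises p2 for t3 s3
        proof -
          let ?s4 = "s3\<lparr>regs := (regs s3)(2 := 0, 3 := 0)\<rparr>"
          have b3: "base s3" using p2 unfolding I2_def by simp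
          have b4: "base ?s4" by (rule base_regs[OF b3]) auto
          have e: "s3\<lparr>regs := (regs s3)(2 := eval_exp (word_mod M) (regs s3) (Const 0))\<rparr>
            \<lparr>regs := (regs (s3\<lparr>regs := (regs s3)(2 := eval_exp (word_mod M) (regs s3) (Const 0))\<rparr>))
              (3 := eval_exp (word_mod M) (regs (s3\<lparr>regs := (regs s3)(2 := eval_exp (word_mod M) (regs s3) (Const 0))\<rparr>)) (Const 0))\<rparr> = ?s4"
            by simp
          show ?thesis unfolding e
          proof (rule wp_levels[OF b4 _ _ R(2,1)])
            show "regs ?s4 4 = Ts 0 \<or> P < regs ?s4 4 \<and> P < Ts 0" using p2 unfolding I2_def by (simp add: Ts_def)
            fix u s5 R' assume A: "u \<le> (\<Sum>i\<in>{0..R'}. Cost i)" "R' \<le> R" "\<forall>i\<in>{0..<R'}. \<not> lvl_ok i" "base s5"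
              "\<exists>j<n. regs s5 3 = Suc j \<and> acc (Kr R') j"
            then obtain j where j: "j < n" "regs s5 3 = Suc j" "acc (Kr R') j" by auto
            have sa: "saddr j + 1 < RB" using saddr_bounds[OF j(1), of 1] P8 by simp
            then have sW: "saddr j + 1 < W" "saddr j < data_cells M" using RB_TB_DS DS_W dc by linarith+
            have ev: "eval_exp W (regs s5) (Const 5 \<oplus> (Reg 3 \<ominus> Const 1) \<otimes> Reg 14) = saddr j + 1"
              "eval_exp W ((regs s5)(0 := v)) (Const 4 \<oplus> (Reg 3 \<ominus> Const 1) \<otimes> Reg 14) = saddr j" for v
              using sW j base_r[OF A(4)] by (simp_all add: mod_simps saddr_def)
            have len: "D (saddr j) = length (xs ! j)" using wfD j(1) unfolding wf_def by blast
            have tt: "t3 \<le> 4 * L + 5" using p2(1) JJ_bounds(2) by simp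
            show "wp M (Assign 0 (Const 5 \<oplus> (Reg 3 \<ominus> Const 1) \<otimes> Reg 14) ;; LoadData 1 (Const 4 \<oplus> (Reg 3 \<ominus> Const 1) \<otimes> Reg 14))
              (\<lambda>ta. Q (Suc (1 + Suc (1 + Suc (t + Suc (t2 + Suc (1 + Suc (1 + Suc (1 + Suc (t3 + Suc (1 + Suc (1 + Suc (u + ta))))))))))))) s5"
              apply (rule wp_Seq, rule wp_Assign, rule wp_LoadData)
              subgoal using sW ev by (simp del: eval_exp.simps add: Wm)
              subgoal
                apply (rule Q[OF _ A(2) _ j(1,3)])
                subgoal using A(1) t tt by simp
                subgoal using A(3) by simp
                using ev len base_r(10)[OF A(4)] by (simp_all del: eval_exp.simps add: Wm)
              done
          qed auto
        qed
        done
    qed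
    done
qed

end

section \<open>The preprocessing program\<close>

definition strings_com :: com where
  "strings_com =
    (Assign 2 (Const 4) ;; Assign 3 (Const 0) ;;
     While (Less (Reg 3) (Reg 10))
      (LoadInput 4 (Reg 2) ;; StoreData (Const 4 \<oplus> Reg 3 \<otimes> Reg 14) (Reg 4) ;; Assign 2 (Reg 2 \<oplus> Const 1) ;;
       Assign 5 (Const 0) ;;
       While (Less (Reg 5) (Reg 4))
        (LoadInput 6 (Reg 2) ;; StoreData ((Const 5 \<oplus> Reg 3 \<otimes> Reg 14) \<oplus> Reg 5) (Reg 6) ;;
         Assign 2 (Reg 2 \<oplus> Const 1) ;; Assign 5 (Reg 5 \<oplus> Const 1)) ;;
       Assign 3 (Reg 3 \<oplus> Const 1)))"

text \<open>Register 3 is cleared after each draw, so the random words survive in the data cells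
  only and the final registers are deterministic.\<close>

definition random_loop :: com where
  "random_loop =
     While (Less (Reg 2) (Reg 22))
      (Rand 3 (Reg 17) ;; StoreData (Reg 2) (Reg 3) ;; Assign 3 (Const 0) ;; Assign 2 (Reg 2 \<oplus> Const 1))"

definition insert_com :: com where
  "insert_com =
    (LoadData 26 (Const 4 \<oplus> Reg 2 \<otimes> Reg 14) ;; Assign 3 (Const 0) ;;
     While (Less (Reg 3) (Reg 26))
      (LoadData 4 ((Const 5 \<oplus> Reg 2 \<otimes> Reg 14) \<oplus> Reg 3) ;; StoreWork (Reg 3) (Reg 4) ;; Assign 3 (Reg 3 \<oplus> Const 1)) ;;
     hash_com ;; LoadData 4 (tab_exp (Reg 30)) ;;
     StoreData (tab_exp (Reg 14 \<oplus> Reg 2)) (Reg 4) ;; StoreData (tab_exp (Reg 30)) (Reg 2))"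

text \<open>Each insertion puts its string at the head of its bucket. Inserting in decreasing order
  of indices makes the buckets increasing, as \<open>nx\<close> demands.\<close>

definition table_com :: com where
  "table_com =
    (Assign 2 (Const 0) ;;
     While (Less (Reg 2) (Reg 14)) (StoreData (tab_exp (Reg 2)) (Reg 10) ;; Assign 2 (Reg 2 \<oplus> Const 1)) ;;
     Assign 2 (Reg 10) ;;
     While (Reg 2) (Assign 2 (Reg 2 \<ominus> Const 1) ;; insert_com))"

definition tables_com :: com where
  "tables_com =
    (Assign 23 (Const 0) ;;
     While (Less (Reg 23) (Reg 20))
      (If (Equal (Mod (Reg 23) (Reg 19)) (Const 0)) (Assign 25 (Div (Reg 17) (Const 2)))
         (Assign 25 (Reg 25 \<ominus> Div (Reg 25) (Reg 18))) ;;
       Assign 24 (Const 0) ;;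
       While (Less (Reg 24) (Const 64 \<otimes> Reg 14)) (table_com ;; Assign 24 (Reg 24 \<oplus> Const 1)) ;;
       Assign 23 (Reg 23 \<oplus> Const 1)))"

definition prefix_com :: com where
  "prefix_com =
    (LoadInput 2 (Const 0) ;; StoreData (Const 0) (Reg 2) ;; LoadInput 2 (Const 1) ;; StoreData (Const 1) (Reg 2) ;;
     LoadInput 2 (Const 2) ;; StoreData (Const 2) (Reg 2) ;; LoadInput 2 (Const 3) ;; StoreData (Const 3) (Reg 2) ;;
     params_com ;; strings_com ;; Assign 2 (Reg 21) ;; Assign 3 (Const 0))"

definition build_com :: com where
  "build_com = (prefix_com ;; random_loop ;; tables_com)"

text \<open>A variant of \<open>wp_for\<close> without a time bound: preprocessing only has to
  halt.\<close>

lemma wp_loop: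
  assumes body: "\<And>k s. k < m \<Longrightarrow> I k s \<Longrightarrow> eval_exp (word_mod M) (regs s) e \<noteq> 0"
    "\<And>k s. k < m \<Longrightarrow> I k s \<Longrightarrow> wp M c (\<lambda>t s'. I (Suc k) s') s"
    and exit: "\<And>s. I m s \<Longrightarrow> eval_exp (word_mod M) (regs s) e = 0"
    and start: "I 0 s" and Q: "\<And>t s'. I m s' \<Longrightarrow> Q t s'"
  shows "wp M (While e c) Q s"
proof -
  have "k \<le> m \<Longrightarrow> I k s \<Longrightarrow> wp M (While e c) (\<lambda>t s'. I m s') s" for k
  proof (induction "m - k" arbitrary: k s)
    case 0
    then show ?case using exit by (intro wp_While_end) auto
  next
    case (Suc j)
    then have k: "k < m" by simp
    show ?case
      by (rule wp_While_step[OF body(1)[OF k Suc.prems(2)]], rule wp_mono[OF body(2)[OF k Suc.prems(2)]])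
        (use Suc(1)[of "Suc k"] Suc(2) k in simp)
  qed
  from this[of 0] show ?thesis using start Q by (auto intro: wp_mono)
qed

context ann
begin

lemma nx_step: "i < n \<Longrightarrow> nx g f i = (if g i = f then i else nx g f (Suc i))" and nx_n: "nx g f n = n"
proof -
  assume i: "i < n"
  note a = nx[where i = i and g = g and f = f] and b = nx[where i = "Suc i" and g = g and f = f]
  show "nx g f i = (if g i = f then i else nx g f (Suc i))"
  proof (cases "g i = f")
    case True
    then have "\<not> i < nx g f i" using a(4)[where j = i] i by auto
    then show ?thesis using a(1) i True by simp
  next
    case False
    then have "nx g f i \<noteq> i" using a(3) i by auto
    then have 1: "Suc i \<le> nx g f i" using a(1) i by simp
    have "\<not> nx g f (Suc i) < nx g f i" using a(4)[where j = "nx g f (Suc i)"] b i a(2) by auto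
    moreover have "\<not> nx g f i < nx g f (Suc i)" using b(4)[where j = "nx g f i"] b(2) a 1 i by auto
    ultimately show ?thesis using False by simp
  qed
next
  show "nx g f n = n" using nx[where i = n and g = g and f = f] by simp
qed

lemma outs_bounds: "set x \<subseteq> {..<e} \<Longrightarrow> (j, a) \<in> set (outs w X e k x) \<Longrightarrow> j < k \<and> a \<le> Suc e"
proof (induction k arbitrary: x)
  case (Suc k)
  then show ?case
    using hd0_le[of x e] set_tl_subset[of x "{..<e}"] by (fastforce simp: Let_def split: if_splits)
qed simp

text \<open>A fingerprint reads only the random cells of its own threshold. This serves both to show
  that writing tables leaves fingerprints unchanged and to make the levels independent.\<close>

lemma fpt_cong_rnd:
  assumes "\<And>b k a. b < L + 7 \<Longrightarrow> k < 16 * P \<Longrightarrow> a < P \<Longrightarrow> D (rnd l b k a) = D' (rnd l b k a)" "set x \<subseteq> {..<sg}"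
  shows "fpt D l t x = fpt D' l t x" "hsum D l t X H x = hsum D' l t X H x"
proof -
  have w: "lett D l t k a = lett D' l t k a" if "k < H" "a \<le> sg" for k a
  proof -
    have "D (rnd l b k a) = D' (rnd l b k a)" if "b < L + 6" for b
      using that \<open>k < H\<close> \<open>a \<le> sg\<close> H_less P_ge by (intro assms(1)) auto
    then show ?thesis unfolding lett_def by simp
  qed
  have o: "outs (lett D l t) X sg H x = outs (lett D' l t) X sg H x" for X
    by (rule outs_cong) (use w assms in auto)
  show *: "hsum D l t X H x = hsum D' l t X H x" for X
    unfolding hsum_def o
  proof (intro arg_cong[where f = sum_list] map_cong refl, clarify)
    fix j a assume "(j, a) \<in> set (outs (lett D' l t) X sg H x)"
    then have "j < H" "a \<le> Suc sg" using outs_bounds[OF assms(2)] by auto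
    then show "D (rnd l (L + 6) j a) = D' (rnd l (L + 6) j a)"
      using H_less P_ge by (intro assms(1)) auto
  qed
  show "fpt D l t x = fpt D' l t x" unfolding fpt_def * ..
qed

lemma fpt_cong:
  assumes "\<And>a. RB \<le> a \<Longrightarrow> a < TB \<Longrightarrow> D a = D' a" "l < NL" "set x \<subseteq> {..<sg}"
  shows "fpt D l t x = fpt D' l t x" "hsum D l t X H x = hsum D' l t X H x"
  by (rule fpt_cong_rnd[OF assms(1)]; (rule rnd_bounds)?; use assms in simp)+

end

section \<open>Copying the strings and drawing the random cells\<close>

locale ann_build = ann +
  fixes M :: machine and xs :: "nat list list"
  assumes M: "mach M" "data_writable M" and inp: "input M = [n, d, sg, N] @ concat (map encode_string xs)"
    and xs: "length xs = n" "\<And>i. i < n \<Longrightarrow> length (xs ! i) \<le> d \<and> set (xs ! i) \<subseteq> {..<sg}"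
begin

lemma Wm: "word_mod M = W" and dc: "DS \<le> data_cells M" "DS \<le> work_cells M" using M by (auto simp: mach_def)

definition "pos i = 4 + length (concat (map encode_string (take i xs)))"

lemma pos_0: "pos 0 = 4" by (simp add: pos_def)

lemma pos_Suc: "i < n \<Longrightarrow> pos (Suc i) = pos i + 1 + length (xs ! i)"
  using xs by (simp add: pos_def take_Suc_conv_app_nth encode_string_def)

lemma pos_le: "i \<le> n \<Longrightarrow> pos i \<le> 4 + i * (d + 1)"
proof (induction i)
  case (Suc i)
  then show ?case using pos_Suc[of i] xs(2)[of i] by simp
qed (simp add: pos_0)

lemma input_nth:
  assumes "i < n"
  shows "input M ! pos i = length (xs ! i)" "j < length (xs ! i) \<Longrightarrow> input M ! (pos i + 1 + j) = xs ! i ! j"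
    "j < length (xs ! i) \<Longrightarrow> pos i + 1 + j < length (input M)" "pos i < length (input M)"
proof -
  let ?A = "[n, d, sg, N] @ concat (map encode_string (take i xs))"
  let ?B = "concat (map encode_string (drop (Suc i) xs))"
  have "xs = take i xs @ xs ! i # drop (Suc i) xs" using assms xs by (simp add: id_take_nth_drop)
  then have "concat (map encode_string xs) = concat (map encode_string (take i xs @ xs ! i # drop (Suc i) xs))" by simp
  then have e: "input M = ?A @ (length (xs ! i) # xs ! i) @ ?B"
    unfolding inp by (simp add: encode_string_def)
  have p: "pos i = length ?A" by (simp add: pos_def)
  show "input M ! pos i = length (xs ! i)" "pos i < length (input M)"
    unfolding e p nth_append_length_plus by (simp_all add: nth_append)
  show "j < length (xs ! i) \<Longrightarrow> input M ! (pos i + 1 + j) = xs ! i ! j"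
    "j < length (xs ! i) \<Longrightarrow> pos i + 1 + j < length (input M)"
    unfolding e p by (simp_all add: nth_append)
qed

lemma pos_W: "i < n \<Longrightarrow> j \<le> length (xs ! i) \<Longrightarrow> pos i + 1 + j < W"
proof -
  assume i: "i < n" "j \<le> length (xs ! i)"
  have "pos i + 1 + j \<le> 5 + i * (d + 1) + d" using pos_le[of i] i xs(2)[of i] by simp
  also have "\<dots> \<le> 5 + P * P + P" using P_ge i by (intro add_mono mult_mono) auto
  also have "\<dots> \<le> P * P * P"
    using P8 mult_le_mono1[of 8 P "P * P"] mult_le_mono1[of 8 P P] unfolding mult.assoc by linarith
  also have "\<dots> < W" using P_power_lt_W[of 3] by (simp add: eval_nat_numeral)
  finally show ?thesis .
qed

definition "strok D i \<longleftrightarrow> D (saddr i) = length (xs ! i) \<and> (\<forall>j<length (xs ! i). D (saddr i + 1 + j) = xs ! i ! j)"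

lemma str_len: "i < n \<Longrightarrow> length (xs ! i) + 4 < P" using xs(2)[of i] P_ge n1 by auto

lemma saddr_less: "i' < i \<Longrightarrow> k' < P \<Longrightarrow> saddr i' + k' < saddr i"
proof -
  assume "i' < i" "k' < P"
  then have "i' * P + k' < Suc i' * P" by simp
  also have "\<dots> \<le> i * P" using \<open>i' < i\<close> by (intro mult_right_mono) auto
  finally show ?thesis by (simp add: saddr_def)
qed

lemma strok_upd: "strok D i' \<Longrightarrow> i' < i \<Longrightarrow> i' < n \<Longrightarrow> strok (D(saddr i + k := v)) i'"
proof -
  assume D: "strok D i'" "i' < i" "i' < n"
  have "saddr i' + k' \<noteq> saddr i + k" if "k' < P" for k'
    using saddr_less[OF D(2) that] by simp
  from this[of 0] this[of "1 + j" for j]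
  show ?thesis using D(1) str_len[OF D(3)] P8 unfolding strok_def by (auto simp: add.assoc)
qed

lemma wp_strings:
  assumes s: "en s"
    and Q: "\<And>t s'. \<forall>i<n. strok (data s') i \<Longrightarrow> \<forall>a<4. data s' a = data s a \<Longrightarrow> \<forall>r\<ge>10. regs s' r = regs s r \<Longrightarrow>
      work s' = work s \<Longrightarrow> Q t s'"
  shows "wp M strings_com Q s"
proof -
  define fr where "fr s' \<longleftrightarrow> (\<forall>a<4. data s' a = data s a) \<and> (\<forall>r\<ge>10. regs s' r = regs s r) \<and> work s' = work s" for s' :: store
  define Inv where "Inv i s' \<longleftrightarrow> fr s' \<and> regs s' 3 = i \<and> regs s' 2 = pos i \<and> (\<forall>i'<i. strok (data s') i')" for i s'
  have r: "regs s' 10 = n" "regs s' 14 = P" if "fr s'" for s' using s that unfolding fr_def env_def by auto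
  show ?thesis
    unfolding strings_com_def
  proof (rule wp_Seq, rule wp_Assign, rule wp_Seq, rule wp_Assign, rule wp_loop[where m = n and I = Inv])
    fix i s1 assume i: "i < n" and I: "Inv i s1"
    then have f1: "fr s1" "regs s1 3 = i" "regs s1 2 = pos i" "\<forall>i'<i. strok (data s1) i'" unfolding Inv_def by auto
    show "eval_exp (word_mod M) (regs s1) (Less (Reg 3) (Reg 10)) \<noteq> 0" using i f1 r by (simp add: Wm)
    note len = str_len[OF i]
    have sb: "saddr i + k < data_cells M" "(4 + (i * P + k)) mod W = saddr i + k" "4 \<le> saddr i + k" if "k < P" for k
      using saddr_bounds[OF i that] RB_TB_DS dc DS_W by (auto simp: saddr_def)
    have ev1: "eval_exp W \<rho> (Const 4 \<oplus> Reg 3 \<otimes> Reg 14) = saddr i" if "\<rho> 3 = i" "\<rho> 14 = P" for \<rho>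
      using sb(2)[of 0] P8 that by (simp add: mod_simps)
    have ev2: "eval_exp W \<rho> ((Const 5 \<oplus> Reg 3 \<otimes> Reg 14) \<oplus> Reg 5) = saddr i + 1 + j"
      if "\<rho> 3 = i" "\<rho> 14 = P" "\<rho> 5 = j" "j < length (xs ! i)" for \<rho> j
      using sb(2)[of "Suc j"] len that by (simp add: mod_simps ac_simps)
    have lW: "length (xs ! i) mod W = length (xs ! i)" using len small_W(2) by simp
    have iW: "Suc i mod W = Suc i" using i P_ge small_W(2) by simp
    have pW: "Suc (pos i + j) mod W = Suc (pos i + j)" if "j \<le> length (xs ! i)" for j using pos_W[OF i that] by simp
    define In where "In j s' \<longleftrightarrow> fr s' \<and> regs s' 3 = i \<and> regs s' 2 = pos i + 1 + j \<and> regs s' 4 = length (xs ! i) \<and> regs s' 5 = j \<and>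
      (\<forall>i'<i. strok (data s') i') \<and> data s' (saddr i) = length (xs ! i) \<and> (\<forall>j'<j. data s' (saddr i + 1 + j') = xs ! i ! j')"
      for j and s' :: store
    have fr_upd: "fr s' \<Longrightarrow> (\<forall>r\<ge>10. f r = regs s' r) \<Longrightarrow> fr (s'\<lparr>regs := f\<rparr>)" for s' f by (simp add: fr_def)
    have fr_upd2: "fr s' \<Longrightarrow> 4 \<le> a \<Longrightarrow> (\<forall>r\<ge>10. f r = regs s' r) \<Longrightarrow> fr (s'\<lparr>data := (data s')(a := v), regs := f\<rparr>)" for s' a v f
      by (auto simp: fr_def)
    have st: "(\<forall>i'<i. strok (D(saddr i + k := v)) i')" if "\<forall>i'<i. strok D i'" for D k v
      using that strok_upd i by auto
    have st0: "(\<forall>i'<i. strok (D(saddr i := v)) i')" if "\<forall>i'<i. strok D i'" for D v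
      using st[OF that, of 0 v] by simp
    show "wp M (LoadInput 4 (Reg 2) ;; StoreData (Const 4 \<oplus> Reg 3 \<otimes> Reg 14) (Reg 4) ;; Assign 2 (Reg 2 \<oplus> Const 1) ;;
       Assign 5 (Const 0) ;;
       While (Less (Reg 5) (Reg 4))
        (LoadInput 6 (Reg 2) ;; StoreData ((Const 5 \<oplus> Reg 3 \<otimes> Reg 14) \<oplus> Reg 5) (Reg 6) ;;
         Assign 2 (Reg 2 \<oplus> Const 1) ;; Assign 5 (Reg 5 \<oplus> Const 1)) ;;
       Assign 3 (Reg 3 \<oplus> Const 1)) (\<lambda>t. Inv (Suc i)) s1"
      apply (rule wp_Seq, rule wp_LoadInput)
      subgoal using input_nth(4)[OF i] f1 by simp
      apply (rule wp_Seq, rule wp_StoreData)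
      subgoal using sb(1)[of 0] P8 f1 r(2)[OF f1(1)] by (simp del: eval_exp.simps(3) add: Wm ev1)
      subgoal by (rule M)
      apply (rule wp_Seq, rule wp_Assign, rule wp_Seq, rule wp_Assign, rule wp_Seq)
      apply (rule wp_loop[where m = "length (xs ! i)" and I = In])
      subgoal by (simp add: In_def Wm)
      subgoal premises p for j s2
      proof -
        have I2: "fr s2" "regs s2 3 = i" "regs s2 2 = pos i + 1 + j" "regs s2 4 = length (xs ! i)" "regs s2 5 = j"
          "\<forall>i'<i. strok (data s2) i'" "data s2 (saddr i) = length (xs ! i)" "\<forall>j'<j. data s2 (saddr i + 1 + j') = xs ! i ! j'"
          using p(2) unfolding In_def by auto
        have v: "xs ! i ! j mod W = xs ! i ! j"
        proof -
          have "xs ! i ! j < sg" using xs(2)[OF i] nth_mem[OF p(1)] by auto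
          then show ?thesis using small_W(7) by simp
        qed
        have jW: "Suc j mod W = Suc j" "Suc (pos i + Suc j) mod W = Suc (pos i + Suc j)"
          using pW[of "Suc j"] p(1) len small_W(2) by auto
        have ev: "eval_exp W (regs s2) ((Const 5 \<oplus> Reg 3 \<otimes> Reg 14) \<oplus> Reg 5) = saddr i + 1 + j"
          "eval_exp W ((regs s2)(6 := z)) ((Const 5 \<oplus> Reg 3 \<otimes> Reg 14) \<oplus> Reg 5) = saddr i + 1 + j" for z
          using ev2 I2 r(2)[OF I2(1)] p(1) by simp_all
        let ?s3 = "s2\<lparr>data := (data s2)(saddr i + 1 + j := xs ! i ! j), regs := (regs s2)(6 := xs ! i ! j, 2 := Suc (pos i + Suc j), 5 := Suc j)\<rparr>"
        have "fr ?s3" using I2(1) sb(3)[of "Suc j"] len p(1) by (auto simp: fr_def)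
        then have "In (Suc j) ?s3"
          using I2 st[OF I2(6), of "1 + j"] unfolding In_def by (auto simp: less_Suc_eq add.assoc)
        then show ?thesis
          apply (intro wp_Seq wp_LoadInput wp_StoreData wp_Assign M)
          subgoal using input_nth(3)[OF i p(1)] I2 by simp
          subgoal using sb(1)[of "Suc j"] len p(1) by (simp del: eval_exp.simps add: Wm ev)
          subgoal using I2 input_nth(2)[OF i p(1)] v jW ev by (simp del: eval_exp.simps(3) add: Wm eval_exp.simps(3)[of W _ "Reg _" "Const _"])
          done
      qed
      subgoal by (simp add: In_def Wm)
      subgoal
        using f1 input_nth(1)[OF i] lW pW[of 0] ev1 r(2)[OF f1(1)] st0[OF f1(4)] sb(3)[of 0] P8 fr_upd2[OF f1(1)]
        unfolding In_def by (simp del: eval_exp.simps(3) add: Wm eval_exp.simps(3)[of W _ "Reg _" "Const _"])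
      subgoal premises p for t s2
      proof (rule wp_Assign)
        have "strok (data s2) i" using p unfolding In_def strok_def by auto
        then show "Inv (Suc i) (s2\<lparr>regs := (regs s2)(3 := eval_exp (word_mod M) (regs s2) (Reg 3 \<oplus> Const 1))\<rparr>)"
          using p iW pos_Suc[OF i] fr_upd[of s2] unfolding Inv_def In_def by (auto simp: Wm less_Suc_eq)
      qed
      done
  next
    fix s' assume "Inv n s'"
    then show "eval_exp (word_mod M) (regs s') (Less (Reg 3) (Reg 10)) = 0" using r(1)[of s'] by (simp add: Inv_def Wm)
  next
    fix t s' assume "Inv n s'"
    then show "Q (Suc (1 + Suc (1 + t))) s'" unfolding Inv_def fr_def by (intro Q) auto
  qed (simp add: Inv_def fr_def pos_0 Wm)
qed

text \<open>The only probabilistic computation: one iteration draws cell \<open>a\<close>, and the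
  uniform distribution on \<open>{a..<TB}\<close> is that of one cell followed by the one on the
  remaining cells.\<close>

lemma run_random:
  assumes "regs s 2 = a" "a \<le> TB" "RB \<le> a" "regs s 22 = TB" "regs s 17 = m" "regs s 3 = 0"
  shows "run M (8 * (TB - a) + 1) (random_loop # cs, s) =
    map_pmf (\<lambda>w. (cs, s\<lparr>regs := (regs s)(2 := TB), data := (\<lambda>i. if a \<le> i \<and> i < TB then w i else data s i)\<rparr>)) (unif {a..<TB} m)"
  using assms
proof (induction "TB - a" arbitrary: a s)
  case 0
  then have "a = TB" by simp
  then have "s\<lparr>regs := (regs s)(2 := TB), data := (\<lambda>i. if a \<le> i \<and> i < TB then w i else data s i)\<rparr> = s" for w
  proof -
    have "(\<lambda>i. if a \<le> i \<and> i < TB then w i else data s i) = data s" using \<open>a = TB\<close> by auto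
    moreover have "(regs s)(2 := TB) = regs s" using 0(2) \<open>a = TB\<close> by auto
    ultimately show ?thesis by simp
  qed
  moreover have "unif {a..<TB} m = return_pmf (\<lambda>_. 0)" using \<open>a = TB\<close> by (simp add: unif_def)
  moreover have "run M (8 * (TB - a) + 1) (random_loop # cs, s) = return_pmf (cs, s)"
    using 0 \<open>a = TB\<close> by (simp add: random_loop_def bind_return_pmf Wm)
  ultimately show ?case by (simp only: map_return_pmf)
next
  case (Suc k)
  then have a: "a < TB" by simp
  have aW: "Suc a mod W = Suc a" using a RB_TB_DS DS_W by simp
  have ad: "a < data_cells M" using a RB_TB_DS dc by linarith
  define sv where "sv v = s\<lparr>data := (data s)(a := v), regs := (regs s)(2 := Suc a)\<rparr>" for v
  have m0': "m \<noteq> 0" using m0 by simp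
  have s3: "(regs s)(3 := v, 3 := 0, 2 := z) = (regs s)(2 := z)" for v z
    using Suc.prems(6) by auto
  \<comment> \<open>An iteration takes eight steps: the loop test, three sequencing steps and four
    elementary commands.\<close>
  have "run M 8 (random_loop # cs, s) = map_pmf (\<lambda>v. (random_loop # cs, sv v)) (pmf_of_set {..<m})"
    using Suc.prems a ad m0' M(2) aW s3
    by (simp add: eval_nat_numeral random_loop_def bind_return_pmf bind_map_pmf Wm sv_def map_pmf_def bind_assoc_pmf
        fun_upd_idem fun_upd_twist)
  then have "run M (8 + (8 * (TB - Suc a) + 1)) (random_loop # cs, s) =
      bind_pmf (pmf_of_set {..<m}) (\<lambda>v. run M (8 * (TB - Suc a) + 1) (random_loop # cs, sv v))"
    by (simp only: run_add[of M 8] bind_map_pmf)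
  also have "\<dots> = bind_pmf (pmf_of_set {..<m}) (\<lambda>v. map_pmf (\<lambda>w. (cs, (sv v)\<lparr>regs := (regs (sv v))(2 := TB),
      data := (\<lambda>i. if Suc a \<le> i \<and> i < TB then w i else data (sv v) i)\<rparr>)) (unif {Suc a..<TB} m))"
    using Suc by (intro bind_pmf_cong refl Suc.hyps) (auto simp: sv_def)
  also have "\<dots> = bind_pmf (pmf_of_set {..<m}) (\<lambda>v. map_pmf (\<lambda>w. (cs, s\<lparr>regs := (regs s)(2 := TB),
      data := (\<lambda>i. if a \<le> i \<and> i < TB then (w(a := v)) i else data s i)\<rparr>)) (unif {Suc a..<TB} m))"
  proof -
    have "(\<lambda>i. if Suc a \<le> i \<and> i < TB then w i else data (sv v) i) = (\<lambda>i. if a \<le> i \<and> i < TB then (w(a := v)) i else data s i)" for w v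
      using a by (auto simp: sv_def)
    then show ?thesis by (simp add: sv_def)
  qed
  also have "\<dots> = map_pmf (\<lambda>w. (cs, s\<lparr>regs := (regs s)(2 := TB), data := (\<lambda>i. if a \<le> i \<and> i < TB then w i else data s i)\<rparr>)) (unif {a..<TB} m)"
  proof -
    have i: "insert a {Suc a..<TB} = {a..<TB}" using a by auto
    have "unif {a..<TB} m = bind_pmf (pmf_of_set {..<m}) (\<lambda>y. map_pmf (\<lambda>f. f(a := y)) (unif {Suc a..<TB} m))"
      using Pi_pmf_insert'[of "{Suc a..<TB}" a 0 "\<lambda>_. pmf_of_set {..<m}"] unfolding i unif_def by (simp add: map_pmf_def)
    then show ?thesis by (simp add: map_bind_pmf map_pmf_comp o_def)
  qed
  also have "8 + (8 * (TB - Suc a) + 1) = 8 * (TB - a) + 1" using a by simp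
  finally show ?case .
qed

end

section \<open>Filling the tables for fixed random cells\<close>

locale ann_tables = ann_build +
  fixes D0 :: "nat \<Rightarrow> nat"
  assumes D0: "\<And>i. i < n \<Longrightarrow> strok D0 i" "\<And>a. RB \<le> a \<Longrightarrow> a < TB \<Longrightarrow> D0 a < m"
begin

definition "F l t j = fpt D0 l t (xs ! j)"
text \<open>The state of a table once the strings with index at least \<open>i\<close> have been
  inserted: heads search from \<open>i\<close> on, and links exist for these indices only.\<close>

definition "tabok D l t i \<longleftrightarrow> (\<forall>f<P. D (tab l t f) = nx (F l t) f i) \<and>
  (\<forall>j. i \<le> j \<and> j < n \<longrightarrow> D (tab l t (P + j)) = nx (F l t) (F l t j) (Suc j))"
definition "before D l t \<longleftrightarrow> (\<forall>l' t'. (l' < l \<or> l' = l \<and> t' < t) \<and> l' < NL \<and> t' < 64 * P \<longrightarrow> tabok D l' t' 0)"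
definition "tf s \<longleftrightarrow> en s \<and> (\<forall>a<TB. data s a = D0 a)"
definition "TI l t s \<longleftrightarrow> tf s \<and> regs s 23 = l \<and> regs s 24 = t \<and> regs s 25 = Xi (l mod GI) \<and> before (data s) l t"

lemma tf_r:
  assumes "tf s"
  shows "en s" "regs s 10 = n" "regs s 14 = P" "regs s 17 = m" "regs s 18 = G" "regs s 19 = GI" "regs s 20 = NL"
  using assms unfolding tf_def by (auto simp: env_def)

lemma tf_regs: "tf s \<Longrightarrow> (\<And>r. 10 \<le> r \<Longrightarrow> r \<le> 22 \<Longrightarrow> f r = regs s r) \<Longrightarrow> tf (s\<lparr>regs := f\<rparr>)"
  unfolding tf_def env_def by auto

lemma tabok_upd:
  assumes "tabok D l' t' i" "(l', t') \<noteq> (l, t)" "t' < 64 * P" "t < 64 * P" "z < 2 * P"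
  shows "tabok (D(tab l t z := v)) l' t' i"
proof -
  have "tab l' t' z' \<noteq> tab l t z" if "z' < 2 * P" for z' using tab_inj[of l' t' z' l t z] assms that by auto
  from this[of "_"] show ?thesis using assms(1) P_ge unfolding tabok_def by auto
qed

lemma before_upd: "before D l t \<Longrightarrow> t < 64 * P \<Longrightarrow> z < 2 * P \<Longrightarrow> before (D(tab l t z := v)) l t"
  unfolding before_def by (auto intro!: tabok_upd)

lemma tf_upd:
  assumes "tf s" "l < NL" "t < 64 * P" "z < 2 * P" shows "tf (s\<lparr>data := (data s)(tab l t z := v)\<rparr>)"
  using assms tab_bounds[OF assms(2-4)] unfolding tf_def by (auto simp: env_def)

lemma F_less: "F l t j < P" using P8 by (simp add: F_def fpt_def)

text \<open>The old head of the bucket of \<open>i\<close> is the first member from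
  \<open>Suc i\<close> on, so it becomes the link of \<open>i\<close>; by \<open>nx_step\<close>
  only this head changes when the search starts at \<open>i\<close>.\<close>

lemma tabok_insert:
  assumes ok: "tabok D l t (Suc i)" and i: "i < n" and t: "t < 64 * P"
  shows "tabok (D(tab l t (P + i) := D (tab l t (F l t i)), tab l t (F l t i) := i)) l t i"
proof -
  let ?f = "F l t i"
  have inj: "tab l t z = tab l t z' \<longleftrightarrow> z = z'" if "z < 2 * P" "z' < 2 * P" for z z'
    using tab_inj[of l t z l t z'] that t by auto
  have n: "i < n \<Longrightarrow> P + i < 2 * P" for i using P_ge by simp
  have f: "?f < P" by (rule F_less)
  note step = nx_step[OF i, of "F l t"]
  show ?thesis
    unfolding tabok_def
  proof (intro conjI allI impI)
    fix f assume fP: "f < P"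
    show "(D(tab l t (P + i) := D (tab l t ?f), tab l t ?f := i)) (tab l t f) = nx (F l t) f i"
      using ok fP f inj[of f ?f] inj[of f "P + i"] n[OF i] step[of f] unfolding tabok_def by auto
  next
    fix j assume j: "i \<le> j \<and> j < n"
    have "P + j \<noteq> ?f" using f by simp
    then show "(D(tab l t (P + i) := D (tab l t ?f), tab l t ?f := i)) (tab l t (P + j)) = nx (F l t) (F l t j) (Suc j)"
      using ok j f inj[of "P + j" ?f] inj[of "P + j" "P + i"] n i unfolding tabok_def
      by (cases "j = i") auto
  qed
qed

lemma wp_insert:
  assumes I: "TI l t s" "l < NL" "t < 64 * P" and i: "regs s 2 = i" "i < n" and ok: "tabok (data s) l t (Suc i)"
    and Q: "\<And>t' s'. TI l t s' \<Longrightarrow> regs s' 2 = i \<Longrightarrow> tabok (data s') l t i \<Longrightarrow> Q t' s'"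
  shows "wp M insert_com Q s"
proof -
  have s: "tf s" "regs s 23 = l" "regs s 24 = t" "regs s 25 = Xi (l mod GI)" "before (data s) l t" using I unfolding TI_def by auto
  note r = tf_r[OF s(1)]
  note len = str_len[OF i(2)]
  have sb: "saddr i + k < data_cells M" "(4 + (i * P + k)) mod W = saddr i + k" "saddr i + k < TB" if "k < P" for k
    using saddr_bounds[OF i(2) that] RB_TB_DS dc DS_W by (auto simp: saddr_def)
  have dstr: "data s (saddr i) = length (xs ! i)" "\<And>j. j < length (xs ! i) \<Longrightarrow> data s (saddr i + 1 + j) = xs ! i ! j"
    using D0(1)[OF i(2)] s(1) sb(3)[of 0] sb(3)[of "Suc _"] len P8 unfolding strok_def tf_def by auto
  define C where "C j s' \<longleftrightarrow> data s' = data s \<and> (\<forall>r. r \<noteq> 3 \<and> r \<noteq> 4 \<and> r \<noteq> 26 \<longrightarrow> regs s' r = regs s r) \<and> regs s' 3 = j \<and>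
    regs s' 26 = length (xs ! i) \<and> (\<forall>k<j. work s' k = xs ! i ! k)" for j and s' :: store
  have ev1: "eval_exp W (regs s) (Const 4 \<oplus> Reg 2 \<otimes> Reg 14) = saddr i"
    using sb(2)[of 0] P8 r i by (simp add: mod_simps)
  have ev2: "eval_exp W (regs s') ((Const 5 \<oplus> Reg 2 \<otimes> Reg 14) \<oplus> Reg 3) = saddr i + 1 + j"
    if "C j s'" "j < length (xs ! i)" for s' j
    using sb(2)[of "Suc j"] len that r i unfolding C_def by (simp add: mod_simps ac_simps)
  show ?thesis
    unfolding insert_com_def
    apply (rule wp_Seq, rule wp_LoadData)
    subgoal using sb(1)[of 0] P8 by (simp del: eval_exp.simps add: Wm ev1)
    apply (rule wp_Seq, rule wp_Assign, rule wp_Seq, rule wp_loop[where m = "length (xs ! i)" and I = C])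
    subgoal by (simp add: C_def Wm)
    subgoal premises p for j s2
    proof -
      have j: "Suc j mod W = Suc j" "j < work_cells M"
        using p(1) len small_W(2) dc RB_TB_DS(4) by auto
      show ?thesis
        apply (intro wp_Seq wp_LoadData wp_StoreWork wp_Assign)
        subgoal using sb(1)[of "Suc j"] p(1) len by (simp del: eval_exp.simps add: Wm ev2[OF p(2,1)])
        subgoal using p(2) j unfolding C_def by (simp add: Wm)
        subgoal using p j dstr(2)[OF p(1)] ev2[OF p(2,1)] unfolding C_def by (auto simp: Wm less_Suc_eq)
        done
    qed
    subgoal by (simp add: C_def Wm)
    subgoal using dstr(1) ev1 unfolding C_def by (simp del: eval_exp.simps(3) add: Wm)
    apply (rule wp_Seq, rule wp_hash[OF M(1), where x = "xs ! i"])
    subgoal using r(1) unfolding C_def env_def by simp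
    subgoal using s I unfolding C_def by simp
    subgoal using s I unfolding C_def by simp
    subgoal using s Xi_le unfolding C_def by simp
    subgoal unfolding C_def by simp
    subgoal using len by simp
    subgoal unfolding C_def by simp
    subgoal using xs(2)[OF i(2)] by simp
    subgoal using s(1) D0(2) unfolding C_def tf_def by simp
    subgoal premises p for t1 s1 t2 s2
    proof -
      have c: "data s1 = data s" "\<And>r. r \<noteq> 3 \<Longrightarrow> r \<noteq> 4 \<Longrightarrow> r \<noteq> 26 \<Longrightarrow> regs s1 r = regs s r" using p(1) unfolding C_def by auto
      have e: "regs s2 23 = l" "regs s2 24 = t" "regs s2 25 = Xi (l mod GI)" "regs s2 2 = i"
        using p(3) c(2) s i by auto
      have "en s2" using r(1) p(3) c(2) unfolding env_def by simp
      then have tf2: "tf s2" using s(1) p(5) c(1) unfolding tf_def by simp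
      note r2 = tf_r[OF tf2]
      have F: "regs s2 30 = F l t i"
      proof -
        have "fpt (data s) l t (xs ! i) = fpt D0 l t (xs ! i)"
          using s(1) xs(2)[OF i(2)] I(2) by (intro fpt_cong) (auto simp: tf_def)
        then show ?thesis using p(4) c s by (simp add: fpt_def F_def)
      qed
      have z: "F l t i < 2 * P" "P + i < 2 * P" using F_less[of l t i] i P_ge by auto
      have a1: "eval_exp W (regs s3) (tab_exp (Reg 30)) = tab l t (F l t i)"
        if "en s3" "regs s3 23 = l" "regs s3 24 = t" "regs s3 30 = F l t i" for s3
        using eval_tab[of s3 "Reg 30"] that I z by simp
      have a2: "eval_exp W (regs s3) (tab_exp (Reg 14 \<oplus> Reg 2)) = tab l t (P + i)"
        if "en s3" "regs s3 23 = l" "regs s3 24 = t" "regs s3 2 = i" "regs s3 14 = P" for s3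
      proof -
        have "(P + i) mod W = P + i" using z small_W(4) by simp
        then show ?thesis using eval_tab[of s3 "Reg 14 \<oplus> Reg 2"] that I z by simp
      qed
      have tb: "tab l t (F l t i) < data_cells M" "tab l t (P + i) < data_cells M"
        using tab_bounds[OF I(2,3)] z dc by (meson less_le_trans)+
      let ?v = "data s (tab l t (F l t i))"
      define s4 where "s4 = s2\<lparr>regs := (regs s2)(4 := ?v)\<rparr>"
      define s5 where "s5 = s4\<lparr>data := (data s4)(tab l t (P + i) := ?v)\<rparr>"
      define s6 where "s6 = s5\<lparr>data := (data s5)(tab l t (F l t i) := i)\<rparr>"
      have t4: "tf s4" unfolding s4_def by (rule tf_regs[OF tf2]) auto
      have t5: "tf s5" unfolding s5_def by (rule tf_upd[OF t4 I(2,3) z(2)])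
      have t6: "tf s6" unfolding s6_def by (rule tf_upd[OF t5 I(2,3) z(1)])
      have d2: "data s2 = data s" using p(5) c by simp
      have e4: "regs s4 23 = l" "regs s4 24 = t" "regs s4 2 = i" "regs s4 14 = P" "regs s4 4 = ?v"
        using e F r2 by (auto simp: s4_def)
      have e5: "regs s5 23 = l" "regs s5 24 = t" "regs s5 2 = i" "regs s5 30 = F l t i" "regs s5 25 = Xi (l mod GI)"
        using e F r2 by (auto simp: s4_def s5_def)
      have d6: "data s6 = (data s)(tab l t (P + i) := ?v, tab l t (F l t i) := i)"
        by (simp add: s6_def s5_def s4_def d2)
      have TI6: "TI l t s6" unfolding TI_def
        using t6 e5 s(5) I z unfolding d6 by (auto simp: s6_def intro!: before_upd)
      have r6: "regs s6 2 = i" using e5 by (simp add: s6_def)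
      have ok6: "tabok (data s6) l t i" unfolding d6 using tabok_insert[OF ok i(2) I(3)] by simp
      show ?thesis
        apply (rule wp_Seq, rule wp_LoadData, unfold Wm a1[OF r2(1) e(1,2) F] d2)
        subgoal by (rule tb)
        unfolding s4_def[symmetric]
        apply (rule wp_Seq, rule wp_StoreData)
        subgoal using a2[OF tf_r(1)[OF t4] e4(1-4)] tb by (simp only: Wm)
        subgoal by (rule M)
        subgoal premises
        proof -
          have w4: "s4\<lparr>data := (data s4)(eval_exp (word_mod M) (regs s4) (tab_exp (Reg 14 \<oplus> Reg 2)) := eval_exp (word_mod M) (regs s4) (Reg 4))\<rparr> = s5"
            using a2[OF tf_r(1)[OF t4] e4(1-4)] e4(5) by (simp only: s5_def Wm eval_exp.simps(2))
          have w5: "s5\<lparr>data := (data s5)(eval_exp (word_mod M) (regs s5) (tab_exp (Reg 30)) := eval_exp (word_mod M) (regs s5) (Reg 2))\<rparr> = s6"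
            using a1[OF tf_r(1)[OF t5] e5(1,2,4)] e5(3) by (simp only: s6_def Wm eval_exp.simps(2))
          show ?thesis unfolding w4
            apply (rule wp_StoreData)
            subgoal using a1[OF tf_r(1)[OF t5] e5(1,2,4)] tb by (simp only: Wm)
            subgoal by (rule M)
            unfolding w5 by (rule Q[OF TI6 r6 ok6])
        qed
        done
    qed
    done
qed

lemma wp_table:
  assumes I: "TI l t s" "l < NL" "t < 64 * P" and Q: "\<And>t' s'. TI l t s' \<Longrightarrow> tabok (data s') l t 0 \<Longrightarrow> Q t' s'"
  shows "wp M table_com Q s"
proof -
  define Z where "Z f s' \<longleftrightarrow> TI l t s' \<and> regs s' 2 = f \<and> (\<forall>f'<f. data s' (tab l t f') = n)" for f and s' :: store
  define Y where "Y j s' \<longleftrightarrow> TI l t s' \<and> regs s' 2 = n - j \<and> tabok (data s') l t (n - j)" for j and s' :: store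
  have TIr: "TI l t (s'\<lparr>regs := (regs s')(2 := v)\<rparr>)" if "TI l t s'" for s' v
    using that tf_regs[of s' "(regs s')(2 := v)"] unfolding TI_def by simp
  show ?thesis
    unfolding table_com_def
    apply (rule wp_Seq, rule wp_Assign, rule wp_Seq, rule wp_loop[where m = P and I = Z])
    subgoal for f s2 using tf_r[of s2] by (simp add: Z_def TI_def Wm)
    subgoal premises p for f s2
    proof -
      have z: "TI l t s2" "tf s2" "regs s2 2 = f" "\<forall>f'<f. data s2 (tab l t f') = n" "regs s2 23 = l" "regs s2 24 = t"
        using p(2) unfolding Z_def TI_def by auto
      note r = tf_r[OF z(2)]
      have f2: "f < 2 * P" using p(1) by simp
      have fW: "Suc f mod W = Suc f" using f2 small_W(4) P8 by simp
      have ev: "eval_exp W (regs s2) (tab_exp (Reg 2)) = tab l t f"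
        using eval_tab[of s2 "Reg 2"] r z I f2 by simp
      have tb: "tab l t f < data_cells M" using tab_bounds[OF I(2,3) f2] dc by linarith
      let ?s3 = "s2\<lparr>data := (data s2)(tab l t f := n)\<rparr>"
      have t3: "TI l t ?s3" using z(1) tf_upd[OF z(2) I(2,3) f2, of n] before_upd[OF _ I(3) f2] unfolding TI_def by simp
      moreover have "\<forall>f'<Suc f. data ?s3 (tab l t f') = n" using z(4) by (auto simp: less_Suc_eq)
      ultimately have "Z (Suc f) (?s3\<lparr>regs := (regs ?s3)(2 := Suc f)\<rparr>)" using TIr[OF t3, of "Suc f"] unfolding Z_def by simp
      then show ?thesis
        using tb r z fW by (intro wp_Seq wp_StoreData wp_Assign M) (simp_all add: Wm ev)
    qed
    subgoal for s2 using tf_r[of s2] by (simp add: Z_def TI_def Wm)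
    subgoal using TIr[OF I(1), of 0] by (simp add: Z_def)
    apply (rule wp_Seq, rule wp_Assign, rule wp_loop[where m = n and I = Y])
    subgoal by (simp add: Y_def)
    subgoal premises p for t1 s1 j s2
    proof -
      have y: "TI l t s2" "regs s2 2 = n - j" "tabok (data s2) l t (n - j)" using p(3) unfolding Y_def by auto
      have j: "n - j = Suc (n - Suc j)" using p(2) by simp
      show ?thesis
        apply (rule wp_Seq, rule wp_Assign, rule wp_insert[OF TIr[OF y(1)] I(2,3), where i = "n - Suc j"])
        subgoal using y(2) by (simp add: Wm)
        subgoal using p(2) by simp
        subgoal using y(3) j by simp
        subgoal by (simp add: Y_def)
        done
    qed
    subgoal by (simp add: Y_def)
    subgoal premises p for t1 s1
    proof -
      have "TI l t s1" "regs s1 10 = n" using p tf_r[of s1] unfolding Z_def TI_def by auto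
      moreover have "tabok (data s1) l t n" using p nx_n unfolding Z_def tabok_def by auto
      ultimately show ?thesis using TIr unfolding Y_def by simp
    qed
    subgoal by (rule Q) (auto simp: Y_def)
    done
qed

lemma wp_tables:
  assumes s: "tf s" and Q: "\<And>t' s'. tf s' \<Longrightarrow> before (data s') NL 0 \<Longrightarrow> Q t' s'"
  shows "wp M tables_com Q s"
proof -
  define A where "A l s' \<longleftrightarrow> tf s' \<and> regs s' 23 = l \<and> (l \<noteq> 0 \<longrightarrow> regs s' 25 = Xi ((l - 1) mod GI)) \<and> before (data s') l 0"
    for l and s' :: store
  have GI0: "0 < GI" using L_ge by (simp add: GI_def)
  have NLW: "Suc l mod W = Suc l" if "l < NL" for l using that NL_le P_power_lt_W[of 5] by simp
  have X: "Xi (l mod GI) = Xi ((l - 1) mod GI) - Xi ((l - 1) mod GI) div G" if nz: "l mod GI \<noteq> 0" for l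
  proof -
    obtain k where k: "l = Suc k" using nz by (metis mod_0 not0_implies_Suc)
    have "Suc k mod GI = Suc (k mod GI)" using nz mod_Suc[of k GI] unfolding k by (auto split: if_splits)
    then show ?thesis by (simp add: k Xi_def)
  qed
  show ?thesis
    unfolding tables_com_def
    apply (rule wp_Seq, rule wp_Assign, rule wp_loop[where m = NL and I = A])
    subgoal for l s1 using tf_r[of s1] by (simp add: A_def Wm)
    subgoal premises p for l s1
    proof -
      have a: "tf s1" "regs s1 23 = l" "l \<noteq> 0 \<longrightarrow> regs s1 25 = Xi ((l - 1) mod GI)" "before (data s1) l 0"
        using p(2) unfolding A_def by auto
      note r = tf_r[OF a(1)]
      have X1: "wp M (If (Equal (Mod (Reg 23) (Reg 19)) (Const 0)) (Assign 25 (Div (Reg 17) (Const 2)))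
         (Assign 25 (Reg 25 \<ominus> Div (Reg 25) (Reg 18)))) Q' s1"
        if "\<And>t. Q' t (s1\<lparr>regs := (regs s1)(25 := Xi (l mod GI))\<rparr>)" for Q'
      proof (rule wp_If)
        assume "eval_exp (word_mod M) (regs s1) (Equal (Mod (Reg 23) (Reg 19)) (Const 0)) \<noteq> 0"
        then have "l mod GI = 0" using a r by (simp add: Wm split: if_splits)
        then have "Xi (l mod GI) = m div 2" by (simp add: Xi_def)
        then show "wp M (Assign 25 (Div (Reg 17) (Const 2))) (\<lambda>t. Q' (Suc t)) s1"
          using that[of "Suc 1"] r by (intro wp_Assign) (simp add: Wm)
      next
        assume "eval_exp (word_mod M) (regs s1) (Equal (Mod (Reg 23) (Reg 19)) (Const 0)) = 0"
        then have nz: "l mod GI \<noteq> 0" using a r by (simp add: Wm split: if_splits)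
        then have "l \<noteq> 0" by (cases l) auto
        then show "wp M (Assign 25 (Reg 25 \<ominus> Div (Reg 25) (Reg 18))) (\<lambda>t. Q' (Suc t)) s1"
          using that[of "Suc 1"] r a X[OF nz] by (intro wp_Assign) (simp add: Wm)
      qed
      have P64: "(64 * P) mod W = 64 * P"
      proof -
        have "64 * P \<le> P * P * P" using mult_mono[of 8 P 8 P] P8 by simp
        then show ?thesis using P_power_lt_W[of 3] by (simp add: eval_nat_numeral)
      qed
      show ?thesis
        apply (rule wp_Seq, rule X1, rule wp_Seq, rule wp_Assign, rule wp_Seq,
            rule wp_loop[where m = "64 * P" and I = "TI l"])
        subgoal for t0 t s2 using tf_r[of s2] P64 by (simp add: TI_def Wm)
        subgoal premises p2 for t0 t s2
        proof -
          show ?thesis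
          proof (rule wp_Seq, rule wp_table[OF p2(2) p(1) p2(1)], rule wp_Assign)
            fix t' s3 assume s3: "TI l t s3" "tabok (data s3) l t 0"
            have tW: "Suc t mod W = Suc t" using p2(1) P64 mod_less_divisor[of W "64 * P"] small_W by (metis Suc_leI le_less_trans mod_less order_le_less_trans par_mod_W(4) num_mod_W(6))
            have "before (data s3) l (Suc t)" using s3 unfolding TI_def before_def by (auto simp: less_Suc_eq)
            then show "TI l (Suc t) (s3\<lparr>regs := (regs s3)(24 := eval_exp (word_mod M) (regs s3) (Reg 24 \<oplus> Const 1))\<rparr>)"
              using s3(1) tW tf_regs[of s3 "(regs s3)(24 := Suc t)"] unfolding TI_def by (simp add: Wm)
          qed
        qed
        subgoal for t0 s2 using tf_r[of s2] P64 by (simp add: TI_def Wm)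
        subgoal using a tf_regs[OF a(1), of "(regs s1)(25 := Xi (l mod GI), 24 := 0)"] unfolding TI_def by (simp add: Wm)
        subgoal premises p3 for t0 t' s4
        proof (rule wp_Assign)
          have b: "before (data s4) (Suc l) 0" using p3 unfolding TI_def before_def by (auto simp: less_Suc_eq)
          show "A (Suc l) (s4\<lparr>regs := (regs s4)(23 := eval_exp (word_mod M) (regs s4) (Reg 23 \<oplus> Const 1))\<rparr>)"
            using p3 b NLW[OF p(1)] tf_regs[of s4 "(regs s4)(23 := Suc l)"] unfolding A_def TI_def by (simp add: Wm)
        qed
        done
    qed
    subgoal for s1 using tf_r[of s1] by (simp add: A_def Wm)
    subgoal using tf_regs[OF s, of "(regs s)(23 := 0)"] by (simp add: A_def before_def)
    subgoal by (rule Q) (auto simp: A_def)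
    done
qed

end

section \<open>The outcome of preprocessing\<close>

context ann_build
begin

lemma N_W: "N mod W = N" "N < W"
proof -
  have "N * 1 < N * P" using P8 nN n1 by simp
  moreover have "N * P \<le> N * P ^ 16" using P_power_le[of 1 16] by (intro mult_le_mono2) simp
  ultimately show "N < W" using NW by linarith
  then show "N mod W = N" by simp
qed

lemma strok_cong:
  assumes i: "i < n" and eq: "\<And>k. k < P \<Longrightarrow> D (saddr i + k) = D' (saddr i + k)" and D: "strok D i"
  shows "strok D' i"
proof -
  have "D' (saddr i) = length (xs ! i)" using eq[of 0] P8 D by (simp add: strok_def)
  moreover have "D' (saddr i + 1 + j) = xs ! i ! j" if j: "j < length (xs ! i)" for j
  proof -
    have "D (saddr i + (1 + j)) = D' (saddr i + (1 + j))" using str_len[OF i] j by (intro eq) simp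
    moreover have "D (saddr i + 1 + j) = xs ! i ! j" using D j unfolding strok_def by blast
    ultimately show ?thesis by (simp add: add.assoc)
  qed
  ultimately show ?thesis unfolding strok_def by blast
qed

lemma wp_copy:
  assumes "k < 4" "v < W" "input M ! k = v"
    "wp M c (\<lambda>t. Q (Suc (1 + Suc (1 + t)))) (s\<lparr>regs := (regs s)(2 := v), data := (data s)(k := v)\<rparr>)"
  shows "wp M (LoadInput 2 (Const k) ;; StoreData (Const k) (Reg 2) ;; c) Q s"
proof -
  have k: "k mod W = k" "k < data_cells M" "k < length (input M)"
    using assms(1) small_W(1)[of k] dc RB_TB_DS by (auto simp: inp)
  show ?thesis
    by (rule wp_Seq, rule wp_LoadInput) (use k M assms in \<open>auto simp: Wm intro!: wp_Seq wp_StoreData\<close>)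
qed

lemma wp_prefix:
  assumes Q: "\<And>t s'. en s' \<Longrightarrow> regs s' 2 = RB \<Longrightarrow> regs s' 3 = 0 \<Longrightarrow> \<forall>i<n. strok (data s') i \<Longrightarrow>
      data s' 0 = n \<Longrightarrow> data s' 1 = d \<Longrightarrow> data s' 2 = sg \<Longrightarrow> data s' 3 = N \<Longrightarrow> Q t s'"
  shows "wp M prefix_com Q s"
proof -
  have NWs: "N < W" "n < W" "d < W" "sg < W" using N_W P_ge small_W(2) by auto
  show ?thesis
    unfolding prefix_com_def
    apply (rule wp_copy[where v = n], simp, rule NWs, simp add: inp)
    apply (rule wp_copy[where v = d], simp, rule NWs, simp add: inp)
    apply (rule wp_copy[where v = sg], simp, rule NWs, simp add: inp)
    apply (rule wp_copy[where v = N], simp, rule NWs, simp add: inp)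
    apply (rule wp_Seq, rule wp_params[OF M(1)], simp, simp, simp, simp)
    subgoal premises p for t s1
      apply (rule wp_Seq, rule wp_strings[OF p(2)])
      subgoal premises p2 for t2 s2
      proof -
        have d: "data s1 0 = n" "data s1 1 = d" "data s1 2 = sg" "data s1 3 = N"
          using p(4) by simp_all
        show ?thesis
        proof (intro wp_Seq wp_Assign Q)
        show "en (s2\<lparr>regs := (regs s2)(2 := eval_exp (word_mod M) (regs s2) (Reg 21))\<rparr>
          \<lparr>regs := (regs (s2\<lparr>regs := (regs s2)(2 := eval_exp (word_mod M) (regs s2) (Reg 21))\<rparr>))
            (3 := eval_exp (word_mod M) (regs (s2\<lparr>regs := (regs s2)(2 := eval_exp (word_mod M) (regs s2) (Reg 21))\<rparr>)) (Const 0))\<rparr>)"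
          using p(2) p2(3) unfolding env_def by simp
        qed (use p(2) p2 d in \<open>auto simp: env_def Wm\<close>)
      qed
      done
    done
qed

text \<open>The prefix is deterministic and so is the filling of the tables for given words
  \<open>w\<close>; hence the final store is a function \<open>S w\<close> of the words drawn in
  between, and these words are still present in it.\<close>

theorem run_build:
  "\<exists>T S. run M T (start build_com (\<lambda>_. 0)) = map_pmf (\<lambda>w. ([], S w)) (unif {RB..<TB} m) \<and>
    (\<forall>w\<in>set_pmf (unif {RB..<TB} m). wf xs (data (S w)) \<and> (\<forall>a. RB \<le> a \<and> a < TB \<longrightarrow> data (S w) a = w a))"
proof -
  let ?U = "unif {RB..<TB} m"
  let ?s0 = "\<lparr>regs = (\<lambda>_. 0), data = (\<lambda>_. 0), work = (\<lambda>_. 0)\<rparr> :: store"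
  have "wp M prefix_com (\<lambda>t s'. en s' \<and> regs s' 2 = RB \<and> regs s' 3 = 0 \<and> (\<forall>i<n. strok (data s') i) \<and>
      data s' 0 = n \<and> data s' 1 = d \<and> data s' 2 = sg \<and> data s' 3 = N) ?s0"
    by (rule wp_prefix) auto
  then obtain t1 s1 where s1: "steps M t1 prefix_com ?s0 s1" "en s1" "regs s1 2 = RB" "regs s1 3 = 0"
      "\<And>i. i < n \<Longrightarrow> strok (data s1) i" "data s1 0 = n" "data s1 1 = d" "data s1 2 = sg" "data s1 3 = N"
    unfolding wp_def by auto
  define D2 where "D2 w = (\<lambda>i. if RB \<le> i \<and> i < TB then w i else data s1 i)" for w
  define s2 where "s2 w = s1\<lparr>regs := (regs s1)(2 := TB), data := D2 w\<rparr>" for w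
  have r1: "regs s1 22 = TB" "regs s1 17 = m" using s1(2) by (auto simp: env_def)
  have run2: "run M (8 * (TB - RB) + 1) (random_loop # [tables_com], s1) = map_pmf (\<lambda>w. ([tables_com], s2 w)) ?U"
    using run_random[OF s1(3) RB_TB_DS(2) le_refl r1 s1(4), of "[tables_com]"] unfolding s2_def D2_def .
  have tab: "\<exists>t s3. steps M t tables_com (s2 w) s3 \<and> wf xs (data s3) \<and> (\<forall>a. RB \<le> a \<and> a < TB \<longrightarrow> data s3 a = w a)"
    if w: "w \<in> set_pmf ?U" for w
  proof -
    have wm: "w a < m" if "RB \<le> a" "a < TB" for a using set_unif[OF _ m0 w] that by auto
    have str: "strok (D2 w) i" if i: "i < n" for i
    proof (rule strok_cong[OF i _ s1(5)[OF i]])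
      fix k assume "k < P"
      then have "\<not> RB \<le> saddr i + k" using saddr_bounds(2)[OF i] by (simp add: not_le)
      then show "data s1 (saddr i + k) = D2 w (saddr i + k)" by (simp add: D2_def)
    qed
    interpret T: ann_tables n d sg N W M xs "D2 w"
      by unfold_locales (use str wm in \<open>auto simp: D2_def\<close>)
    have "T.tf (s2 w)" unfolding T.tf_def s2_def using s1(2) by (auto simp: env_def)
    then have "wp M tables_com (\<lambda>t s'. T.tf s' \<and> T.before (data s') NL 0) (s2 w)"
      by (rule T.wp_tables) auto
    then obtain t s3 where s3: "steps M t tables_com (s2 w) s3" "T.tf s3" "T.before (data s3) NL 0"
      unfolding wp_def by blast
    have same: "data s3 a = D2 w a" if "a < TB" for a using s3(2) that unfolding T.tf_def by auto
    have R4: "4 \<le> RB" by (rule RB_TB_DS)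
    have "wf xs (data s3)"
      unfolding wf_def
    proof (intro conjI allI impI)
      show "data s3 0 = n" "data s3 1 = d" "data s3 2 = sg" "data s3 3 = N"
        using same[of 0] same[of 1] same[of 2] same[of 3] s1 R4 RB_TB_DS(2) by (auto simp: D2_def)
    next
      fix i assume i: "i < n"
      have "saddr i + k < TB" if "k < P" for k using saddr_bounds[OF i that] RB_TB_DS(2) by simp
      then have "strok (data s3) i" by (intro strok_cong[OF i _ str[OF i]]) (simp add: same)
      then show "data s3 (saddr i) = length (xs ! i)" "\<And>j. j < length (xs ! i) \<Longrightarrow> data s3 (saddr i + 1 + j) = xs ! i ! j"
        unfolding strok_def by blast+
    next
      fix a assume "RB \<le> a \<and> a < TB" then show "data s3 a < m" using same[of a] wm[of a] by (simp add: D2_def)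
    next
      fix l t assume lt: "l < NL" "t < 64 * P"
      have F: "T.F l t j = fpt (data s3) l t (xs ! j)" if "j < n" for j
        unfolding T.F_def using same xs(2)[OF that] lt(1) by (intro fpt_cong) auto
      have nxF: "nx (T.F l t) f i = nx (\<lambda>j. fpt (data s3) l t (xs ! j)) f i" for f i
      proof -
        have "(i \<le> j \<and> (n \<le> j \<or> T.F l t j = f)) = (i \<le> j \<and> (n \<le> j \<or> fpt (data s3) l t (xs ! j) = f))" for j
          by (cases "j < n") (simp_all add: F)
        then show ?thesis unfolding nx_def by presburger
      qed
      have ok: "T.tabok (data s3) l t 0" using s3(3) lt unfolding T.before_def by auto
      show "data s3 (tab l t f) = nx (\<lambda>j. fpt (data s3) l t (xs ! j)) f 0" if "f < P" for f
        using ok that unfolding T.tabok_def nxF by auto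
      show "data s3 (tab l t (P + i)) = nx (\<lambda>j. fpt (data s3) l t (xs ! j)) (fpt (data s3) l t (xs ! i)) (Suc i)" if "i < n" for i
        using ok that F[OF that] unfolding T.tabok_def nxF by auto
    qed
    moreover have "data s3 a = w a" if "RB \<le> a" "a < TB" for a using same[of a] that by (simp add: D2_def)
    ultimately show ?thesis using s3(1) by blast
  qed
  then obtain t3 S where S: "\<And>w. w \<in> set_pmf ?U \<Longrightarrow> steps M (t3 w) tables_com (s2 w) (S w) \<and> wf xs (data (S w)) \<and>
      (\<forall>a. RB \<le> a \<and> a < TB \<longrightarrow> data (S w) a = w a)" by metis
  \<comment> \<open>The filling time may depend on \<open>w\<close>. The support is finite and
    halted configurations persist, so the maximum serves for all \<open>w\<close> at once.\<close>
  define t4 where "t4 = Max (t3 ` set_pmf ?U)"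
  have fin: "finite (set_pmf ?U)" using m0 by (intro finite_set_unif) auto
  have run3: "run M t4 ([tables_com], s2 w) = return_pmf ([], S w)" if w: "w \<in> set_pmf ?U" for w
  proof -
    have "t3 w \<le> t4" unfolding t4_def using fin w by (intro Max_ge) auto
    then obtain u where u: "t4 = t3 w + u" using le_Suc_ex by blast
    have "run M (t3 w) ([tables_com], s2 w) = return_pmf ([], S w)" using S[OF w] unfolding steps_def by blast
    then show ?thesis unfolding u run_add by (simp add: bind_return_pmf run_halted)
  qed
  let ?T = "Suc (t1 + Suc (8 * (TB - RB) + 1 + t4))"
  have "run M ?T (start build_com (\<lambda>_. 0)) = run M (t1 + Suc (8 * (TB - RB) + 1 + t4)) (prefix_com # [random_loop ;; tables_com], ?s0)"
    by (simp add: start_def build_com_def bind_return_pmf)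
  also have "\<dots> = run M (Suc (8 * (TB - RB) + 1 + t4)) ([random_loop ;; tables_com], s1)"
    using s1(1) unfolding run_add[of M t1] steps_def by (simp add: bind_return_pmf del: run.simps)
  also have "\<dots> = run M (8 * (TB - RB) + 1 + t4) (random_loop # [tables_com], s1)"
    by (simp only: run.simps step.simps bind_return_pmf)
  also have "\<dots> = bind_pmf ?U (\<lambda>w. run M t4 ([tables_com], s2 w))"
    by (subst run_add[of M "8 * (TB - RB) + 1" t4]) (simp only: run2 bind_map_pmf)
  also have "\<dots> = bind_pmf ?U (\<lambda>w. return_pmf ([], S w))"
    by (intro bind_pmf_cong refl run3)
  also have "\<dots> = map_pmf (\<lambda>w. ([], S w)) ?U" by (simp add: map_pmf_def)
  finally show ?thesis using S by blast
qed

end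

section \<open>Halting programs\<close>

text \<open>\<open>final\<close> stops at the first time at which halting is certain; running on
  until \<open>T\<close> changes nothing.\<close>

lemma final_eqI:
  assumes "run M T cf = map_pmf (\<lambda>w. ([], S w)) p"
  shows "halts_surely M cf" "final M cf = map_pmf (\<lambda>w. ([], S w)) p"
proof -
  let ?h = "\<lambda>t. \<forall>cf'\<in>set_pmf (run M t cf). halted cf'"
  have h: "?h T" using assms by (auto simp: halted_def)
  then show "halts_surely M cf" unfolding halts_surely_def by blast
  define t0 where "t0 = (LEAST t. ?h t)"
  have t0: "?h t0" "t0 \<le> T" unfolding t0_def by (rule LeastI[of ?h, OF h], rule Least_le[of ?h, OF h])
  obtain k where k: "T = t0 + k" using t0(2) le_Suc_ex by blast
  have "run M T cf = bind_pmf (run M t0 cf) (run M k)" unfolding k run_add ..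
  also have "\<dots> = bind_pmf (run M t0 cf) return_pmf"
  proof (intro bind_pmf_cong refl)
    fix cf' assume "cf' \<in> set_pmf (run M t0 cf)"
    then have "fst cf' = []" using t0(1) by (auto simp: halted_def)
    then show "run M k cf' = return_pmf cf'" using run_halted[of M k "snd cf'"] by (cases cf') auto
  qed
  finally have "run M T cf = run M t0 cf" by (simp add: bind_return_pmf')
  then show "final M cf = map_pmf (\<lambda>w. ([], S w)) p" unfolding final_def t0_def[symmetric] using assms by simp
qed

text \<open>The event of not having halted by time \<open>t\<close> forces
  \<open>t < \<tau> w\<close>, and summing these indicators over \<open>t\<close> gives
  \<open>\<tau> w\<close>.\<close>

lemma expected_time_le:
  assumes "\<And>w. w \<in> set_pmf p \<Longrightarrow> \<exists>s'. run M (\<tau> w) (f w) = return_pmf ([], s')"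
  shows "expected_time M (map_pmf f p) \<le> (\<integral>\<^sup>+w. ennreal (real (\<tau> w)) \<partial>measure_pmf p)"
proof -
  have "emeasure (measure_pmf (bind_pmf (map_pmf f p) (run M t))) {cf. \<not> halted cf} =
      (\<integral>\<^sup>+w. emeasure (measure_pmf (run M t (f w))) {cf. \<not> halted cf} \<partial>measure_pmf p)" for t
    by (simp add: bind_map_pmf emeasure_bind_pmf)
  also have "\<dots> t \<le> (\<integral>\<^sup>+w. (if t < \<tau> w then 1 else 0) \<partial>measure_pmf p)" for t
  proof (intro nn_integral_mono_AE, simp add: AE_measure_pmf_iff, intro ballI impI conjI)
    fix w assume w: "w \<in> set_pmf p" "\<not> t < \<tau> w"
    then obtain u s' where "t = \<tau> w + u" "run M (\<tau> w) (f w) = return_pmf ([], s')"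
      using assms by (metis le_Suc_ex not_less)
    then have "run M t (f w) = return_pmf ([], s')" by (simp add: run_add bind_return_pmf run_halted)
    then show "emeasure (measure_pmf (run M t (f w))) {cf. \<not> halted cf} = 0"
      by (simp add: halted_def)
  qed (auto intro: measure_pmf.emeasure_le_1)
  finally have "expected_time M (map_pmf f p) \<le> (\<Sum>t. \<integral>\<^sup>+w. (if t < \<tau> w then 1 else 0) \<partial>measure_pmf p)"
    unfolding expected_time_def by (intro suminf_le) auto
  also have "\<dots> = (\<integral>\<^sup>+w. (\<Sum>t. (if t < \<tau> w then 1 else 0)) \<partial>measure_pmf p)"
    by (intro nn_integral_suminf[symmetric]) auto
  also have "\<dots> = (\<integral>\<^sup>+w. ennreal (real (\<tau> w)) \<partial>measure_pmf p)"
  proof (intro nn_integral_cong)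
    fix w
    have "(\<Sum>t. if t < \<tau> w then 1 else 0 :: ennreal) = (\<Sum>t\<in>{..<\<tau> w}. if t < \<tau> w then 1 else 0)"
      by (intro suminf_finite) auto
    also have "\<dots> = of_nat (\<tau> w)" by simp
    finally show "(\<Sum>t. if t < \<tau> w then 1 else 0) = ennreal (real (\<tau> w))" by (simp add: ennreal_of_nat_eq_real_of_nat)
  qed
  finally show ?thesis .
qed

lemma prob_halts_ge:
  assumes "\<And>w. w \<in> set_pmf p \<Longrightarrow> E w \<Longrightarrow> \<exists>s'. run M T (f w) = return_pmf ([], s') \<and> Q s'"
  shows "measure_pmf.prob p {w. E w} \<le> prob_halts_with M (map_pmf f p) Q"
proof -
  let ?A = "\<lambda>t. measure_pmf.prob (bind_pmf (map_pmf f p) (run M t)) {cf. halted cf \<and> Q (snd cf)}"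
  have "emeasure (measure_pmf p) {w. E w} = (\<integral>\<^sup>+w. indicator {w. E w} w \<partial>measure_pmf p)" by simp
  also have "\<dots> \<le> (\<integral>\<^sup>+w. emeasure (measure_pmf (run M T (f w))) {cf. halted cf \<and> Q (snd cf)} \<partial>measure_pmf p)"
  proof (intro nn_integral_mono_AE, simp add: AE_measure_pmf_iff, intro ballI)
    fix w assume w: "w \<in> set_pmf p"
    show "indicator {w. E w} w \<le> emeasure (measure_pmf (run M T (f w))) {cf. halted cf \<and> Q (snd cf)}"
    proof (cases "E w")
      case True
      then obtain s' where "run M T (f w) = return_pmf ([], s')" "Q s'" using assms[OF w] by blast
      then show ?thesis by (simp add: halted_def indicator_def)
    qed simp
  qed
  also have "\<dots> = emeasure (measure_pmf (bind_pmf (map_pmf f p) (run M T))) {cf. halted cf \<and> Q (snd cf)}"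
    by (simp add: bind_map_pmf emeasure_bind_pmf)
  finally have "measure_pmf.prob p {w. E w} \<le> ?A T" by (simp add: measure_pmf.emeasure_eq_measure)
  also have "\<dots> \<le> (SUP t. ?A t)"
    by (intro cSUP_upper bdd_aboveI[of _ 1]) auto
  finally show ?thesis unfolding prob_halts_with_def .
qed

section \<open>Success probability of a level\<close>

lemma outs_fst: "map fst (outs w X e k x) = rev [0..<k]"
  by (induction k arbitrary: x) (auto simp: Let_def)

text \<open>Entries carry their step numbers, so an entry of one list can occur in the other only at
  the same position. Thus different output lists always leave an address to resample in
  \<open>fingerprint_collision\<close>.\<close>

lemma outs_subset_eq:
  assumes "set (outs w X e k x) \<subseteq> set (outs w X e k y)"
  shows "outs w X e k x = outs w X e k y"
proof (rule nth_equalityI)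
  let ?x = "outs w X e k x" and ?y = "outs w X e k y"
  have len: "length ?x = k" "length ?y = k"
    using arg_cong[OF outs_fst, of length] by (metis length_map length_rev length_upt diff_zero)+
  then show "length ?x = length ?y" by simp
  have fst_nth: "fst (?x ! i) = k - Suc i" "fst (?y ! i) = k - Suc i" if "i < k" for i
    using arg_cong[OF outs_fst, of "\<lambda>l. l ! i"] len that by (metis nth_map rev_nth length_upt diff_zero nth_upt add_0 diff_less zero_less_Suc order_le_less_trans zero_le)+
  fix i assume "i < length ?x"
  then have i: "i < k" using len by simp
  then have "?x ! i \<in> set ?y" using assms len by auto
  then obtain j where j: "j < k" "?y ! j = ?x ! i" using len by (metis in_set_conv_nth)
  then have "k - Suc j = k - Suc i" using fst_nth i by metis
  then have "j = i" using i j by simp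
  then show "?x ! i = ?y ! i" using j by simp
qed

lemma markov_nat:
  fixes X :: "'a \<Rightarrow> nat" and c :: nat
  assumes fin: "finite (set_pmf p)" and c: "0 < c" and E: "measure_pmf.expectation p (\<lambda>x. real (X x)) \<le> e"
  shows "measure_pmf.prob p {x. \<not> X x \<le> c} \<le> e / real c"
proof -
  have int: "integrable p f" for f :: "'a \<Rightarrow> real" using fin by (rule integrable_measure_pmf_finite)
  have "real c * measure_pmf.prob p {x. \<not> X x \<le> c} =
      measure_pmf.expectation p (\<lambda>x. real c * (indicator {x. \<not> X x \<le> c} x :: real))" by simp
  also have "\<dots> \<le> measure_pmf.expectation p (\<lambda>x. real (X x))"
    by (intro integral_mono int) (auto simp: indicator_def)
  finally show ?thesis using c E by (simp add: field_simps)
qed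

context ann
begin

abbreviation "U \<equiv> {RB..<TB}"
abbreviation "prU E \<equiv> pr U m E"

definition "ss i = real (Xi i) / real m"
definition "qq i = 3 * (ss i)\<^sup>2 / (1 - (ss i)\<^sup>2)"

definition "bits t = {b. b < L + 6 \<and> bit (t::nat) b}"

lemma bits_sub: "bits t \<subseteq> {..<L + 6}" by (auto simp: bits_def)

lemma bits_inj:
  assumes "t < 64 * P" "t' < 64 * P" "bits t = bits t'" shows "t = t'"
proof -
  have "64 * P = 2 ^ (L + 6)" by (simp add: P_def power_add)
  then have t: "take_bit (L + 6) t = t" "take_bit (L + 6) t' = t'"
    using assms by (simp_all add: take_bit_nat_eq_self_iff)
  have "take_bit (L + 6) t = take_bit (L + 6) t'"
    using assms(3) by (intro bit_eqI) (auto simp: bit_take_bit_iff bits_def set_eq_iff)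
  then show ?thesis using t by simp
qed

lemma bits_0: "bits 0 = {}" by (simp add: bits_def)

definition "Zl l = (\<lambda>(k, a). rnd l (L + 6) k a) ` ({..<H} \<times> {..Suc sg})"

lemma rows_rnd:
  assumes "l < NL" shows "rows U m (L + 6) H sg (rnd l) (Zl l)"
proof
  show "finite U" "0 < m" by (auto simp: m0)
next
  fix b k a assume A: "b < L + 6" "k < H" "a \<le> sg"
  have "rnd l b k a \<noteq> rnd l (L + 6) k' a'" if "k' < H" "a' \<le> Suc sg" for k' a'
    using rnd_inj[of l b k a l "L + 6" k' a'] A that H_less P_ge by auto
  then show "rnd l b k a \<in> U \<and> rnd l b k a \<notin> Zl l"
    using rnd_bounds[OF assms, of b k a] A H_less P_ge by (auto simp: Zl_def)
next
  fix b k a b' k' a'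
  assume "b < L + 6" "k < H" "a \<le> sg" "b' < L + 6" "k' < H" "a' \<le> sg" "rnd l b k a = rnd l b' k' a'"
  then show "b = b' \<and> k = k' \<and> a = a'"
    using rnd_inj[of l b k a l b' k' a'] H_less P_ge by auto
qed

lemma lett_mix: "l < NL \<Longrightarrow> lett D l t = rows.mix m (rnd l) (bits t) D"
  using rows.mix_def[OF rows_rnd] by (auto simp: lett_def bits_def fun_eq_iff)

lemma letter_cells_rnd:
  assumes "l < NL" "b < L + 6" shows "letter_cells U m (Xi i) sg H (rnd l b)"
proof
  show "finite U" "0 < m" "2 * Xi i \<le> m" by (auto simp: m0 Xi_le)
next
  fix k a assume "k < H" "a \<le> sg"
  then show "rnd l b k a \<in> U" using rows.rI[OF rows_rnd[OF assms(1)] assms(2)] by blast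
next
  fix k a k' a' assume "k < H" "a \<le> sg" "k' < H" "a' \<le> sg" "rnd l b k a = rnd l b k' a'"
  then show "k = k' \<and> a = a'" using rows.inj[OF rows_rnd[OF assms(1)] assms(2) _ _ assms(2)] by blast
qed

definition "same l t i x y D \<longleftrightarrow> outs (lett D l t) (Xi i) sg H x = outs (lett D l t) (Xi i) sg H y"

context
  fixes l i :: nat and x y :: "nat list"
  assumes l: "l < NL" "l mod GI = i" and x: "set x \<subseteq> {..<sg}" "length x \<le> d" and y: "set y \<subseteq> {..<sg}" "length y \<le> d"
begin

interpretation R: rows U m "L + 6" H sg "rnd l" "Zl l" by (rule rows_rnd[OF l(1)])

lemma dep_same: "R.dep (\<lambda>w D. outs w (Xi i) sg H x = outs w (Xi i) sg H y)"
  unfolding R.dep_def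
proof (intro allI impI)
  fix w w' :: "nat \<Rightarrow> nat \<Rightarrow> nat" assume w: "\<forall>k<H. \<forall>a\<le>sg. w k a = w' k a"
  have "outs w (Xi i) sg H z = outs w' (Xi i) sg H z" if "set z \<subseteq> {..<sg}" for z
    using w that by (intro outs_cong) auto
  then show "(outs w (Xi i) sg H x = outs w (Xi i) sg H y) = (outs w' (Xi i) sg H x = outs w' (Xi i) sg H y)"
    using x y by simp
qed

lemma pr_same:
  assumes t: "1 \<le> t" "t < 64 * P"
  obtains b where "b < L + 6"
    "prU (same l t i x y) = prU (\<lambda>D. outs (\<lambda>k a. D (rnd l b k a)) (Xi i) sg H x = outs (\<lambda>k a. D (rnd l b k a)) (Xi i) sg H y)"
proof -
  have "bits t \<noteq> {}" using bits_inj[of t 0] t bits_0 P8 by auto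
  then obtain b where b: "b \<in> bits t" by auto
  then have "b < L + 6" using bits_sub by auto
  moreover have "prU (same l t i x y) = prU (\<lambda>D. outs (\<lambda>k a. D (rnd l b k a)) (Xi i) sg H x = outs (\<lambda>k a. D (rnd l b k a)) (Xi i) sg H y)"
    using R.mix_row[OF bits_sub b dep_same, of "\<lambda>_. True"] unfolding same_def lett_mix[OF l(1)] by simp
  ultimately show ?thesis using that by blast
qed

lemma same_near:
  assumes "1 \<le> t" "t < 64 * P"
  shows "(qq i / 3) ^ lev x y \<le> prU (same l t i x y)"
proof -
  obtain b where b: "b < L + 6"
    "prU (same l t i x y) = prU (\<lambda>D. outs (\<lambda>k a. D (rnd l b k a)) (Xi i) sg H x = outs (\<lambda>k a. D (rnd l b k a)) (Xi i) sg H y)"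
    using pr_same[OF assms] .
  interpret C: letter_cells U m "Xi i" sg H "rnd l b" by (rule letter_cells_rnd[OF l(1) b(1)])
  have e: "3 * u / v / 3 = u / v" for u v :: real by simp
  show ?thesis using C.agree_near[OF le_refl x(1) y(1)] unfolding b(2) qq_def ss_def C.s_def e .
qed

lemma power_aux: "2 ^ (length x + length y) * (3 / 4 :: real) ^ H \<le> 1 / P"
proof -
  have "2 ^ (length x + length y) * (3 / 4 :: real) ^ H \<le> 2 ^ (2 * d) * (3 / 4) ^ H"
    using x y by (intro mult_right_mono power_increasing) auto
  also have "\<dots> = 4 ^ d * ((3 / 4) ^ 5) ^ (d + L)" unfolding H_def power_mult by simp
  \<comment> \<open>Uses \<open>(3 / 4) ^ 5 = 243 / 1024 < 1 / 4\<close>.\<close>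
  also have "\<dots> \<le> 4 ^ d * (1 / 4) ^ (d + L)"
    by (intro mult_left_mono power_mono) (auto simp: eval_nat_numeral)
  also have "\<dots> = (1 / 4) ^ L" by (simp add: power_add power_divide)
  also have "\<dots> \<le> (1 / 2) ^ L" by (intro power_mono) auto
  also have "\<dots> = 1 / P" by (simp add: P_def power_divide)
  finally show ?thesis .
qed

text \<open>Equal fingerprints come from equal outputs or from a collision of the sums. The latter
  costs \<open>1 / P\<close>; the former costs the power of q and another \<open>1 / P\<close> for
  walks that are cut off.\<close>

lemma fpt_far:
  assumes t: "1 \<le> t" "t < 64 * P"
  shows "prU (\<lambda>D. fpt D l t x = fpt D l t y) \<le> qq i ^ lev x y + 2 / P"
proof -
  define u where "u z D = map (\<lambda>(k, a). rnd l (L + 6) k a) (outs (lett D l t) (Xi i) sg H z)" for z D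
  have fu: "fpt D l t z = sum_list (map D (u z D)) mod P" for D z
    unfolding fpt_def hsum_def u_def l(2) by (simp add: o_def case_prod_unfold)
  have ZU: "Zl l \<subseteq> U"
    using rnd_bounds[OF l(1), of "L + 6"] H_less P_ge by (auto simp: Zl_def)
  have ou: "set (outs (lett D l t) (Xi i) sg H z) \<subseteq> {..<H} \<times> {..Suc sg}" if "set z \<subseteq> {..<sg}" for D z
    using outs_bounds[OF that] by auto
  have injZ: "inj_on (\<lambda>(k, a). rnd l (L + 6) k a) ({..<H} \<times> {..Suc sg})"
  proof (rule inj_onI)
    fix p p' assume A: "p \<in> {..<H} \<times> {..Suc sg}" "p' \<in> {..<H} \<times> {..Suc sg}"
      "(case p of (k, a) \<Rightarrow> rnd l (L + 6) k a) = (case p' of (k, a) \<Rightarrow> rnd l (L + 6) k a)"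
    then show "p = p'"
      using rnd_inj[of l "L + 6" "fst p" "snd p" l "L + 6" "fst p'" "snd p'"] H_less P_ge
      by (auto simp: case_prod_unfold prod_eq_iff)
  qed
  have dist: "distinct (u z D)" if "set z \<subseteq> {..<sg}" for z D
  proof -
    have "distinct (map fst (outs (lett D l t) (Xi i) sg H z))" unfolding outs_fst by simp
    then have "distinct (outs (lett D l t) (Xi i) sg H z)" by (simp add: distinct_map)
    then show ?thesis unfolding u_def distinct_map using inj_on_subset[OF injZ ou[OF that]] by simp
  qed
  have uZ: "set (u z D) \<subseteq> Zl l" if "set z \<subseteq> {..<sg}" for z D
    unfolding u_def Zl_def set_map using ou[OF that] by (intro image_mono) auto
  have upd: "u z (D(j := v)) = u z D" if "j \<in> Zl l" "set z \<subseteq> {..<sg}" for z D j v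
  proof -
    have "lett (D(j := v)) l t k a = lett D l t k a" if ka: "k < H" "a \<le> sg" for k a
    proof -
      have "rnd l b k a \<noteq> j" if "b < L + 6" for b using R.rI[OF that ka] \<open>j \<in> Zl l\<close> by auto
      then show ?thesis unfolding lett_def by (intro arg_cong[where f = "\<lambda>s. s mod m"] sum.cong) auto
    qed
    then have "outs (lett (D(j := v)) l t) (Xi i) sg H z = outs (lett D l t) (Xi i) sg H z"
      using that(2) by (intro outs_cong) auto
    then show ?thesis by (simp add: u_def)
  qed
  have eq: "same l t i x y D" if "set (u x D) \<subseteq> set (u y D)" for D
  proof -
    have "set (outs (lett D l t) (Xi i) sg H x) \<subseteq> set (outs (lett D l t) (Xi i) sg H y)"
      using that inj_on_image_subset_iff[OF injZ ou[OF x(1)] ou[OF y(1)]] unfolding u_def set_map by simp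
    then show ?thesis unfolding same_def by (rule outs_subset_eq)
  qed
  have us: "u x D = u y D \<longleftrightarrow> same l t i x y D" for D
  proof
    assume "u x D = u y D"
    then show "same l t i x y D" by (intro eq) simp
  qed (simp add: u_def same_def)
  have Pm: "P dvd m" unfolding m_def by simp
  have fp: "prU (\<lambda>D. u x D \<noteq> u y D \<and> sum_list (map D (u x D)) mod P = sum_list (map D (u y D)) mod P) \<le> 1 / P"
    using P8 m0 Pm ZU dist[OF x(1)] uZ[OF x(1)] upd[OF _ x(1)] upd[OF _ y(1)] eq us
    by (intro fingerprint_collision[where Z = "Zl l"]) auto
  have "prU (\<lambda>D. fpt D l t x = fpt D l t y) \<le>
      prU (same l t i x y) + prU (\<lambda>D. u x D \<noteq> u y D \<and> sum_list (map D (u x D)) mod P = sum_list (map D (u y D)) mod P)"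
  proof -
    have "{D. fpt D l t x = fpt D l t y} \<subseteq> {D. same l t i x y D} \<union>
        {D. u x D \<noteq> u y D \<and> sum_list (map D (u x D)) mod P = sum_list (map D (u y D)) mod P}"
      unfolding fu us by auto
    then show ?thesis
      by (rule order_trans[OF measure_pmf.finite_measure_mono measure_Un_le]) auto
  qed
  moreover have "prU (same l t i x y) \<le> qq i ^ lev x y + 1 / P"
  proof -
    obtain b where b: "b < L + 6"
      "prU (same l t i x y) = prU (\<lambda>D. outs (\<lambda>k a. D (rnd l b k a)) (Xi i) sg H x = outs (\<lambda>k a. D (rnd l b k a)) (Xi i) sg H y)"
      using pr_same[OF t] .
    interpret C: letter_cells U m "Xi i" sg H "rnd l b" by (rule letter_cells_rnd[OF l(1) b(1)])
    show ?thesis using C.agree_far[OF le_refl x(1) y(1)] power_aux unfolding b(2) qq_def ss_def C.s_def by simp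
  qed
  ultimately show ?thesis using fp by simp
qed

lemma same_indep:
  assumes "1 \<le> t" "t < 64 * P" "1 \<le> t'" "t' < 64 * P" "t \<noteq> t'"
  shows "prU (\<lambda>D. same l t i x y D \<and> same l t' i x y D) = prU (same l t i x y) * prU (same l t' i x y)"
proof -
  have "bits t \<noteq> {}" "bits t' \<noteq> {}" "bits t \<noteq> bits t'"
    using bits_inj[of t 0] bits_inj[of t' 0] bits_inj[of t t'] assms bits_0 P8 by auto
  then show ?thesis
    using R.mix_indep[OF bits_sub bits_sub _ _ _ dep_same dep_same] unfolding same_def lett_mix[OF l(1)] by simp
qed

end

text \<open>The constants give 1/20 + 1/20. The expected number of tables in which the near string
  has equal outputs is at least 40 * 2^JJ * q^r \<ge> 20, so the second moment bound is 1/20. A far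
  string collides in a table with probability at most \<open>3 / P\<close>, so at most
  \<open>40 * Ts r * n * 3 / P \<le> 120 * Ts r\<close> false candidates are expected, and Markov's
  inequality against \<open>2400 * Ts r\<close> gives 1/20.\<close>

lemma hit_failure:
  assumes q: "set q \<subseteq> {..<sg}" "length q \<le> d"
    and xs: "\<And>j. j < n \<Longrightarrow> set (xs ! j) \<subseteq> {..<sg} \<and> length (xs ! j) \<le> d"
    and j0: "j0 < n" "lev q (xs ! j0) \<le> r" and Ts: "Ts r \<le> P" and i: "i < GI"
    and g: "\<And>k. N * r < k * n \<Longrightarrow> qq i ^ k \<le> 1 / P" "1 \<le> 2 * 2 ^ JJ * qq i ^ r" "0 \<le> qq i" "qq i \<le> 1"
  shows "prU (\<lambda>D. \<not> Hit D q xs (Kr r) (40 * Ts r) (2400 * Ts r) (r * GI + i)) \<le> 1 / 10"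
proof -
  let ?l = "r * GI + i" and ?T = "40 * Ts r" and ?K = "Kr r"
  have l: "?l < NL" "?l mod GI = i"
    using mixed_radix_less[of r "L + 1" i GI] Ts_level[OF Ts] i by (auto simp: NL_def)
  have tP: "t < 64 * P" if "t \<in> {1..?T}" for t using that Ts P8 by auto
  have T0: "0 < Ts r" by (simp add: Ts_def)
  have fin: "finite (set_pmf (unif U m))" using m0 by (intro finite_set_unif) auto
  have int: "integrable (unif U m) f" for f :: "_ \<Rightarrow> real" using fin by (rule integrable_measure_pmf_finite)
  let ?A = "\<lambda>t D. same ?l t i q (xs ! j0) D"
  have near: "prU (\<lambda>D. \<forall>t\<in>{1..?T}. \<not> ?A t D) \<le> 1 / 20"
  proof (rule second_moment[OF fin])
    show "prU (\<lambda>D. ?A t D \<and> ?A t' D) = prU (?A t) * prU (?A t')" if "t \<in> {1..?T}" "t' \<in> {1..?T}" "t \<noteq> t'" for t t'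
      using that tP by (intro same_indep[OF l q]) (auto simp: xs j0)
    have "(20::real) \<le> ?T * (qq i / 3) ^ r"
    proof -
      have "(20::real) \<le> 20 * (2 * 2 ^ JJ * qq i ^ r)" using g(2) by linarith
      also have "\<dots> = ?T * (qq i / 3) ^ r" by (simp add: Ts_def power_divide)
      finally show ?thesis .
    qed
    also have "\<dots> = (\<Sum>t\<in>{1..?T}. (qq i / 3) ^ r)" by simp
    also have "\<dots> \<le> (\<Sum>t\<in>{1..?T}. prU (?A t))"
    proof (rule sum_mono)
      fix t assume t: "t \<in> {1..?T}"
      have "(qq i / 3) ^ r \<le> (qq i / 3) ^ lev q (xs ! j0)" using g j0 by (intro power_decreasing) auto
      also have "\<dots> \<le> prU (?A t)" using t tP xs[OF j0(1)] by (intro same_near[OF l q]) auto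
      finally show "(qq i / 3) ^ r \<le> prU (?A t)" .
    qed
    finally show "20 \<le> (\<Sum>t\<in>{1..?T}. prU (?A t))" .
  qed auto
  let ?X = "\<lambda>D. \<Sum>t\<in>{1..?T}. card {j \<in> Coll D q xs ?l t. ?K < lev q (xs ! j)}"
  let ?J = "{j. j < n \<and> ?K < lev q (xs ! j)}"
  have EX: "measure_pmf.expectation (unif U m) (\<lambda>D. real (?X D)) \<le> 120 * Ts r"
  proof -
    have X: "real (?X D) = (\<Sum>t\<in>{1..?T}. \<Sum>j\<in>?J. indicator {D. fpt D ?l t (xs ! j) = fpt D ?l t q} D)" for D
    proof -
      have "{j \<in> Coll D q xs ?l t. ?K < lev q (xs ! j)} = {j\<in>?J. fpt D ?l t (xs ! j) = fpt D ?l t q}" for t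
        by (auto simp: Coll_def)
      then show ?thesis by (simp add: indicator_def sum.If_cases Int_def)
    qed
    have "measure_pmf.expectation (unif U m) (\<lambda>D. real (?X D)) =
        (\<Sum>t\<in>{1..?T}. \<Sum>j\<in>?J. prU (\<lambda>D. fpt D ?l t (xs ! j) = fpt D ?l t q))"
      unfolding X using int by (simp add: Bochner_Integration.integral_sum)
    also have "\<dots> \<le> (\<Sum>t\<in>{1..?T}. \<Sum>j\<in>?J. 3 / P)"
    proof (intro sum_mono)
      fix t j assume t: "t \<in> {1..?T}" and j: "j \<in> ?J"
      have "N * r < lev q (xs ! j) * n"
      proof -
        have "N * r div n < lev q (xs ! j)" using j by (simp add: Kr_def)
        then show ?thesis using n1 by (simp add: div_less_iff_less_mult)
      qed
      then have "qq i ^ lev q (xs ! j) \<le> 1 / P" by (rule g)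
      moreover have "prU (\<lambda>D. fpt D ?l t q = fpt D ?l t (xs ! j)) \<le> qq i ^ lev q (xs ! j) + 2 / P"
        using t j tP xs[of j] by (intro fpt_far[OF l q]) auto
      ultimately show "prU (\<lambda>D. fpt D ?l t (xs ! j) = fpt D ?l t q) \<le> 3 / P" by (simp add: eq_commute)
    qed
    also have "\<dots> = ?T * (card ?J * (3 / P))" by simp
    also have "\<dots> \<le> ?T * (P * (3 / P))"
    proof -
      have "card ?J \<le> card {..<n}" by (intro card_mono) auto
      then have "real (card ?J) \<le> P" using P_ge by simp
      then show ?thesis by (intro mult_left_mono mult_right_mono) auto
    qed
    also have "\<dots> = 120 * Ts r" using P8 by simp
    finally show ?thesis .
  qed
  have far: "prU (\<lambda>D. \<not> ?X D \<le> 2400 * Ts r) \<le> 1 / 20"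
  proof -
    have "prU (\<lambda>D. \<not> ?X D \<le> 2400 * Ts r) \<le> 120 * Ts r / real (2400 * Ts r)"
      by (rule markov_nat[OF fin _ EX]) (use T0 in simp)
    then show ?thesis using T0 by simp
  qed
  have "{D. \<not> Hit D q xs ?K ?T (2400 * Ts r) ?l} \<subseteq> {D. \<forall>t\<in>{1..?T}. \<not> ?A t D} \<union> {D. \<not> ?X D \<le> 2400 * Ts r}"
  proof
    fix D assume "D \<in> {D. \<not> Hit D q xs ?K ?T (2400 * Ts r) ?l}"
    then have nh: "\<not> Hit D q xs ?K ?T (2400 * Ts r) ?l" by simp
    show "D \<in> {D. \<forall>t\<in>{1..?T}. \<not> ?A t D} \<union> {D. \<not> ?X D \<le> 2400 * Ts r}"
    proof (rule ccontr)
      assume "D \<notin> {D. \<forall>t\<in>{1..?T}. \<not> ?A t D} \<union> {D. \<not> ?X D \<le> 2400 * Ts r}"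
      then obtain t where t: "t \<in> {1..?T}" "?A t D" and X: "?X D \<le> 2400 * Ts r" by auto
      have "fpt D ?l t (xs ! j0) = fpt D ?l t q" using t(2) l(2) by (simp add: same_def fpt_def hsum_def)
      then have "j0 \<in> Coll D q xs ?l t" using j0 by (simp add: Coll_def)
      moreover have "lev q (xs ! j0) \<le> ?K" using j0 r_le_Kr[of r] by simp
      ultimately show False using nh t(1) X unfolding Hit_def by blast
    qed
  qed
  then have "prU (\<lambda>D. \<not> Hit D q xs ?K ?T (2400 * Ts r) ?l) \<le>
      prU (\<lambda>D. \<forall>t\<in>{1..?T}. \<not> ?A t D) + prU (\<lambda>D. \<not> ?X D \<le> 2400 * Ts r)"
    by (rule order_trans[OF measure_pmf.finite_measure_mono measure_Un_le]) auto
  then show ?thesis using near far by simp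
qed

end

subsection \<open>The grid of thresholds\<close>

text \<open>Shrinking s by b costs b^2 in the numerator of s^2 / (1 - s^2); the other b^2 pays for
  the larger denominator.\<close>

lemma ratio_step:
  fixes a b s t :: real
  assumes "0 \<le> s" "s \<le> 1 / 2" "0 \<le> b" "b \<le> 1" "b * s \<le> t" "t \<le> s"
  shows "b ^ 4 * (3 * s\<^sup>2 / (1 - s\<^sup>2)) \<le> 3 * t\<^sup>2 / (1 - t\<^sup>2)"
proof -
  have s2: "s\<^sup>2 \<le> 1 / 4" using power_mono[of s "1/2" 2] assms by (simp add: power2_eq_square)
  have t0: "0 \<le> t" using assms by (meson mult_nonneg_nonneg order_trans)
  have bs: "(b * s)\<^sup>2 \<le> t\<^sup>2" using assms by (intro power_mono) auto
  have ts: "t\<^sup>2 \<le> s\<^sup>2" using assms t0 by (intro power_mono) auto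
  have b2: "b\<^sup>2 \<le> 1" "0 \<le> b\<^sup>2" using assms by (auto simp: power_le_one)
  \<comment> \<open>The difference of the sides factors as (1 - b^2) (1 - s^2 (1 + b^2)), and both
    factors are nonnegative since s^2 \<le> 1/4.\<close>
  have "b\<^sup>2 * (1 - b\<^sup>2 * s\<^sup>2) \<le> 1 - s\<^sup>2"
  proof -
    have "s\<^sup>2 * (1 + b\<^sup>2) \<le> 1 / 4 * 2" using s2 b2 by (intro mult_mono) auto
    then have "0 \<le> (1 - b\<^sup>2) * (1 - s\<^sup>2 * (1 + b\<^sup>2))" using b2 by (intro mult_nonneg_nonneg) auto
    then show ?thesis by (simp add: algebra_simps power2_eq_square)
  qed
  moreover have bs1: "b\<^sup>2 * s\<^sup>2 \<le> 1 / 4" using mult_mono[OF b2(1) s2] by simp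
  ultimately have "b ^ 4 * s\<^sup>2 / (1 - s\<^sup>2) \<le> b\<^sup>2 * s\<^sup>2 / (1 - b\<^sup>2 * s\<^sup>2)"
  proof -
    assume *: "b\<^sup>2 * (1 - b\<^sup>2 * s\<^sup>2) \<le> 1 - s\<^sup>2"
    have "b ^ 4 * s\<^sup>2 * (1 - b\<^sup>2 * s\<^sup>2) = (b\<^sup>2 * s\<^sup>2) * (b\<^sup>2 * (1 - b\<^sup>2 * s\<^sup>2))"
      by (simp add: power2_eq_square power4_eq_xxxx algebra_simps)
    also have "\<dots> \<le> (b\<^sup>2 * s\<^sup>2) * (1 - s\<^sup>2)" using * by (intro mult_left_mono) auto
    finally show ?thesis using s2 bs1 by (simp add: divide_simps)
  qed
  also have "\<dots> \<le> t\<^sup>2 / (1 - t\<^sup>2)"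
    using bs ts s2 by (intro frac_le) (auto simp: power_mult_distrib)
  finally have "3 * (b ^ 4 * s\<^sup>2 / (1 - s\<^sup>2)) \<le> 3 * (t\<^sup>2 / (1 - t\<^sup>2))" by simp
  then show ?thesis by (simp add: mult.commute mult.left_commute)
qed

context ann
begin

lemma Xi_Suc: "Xi (Suc i) = Xi i - Xi i div G" by (simp add: Xi_def)

lemma ss_bounds: "0 \<le> ss i" "ss i \<le> 1 / 2"
  using Xi_le[of i] m0 unfolding ss_def by (auto simp: field_simps)

lemma qq_bounds: "0 \<le> qq i" "qq i \<le> 1" "qq i \<le> 4 * (ss i)\<^sup>2"
proof -
  have s2: "0 \<le> (ss i)\<^sup>2" "(ss i)\<^sup>2 \<le> 1 / 4"
    using ss_bounds[of i] power_mono[of "ss i" "1/2" 2] by (auto simp: power2_eq_square)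
  then show "0 \<le> qq i" "qq i \<le> 1" by (auto simp: qq_def field_simps)
  have "4 * (ss i)\<^sup>2 * (1 - (ss i)\<^sup>2) \<ge> 4 * (ss i)\<^sup>2 * (3 / 4)" using s2 by (intro mult_left_mono) auto
  then show "qq i \<le> 4 * (ss i)\<^sup>2" using s2 by (simp add: qq_def divide_simps)
qed

lemma qq_step: "(1 - 1 / G) ^ 4 * qq i \<le> qq (Suc i)"
  unfolding qq_def
proof (rule ratio_step)
  have G: "0 < G" using L_ge by (simp add: G_def)
  show "0 \<le> ss i" "ss i \<le> 1 / 2" by (rule ss_bounds)+
  show "0 \<le> 1 - 1 / real G" "1 - 1 / real G \<le> 1" using G by auto
  have "real (Xi i div G) \<le> Xi i / G" by (rule of_nat_div_le_of_nat)
  then have "(1 - 1 / G) * Xi i \<le> real (Xi i) - real (Xi i div G)" by (simp add: algebra_simps)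
  also have "\<dots> = Xi (Suc i)" unfolding Xi_Suc by (simp add: of_nat_diff)
  finally have "(1 - 1 / G) * Xi i / m \<le> Xi (Suc i) / m" by (rule divide_right_mono) simp
  then show "(1 - 1 / G) * ss i \<le> ss (Suc i)" unfolding ss_def by (simp only: times_divide_eq_right)
  show "ss (Suc i) \<le> ss i" unfolding ss_def Xi_Suc by (intro divide_right_mono) auto
qed

text \<open>Rounding loses less than 1 in \<open>Xi i div G\<close>. Above \<open>2 * G\<close> this
  is at most half of \<open>Xi i / G\<close>, so the decay rate is at least
  \<open>1 / (2 * G)\<close>; below, the sequence merely stays small.\<close>

lemma Xi_decay: "real (Xi i) \<le> max (2 * real G) (m / 2 * (1 - 1 / (2 * G)) ^ i)"
proof (induction i)
  case (Suc i)
  have G: "1 \<le> real G" using L_ge by (simp add: G_def)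
  show ?case
  proof (cases "real (Xi i) \<le> 2 * G")
    case True
    then show ?thesis unfolding Xi_Suc by simp
  next
    case False
    then have *: "real (Xi i) \<le> m / 2 * (1 - 1 / (2 * G)) ^ i" using Suc by simp
    have "real (Xi i) < G * real (Suc (Xi i div G))"
      using div_less_iff_less_mult[of G "Xi i" "Suc (Xi i div G)"] G by (metis dividend_less_times_div less_le_trans mult_Suc_right add.commute of_nat_less_iff of_nat_mult of_nat_0_less_iff zero_less_one order_refl mult.commute)
    then have "real (Xi i) / G \<le> real (Xi i div G) + 1" using G by (simp add: field_simps)
    then have "real (Xi (Suc i)) \<le> Xi i - Xi i / G + 1" unfolding Xi_Suc by (simp add: of_nat_diff)
    also have "\<dots> \<le> Xi i - Xi i / G + Xi i / (2 * G)" using False G by (simp add: field_simps)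
    also have "\<dots> = Xi i * (1 - 1 / (2 * G))" using G by (simp add: field_simps)
    also have "\<dots> \<le> m / 2 * (1 - 1 / (2 * G)) ^ i * (1 - 1 / (2 * G))"
      using * G by (intro mult_right_mono) auto
    also have "\<dots> = m / 2 * (1 - 1 / (2 * G)) ^ Suc i" by simp
    finally show ?thesis by (rule max.coboundedI2)
  qed
qed (simp add: Xi_def real_of_nat_div)

text \<open>Every \<open>2 * G\<close> steps at least halve the bound of \<open>Xi_decay\<close>, so
  after \<open>L\<close> such blocks s is at most \<open>1 / (2 * P)\<close>, and q \<le> 4
  s^2.\<close>

lemma qq_last: "qq (2 * G * L) \<le> 1 / P\<^sup>2"
proof -
  let ?x = "1 / (2 * real G)"
  have G: "1 \<le> real G" using L_ge by (simp add: G_def)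
  have x0: "- 1 \<le> ?x" by (rule order_trans[of _ 0]) auto
  \<comment> \<open>Bernoulli's inequality gives \<open>2 \<le> (1 + ?x) ^ (2 * G)\<close>, and the
    product with \<open>(1 - ?x) ^ (2 * G)\<close> is at most 1.\<close>
  have "(1 - ?x) ^ (2 * G) * 2 \<le> (1 - ?x) ^ (2 * G) * (1 + ?x) ^ (2 * G)"
    using G Bernoulli_inequality[OF x0, of "2 * G"] by (intro mult_left_mono) auto
  also have "\<dots> = ((1 - ?x) * (1 + ?x)) ^ (2 * G)" by (simp add: power_mult_distrib)
  also have "\<dots> \<le> 1"
  proof (rule power_le_one)
    show "0 \<le> (1 - ?x) * (1 + ?x)" using G by (intro mult_nonneg_nonneg) auto
    have "(1 - ?x) * (1 + ?x) = 1 - ?x * ?x" by (simp add: algebra_simps)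
    then show "(1 - ?x) * (1 + ?x) \<le> 1" using zero_le_square[of ?x] by linarith
  qed
  finally have "(1 - ?x) ^ (2 * G) \<le> 1 / 2" by simp
  then have "((1 - ?x) ^ (2 * G)) ^ L \<le> (1 / 2) ^ L" using G by (intro power_mono) auto
  also have "\<dots> = 1 / P" by (simp add: P_def power_divide)
  finally have e: "(1 - ?x) ^ (2 * G * L) \<le> 1 / P" by (simp add: power_mult)
  \<comment> \<open>The floor left by rounding lies below the target; here the size of
    \<open>m\<close> matters.\<close>
  have "2 * real G \<le> m / (2 * P)"
  proof -
    have "32 * L * P \<le> (P * P) * P * P" using L_less P8 mult_mono[of 8 P 8 P] by (intro mult_mono) auto
    then have "4 * G * P \<le> m" by (simp add: G_def m_def eval_nat_numeral ac_simps)
    then have "real (4 * G * P) \<le> m" by (rule of_nat_mono)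
    then show ?thesis using P8 by (simp add: field_simps)
  qed
  moreover have "m / 2 * (1 - ?x) ^ (2 * G * L) \<le> m / 2 * (1 / P)" using e by (intro mult_left_mono) auto
  ultimately have "real (Xi (2 * G * L)) \<le> m / (2 * P)" using Xi_decay[of "2 * G * L"] by simp
  then have "ss (2 * G * L) \<le> 1 / (2 * P)" unfolding ss_def using m0 P8 by (simp add: field_simps)
  then have "(ss (2 * G * L))\<^sup>2 \<le> (1 / (2 * P))\<^sup>2" using ss_bounds by (intro power_mono) auto
  then have "4 * (ss (2 * G * L))\<^sup>2 \<le> 4 * (1 / (2 * P))\<^sup>2" by simp
  also have "\<dots> = 1 / P\<^sup>2" by (simp add: power2_eq_square)
  finally show ?thesis using qq_bounds(3)[of "2 * G * L"] by linarith
qed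

text \<open>The first grid point with \<open>2 ^ JJ * qq i ^ r \<le> 1\<close> works. Being below 1
  suppresses far strings by the choice of \<open>JJ\<close>; its predecessor is above 1 and one grid
  step costs at most a factor 2, so near strings still collide often enough.\<close>

lemma grid:
  assumes r: "r \<le> L"
  shows "\<exists>i<GI. (\<forall>k. N * r < k * n \<longrightarrow> qq i ^ k \<le> 1 / P) \<and> 1 \<le> 2 * 2 ^ JJ * qq i ^ r"
proof -
  let ?i = "2 * G * L"
  have "0 < L * L" using L_ge by simp
  then have iGI: "?i < GI" by (simp add: G_def GI_def)
  have PP: "1 / (real P)\<^sup>2 \<le> 1 / P" using P8 by (simp add: power2_eq_square field_simps)
  show ?thesis
  proof (cases "r = 0")
    \<comment> \<open>Exact search: the power of q for the near string is 1, so the smallest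
      threshold is best.\<close>
    case True
    have "qq ?i ^ k \<le> 1 / P" if "N * r < k * n" for k
    proof -
      have "k \<noteq> 0" using that by (cases k) auto
      then have "qq ?i ^ k \<le> qq ?i ^ 1" using qq_bounds by (intro power_decreasing) auto
      then show ?thesis using qq_last PP by simp
    qed
    moreover have "1 \<le> 2 * (2::real) ^ JJ" using one_le_power[of "2::real" JJ] by linarith
    ultimately show ?thesis using iGI True by (intro exI[of _ ?i]) auto
  next
    case False
    let ?p = "\<lambda>i. 2 ^ JJ * qq i ^ r \<le> 1"
    have "?p ?i"
    proof -
      have "qq ?i ^ r \<le> qq ?i ^ 1" using qq_bounds False by (intro power_decreasing) auto
      then have "2 ^ JJ * qq ?i ^ r \<le> 2 ^ (L + 1) * (1 / (real P)\<^sup>2)"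
        using qq_last JJ_bounds(2) qq_bounds(1) by (intro mult_mono power_increasing) auto
      also have "(2::real) ^ (L + 1) = 2 * real P" by (simp add: P_def)
      also have "2 * real P * (1 / (real P)\<^sup>2) = 2 / real P" by (simp add: power2_eq_square)
      also have "\<dots> \<le> 1" using P8 by simp
      finally show ?thesis .
    qed
    define i where "i = (LEAST i. ?p i)"
    have i: "?p i" "i \<le> ?i" unfolding i_def using LeastI[of ?p, OF \<open>?p ?i\<close>] Least_le[of ?p, OF \<open>?p ?i\<close>] by auto
    have g1: "qq i ^ k \<le> 1 / P" if k: "N * r < k * n" for k
    proof -
      have q: "qq i ^ r \<le> (1 / 2) ^ JJ" using i(1) by (simp add: power_divide field_simps)
      \<comment> \<open>Raising to the power \<open>r * n\<close> turns the rational exponents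
        \<open>k / r\<close> and \<open>N / n\<close> into integers.\<close>
      have "(qq i ^ k) ^ (r * n) = (qq i ^ r) ^ (k * n)" by (simp flip: power_mult add: ac_simps)
      also have "\<dots> \<le> ((1 / 2) ^ JJ) ^ (k * n)" using q qq_bounds by (intro power_mono) auto
      also have "\<dots> \<le> ((1 / 2) ^ JJ) ^ (N * r)" using k by (intro power_decreasing) (auto simp: power_le_one)
      also have "\<dots> = (1 / 2) ^ (JJ * N * r)" by (simp flip: power_mult add: ac_simps)
      also have "\<dots> \<le> (1 / 2) ^ (L * n * r)" using JJ_bounds(1) by (intro power_decreasing mult_right_mono) auto
      also have "\<dots> = (1 / P) ^ (r * n)" by (simp add: P_def power_divide ac_simps flip: power_mult)
      finally have "(qq i ^ k) ^ (r * n) \<le> (1 / P) ^ (r * n)" .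
      moreover have "0 < r * n" using False n1 by simp
      ultimately show ?thesis using power_mono_iff[of "qq i ^ k" "1 / P" "r * n"] qq_bounds[of i] by simp
    qed
    have "1 \<le> 2 * 2 ^ JJ * qq i ^ r"
    proof (cases i)
      case 0
      \<comment> \<open>The first grid point has no predecessor, but there s is exactly 1/2 and q =
        1.\<close>
      have "even m" using L_ge unfolding m_def P_def by simp
      then have h: "ss 0 = 1 / 2" using m0 unfolding ss_def Xi_def by (auto elim!: evenE)
      have "qq i = 1" unfolding qq_def 0 h by (simp add: power2_eq_square)
      then show ?thesis by (simp add: order_trans[of 1 "2 :: real"])
    next
      case (Suc i')
      have G: "1 \<le> real G" using L_ge by (simp add: G_def)
      have "\<not> ?p i'" using not_less_Least[of i' ?p] Suc unfolding i_def by simp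
      then have "1 / 2 \<le> 1 / 2 * (2 ^ JJ * qq i' ^ r)" by simp
      also have "\<dots> \<le> (1 - 1 / G) ^ (4 * r) * (2 ^ JJ * qq i' ^ r)"
      proof (rule mult_right_mono)
        have "1 - real (4 * r) * (1 / G) \<le> (1 - 1 / G) ^ (4 * r)"
          using Bernoulli_inequality[of "- (1 / real G)" "4 * r"] G by simp
        \<comment> \<open>This is where \<open>G = 8 * L\<close> and \<open>r \<le> L\<close>
          enter.\<close>
        moreover have "real (4 * r) * (1 / G) \<le> 1 / 2" using r L_ge by (simp add: G_def field_simps)
        ultimately show "1 / 2 \<le> (1 - 1 / G) ^ (4 * r)" by linarith
      qed (use qq_bounds in auto)
      also have "\<dots> = 2 ^ JJ * ((1 - 1 / G) ^ 4 * qq i') ^ r" by (simp add: power_mult_distrib flip: power_mult)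
      also have "\<dots> \<le> 2 ^ JJ * qq i ^ r"
        using qq_step[of i'] G qq_bounds[of i'] unfolding Suc by (intro mult_left_mono power_mono) auto
      finally show ?thesis by simp
    qed
    then show ?thesis using g1 i iGI by (intro exI[of _ i]) auto
  qed
qed

subsection \<open>Independence of the levels\<close>

text \<open>All random cells owned by the thresholds of level \<open>r\<close>.\<close>

definition "Blk r = (\<lambda>(l, b, k, a). rnd l b k a) ` ({r * GI..<Suc r * GI} \<times> {..<L + 7} \<times> {..<16 * P} \<times> {..<P})"

lemma Blk_mem: "i < GI \<Longrightarrow> b < L + 7 \<Longrightarrow> k < 16 * P \<Longrightarrow> a < P \<Longrightarrow> rnd (r * GI + i) b k a \<in> Blk r"
  unfolding Blk_def by (rule image_eqI[where x = "(r * GI + i, b, k, a)"]) auto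

lemma Blk_U: "r \<le> L \<Longrightarrow> Blk r \<subseteq> U"
proof -
  assume "r \<le> L"
  then have "Suc r * GI \<le> NL" unfolding NL_def by (intro mult_right_mono) auto
  then show ?thesis using rnd_bounds by (fastforce simp: Blk_def)
qed

lemma Blk_disjoint: "r \<noteq> r' \<Longrightarrow> Blk r \<inter> Blk r' = {}"
proof -
  assume r: "r \<noteq> r'"
  have "l div GI = r" if "l \<in> {r * GI..<Suc r * GI}" for l r
    using that by (intro div_nat_eqI) (auto simp: mult.commute)
  then have "l \<noteq> l'" if "l \<in> {r * GI..<Suc r * GI}" "l' \<in> {r' * GI..<Suc r' * GI}" for l l'
    using that r by metis
  then have "rnd l b k a \<noteq> rnd l' b' k' a'"
    if "l \<in> {r * GI..<Suc r * GI}" "l' \<in> {r' * GI..<Suc r' * GI}" "b < L + 7" "k < 16 * P" "a < P" "b' < L + 7" "k' < 16 * P" "a' < P"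
    for l l' b b' k k' a a' using rnd_inj[of l b k a l' b' k' a'] that by blast
  then show ?thesis unfolding Blk_def by force
qed

lemma level_ok_cong:
  assumes "\<And>a. a \<in> Blk r \<Longrightarrow> D a = D' a" "set q \<subseteq> {..<sg}" "\<And>j. j < n \<Longrightarrow> set (xs ! j) \<subseteq> {..<sg}"
  shows "level_ok D q xs r = level_ok D' q xs r"
proof -
  have "fpt D (r * GI + i) t x = fpt D' (r * GI + i) t x" if "i < GI" "set x \<subseteq> {..<sg}" for i t x
    using that by (intro fpt_cong_rnd assms(1) Blk_mem)
  then have "Coll D q xs (r * GI + i) t = Coll D' q xs (r * GI + i) t" if "i < GI" for i t
    using that assms(2,3) by (auto simp: Coll_def)
  then have "Hit D q xs K T B (r * GI + i) = Hit D' q xs K T B (r * GI + i)" if "i < GI" for K T B i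
    using that by (simp add: Hit_def)
  then show ?thesis unfolding level_ok_def by auto
qed

context
  fixes q :: "nat list" and xs :: "nat list list" and r0 :: nat
  assumes q: "set q \<subseteq> {..<sg}" "length q \<le> d"
    and xs: "\<And>j. j < n \<Longrightarrow> set (xs ! j) \<subseteq> {..<sg} \<and> length (xs ! j) \<le> d"
    and near: "\<exists>j<n. lev q (xs ! j) \<le> r0"
begin

lemma level_failure:
  assumes "r0 \<le> r" "Ts r \<le> P"
  shows "prU (\<lambda>D. \<not> level_ok D q xs r) \<le> 1 / 10"
proof -
  obtain j0 where j0: "j0 < n" "lev q (xs ! j0) \<le> r0" using near by auto
  obtain i where i: "i < GI" "\<And>k. N * r < k * n \<Longrightarrow> qq i ^ k \<le> 1 / P" "1 \<le> 2 * 2 ^ JJ * qq i ^ r"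
    using grid[OF Ts_level[OF assms(2)]] by blast
  have "prU (\<lambda>D. \<not> level_ok D q xs r) \<le> prU (\<lambda>D. \<not> Hit D q xs (Kr r) (40 * Ts r) (2400 * Ts r) (r * GI + i))"
    using i(1) assms(2) by (intro pr_mono) (auto simp: level_ok_def)
  also have "\<dots> \<le> 1 / 10"
    using hit_failure[OF q xs j0(1) _ assms(2) i(1,2,3) qq_bounds(1,2)] j0(2) assms(1) by simp
  finally show ?thesis .
qed

text \<open>The events of different levels read disjoint blocks, hence their probabilities multiply.
  The string within \<open>r0\<close> is also within every larger radius, so each level from
  \<open>r0\<close> on fails with probability at most 1/10.\<close>

lemma levels_failure:
  assumes "r0 \<le> R" "\<And>r. r < R \<Longrightarrow> Ts r \<le> P"
  shows "prU (\<lambda>D. \<forall>r\<in>{r0..<R}. \<not> level_ok D q xs r) \<le> (1 / 10) ^ (R - r0)"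
  using assms
proof (induction "R - r0" arbitrary: R)
  case 0
  then show ?case by (simp add: pr_le_1)
next
  case (Suc k)
  then obtain R' where R: "R = Suc R'" "r0 \<le> R'" by (cases R) auto
  have TsR: "Ts R' \<le> P" using Suc.prems R by simp
  let ?B = "\<Union>r\<in>{r0..<R'}. Blk r"
  have "prU (\<lambda>D. \<forall>r\<in>{r0..<R}. \<not> level_ok D q xs r) = prU (\<lambda>D. \<not> level_ok D q xs R' \<and> (\<forall>r\<in>{r0..<R'}. \<not> level_ok D q xs r))"
    using R by (intro arg_cong[where f = "measure_pmf.prob _"]) (auto simp: less_Suc_eq)
  also have "\<dots> = prU (\<lambda>D. \<not> level_ok D q xs R') * prU (\<lambda>D. \<forall>r\<in>{r0..<R'}. \<not> level_ok D q xs r)"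
  proof (rule unif_indep[where A = "Blk R'" and B = ?B])
    show "Blk R' \<subseteq> U" by (rule Blk_U[OF Ts_level[OF TsR]])
    have "Blk R' \<inter> Blk r = {}" if "r \<in> {r0..<R'}" for r using that by (intro Blk_disjoint) auto
    then show "Blk R' \<inter> ?B = {}" by blast
  next
    fix D D' :: "nat \<Rightarrow> nat" assume "\<And>i. i \<in> Blk R' \<Longrightarrow> D i = D' i"
    then show "(\<not> level_ok D q xs R') = (\<not> level_ok D' q xs R')"
      using level_ok_cong[of R' D D' q xs] q xs by auto
  next
    fix D D' :: "nat \<Rightarrow> nat" assume A: "\<And>i. i \<in> ?B \<Longrightarrow> D i = D' i"
    have "level_ok D q xs r = level_ok D' q xs r" if "r \<in> {r0..<R'}" for r
    proof (rule level_ok_cong)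
      fix a assume "a \<in> Blk r" then show "D a = D' a" using that by (intro A) blast
    qed (use q xs in auto)
    then show "(\<forall>r\<in>{r0..<R'}. \<not> level_ok D q xs r) = (\<forall>r\<in>{r0..<R'}. \<not> level_ok D' q xs r)" by auto
  qed (simp_all add: m0)
  also have "\<dots> \<le> 1 / 10 * (1 / 10) ^ (R' - r0)"
    using level_failure[OF R(2) TsR] Suc R by (intro mult_mono) auto
  also have "\<dots> = (1 / 10) ^ (R - r0)" using R by (simp add: Suc_diff_le)
  finally show ?case .
qed

end

end

section \<open>Running time of a query\<close>

text \<open>With \<open>k\<close> the distance to the nearest string, costs grow by 3 per level up
  to \<open>k\<close>; beyond it the probability of arriving falls by 10, which leaves the ratio
  3/10.\<close>

lemma two_sided_geometric_sum:
  "(\<Sum>r\<le>R. if r \<le> k then (1 / 3 :: real) ^ (k - r) else (3 / 10) ^ (r - k)) \<le> 3"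
proof -
  let ?S = "\<lambda>R. \<Sum>r\<le>R. if r \<le> k then (1 / 3 :: real) ^ (k - r) else (3 / 10) ^ (r - k)"
  \<comment> \<open>Strengthened for the induction: the subtracted power makes room for the next
    summand of the falling side.\<close>
  have "?S R \<le> (if R \<le> k then 3 / 2 * (1 / 3) ^ (k - R) else 3 - (3 / 10) ^ (R - k))"
  proof (induction R)
    case (Suc R)
    consider "Suc R \<le> k" | "R = k" | "k < R" by linarith
    then show ?case
    proof cases
      case 1
      then have "k - R = Suc (k - Suc R)" by simp
      then show ?thesis using Suc 1 by simp
    next
      case 3
      define z where "z = (3 / 10 :: real) ^ (R - k)"
      have "Suc R - k = Suc (R - k)" using 3 by simp
      then have z: "(3 / 10 :: real) ^ (Suc R - k) = 3 / 10 * z" by (simp add: z_def)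
      have z0: "0 \<le> z" by (simp add: z_def)
      have "?S (Suc R) = ?S R + 3 / 10 * z" using 3 z by (simp del: power_Suc)
      moreover have "?S R \<le> 3 - z" using Suc 3 by (simp add: z_def)
      ultimately have "?S (Suc R) \<le> 3 - 3 / 10 * z" using z0 by linarith
      then show ?thesis using 3 z by (simp del: sum.atMost_Suc)
    qed (use Suc in simp)
  qed simp
  also have "\<dots> \<le> 3" using power_le_one[of "1 / 3 :: real" "k - R"] by simp
  finally show ?thesis .
qed

context ann
begin

text \<open>A scan costs about \<open>n * (r + 1)\<close> tests of unit radius. Up to level
  \<open>L + 1\<close> the factor \<open>n\<close> is below \<open>P < Ts r\<close>; beyond, the
  powers of 3 past \<open>3 ^ (L + 1)\<close> also absorb the growing radius.\<close>

lemma scan_levels: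
  assumes "P < Ts r" shows "n * (r + 1) \<le> (L + 2) * Ts r"
proof (cases "r \<le> L + 1")
  case True
  have "n * (r + 1) \<le> Ts r * (L + 2)" using assms P_ge True by (intro mult_mono) auto
  then show ?thesis by (simp add: mult.commute)
next
  case False
  then obtain j where j: "r = L + 1 + j" using le_Suc_ex[of "L + 1" r] by auto
  have j3: "j + 1 \<le> 3 ^ j"
  proof (induction j)
    case (Suc j)
    then show ?case by simp
  qed simp
  have "P \<le> 3 ^ (L + 1)"
  proof -
    have "P \<le> 3 ^ L" unfolding P_def by (intro power_mono) auto
    then show ?thesis by simp
  qed
  then have "P * (j + 1) \<le> 3 ^ (L + 1) * 3 ^ j" using j3 by (intro mult_mono) auto
  also have "\<dots> = 3 ^ r" by (simp add: j power_add)
  also have "\<dots> \<le> Ts r" by (simp add: Ts_def)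
  finally have P: "P * (j + 1) \<le> Ts r" .
  have "r + 1 \<le> (L + 2) * (j + 1)" using j by simp
  then have "n * (r + 1) \<le> P * ((L + 2) * (j + 1))" using P_ge by (intro mult_mono) auto
  also have "\<dots> = (L + 2) * (P * (j + 1))" by (rule mult.left_commute)
  also have "\<dots> \<le> (L + 2) * Ts r" using P by (intro mult_left_mono) auto
  finally show ?thesis .
qed

text \<open>The fourth power of \<open>L\<close> consists of \<open>L\<^sup>2\<close> thresholds and
  \<open>L\<^sup>2\<close> for a test with radius up to order \<open>e * L\<close> or for a hash of
  \<open>H\<close> letters with \<open>L + 6\<close> summands each.\<close>

lemma Cost_le:
  assumes c: "N \<le> e * n" "1 \<le> e"
  shows "Cost r \<le> 500000000 * (e * d * L ^ 4 * Ts r)"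
proof -
  have e: "1 \<le> e" and L: "1 \<le> L" using c L_ge by auto
  have "Kr r \<le> e * n * r div n" unfolding Kr_def using c by (intro div_le_mono mult_right_mono) auto
  also have "\<dots> = e * r" using n1 by (metis div_mult_self_is_m less_le_trans mult.assoc mult.commute zero_less_one)
  finally have K: "Kr r \<le> e * r" .
  have K1: "Kr r + 1 \<le> e * (r + 1)" using K e by simp
  have d1': "d + 1 \<le> 2 * d" using d1 by simp
  have T: "200 * (d + 1) * (Kr r + 1) \<le> 400 * (e * d * (r + 1))"
  proof -
    have "200 * (d + 1) * (Kr r + 1) \<le> 200 * (2 * d) * (e * (r + 1))" using d1' K1 by (intro mult_mono) auto
    then show ?thesis by (simp add: ac_simps)
  qed
  have Ts1: "1 \<le> Ts r" by (simp add: Ts_def Suc_le_eq)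
  let ?B = "e * d * L ^ 4 * Ts r"
  have B1: "1 \<le> ?B" using e d1 L Ts1 by (simp add: Suc_le_eq)
  show ?thesis
  proof (cases "Ts r \<le> P")
    case True
    have r: "r + 1 \<le> 2 * L" using Ts_level[OF True] L_ge by simp
    have A1: "200 * (d + 1) * (Kr r + 1) \<le> 800 * (e * d * L ^ 2)"
    proof -
      have "400 * (e * d * (r + 1)) \<le> 400 * (e * d * (2 * L))" using r by (intro mult_left_mono) auto
      also have "\<dots> \<le> 400 * (e * d * (2 * L * L))" using L by (intro mult_left_mono) auto
      also have "\<dots> = 800 * (e * d * L ^ 2)" by (simp add: power2_eq_square)
      finally show ?thesis using T by (rule order_trans[rotated])
    qed
    have A2: "64 * (L + 6) * H \<le> 1920 * (e * d * L ^ 2)"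
    proof -
      have "d + L \<le> 2 * (d * L)"
      proof -
        have "d * 1 \<le> d * L" using L by (rule mult_le_mono2)
        moreover have "1 * L \<le> d * L" using d1 by (rule mult_le_mono1)
        ultimately show ?thesis by linarith
      qed
      then have "64 * (L + 6) * H \<le> 64 * (3 * L) * (5 * (2 * (d * L)))"
        unfolding H_def using L_ge by (intro mult_mono) auto
      also have "\<dots> = 1920 * (1 * d * L ^ 2)" by (simp add: power2_eq_square)
      also have "\<dots> \<le> 1920 * (e * d * L ^ 2)" using e by (intro mult_left_mono mult_right_mono) auto
      finally show ?thesis .
    qed
    define X where "X = e * d * L ^ 2"
    have X: "1 \<le> X" using e d1 L by (simp add: X_def Suc_le_eq)
    have "1 * 1 \<le> Ts r * X" using Ts1 X by (rule mult_le_mono)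
    moreover have "2441 * Ts r * (200 * (d + 1) * (Kr r + 1) + 64 * (L + 6) * H + 13) \<le> 2441 * Ts r * (2733 * X)"
      using A1 A2 X unfolding X_def[symmetric] by (intro mult_left_mono) linarith+
    ultimately have "2441 * Ts r * (200 * (d + 1) * (Kr r + 1) + 64 * (L + 6) * H + 13) + 20 \<le> 6680000 * (Ts r * X)" by linarith
    then have "GI * (2441 * Ts r * (200 * (d + 1) * (Kr r + 1) + 64 * (L + 6) * H + 13) + 20) \<le>
        GI * (6680000 * (Ts r * X))" by (rule mult_left_mono) simp
    also have "\<dots> = 213760000 * ?B" by (simp add: GI_def X_def power4_eq_xxxx power2_eq_square)
    finally show ?thesis unfolding Cost_def TT_def TH_def if_P[OF True] using B1 by linarith
  next
    case False
    have "n * (200 * (d + 1) * (Kr r + 1) + 7) \<le> n * (407 * (e * d * (r + 1)))"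
    proof (rule mult_left_mono)
      have "1 \<le> e * d * (r + 1)" using e d1 by (simp add: Suc_le_eq)
      then show "200 * (d + 1) * (Kr r + 1) + 7 \<le> 407 * (e * d * (r + 1))" using T by linarith
    qed simp
    also have "\<dots> = 407 * (e * d * (n * (r + 1)))" by (simp add: algebra_simps)
    also have "\<dots> \<le> 407 * (e * d * ((L + 2) * Ts r))" using scan_levels[of r] False by (intro mult_left_mono) auto
    also have "\<dots> \<le> 407 * (e * d * ((3 * L ^ 4) * Ts r))"
    proof (intro mult_left_mono mult_right_mono)
      have "L ^ 1 \<le> L ^ 4" using L by (intro power_increasing) auto
      then show "L + 2 \<le> 3 * L ^ 4" using L by simp
    qed auto
    also have "\<dots> = 1221 * ?B" by (simp add: ac_simps)
    finally show ?thesis unfolding Cost_def TT_def TH_def if_not_P[OF False] using B1 by linarith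
  qed
qed

text \<open>Level \<open>r\<close> is charged if all earlier levels fail. The search may in fact
  have stopped earlier, so this only bounds the running time.\<close>

definition "query_time q xs R D = (\<Sum>r\<le>R. if \<forall>i<r. \<not> level_ok D q xs i then Cost r else 0) + 7 * d + 9 * L + 90"

context
  fixes q :: "nat list" and xs :: "nat list list" and r0 R :: nat
  assumes q: "set q \<subseteq> {..<sg}" "length q \<le> d"
    and xs: "\<And>j. j < n \<Longrightarrow> set (xs ! j) \<subseteq> {..<sg} \<and> length (xs ! j) \<le> d"
    and near: "\<exists>j<n. lev q (xs ! j) \<le> r0"
    and R: "r0 \<le> R" "\<And>r. r0 < r \<Longrightarrow> r \<le> R \<Longrightarrow> Ts (r - 1) \<le> P"
begin

text \<open>Reaching \<open>r > r0\<close> requires failing at \<open>r0, ..., r - 1\<close>. By the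
  choice of \<open>R\<close> all of these are still probed by tables, so
  \<open>levels_failure\<close> applies.\<close>

lemma reach_le:
  assumes "r \<le> R"
  shows "prU (\<lambda>D. \<forall>i<r. \<not> level_ok D q xs i) \<le> (1 / 10) ^ (r - r0)"
proof (cases "r0 < r")
  case True
  have Tm: "Ts i \<le> Ts j" if "i \<le> j" for i j unfolding Ts_def using that by (intro mult_right_mono power_increasing) auto
  have "prU (\<lambda>D. \<forall>i<r. \<not> level_ok D q xs i) \<le> prU (\<lambda>D. \<forall>i\<in>{r0..<r}. \<not> level_ok D q xs i)"
    by (rule pr_mono) auto
  also have "\<dots> \<le> (1 / 10) ^ (r - r0)"
  proof (rule levels_failure[OF q xs near])
    fix i assume "i < r"
    then have "Ts i \<le> Ts (r - 1)" by (intro Tm) auto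
    then show "Ts i \<le> P" using R(2)[OF True assms] by simp
  qed (use True in auto)
  finally show ?thesis .
qed (simp add: pr_le_1)

lemma expected_query_time:
  assumes c: "N \<le> e * n" "1 \<le> e"
  shows "(\<integral>\<^sup>+D. ennreal (real (query_time q xs R D)) \<partial>measure_pmf (unif U m)) \<le>
    ennreal (2000000000 * (real e * d * real L ^ 4 * (3 ^ r0 * 2 ^ JJ)))"
proof -
  have fin: "finite (set_pmf (unif U m))" using m0 by (intro finite_set_unif) auto
  have int: "integrable (unif U m) f" for f :: "_ \<Rightarrow> real" using fin by (rule integrable_measure_pmf_finite)
  define A where "A = real e * d * real L ^ 4 * 2 ^ JJ"
  have A0: "0 \<le> A" by (simp add: A_def)
  have "measure_pmf.expectation (unif U m) (\<lambda>D. real (query_time q xs R D)) =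
      (\<Sum>r\<le>R. Cost r * prU (\<lambda>D. \<forall>i<r. \<not> level_ok D q xs i)) + 7 * d + 9 * L + 90"
  proof -
    have "real (query_time q xs R D) = (\<Sum>r\<le>R. Cost r * (indicator {D. \<forall>i<r. \<not> level_ok D q xs i} D :: real)) + (7 * d + 9 * L + 90)" for D
    proof -
      have "real (if \<forall>i<r. \<not> level_ok D q xs i then Cost r else 0) = Cost r * (indicator {D. \<forall>i<r. \<not> level_ok D q xs i} D :: real)" for r
        by simp
      then show ?thesis unfolding query_time_def by (simp only: of_nat_add of_nat_sum of_nat_mult of_nat_numeral)
    qed
    then have "measure_pmf.expectation (unif U m) (\<lambda>D. real (query_time q xs R D)) =
        measure_pmf.expectation (unif U m) (\<lambda>D. (\<Sum>r\<le>R. Cost r * (indicator {D. \<forall>i<r. \<not> level_ok D q xs i} D :: real)) + (7 * d + 9 * L + 90))"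
      by presburger
    also have "\<dots> = measure_pmf.expectation (unif U m) (\<lambda>D. \<Sum>r\<le>R. Cost r * (indicator {D. \<forall>i<r. \<not> level_ok D q xs i} D :: real)) + (7 * d + 9 * L + 90)"
      by (subst Bochner_Integration.integral_add[OF int int]) simp
    also have "measure_pmf.expectation (unif U m) (\<lambda>D. \<Sum>r\<le>R. Cost r * (indicator {D. \<forall>i<r. \<not> level_ok D q xs i} D :: real)) =
        (\<Sum>r\<le>R. measure_pmf.expectation (unif U m) (\<lambda>D. Cost r * (indicator {D. \<forall>i<r. \<not> level_ok D q xs i} D :: real)))"
      by (rule Bochner_Integration.integral_sum[OF int])
    also have "\<dots> = (\<Sum>r\<le>R. Cost r * prU (\<lambda>D. \<forall>i<r. \<not> level_ok D q xs i))"
      by (rule sum.cong[OF refl], subst integral_mult_right_zero) simp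
    finally show ?thesis by simp
  qed
  also have "\<dots> \<le> (\<Sum>r\<le>R. 500000000 * (A * 3 ^ r0) * (if r \<le> r0 then (1 / 3) ^ (r0 - r) else (3 / 10) ^ (r - r0))) + 7 * d + 9 * L + 90"
  proof (intro add_right_mono sum_mono)
    fix r assume r: "r \<in> {..R}"
    have "real (Cost r) \<le> 500000000 * (e * d * L ^ 4 * Ts r)" using of_nat_mono[OF Cost_le[OF c, of r], where 'a = real] by simp
    also have "\<dots> = 500000000 * (A * 3 ^ r)" by (simp add: A_def Ts_def)
    finally have C: "real (Cost r) \<le> 500000000 * (A * 3 ^ r)" .
    have "Cost r * prU (\<lambda>D. \<forall>i<r. \<not> level_ok D q xs i) \<le> 500000000 * (A * 3 ^ r) * (1 / 10) ^ (r - r0)"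
      using C reach_le[of r] r A0 by (intro mult_mono) auto
    also have "\<dots> \<le> 500000000 * (A * 3 ^ r0) * (if r \<le> r0 then (1 / 3) ^ (r0 - r) else (3 / 10) ^ (r - r0))"
    proof (cases "r \<le> r0")
      case True
      then have "(3::real) ^ r = 3 ^ r0 * (1 / 3) ^ (r0 - r)" by (simp add: power_diff power_divide)
      then show ?thesis using True A0 by (simp add: algebra_simps)
    next
      case False
      then obtain j where j: "r = r0 + j" using le_Suc_ex[of r0 r] by auto
      have "(3::real) ^ j * (1 / 10) ^ j = (3 / 10) ^ j" by (simp flip: power_mult_distrib)
      then show ?thesis using False by (simp add: j power_add mult.assoc)
    qed
    finally show "Cost r * prU (\<lambda>D. \<forall>i<r. \<not> level_ok D q xs i) \<le>
      500000000 * (A * 3 ^ r0) * (if r \<le> r0 then (1 / 3) ^ (r0 - r) else (3 / 10) ^ (r - r0))" .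
  qed
  also have "\<dots> \<le> 500000000 * (A * 3 ^ r0) * 3 + 7 * d + 9 * L + 90"
    unfolding sum_distrib_left[symmetric] using two_sided_geometric_sum[where R = R and k = r0] A0
    by (intro add_right_mono mult_left_mono) auto
  also have "\<dots> \<le> 2000000000 * (A * 3 ^ r0)"
  proof -
    define z where "z = e * d * L ^ 4 * 2 ^ JJ * 3 ^ r0"
    have "1 * d * 1 * 1 * 1 \<le> z" "1 * 1 * L ^ 1 * 1 * 1 \<le> z"
      unfolding z_def using c d1 L_ge by (intro mult_mono power_increasing; simp add: Suc_le_eq)+
    then have "real (d + L) \<le> real (2 * z)" by (intro of_nat_mono) simp
    then have "real d + L \<le> 2 * (A * 3 ^ r0)" by (simp add: A_def z_def)
    moreover have "1 \<le> real d" using d1 by simp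
    ultimately show ?thesis using L_ge by simp
  qed
  also have "A * 3 ^ r0 = real e * d * real L ^ 4 * (3 ^ r0 * 2 ^ JJ)" by (simp add: A_def)
  finally have E: "measure_pmf.expectation (unif U m) (\<lambda>D. real (query_time q xs R D)) \<le>
    2000000000 * (real e * d * real L ^ 4 * (3 ^ r0 * 2 ^ JJ))" .
  have "(\<integral>\<^sup>+D. ennreal (real (query_time q xs R D)) \<partial>measure_pmf (unif U m)) =
      ennreal (measure_pmf.expectation (unif U m) (\<lambda>D. real (query_time q xs R D)))"
    by (intro nn_integral_eq_integral int) auto
  also have "\<dots> \<le> ennreal (2000000000 * (real e * d * real L ^ 4 * (3 ^ r0 * 2 ^ JJ)))"
    using E by (rule ennreal_leI)
  finally show ?thesis .
qed

end

end

lemma log_size_upper: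
  assumes "1 \<le> n" "1 \<le> d" shows "2 ^ log_size n d sg < 2 * (n + d + sg + 4)"
proof -
  \<comment> \<open>\<open>L\<close> depends on \<open>n\<close>, \<open>d\<close> and
    \<open>sg\<close> alone, so any admissible values for the other parameters will do.\<close>
  interpret ann n d sg n "n * (2 ^ log_size n d sg) ^ 16" by unfold_locales (use assms in auto)
  show ?thesis using P_le by (simp add: P_def L_def)
qed

section \<open>Correctness of the data structure\<close>

lemma (in ann_query) run_query:
  assumes "input M = length q # q" "level_ok D q xs R" "R \<le> P"
  shows "\<exists>t s' R' j. run M t (start query_com D) = return_pmf ([], s') \<and>
    t \<le> (\<Sum>i\<le>R'. Cost i) + 7 * d + 9 * L + 90 \<and> R' \<le> R \<and> (\<forall>i<R'. \<not> level_ok D q xs i) \<and>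
    j < n \<and> lev q (xs ! j) \<le> Kr R' \<and> regs s' 0 = saddr j + 1 \<and> regs s' 1 = length (xs ! j) \<and> data s' = D"
proof -
  let ?Q = "\<lambda>t s'. \<exists>R' j. t \<le> (\<Sum>i\<le>R'. Cost i) + 7 * d + 9 * L + 90 \<and> R' \<le> R \<and> (\<forall>i<R'. \<not> level_ok D q xs i) \<and>
    j < n \<and> lev q (xs ! j) \<le> Kr R' \<and> regs s' 0 = saddr j + 1 \<and> regs s' 1 = length (xs ! j) \<and> data s' = D"
  have "wp M query_com ?Q \<lparr>regs = (\<lambda>_. 0), data = D, work = (\<lambda>_. 0)\<rparr>"
  proof (rule wp_query[where R = R])
    fix t s' R' j
    assume "t \<le> (\<Sum>i\<in>{0..R'}. Cost i) + 7 * d + 9 * L + 90" "R' \<le> R" "\<forall>i<R'. \<not> lvl_ok i" "j < n" "acc (Kr R') j"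
      "regs s' 0 = saddr j + 1" "regs s' 1 = length (xs ! j)" "data s' = D"
    then show "?Q t s'" unfolding acc_def atLeast0AtMost by metis
  qed (use assms in simp_all)
  then obtain t s' where "steps M t query_com \<lparr>regs = (\<lambda>_. 0), data = D, work = (\<lambda>_. 0)\<rparr> s'" "?Q t s'"
    unfolding wp_def by blast
  then show ?thesis unfolding start_def steps_def by blast
qed

text \<open>Two different levels are used: success needs only level \<open>r0\<close> of the nearest
  string, whereas the time bound needs a level \<open>R\<close> at which every query stops, whatever
  words were drawn.\<close>

theorem (in ann) solves_ANN:
  assumes c: "1 \<le> c" "N = nat \<lfloor>c * real n\<rfloor>" and xs: "length xs = n" "set xs \<subseteq> strings sg d"
    and s: "DS \<le> s" and e: "N \<le> e * n" "1 \<le> e"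
    and time: "\<And>r. 2000000000 * (real e * d * real L ^ 4 * (3 ^ r * 2 ^ JJ)) \<le> time r"
  shows "solves_ANN build_com query_com W s time c d sg xs"
proof -
  have str: "length (xs ! i) \<le> d \<and> set (xs ! i) \<subseteq> {..<sg}" if "i < n" for i
    using xs that nth_mem unfolding strings_def by fastforce
  define B where "B = build_machine W s c d sg xs"
  interpret b: ann_build n d sg N W B xs
    by unfold_locales (use s DS_W xs str in \<open>auto simp: B_def build_machine_def build_input_def mach_def c(2)\<close>)
  obtain T S where run: "run B T (start build_com (\<lambda>_. 0)) = map_pmf (\<lambda>w. ([], S w)) (unif U m)"
    and S: "\<And>w. w \<in> set_pmf (unif U m) \<Longrightarrow> wf xs (data (S w))"
      "\<And>w a. w \<in> set_pmf (unif U m) \<Longrightarrow> a \<in> U \<Longrightarrow> data (S w) a = w a"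
    using b.run_build by auto
  note fin = final_eqI[OF run]
  have start: "query_start B build_com query_com = map_pmf (\<lambda>w. start query_com (data (S w))) (unif U m)"
    unfolding query_start_def fin(2) by (simp add: map_pmf_comp)
  show ?thesis unfolding solves_ANN_def Let_def B_def[symmetric] start
  proof (intro conjI ballI)
    show "halts_surely B (start build_com (\<lambda>_. 0))" by (rule fin(1))
    fix q assume "q \<in> strings sg d"
    then have q: "set q \<subseteq> {..<sg}" "length q \<le> d" by (auto simp: strings_def)
    define M where "M = query_machine W s q"
    define r0 where "r0 = nearest_distance q (set xs)"
    have r0: "r0 = (LEAST r. \<exists>y\<in>set xs. lev q y \<le> r)"
      by (simp add: r0_def nearest_distance_def edit_distance_eq_lev)
    have x0: "xs ! 0 \<in> set xs" using xs n1 by simp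
    have "\<exists>y\<in>set xs. lev q y \<le> r0" unfolding r0 by (rule LeastI) (use x0 in blast)
    then have near: "\<exists>j<n. lev q (xs ! j) \<le> r0" using xs(1) by (auto simp: in_set_conv_nth)
    have "r0 \<le> lev q (xs ! 0)" unfolding r0 by (rule Least_le) (use x0 in blast)
    then have r0d: "r0 \<le> d" using lev_le_max[of q "xs ! 0"] q str[of 0] n1 by auto
    have aq: "ann_query n d sg N W M q xs (data (S w))" if "w \<in> set_pmf (unif U m)" for w
      by unfold_locales (use that S(1) s q xs str in \<open>auto simp: M_def query_machine_def mach_def\<close>)
    have inM: "input M = length q # q" by (simp add: M_def query_machine_def encode_string_def)
    have same: "level_ok (data (S w)) q xs r = level_ok w q xs r" if "w \<in> set_pmf (unif U m)" for w r
    proof (cases "Ts r \<le> P")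
      case True
      show ?thesis
        by (rule level_ok_cong) (use Blk_U[OF Ts_level[OF True]] S(2)[OF that] q str in auto)
    qed (simp add: level_ok_def)
    have brute: "level_ok D q xs r" if "P < Ts r" "r0 \<le> r" for D r
      using that near r_le_Kr[of r] unfolding level_ok_def by (auto intro: order_trans)
    \<comment> \<open>The first level answered by a scan. Scans with radius at least
      \<open>r0\<close> always succeed, so \<open>max r0 R1\<close> stops every query.\<close>
    define R1 where "R1 = (LEAST r. P < Ts r)"
    have "P < Ts (L + 1)" using Ts_level[of "L + 1"] by linarith
    then have R1: "P < Ts R1" "R1 \<le> L + 1" unfolding R1_def by (rule LeastI, rule Least_le)
    define R where "R = max r0 R1"
    have Tm: "Ts i \<le> Ts j" if "i \<le> j" for i j
      unfolding Ts_def using that by (intro mult_right_mono power_increasing) auto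
    have R: "level_ok D q xs R" "R \<le> P" "r0 \<le> R" for D
      using R1 Tm[of R1 R] P_ge L_less r0d by (auto simp: R_def intro!: brute)
    have TR: "Ts (r - 1) \<le> P" if "r0 < r" "r \<le> R" for r
    proof -
      have "r - 1 < R1" using that by (auto simp: R_def)
      then show ?thesis using not_less_Least[of "r - 1" "\<lambda>r. P < Ts r"] by (auto simp: R1_def)
    qed
    have N_le: "real N \<le> c * n" using c by simp
    have Kr_le: "real (Kr r) \<le> c * r" for r
    proof -
      have "real (Kr r) \<le> real (N * r) / n" unfolding Kr_def by (rule of_nat_div_le_of_nat)
      also have "\<dots> \<le> c * n * r / n" using N_le by (intro divide_right_mono) (auto intro: mult_right_mono)
      also have "\<dots> = c * r" using n1 by simp
      finally show ?thesis .
    qed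
    have "1 / 10 < measure_pmf.prob (unif U m) {w. level_ok w q xs r0}"
    proof (cases "Ts r0 \<le> P")
      case True
      have "prU (\<lambda>w. \<not> level_ok w q xs r0) \<le> 1 / 10"
        by (rule level_failure[where q = q and xs = xs]) (use q str near True in auto)
      moreover have "prU (\<lambda>w. \<not> level_ok w q xs r0) = 1 - prU (\<lambda>w. level_ok w q xs r0)"
        using measure_pmf.prob_compl[of "{w. level_ok w q xs r0}" "unif U m"] by (simp add: Collect_neg_eq Compl_eq_Diff_UNIV)
      ultimately show ?thesis by simp
    next
      case False
      then have "{w. level_ok w q xs r0} = UNIV" using brute by auto
      then show ?thesis by simp
    qed
    also have "\<dots> \<le> prob_halts_with M (map_pmf (\<lambda>w. start query_com (data (S w))) (unif U m))
        (\<lambda>st. \<exists>y. returns M st y \<and> approx_nearest c (set xs) q y)"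
    \<comment> \<open>If level \<open>r0\<close> succeeds, the search stops at some
      \<open>R' \<le> r0\<close>. Stopping early does no harm, since whatever is accepted there lies
      within \<open>c * R' \<le> c * r0\<close>.\<close>
    proof (rule prob_halts_ge[where T = "(\<Sum>i\<le>r0. Cost i) + 7 * d + 9 * L + 90"])
      fix w assume w: "w \<in> set_pmf (unif U m)" "level_ok w q xs r0"
      interpret Q: ann_query n d sg N W M q xs "data (S w)" by (rule aq[OF w(1)])
      have level: "level_ok (data (S w)) q xs r0" using same w by blast
      have r0P: "r0 \<le> P" using r0d P_ge by simp
      obtain t s' R' j where A: "run M t (start query_com (data (S w))) = return_pmf ([], s')"
        "t \<le> (\<Sum>i\<le>R'. Cost i) + 7 * d + 9 * L + 90" "R' \<le> r0" "j < n" "lev q (xs ! j) \<le> Kr R'"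
        "regs s' 0 = saddr j + 1" "regs s' 1 = length (xs ! j)" "data s' = data (S w)"
        using Q.run_query[OF inM level r0P] by blast
      have "(\<Sum>i\<le>R'. Cost i) \<le> (\<Sum>i\<le>r0. Cost i)" using A(3) by (intro sum_mono2) auto
      then have "run M ((\<Sum>i\<le>r0. Cost i) + 7 * d + 9 * L + 90) (start query_com (data (S w))) = return_pmf ([], s')"
        using A(2) by (intro run_le[OF A(1)]) simp
      moreover have "returns M s' (xs ! j)"
      proof -
        have "length (xs ! j) + 1 < P" using str[OF A(4)] P_ge by simp
        then have "saddr j + (length (xs ! j) + 1) < RB" by (rule saddr_bounds(2)[OF A(4)])
        then have "regs s' 0 + regs s' 1 \<le> s" using A RB_TB_DS s by simp
        moreover have "xs ! j = map (data s') [regs s' 0..<regs s' 0 + regs s' 1]"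
        proof (rule nth_equalityI)
          fix i assume "i < length (xs ! j)"
          then have "data (S w) (saddr j + 1 + i) = xs ! j ! i" using S(1)[OF w(1)] A(4) unfolding wf_def by blast
          then show "xs ! j ! i = map (data s') [regs s' 0..<regs s' 0 + regs s' 1] ! i"
            using \<open>i < length (xs ! j)\<close> by (simp add: A(6-8) del: upt_Suc One_nat_def)
        qed (simp add: A(7) del: upt_Suc One_nat_def)
        ultimately show ?thesis by (simp add: returns_def M_def query_machine_def)
      qed
      moreover have "approx_nearest c (set xs) q (xs ! j)"
      proof -
        have "real (lev q (xs ! j)) \<le> real (Kr R')" using A(5) by simp
        also have "\<dots> \<le> c * R'" by (rule Kr_le)
        also have "\<dots> \<le> c * r0" using A(3) c by (intro mult_left_mono) auto
        finally show ?thesis using A(4) xs by (simp add: approx_nearest_def edit_distance_eq_lev r0_def)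
      qed
      ultimately show "\<exists>s'. run M ((\<Sum>i\<le>r0. Cost i) + 7 * d + 9 * L + 90) (start query_com (data (S w))) = return_pmf ([], s') \<and>
          (\<exists>y. returns M s' y \<and> approx_nearest c (set xs) q y)" by blast
    qed
    finally show "1 / 10 < prob_halts_with (query_machine W s q) (map_pmf (\<lambda>w. start query_com (data (S w))) (unif U m))
        (\<lambda>st. \<exists>y. returns (query_machine W s q) st y \<and> approx_nearest c (set xs) q y)" unfolding M_def .
    have "expected_time M (map_pmf (\<lambda>w. start query_com (data (S w))) (unif U m)) \<le>
        (\<integral>\<^sup>+w. ennreal (real (query_time q xs R w)) \<partial>measure_pmf (unif U m))"
    proof (rule expected_time_le)
      fix w assume w: "w \<in> set_pmf (unif U m)"
      interpret Q: ann_query n d sg N W M q xs "data (S w)" by (rule aq[OF w])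
      obtain t s' R' where A: "run M t (start query_com (data (S w))) = return_pmf ([], s')"
        "t \<le> (\<Sum>i\<le>R'. Cost i) + 7 * d + 9 * L + 90" "R' \<le> R" "\<forall>i<R'. \<not> level_ok w q xs i"
        using Q.run_query[OF inM R(1,2)] same[OF w] by metis
      have "(\<Sum>i\<le>R'. Cost i) = (\<Sum>r\<le>R'. if \<forall>i<r. \<not> level_ok w q xs i then Cost r else 0)"
        using A(4) by (intro sum.cong) auto
      also have "\<dots> \<le> (\<Sum>r\<le>R. if \<forall>i<r. \<not> level_ok w q xs i then Cost r else 0)"
        using A(3) by (intro sum_mono2) auto
      finally have "t \<le> query_time q xs R w" unfolding query_time_def using A(2) by linarith
      then show "\<exists>s'. run M (query_time q xs R w) (start query_com (data (S w))) = return_pmf ([], s')"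
        using run_le[OF A(1)] by blast
    qed
    also have "\<dots> \<le> ennreal (2000000000 * (real e * d * real L ^ 4 * (3 ^ r0 * 2 ^ JJ)))"
      by (rule expected_query_time) (use q str near R(3) TR e in auto)
    also have "\<dots> \<le> ennreal (time r0)" using time by (rule ennreal_leI)
    finally show "expected_time (query_machine W s q) (map_pmf (\<lambda>w. start query_com (data (S w))) (unif U m)) \<le>
        ennreal (time (nearest_distance q (set xs)))" unfolding M_def r0_def .
  qed
qed

section \<open>Choice of the constants\<close>

context ann
begin

context
  fixes K :: nat
  assumes PK: "P \<le> K * n"
begin

lemma K_pos: "0 < K" using PK P8 by (cases K) auto

lemma L_le_log: "real L \<le> K + log 2 n"
proof -
  have "log 2 (real (2 ^ L)) \<le> log 2 (real (K * n))"
    using PK K_pos n1 by (subst log_le_cancel_iff) (auto simp: P_def simp flip: of_nat_mult of_nat_power)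
  also have "\<dots> = log 2 K + log 2 n" using K_pos n1 by (simp add: log_mult)
  also have "log 2 K \<le> K" using K_pos by (intro log2_of_power_le) (auto intro: less_imp_le less_exp)
  finally show ?thesis by simp
qed

lemma L_le: "real L \<le> (K + 1) * log 2 (real n + 2)"
proof -
  have "log 2 n \<le> log 2 (real n + 2)" using n1 by simp
  moreover have "real K * 1 \<le> real K * log 2 (real n + 2)" using n1 by (intro mult_left_mono) auto
  ultimately show ?thesis using L_le_log by (simp add: algebra_simps)
qed

text \<open>There are \<open>O(L ^ 3)\<close> thresholds in all, each with \<open>O(L)\<close> times
  \<open>P\<^sup>2\<close> cells, and \<open>P\<close> is linear in \<open>n\<close>.\<close>

lemma DS_log: "real DS \<le> 6146 * (K + 1) ^ 6 * (real n)\<^sup>2 * log 2 (real n + 2) ^ 4"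
proof -
  have L1: "1 \<le> L" using L_ge by simp
  have NL: "NL \<le> 64 * L ^ 3"
  proof -
    have "(L + 1) * (32 * L * L) \<le> (2 * L) * (32 * L * L)" using L1 by (intro mult_right_mono) auto
    then show ?thesis by (simp add: NL_def GI_def power3_eq_cube)
  qed
  have "DS = 4 + P * P + NL * (16 * (L + 7) + 128) * (P * P)"
    unfolding DS_def TB_def RB_def by (simp add: algebra_simps)
  also have "\<dots> \<le> 2 * (L ^ 4 * (P * P)) + 64 * L ^ 3 * (96 * L) * (P * P)"
  proof (intro add_mono mult_mono NL)
    have "1 * (P * P) \<le> L ^ 4 * (P * P)" using L1 by (intro mult_right_mono) auto
    moreover have "8 * 8 \<le> P * P" using P8 by (intro mult_mono) auto
    ultimately show "4 + P * P \<le> 2 * (L ^ 4 * (P * P))" by linarith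
  qed (use L_ge in auto)
  also have "\<dots> = 6146 * (L ^ 4 * P ^ 2)" by (simp add: power4_eq_xxxx power3_eq_cube power2_eq_square)
  finally have "DS \<le> 6146 * (L ^ 4 * P\<^sup>2)" .
  then have "real DS \<le> real (6146 * (L ^ 4 * P\<^sup>2))" by (rule of_nat_mono)
  also have "\<dots> = 6146 * (real L ^ 4 * (real P)\<^sup>2)" by simp
  also have "\<dots> \<le> 6146 * (((K + 1) * log 2 (real n + 2)) ^ 4 * ((K + 1) * real n)\<^sup>2)"
  proof (intro mult_left_mono mult_mono power_mono L_le)
    have "real P \<le> real (K * n)" using PK by (rule of_nat_mono)
    then show "real P \<le> real (K + 1) * real n" by (simp add: algebra_simps)
  qed auto
  also have "\<dots> = 6146 * (K + 1) ^ 6 * (real n)\<^sup>2 * log 2 (real n + 2) ^ 4"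
    by (simp add: power_mult_distrib flip: power_add)
  finally show ?thesis .
qed

text \<open>Replacing \<open>c\<close> by \<open>N / n\<close> changes its reciprocal by at most
  \<open>1 / n\<close>, so the exponent changes by \<open>L / n \<le> K + 1\<close>, a constant. The
  rest is 2^(L/c) = P^(1/c), where P \<le> K n.\<close>

lemma two_power_JJ:
  assumes c: "1 \<le> c" "N = nat \<lfloor>c * real n\<rfloor>"
  shows "2 ^ JJ \<le> 2 ^ (K + 2) * K * real n powr (1 / c)"
proof -
  have n: "0 < real n" "0 < real N" using n1 nN by auto
  have "real L * n / N \<le> L / c + (K + 1)"
  proof -
    have "c * n - N \<le> 1" using c by linarith
    then have "(c * n - N) / (c * N) \<le> 1 / (c * N)" using c n by (intro divide_right_mono) auto
    also have "\<dots> \<le> 1 / n" using c n nN mult_mono[of 1 c "real n" "real N"] by (intro divide_left_mono) auto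
    finally have "real n / N \<le> 1 / c + 1 / n" using c n by (simp add: field_simps)
    then have "L * (real n / N) \<le> L * (1 / c + 1 / n)" by (intro mult_left_mono) auto
    moreover have "L / n \<le> K + 1"
    proof -
      have "log 2 n \<le> n" using n1 by (intro log2_of_power_le) (auto intro: less_imp_le less_exp)
      then have "real L \<le> real K * 1 + real n" using L_le_log by simp
      also have "\<dots> \<le> real K * real n + real n" using n1 by (intro add_right_mono mult_left_mono) auto
      finally show ?thesis using n by (simp add: field_simps)
    qed
    ultimately show ?thesis by (simp add: distrib_left)
  qed
  moreover have "real (L * n div N) \<le> real (L * n) / N" by (rule of_nat_div_le_of_nat)
  ultimately have "real JJ \<le> L / c + (K + 2)" unfolding JJ_def by simp
  then have "2 powr real JJ \<le> 2 powr (L / c + (K + 2))" by simp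
  also have "\<dots> = 2 ^ (K + 2) * 2 powr (L / c)"
    by (simp add: powr_add powr_realpow flip: of_nat_add)
  also have "2 powr (L / c) = P powr (1 / c)" by (simp add: P_def powr_powr flip: powr_realpow)
  also have "\<dots> \<le> (K * n) powr (1 / c)" using of_nat_mono[OF PK, where 'a = real] c by (intro powr_mono2) auto
  also have "\<dots> = K powr (1 / c) * n powr (1 / c)" by (simp add: powr_mult)
  also have "K powr (1 / c) \<le> K powr 1" using K_pos c by (intro powr_mono) auto
  finally show ?thesis using K_pos by (simp add: powr_realpow mult_left_mono mult_right_mono mult.assoc)
qed

lemma time_le:
  assumes c: "1 \<le> c" "N = nat \<lfloor>c * real n\<rfloor>"
  shows "2000000000 * (real e * d * real L ^ 4 * (3 ^ r * 2 ^ JJ)) \<le>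
    2000000000 * e * (K + 1) ^ 4 * 2 ^ (K + 2) * K * (real d * 3 ^ r * real n powr (1 / c)) * log 2 (real n + 2) ^ 4"
proof -
  have "2000000000 * (real e * d * real L ^ 4 * (3 ^ r * 2 ^ JJ)) \<le>
      2000000000 * (real e * d * ((K + 1) * log 2 (real n + 2)) ^ 4 * (3 ^ r * (2 ^ (K + 2) * K * real n powr (1 / c))))"
    using n1 by (intro mult_left_mono mult_mono power_mono L_le two_power_JJ[OF c]) auto
  then show ?thesis by (simp add: power_mult_distrib ac_simps)
qed

end

end

text \<open>The product has 17 factors linear in \<open>n\<close>. Since a word has at least one
  block of \<open>\<kappa>\<close> bits, the constants \<open>e\<close> and \<open>K ^ 16\<close>
  are absorbed by enlarging \<open>\<kappa>\<close>.\<close>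

lemma word_bound_ge:
  assumes "1 \<le> n" "N \<le> e * n" "P \<le> K * n"
  shows "N * P ^ 16 \<le> word_bound (e + 16 * K + 17) n"
proof -
  define b where "b = nat \<lceil>log 2 (real n + 2)\<rceil>"
  have l: "1 \<le> log 2 (real n + 2)" by simp
  have b1: "1 \<le> b" using l unfolding b_def by linarith
  have "log 2 (real n + 2) \<le> b" unfolding b_def by (rule real_nat_ceiling_ge)
  then have "real n + 2 \<le> 2 powr b" by (subst (asm) log_le_iff) auto
  then have "real (n + 2) \<le> real (2 ^ b)" by (simp add: powr_realpow)
  then have n: "n \<le> 2 ^ b" unfolding of_nat_le_iff by simp
  have "N * P ^ 16 \<le> (e * n) * (K * n) ^ 16" using assms by (intro mult_mono power_mono) auto
  also have "\<dots> \<le> (2 ^ e * 2 ^ b) * (2 ^ K * 2 ^ b) ^ 16"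
    using n by (intro mult_mono power_mono) (auto intro: less_imp_le less_exp)
  also have "\<dots> = 2 ^ (e + 16 * K + 17 * b)" by (simp flip: power_add power_mult)
  also have "\<dots> \<le> 2 ^ ((e + 16 * K + 17) * b)"
  proof (rule power_increasing)
    have "(e + 16 * K) * 1 \<le> (e + 16 * K) * b" using b1 by (rule mult_le_mono2)
    then show "e + 16 * K + 17 * b \<le> (e + 16 * K + 17) * b" unfolding distrib_right[of "e + 16 * K"] by simp
  qed simp
  finally show ?thesis by (simp add: word_bound_def b_def)
qed

theorem theorem1p2:
  fixes c A\<^sub>d A\<^sub>\<sigma> :: real
  assumes "c \<ge> 1"
  shows "\<exists>(build :: com) (query :: com) (\<kappa> :: nat) (C :: real) (k :: nat).
    \<forall>(n :: nat) (d :: nat) (\<sigma> :: nat) (S :: nat list set) (xs :: nat list list).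
      n \<ge> 1 \<longrightarrow> d \<ge> 1 \<longrightarrow> real d \<le> A\<^sub>d * real n \<longrightarrow> real \<sigma> \<le> A\<^sub>\<sigma> * real n \<longrightarrow>
      S \<subseteq> strings \<sigma> d \<longrightarrow> finite S \<longrightarrow> card S = n \<longrightarrow> set xs = S \<longrightarrow> distinct xs \<longrightarrow>
      solves_ANN build query
        (word_bound \<kappa> n)
        (nat \<lfloor>C * real n ^ 2 * log 2 (real n + 2) ^ k\<rfloor>)
        (\<lambda>r. C * (real d * 3 ^ r * real n powr (1 / c)) * log 2 (real n + 2) ^ k)
        c d \<sigma> xs"
proof -
  define e where "e = nat \<lceil>c\<rceil>"
  \<comment> \<open>The 2 comes from rounding up to a power of two, and the 5 from
    \<open>n + 4 \<le> 5 * n\<close>.\<close>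
  define K where "K = 2 * (nat \<lceil>A\<^sub>d\<rceil> + nat \<lceil>A\<^sub>\<sigma>\<rceil> + 5)"
  \<comment> \<open>One constant serves both bounds, hence the sum of the constants from
    \<open>DS_log\<close> and \<open>time_le\<close>; both have the fourth power of the
    logarithm.\<close>
  define C where "C = 6146 * real (K + 1) ^ 6 + 2000000000 * e * (K + 1) ^ 4 * 2 ^ (K + 2) * K"
  show ?thesis
  proof (rule exI[of _ build_com], rule exI[of _ query_com], rule exI[of _ "e + 16 * K + 17"], rule exI[of _ C],
      rule exI[of _ 4], intro allI impI)
    fix n d \<sigma> :: nat and S :: "nat list set" and xs :: "nat list list"
    assume n: "1 \<le> n" and d: "1 \<le> d" "real d \<le> A\<^sub>d * n" and \<sigma>: "real \<sigma> \<le> A\<^sub>\<sigma> * n"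
      and S: "S \<subseteq> strings \<sigma> d" "finite S" "card S = n" "set xs = S" "distinct xs"
    define N where "N = nat \<lfloor>c * real n\<rfloor>"
    let ?W = "word_bound (e + 16 * K + 17) n" and ?l = "log 2 (real n + 2)"
    define Q where "Q = (2::nat) ^ log_size n d \<sigma>"
    have up: "x \<le> nat \<lceil>A\<rceil> * n" if "real x \<le> A * n" for x :: nat and A :: real
    proof -
      have "real x \<le> real (nat \<lceil>A\<rceil>) * n" using that real_nat_ceiling_ge[of A]
        by (meson mult_right_mono of_nat_0_le_iff order_trans)
      then show ?thesis by (simp flip: of_nat_mult)
    qed
    have ce: "1 \<le> e" "c \<le> e" using assms real_nat_ceiling_ge[of c] by (auto simp: e_def le_nat_iff)
    have Ne: "N \<le> e * n"
    proof -
      have "c * n \<le> real (e * n)" using ce by (simp add: mult_right_mono)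
      then show ?thesis using assms unfolding N_def by linarith
    qed
    have nN: "n \<le> N"
    proof -
      have "1 * real n \<le> c * n" using assms by (intro mult_right_mono) auto
      then show ?thesis unfolding N_def by linarith
    qed
    have "n + d + \<sigma> + 4 \<le> (nat \<lceil>A\<^sub>d\<rceil> + nat \<lceil>A\<^sub>\<sigma>\<rceil> + 5) * n"
      using up[OF d(2)] up[OF \<sigma>] n by (simp add: algebra_simps)
    then have "2 * (n + d + \<sigma> + 4) \<le> K * n" unfolding K_def mult.assoc by (rule mult_le_mono2)
    moreover have "Q < 2 * (n + d + \<sigma> + 4)" unfolding Q_def using n d(1) by (rule log_size_upper)
    ultimately have PK: "Q \<le> K * n" by linarith
    interpret ann n d \<sigma> N ?W
      by unfold_locales (use n d nN word_bound_ge[OF n Ne PK] in \<open>simp_all add: Q_def\<close>)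
    have PK': "ann.P n d \<sigma> \<le> K * n" using PK by (simp add: Q_def P_def L_def)
    show "solves_ANN build_com query_com ?W (nat \<lfloor>C * real n ^ 2 * ?l ^ 4\<rfloor>)
        (\<lambda>r. C * (real d * 3 ^ r * real n powr (1 / c)) * ?l ^ 4) c d \<sigma> xs"
    proof (rule solves_ANN[OF assms N_def _ _ _ Ne ce(1)])
      have l: "0 \<le> ?l" using n by simp
      have "6146 * (K + 1) ^ 6 * (real n)\<^sup>2 * ?l ^ 4 \<le> C * (real n)\<^sup>2 * ?l ^ 4"
        using l by (intro mult_right_mono) (auto simp: C_def)
      then have "real DS \<le> C * (real n)\<^sup>2 * ?l ^ 4" using DS_log[OF PK'] by simp
      then show "DS \<le> nat \<lfloor>C * real n ^ 2 * ?l ^ 4\<rfloor>" by (simp add: le_nat_floor)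
      fix r
      have "2000000000 * e * (K + 1) ^ 4 * 2 ^ (K + 2) * K * (real d * 3 ^ r * real n powr (1 / c)) * ?l ^ 4 \<le>
          C * (real d * 3 ^ r * real n powr (1 / c)) * ?l ^ 4"
        using l by (intro mult_right_mono) (auto simp: C_def)
      then show "2000000000 * (real e * d * real L ^ 4 * (3 ^ r * 2 ^ JJ)) \<le>
          C * (real d * 3 ^ r * real n powr (1 / c)) * ?l ^ 4"
        using time_le[OF PK' assms N_def, of e r] by linarith
    qed (use S distinct_card[of xs] in auto)
  qed
qed

end
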